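(* Let $A$ be a (Noetherian) local ring, let $\underline a=a_1,\ldots,a_t$ be a system of elements of $A$, and let $M$ be a finitely generated $A$-module. Then there are isomorphisms $$H^i_{\underline a}(M)\cong\check L^i(\underline a,\underline a,M;n)$$ for all $n\gg0$ and all $i\ge0$, where $\check L^i(\underline a,\underline a,M;n)$ is formed with the ideal $\mathfrak q=\underline aA$ and exponents $c_1=\cdots=c_t=1$.
   Context: $H^i_{\underline a}(M)$ is the $i$-th local cohomology module of $M$ with respect to the ideal $\underline aA=(a_1,\ldots,a_t)A$. Put $\mathfrak q=\underline aA$. For $x\in\mathfrak q^e$ let $M[\mathfrak q^e/x]\subseteq M_x$ be the $A$-submodule of all elements of the form $m_0/1+q_1m_1/x+\cdots+q_sm_s/x^s$ with $s\ge0$, $m_0,\ldots,m_s\in M$ and $q_i\in\mathfrak q^{ei}$; $\mathfrak q^nM[\mathfrak q^e/x]$ denotes $\mathfrak q^n\cdot M[\mathfrak q^e/x]\subseteq M_x$. Let $\check C_{\underline a}\otimes_AM$ be the Čech complex of $M$ with respect to $\underline a$, with $i$-th term $\bigoplus_{1\le j_1<\cdots<j_i\le t}M_{a_{j_1}\cdots a_{j_i}}$. For $n\in\mathbb N$ let $\check C^\bullet(\underline a,\underline a,M;n)$ be the subcomplex with $i$-th term $\bigoplus_{1\le j_1<\cdots<j_i\le t}\mathfrak q^nM[\mathfrak q^{i}/(a_{j_1}\cdots a_{j_i})]$ for $0\le i\le t$ (for $i=0$ this is $\mathfrak q^nM$). Then $\check L^i(\underline a,\underline a,M;n)$ is the $i$-th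 cohomology of the quotient complex $(\check C_{\underline a}\otimes_AM)/\check C^\bullet(\underline a,\underline a,M;n)$. *)

theory Defs
  imports "HOL-Algebra.Algebra"
begin

section \<open>Modules over a commutative ring\<close>

definition local_ring :: "('a, 'k) ring_scheme \<Rightarrow> bool"
  where "local_ring R \<longleftrightarrow> cring R \<and> (\<exists>!I. maximalideal I R)"

definition ideal_power :: "('a, 'k) ring_scheme \<Rightarrow> 'a set \<Rightarrow> nat \<Rightarrow> 'a set"
  where "ideal_power R I n = I [^]\<^bsub>ideals_set R\<^esub> n"

text \<open>The submodule \<open>I N\<close>; if \<open>I\<close> is an ideal, the additive subgroup generated by the products
  is already stable under scalars. For \<open>I = carrier R\<close> it is the submodule spanned by \<open>N\<close>.\<close>

definition ideal_smult ::
    "('a, 'm, 'x) module_scheme \<Rightarrow> 'a set \<Rightarrow> 'm set \<Rightarrow> 'm set"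
  where "ideal_smult M I N = generate (add_monoid M) {r \<odot>\<^bsub>M\<^esub> x | r x. r \<in> I \<and> x \<in> N}"

definition finitely_generated_module ::
    "('a, 'k) ring_scheme \<Rightarrow> ('a, 'm, 'x) module_scheme \<Rightarrow> bool"
  where "finitely_generated_module R M \<longleftrightarrow> module R M \<and>
    (\<exists>S. S \<subseteq> carrier M \<and> finite S \<and> ideal_smult M (carrier R) S = carrier M)"

definition module_hom ::
    "('a, 'k) ring_scheme \<Rightarrow> ('a, 'm, 'x) module_scheme \<Rightarrow> ('a, 'n, 'y) module_scheme \<Rightarrow> ('m \<Rightarrow> 'n) set"
  where "module_hom R M N = {f \<in> carrier M \<rightarrow> carrier N.
    (\<forall>x\<in>carrier M. \<forall>y\<in>carrier M. f (x \<oplus>\<^bsub>M\<^esub> y) = f x \<oplus>\<^bsub>N\<^esub> f y) \<and>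
    (\<forall>r\<in>carrier R. \<forall>x\<in>carrier M. f (r \<odot>\<^bsub>M\<^esub> x) = r \<odot>\<^bsub>N\<^esub> f x)}"

definition module_isomorphic ::
    "('a, 'k) ring_scheme \<Rightarrow> ('a, 'm, 'x) module_scheme \<Rightarrow> ('a, 'n, 'y) module_scheme \<Rightarrow> bool"
  where "module_isomorphic R M N \<longleftrightarrow>
    (\<exists>f\<in>module_hom R M N. bij_betw f (carrier M) (carrier N))"

text \<open>The record type of modules extends that of rings; the multiplicative fields \<open>monoid.mult\<close> and
  \<open>one\<close> carry no meaning for a module and are left undefined in the constructions below.\<close>

definition quot_module :: "('a, 'm, 'x) module_scheme \<Rightarrow> 'm set \<Rightarrow> ('a, 'm set) module"
  where "quot_module M N =
    \<lparr>carrier = a_rcosets\<^bsub>M\<^esub> N, monoid.mult = undefined, one = undefined,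
     ring.zero = N, add = set_add M,
     smult = (\<lambda>r U. \<Union>x\<in>U. N +>\<^bsub>M\<^esub> (r \<odot>\<^bsub>M\<^esub> x))\<rparr>"

definition prod_module ::
    "'i set \<Rightarrow> ('i \<Rightarrow> ('a, 'm, 'x) module_scheme) \<Rightarrow> ('a, 'i \<Rightarrow> 'm) module"
  where "prod_module I M =
    \<lparr>carrier = (\<Pi>\<^sub>E i\<in>I. carrier (M i)), monoid.mult = undefined, one = undefined,
     ring.zero = (\<lambda>i\<in>I. \<zero>\<^bsub>M i\<^esub>), add = (\<lambda>f g. \<lambda>i\<in>I. f i \<oplus>\<^bsub>M i\<^esub> g i),
     smult = (\<lambda>r f. \<lambda>i\<in>I. r \<odot>\<^bsub>M i\<^esub> f i)\<rparr>"


section \<open>Cohomology of cochain complexes\<close>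

text \<open>A complex consists of terms \<open>C i\<close> and maps \<open>d i\<close> from \<open>C i\<close> to \<open>C (Suc i)\<close>,
  for \<open>i \<ge> 0\<close>; the term in degree \<open>-1\<close> is zero.\<close>

definition coboundaries ::
    "(nat \<Rightarrow> ('a, 'm, 'x) module_scheme) \<Rightarrow> (nat \<Rightarrow> 'm \<Rightarrow> 'm) \<Rightarrow> nat \<Rightarrow> 'm set"
  where "coboundaries C d i =
    (case i of 0 \<Rightarrow> {\<zero>\<^bsub>C 0\<^esub>} | Suc j \<Rightarrow> d j ` carrier (C j))"

definition cohomology ::
    "(nat \<Rightarrow> ('a, 'm, 'x) module_scheme) \<Rightarrow> (nat \<Rightarrow> 'm \<Rightarrow> 'm) \<Rightarrow> nat \<Rightarrow> ('a, 'm set) module"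
  where "cohomology C d i =
    quot_module ((C i)\<lparr>carrier := a_kernel (C i) (C (Suc i)) (d i)\<rparr>) (coboundaries C d i)"

text \<open>The quotient of a complex by a subcomplex with terms \<open>D i \<subseteq> carrier (C i)\<close>.\<close>

definition quot_complex ::
    "(nat \<Rightarrow> ('a, 'm, 'x) module_scheme) \<Rightarrow> (nat \<Rightarrow> 'm set) \<Rightarrow> nat \<Rightarrow> ('a, 'm set) module"
  where "quot_complex C D i = quot_module (C i) (D i)"

definition quot_diff ::
    "(nat \<Rightarrow> ('a, 'm, 'x) module_scheme) \<Rightarrow> (nat \<Rightarrow> 'm \<Rightarrow> 'm) \<Rightarrow> (nat \<Rightarrow> 'm set) \<Rightarrow>
      nat \<Rightarrow> 'm set \<Rightarrow> 'm set"
  where "quot_diff C d D i U = (\<Union>x\<in>U. D (Suc i) +>\<^bsub>C (Suc i)\<^esub> d i x)"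


section \<open>Local cohomology as a right derived functor\<close>

text \<open>A definition in HOL cannot quantify over all carrier types, so the test modules have their
  carriers in the type of ring elements. These include \<open>R\<close> and its ideals, so by Baer's criterion
  a larger universe of test modules gives the same injective modules.\<close>

definition injective_module ::
    "('a, 'k) ring_scheme \<Rightarrow> ('a, 'e, 'x) module_scheme \<Rightarrow> bool"
  where "injective_module R Q \<longleftrightarrow> module R Q \<and>
    (\<forall>(N :: ('a, 'a) module) (P :: ('a, 'a) module). \<forall>f\<in>module_hom R N P. \<forall>g\<in>module_hom R N Q.
      module R N \<and> module R P \<and> inj_on f (carrier N) \<longrightarrow>
      (\<exists>h\<in>module_hom R P Q. \<forall>x\<in>carrier N. h (f x) = g x))"

text \<open>Exactness of \<open>0 \<rightarrow> M \<rightarrow> E 0 \<rightarrow> E 1 \<rightarrow> \<dots>\<close> with augmentation \<open>\<epsilon>\<close> and maps \<open>\<delta> i\<close>.\<close>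

definition injective_resolution ::
    "('a, 'k) ring_scheme \<Rightarrow> ('a, 'm, 'x) module_scheme \<Rightarrow>
      (nat \<Rightarrow> ('a, 'e, 'y) module_scheme) \<Rightarrow> (nat \<Rightarrow> 'e \<Rightarrow> 'e) \<Rightarrow> ('m \<Rightarrow> 'e) \<Rightarrow> bool"
  where "injective_resolution R M E \<delta> \<epsilon> \<longleftrightarrow>
    (\<forall>i. injective_module R (E i)) \<and>
    \<epsilon> \<in> module_hom R M (E 0) \<and> inj_on \<epsilon> (carrier M) \<and>
    (\<forall>i. \<delta> i \<in> module_hom R (E i) (E (Suc i))) \<and>
    \<epsilon> ` carrier M = a_kernel (E 0) (E 1) (\<delta> 0) \<and>
    (\<forall>i. \<delta> i ` carrier (E i) = a_kernel (E (Suc i)) (E (Suc (Suc i))) (\<delta> (Suc i)))"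

text \<open>The section functor of an ideal \<open>I\<close>: elements annihilated by some power of \<open>I\<close>.\<close>

definition section_functor ::
    "('a, 'k) ring_scheme \<Rightarrow> 'a set \<Rightarrow> ('a, 'm, 'x) module_scheme \<Rightarrow> ('a, 'm, 'x) module_scheme"
  where "section_functor R I N =
    N\<lparr>carrier := {x \<in> carrier N. \<exists>k. \<forall>r\<in>ideal_power R I k. r \<odot>\<^bsub>N\<^esub> x = \<zero>\<^bsub>N\<^esub>}\<rparr>"

text \<open>The local cohomology modules with respect to \<open>I\<close>, computed from an injective
  resolution \<open>E\<close>, \<open>\<delta>\<close>.\<close>

definition local_cohomology ::
    "('a, 'k) ring_scheme \<Rightarrow> 'a set \<Rightarrow> (nat \<Rightarrow> ('a, 'e, 'y) module_scheme) \<Rightarrow> (nat \<Rightarrow> 'e \<Rightarrow> 'e) \<Rightarrow>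
      nat \<Rightarrow> ('a, 'e set) module"
  where "local_cohomology R I E \<delta> i = cohomology (\<lambda>j. section_functor R I (E j)) \<delta> i"


section \<open>Localization at an element\<close>

text \<open>The fraction \<open>m / x ^ s\<close>, as the equivalence class of the pair \<open>(m, s)\<close>.\<close>

definition fraction ::
    "('a, 'k) ring_scheme \<Rightarrow> ('a, 'm, 'x) module_scheme \<Rightarrow> 'a \<Rightarrow> 'm \<Rightarrow> nat \<Rightarrow> ('m \<times> nat) set"
  where "fraction R M x m s = {(m', s'). m' \<in> carrier M \<and>
    (\<exists>k. x [^]\<^bsub>R\<^esub> (k + s') \<odot>\<^bsub>M\<^esub> m = x [^]\<^bsub>R\<^esub> (k + s) \<odot>\<^bsub>M\<^esub> m')}"

definition localization ::
    "('a, 'k) ring_scheme \<Rightarrow> ('a, 'm, 'x) module_scheme \<Rightarrow> 'a \<Rightarrow> ('a, ('m \<times> nat) set) module"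
  where "localization R M x =
    \<lparr>carrier = {fraction R M x m s | m s. m \<in> carrier M}, monoid.mult = undefined, one = undefined,
     ring.zero = fraction R M x \<zero>\<^bsub>M\<^esub> 0,
     add = (\<lambda>U V. \<Union>(m, s)\<in>U. \<Union>(m', s')\<in>V.
       fraction R M x (x [^]\<^bsub>R\<^esub> s' \<odot>\<^bsub>M\<^esub> m \<oplus>\<^bsub>M\<^esub> x [^]\<^bsub>R\<^esub> s \<odot>\<^bsub>M\<^esub> m') (s + s')),
     smult = (\<lambda>r U. \<Union>(m, s)\<in>U. fraction R M x (r \<odot>\<^bsub>M\<^esub> m) s)\<rparr>"

text \<open>The canonical map from the localization at \<open>x\<close> to the localization at \<open>z = x y\<close>,
  sending \<open>m / x ^ s\<close> to \<open>y ^ s m / z ^ s\<close>.\<close>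

definition loc_map ::
    "('a, 'k) ring_scheme \<Rightarrow> ('a, 'm, 'x) module_scheme \<Rightarrow> 'a \<Rightarrow> 'a \<Rightarrow>
      ('m \<times> nat) set \<Rightarrow> ('m \<times> nat) set"
  where "loc_map R M y z U = (\<Union>(m, s)\<in>U. fraction R M z (y [^]\<^bsub>R\<^esub> s \<odot>\<^bsub>M\<^esub> m) s)"

text \<open>The submodule \<open>M[\<qq> ^ e / x]\<close> of the localization at \<open>x \<in> \<qq> ^ e\<close>.\<close>

definition adjoin_fractions ::
    "('a, 'k) ring_scheme \<Rightarrow> ('a, 'm, 'x) module_scheme \<Rightarrow> 'a set \<Rightarrow> nat \<Rightarrow> 'a \<Rightarrow> ('m \<times> nat) set set"
  where "adjoin_fractions R M \<qq> e x =
    {fraction R M x (m 0) 0 \<oplus>\<^bsub>localization R M x\<^esub>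
       (\<Oplus>\<^bsub>localization R M x\<^esub>i\<in>{1..s}. fraction R M x (q i \<odot>\<^bsub>M\<^esub> m i) i) | s m q.
     (\<forall>i\<in>{0..s}. m i \<in> carrier M) \<and> (\<forall>i\<in>{1..s}. q i \<in> ideal_power R \<qq> (e * i))}"


section \<open>The Cech complex and its subcomplexes\<close>

text \<open>The sequence \<open>a\<close> is a list, indexed from 0. An index \<open>j\<^sub>1 < \<dots> < j\<^sub>i\<close> is given by the set
  \<open>J\<close> of its members; in degree 0 the only index is \<open>{}\<close>, with the empty product 1.\<close>

definition cech_index :: "'a list \<Rightarrow> nat \<Rightarrow> nat set set"
  where "cech_index a i = {J. J \<subseteq> {..<length a} \<and> card J = i}"

definition cech_elt :: "('a, 'k) ring_scheme \<Rightarrow> 'a list \<Rightarrow> nat set \<Rightarrow> 'a"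
  where "cech_elt R a J = (\<Otimes>\<^bsub>R\<^esub>j\<in>J. a ! j)"

definition cech_term ::
    "('a, 'k) ring_scheme \<Rightarrow> 'a list \<Rightarrow> ('a, 'm, 'x) module_scheme \<Rightarrow> nat \<Rightarrow>
      ('a, nat set \<Rightarrow> ('m \<times> nat) set) module"
  where "cech_term R a M i =
    prod_module (cech_index a i) (\<lambda>J. localization R M (cech_elt R a J))"

definition cech_diff ::
    "('a, 'k) ring_scheme \<Rightarrow> 'a list \<Rightarrow> ('a, 'm, 'x) module_scheme \<Rightarrow> nat \<Rightarrow>
      (nat set \<Rightarrow> ('m \<times> nat) set) \<Rightarrow> (nat set \<Rightarrow> ('m \<times> nat) set)"
  where "cech_diff R a M i f = (\<lambda>J\<in>cech_index a (Suc i).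
    \<Oplus>\<^bsub>localization R M (cech_elt R a J)\<^esub>j\<in>J.
      (\<ominus>\<^bsub>R\<^esub> \<one>\<^bsub>R\<^esub>) [^]\<^bsub>R\<^esub> card {l \<in> J. l < j} \<odot>\<^bsub>localization R M (cech_elt R a J)\<^esub>
        loc_map R M (a ! j) (cech_elt R a J) (f (J - {j})))"

text \<open>The degree \<open>i\<close> term of the subcomplex attached to \<open>a\<close>, \<open>\<qq> = Idl (set a)\<close> and \<open>n\<close>.\<close>

definition cech_sub ::
    "('a, 'k) ring_scheme \<Rightarrow> 'a list \<Rightarrow> ('a, 'm, 'x) module_scheme \<Rightarrow> nat \<Rightarrow> nat \<Rightarrow>
      (nat set \<Rightarrow> ('m \<times> nat) set) set"
  where "cech_sub R a M n i = (let \<qq> = Idl\<^bsub>R\<^esub> (set a) in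
    \<Pi>\<^sub>E J\<in>cech_index a i. ideal_smult (localization R M (cech_elt R a J)) (ideal_power R \<qq> n)
      (adjoin_fractions R M \<qq> i (cech_elt R a J)))"

definition cech_L ::
    "('a, 'k) ring_scheme \<Rightarrow> 'a list \<Rightarrow> ('a, 'm, 'x) module_scheme \<Rightarrow> nat \<Rightarrow> nat \<Rightarrow>
      ('a, (nat set \<Rightarrow> ('m \<times> nat) set) set set) module"
  where "cech_L R a M n i =
    cohomology (quot_complex (cech_term R a M) (cech_sub R a M n))
      (quot_diff (cech_term R a M) (cech_diff R a M) (cech_sub R a M n)) i"

end

theory Submission
  imports Defs
begin

text \<open>Elements of the localizations are fractions, and after passing to a common denominator a Cech
  cochain is a family \<open>v J\<close> of numerators over the \<open>s\<close>-th powers of the products of the \<open>a j\<close>,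
  \<open>j \<in> J\<close>. On numerators the Cech differential is the Koszul differential of the powers \<open>a j ^ s\<close>, so
  that Cech cohomology is the direct limit over \<open>s\<close> of Koszul cohomology.

  The \<open>i\<close>-th cohomology of the quotient complex is that of the Cech complex as soon as the subcomplex is
  exact. The subcomplex is the degree \<open>n\<close> part of the Cech complex of the Rees module
  \<open>\<Oplus> \<qq> ^ n M\<close>, a finitely generated graded module over the Rees algebra, so its exactness for large
  \<open>n\<close> is Serre's vanishing theorem. It is proved for all graded subquotients \<open>A / B\<close> by induction on the
  number of variables that act nontrivially: the kernel and the cokernel of such a variable are covered
  by the induction hypothesis, so the variable is injective on cohomology in large degrees, and
  cohomology classes are torsion.

  The Cech complex computes local cohomology since its higher cohomology vanishes on injective modules;
  the latter holds since over a noetherian ring an injective module \<open>E\<close> maps onto \<open>E\<^sub>x\<close>, with a kernel that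
  satisfies Baer's criterion again.\<close>

section \<open>Koszul differentials\<close>

text \<open>Direct limits are never formed: a cohomology class is represented by numerators at an
  explicit exponent, and vanishing or exactness on the Cech side is stated up to a further lift by
  some \<open>k\<close>. Since \<open>px J\<close> has Rees degree \<open>card J\<close>, an element
  of degree \<open>n\<close> over the power \<open>px J [^] s\<close> has its numerator in degree
  \<open>n + s * card J\<close>; this explains the degree shifts below. Families of numerators are
  indexed by all subsets \<open>J\<close> at once, so one bound on \<open>n\<close> serves every
  cohomological degree.

  Only the quotient of \<open>qpow\<close> by zero is wanted at the end, but kernels and cokernels
  of a variable lead from submodules to subquotients, hence the pairs \<open>A\<close>,
  \<open>B\<close>. All of them stay inside one fixed family \<open>G\<close> in which chains of
  graded submodules are stationary, and the bound on \<open>n\<close> comes from there.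

  Passing between the injective resolution and the Cech complex requires choices of preimages and of
  exponents. The comparison is therefore a relation between representatives, which becomes a map
  only on cohomology.\<close>

definition koszul_diff ::
    "('a, 'k) ring_scheme \<Rightarrow> ('a, 'm, 'x) module_scheme \<Rightarrow> (nat \<Rightarrow> 'a) \<Rightarrow> nat \<Rightarrow>
      (nat set \<Rightarrow> 'm) \<Rightarrow> nat set \<Rightarrow> 'm"
  where "koszul_diff R M a s v J = (\<Oplus>\<^bsub>M\<^esub>j\<in>J.
    (((\<ominus>\<^bsub>R\<^esub> \<one>\<^bsub>R\<^esub>) [^]\<^bsub>R\<^esub> card {l \<in> J. l < j}) \<otimes>\<^bsub>R\<^esub> (a j [^]\<^bsub>R\<^esub> s)) \<odot>\<^bsub>M\<^esub> v (J - {j}))"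

text \<open>The effect on numerators of expanding all fractions from exponent \<open>s\<close> to
  \<open>s + k\<close>, that is, the transition map in the direct system of Koszul
  complexes.\<close>

definition koszul_lift ::
    "('a, 'k) ring_scheme \<Rightarrow> ('a, 'm, 'x) module_scheme \<Rightarrow> (nat \<Rightarrow> 'a) \<Rightarrow> nat \<Rightarrow>
      (nat set \<Rightarrow> 'm) \<Rightarrow> nat set \<Rightarrow> 'm"
  where "koszul_lift R M a k v J = ((\<Otimes>\<^bsub>R\<^esub>j\<in>J. a j) [^]\<^bsub>R\<^esub> k) \<odot>\<^bsub>M\<^esub> v J"

lemma (in module) finsum_in_submodule:
  assumes "submodule H R M" "finite A" "\<And>i. i \<in> A \<Longrightarrow> f i \<in> H"
  shows "finsum M f A \<in> H"
proof -
  have HM: "H \<subseteq> carrier M" using submoduleE(1)[OF assms(1)] .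
  have z: "\<zero>\<^bsub>M\<^esub> \<in> H"
    using assms(1) subgroup.one_closed[of H "add_monoid M"] unfolding submodule_def by simp
  show ?thesis using assms(2,3)
  proof (induction A rule: finite_induct)
    case (insert x F)
    have "f \<in> F \<rightarrow> carrier M" "f x \<in> carrier M" using insert.prems HM by auto
    then have "finsum M f (insert x F) = f x \<oplus>\<^bsub>M\<^esub> finsum M f F"
      using insert.hyps by (intro M.finsum_insert)
    then show ?case using insert submoduleE(5)[OF assms(1)] by auto
  qed (simp add: z)
qed

lemma (in module) submodule_zero: "submodule H R M \<Longrightarrow> \<zero>\<^bsub>M\<^esub> \<in> H"
  using subgroup.one_closed[of H "add_monoid M"] unfolding submodule_def by simp

lemma (in module) submodule_minus:
  "submodule H R M \<Longrightarrow> x \<in> H \<Longrightarrow> y \<in> H \<Longrightarrow> x \<ominus>\<^bsub>M\<^esub> y \<in> H"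
  using submoduleE[of H] unfolding a_minus_def by blast

lemma (in module) smult_comm:
  "x \<in> carrier R \<Longrightarrow> y \<in> carrier R \<Longrightarrow> m \<in> carrier M \<Longrightarrow> x \<odot>\<^bsub>M\<^esub> (y \<odot>\<^bsub>M\<^esub> m) = y \<odot>\<^bsub>M\<^esub> (x \<odot>\<^bsub>M\<^esub> m)"
  by (metis R.m_comm smult_assoc1)

locale koszul = module +
  fixes a :: "nat \<Rightarrow> 'a"
  assumes a_closed [simp, intro]: "a j \<in> carrier R"
begin

abbreviation d where "d \<equiv> koszul_diff R M a"
abbreviation lift where "lift \<equiv> koszul_lift R M a"
abbreviation px where "px J \<equiv> (\<Otimes>j\<in>J. a j)"
abbreviation sg :: "nat \<Rightarrow> 'a" where "sg n \<equiv> (\<ominus> \<one>) [^] n"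

lemma sg_closed [simp, intro]: "sg n \<in> carrier R" by simp

lemma px_closed [simp, intro]: "px J \<in> carrier R" by (intro R.finprod_closed) auto

lemma px_insert: "finite J \<Longrightarrow> r \<notin> J \<Longrightarrow> px (insert r J) = a r \<otimes> px J"
  by (intro R.finprod_insert) auto

lemma smult_sg: "m \<in> carrier M \<Longrightarrow> sg (Suc n) \<odot>\<^bsub>M\<^esub> m = \<ominus>\<^bsub>M\<^esub> (sg n \<odot>\<^bsub>M\<^esub> m)"
  by (simp add: R.r_minus smult_l_minus)

lemma smult_sg_sg:
  assumes "m \<in> carrier M"
  shows "sg n \<odot>\<^bsub>M\<^esub> (sg n \<odot>\<^bsub>M\<^esub> m) = m"
proof (induction n)
  case (Suc n)
  have "sg (Suc n) \<odot>\<^bsub>M\<^esub> (sg (Suc n) \<odot>\<^bsub>M\<^esub> m) = \<ominus>\<^bsub>M\<^esub> (sg n \<odot>\<^bsub>M\<^esub> (\<ominus>\<^bsub>M\<^esub> (sg n \<odot>\<^bsub>M\<^esub> m)))"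
    using assms smult_sg by (metis sg_closed smult_closed M.a_inv_closed)
  also have "\<dots> = m" using assms Suc by (simp add: smult_r_minus)
  finally show ?case .
qed (use assms in simp)

lemma d_empty [simp]: "d s v {} = \<zero>\<^bsub>M\<^esub>"
  unfolding koszul_diff_def by simp

lemma d_closed [intro]:
  assumes "\<And>I. I \<subseteq> J \<Longrightarrow> v I \<in> carrier M"
  shows "d s v J \<in> carrier M"
  unfolding koszul_diff_def using assms by (intro M.finsum_closed) auto

lemma lift_closed [intro]: "v J \<in> carrier M \<Longrightarrow> lift k v J \<in> carrier M"
  unfolding koszul_lift_def by auto

text \<open>The index \<open>r\<close> exceeds all others, so it does not change the signs of the
  remaining terms, and removing it costs the sign of \<open>card J\<close>. Up to sign the complex
  with \<open>r\<close> is thus the mapping cone of multiplication by \<open>a r [^] s\<close> on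
  the complex without \<open>r\<close>; inductions on the number of variables use this form.\<close>

lemma d_insert:
  assumes "finite J" "\<And>l. l \<in> J \<Longrightarrow> l < r" "\<And>I. I \<subseteq> insert r J \<Longrightarrow> v I \<in> carrier M"
  shows "d s v (insert r J) =
    d s (\<lambda>I. v (insert r I)) J \<oplus>\<^bsub>M\<^esub> (sg (card J) \<otimes> a r [^] s) \<odot>\<^bsub>M\<^esub> v J"
proof -
  have r: "r \<notin> J" using assms(2) by blast
  let ?f = "\<lambda>j. (sg (card {l \<in> insert r J. l < j}) \<otimes> a j [^] s) \<odot>\<^bsub>M\<^esub> v (insert r J - {j})"
  have "d s v (insert r J) = ?f r \<oplus>\<^bsub>M\<^esub> (\<Oplus>\<^bsub>M\<^esub>j\<in>J. ?f j)"
    unfolding koszul_diff_def using r assms by (intro M.finsum_insert) auto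
  also have "(\<Oplus>\<^bsub>M\<^esub>j\<in>J. ?f j) = d s (\<lambda>I. v (insert r I)) J"
    unfolding koszul_diff_def
  proof (intro M.finsum_cong')
    fix j assume j: "j \<in> J"
    have 1: "insert r J - {j} = insert r (J - {j})" using j r by auto
    have 2: "{l \<in> insert r J. l < j} = {l \<in> J. l < j}" using assms(2)[OF j] by auto
    show "?f j = (sg (card {l \<in> J. l < j}) \<otimes> a j [^] s) \<odot>\<^bsub>M\<^esub> v (insert r (J - {j}))"
      unfolding 1 2 ..
  next
    have "v (insert r (J - {j})) \<in> carrier M" for j by (intro assms(3)) auto
    then show "(\<lambda>j. (sg (card {l \<in> J. l < j}) \<otimes> a j [^] s) \<odot>\<^bsub>M\<^esub> v (insert r (J - {j}))) \<in> J \<rightarrow> carrier M"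
      by auto
  qed simp
  also have "{l \<in> insert r J. l < r} = J" using assms(2) by auto
  also have "insert r J - {r} = J" using r by auto
  finally show ?thesis using assms
    by (subst M.a_comm) (auto intro!: d_closed simp: subset_insertI2)
qed

lemma d_cong:
  assumes "\<And>j. j \<in> J \<Longrightarrow> v (J - {j}) = w (J - {j})" "\<And>I. I \<subseteq> J \<Longrightarrow> w I \<in> carrier M"
  shows "d s v J = d s w J"
  unfolding koszul_diff_def using assms by (intro M.finsum_cong') (auto intro!: smult_closed)

lemma d_zero: "d s (\<lambda>_. \<zero>\<^bsub>M\<^esub>) J = \<zero>\<^bsub>M\<^esub>"
proof -
  have "d s (\<lambda>_. \<zero>\<^bsub>M\<^esub>) J = (\<Oplus>\<^bsub>M\<^esub>j\<in>J. \<zero>\<^bsub>M\<^esub>)"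
    unfolding koszul_diff_def by (intro M.finsum_cong') auto
  then show ?thesis by simp
qed

lemma d_add:
  assumes "\<And>I. I \<subseteq> J \<Longrightarrow> v I \<in> carrier M" "\<And>I. I \<subseteq> J \<Longrightarrow> w I \<in> carrier M"
  shows "d s (\<lambda>I. v I \<oplus>\<^bsub>M\<^esub> w I) J = d s v J \<oplus>\<^bsub>M\<^esub> d s w J"
proof -
  let ?c = "\<lambda>j. sg (card {l \<in> J. l < j}) \<otimes> a j [^] s"
  have "d s (\<lambda>I. v I \<oplus>\<^bsub>M\<^esub> w I) J = (\<Oplus>\<^bsub>M\<^esub>j\<in>J. ?c j \<odot>\<^bsub>M\<^esub> v (J - {j}) \<oplus>\<^bsub>M\<^esub> ?c j \<odot>\<^bsub>M\<^esub> w (J - {j}))"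
    unfolding koszul_diff_def using assms
    by (intro M.finsum_cong') (auto simp: smult_r_distr intro!: smult_closed M.a_closed)
  also have "\<dots> = d s v J \<oplus>\<^bsub>M\<^esub> d s w J"
    unfolding koszul_diff_def using assms by (intro M.finsum_addf) (auto intro!: smult_closed)
  finally show ?thesis .
qed

lemma d_smult:
  assumes "finite J" "c \<in> carrier R" "\<And>I. I \<subseteq> J \<Longrightarrow> v I \<in> carrier M"
  shows "d s (\<lambda>I. c \<odot>\<^bsub>M\<^esub> v I) J = c \<odot>\<^bsub>M\<^esub> d s v J"
proof -
  let ?c = "\<lambda>j. sg (card {l \<in> J. l < j}) \<otimes> a j [^] s"
  have "d s (\<lambda>I. c \<odot>\<^bsub>M\<^esub> v I) J = (\<Oplus>\<^bsub>M\<^esub>j\<in>J. c \<odot>\<^bsub>M\<^esub> (?c j \<odot>\<^bsub>M\<^esub> v (J - {j})))"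
    unfolding koszul_diff_def using assms
    by (intro M.finsum_cong') (auto intro!: smult_closed smult_comm)
  also have "\<dots> = c \<odot>\<^bsub>M\<^esub> d s v J"
    unfolding koszul_diff_def using assms
    by (intro finsum_smult_ldistr[symmetric]) (auto intro!: smult_closed)
  finally show ?thesis .
qed

lemma d_uminus:
  assumes "finite J" "\<And>I. I \<subseteq> J \<Longrightarrow> v I \<in> carrier M"
  shows "d s (\<lambda>I. \<ominus>\<^bsub>M\<^esub> v I) J = \<ominus>\<^bsub>M\<^esub> d s v J"
proof -
  have "d s (\<lambda>I. \<ominus>\<^bsub>M\<^esub> v I) J = d s (\<lambda>I. (\<ominus> \<one>) \<odot>\<^bsub>M\<^esub> v I) J"
    using assms by (intro d_cong) (auto simp: smult_l_minus)
  also have "\<dots> = (\<ominus> \<one>) \<odot>\<^bsub>M\<^esub> d s v J" using assms by (intro d_smult) auto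
  also have "\<dots> = \<ominus>\<^bsub>M\<^esub> d s v J" using assms d_closed by (simp add: smult_l_minus)
  finally show ?thesis .
qed

lemma d_minus:
  assumes "finite J" "\<And>I. I \<subseteq> J \<Longrightarrow> v I \<in> carrier M" "\<And>I. I \<subseteq> J \<Longrightarrow> w I \<in> carrier M"
  shows "d s (\<lambda>I. v I \<ominus>\<^bsub>M\<^esub> w I) J = d s v J \<ominus>\<^bsub>M\<^esub> d s w J"
  unfolding a_minus_def using assms by (simp add: d_add d_uminus)

lemma lift_lift:
  "v J \<in> carrier M \<Longrightarrow> lift k (lift l v) J = lift (k + l) v J"
  unfolding koszul_lift_def by (simp add: smult_assoc1[symmetric] R.nat_pow_mult)

lemma lift_0: "v J \<in> carrier M \<Longrightarrow> lift 0 v J = v J"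
  unfolding koszul_lift_def by simp

lemma lift_empty [simp]: "v {} \<in> carrier M \<Longrightarrow> lift k v {} = v {}"
  unfolding koszul_lift_def by (simp add: R.nat_pow_one)

lemma lift_minus:
  "v J \<in> carrier M \<Longrightarrow> w J \<in> carrier M \<Longrightarrow>
    lift k (\<lambda>I. v I \<ominus>\<^bsub>M\<^esub> w I) J = lift k v J \<ominus>\<^bsub>M\<^esub> lift k w J"
  unfolding koszul_lift_def by (simp add: smult_r_distr smult_r_minus a_minus_def)

text \<open>The identity \<open>px J = a j \<otimes> px (J - {j})\<close> turns the extra factor
  \<open>a j [^] k\<close> of the differential and the factor of \<open>J - {j}\<close> into that of
  \<open>J\<close>. So lifting is a chain map from exponent \<open>s\<close> to
  \<open>s + k\<close>.\<close>

lemma d_lift: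
  assumes "finite J" "\<And>I. I \<subseteq> J \<Longrightarrow> v I \<in> carrier M"
  shows "d (s + k) (lift k v) J = lift k (d s v) J"
proof -
  let ?c = "\<lambda>j s. sg (card {l \<in> J. l < j}) \<otimes> a j [^] s"
  have "d (s + k) (lift k v) J = (\<Oplus>\<^bsub>M\<^esub>j\<in>J. (px J [^] k) \<odot>\<^bsub>M\<^esub> (?c j s \<odot>\<^bsub>M\<^esub> v (J - {j})))"
    unfolding koszul_diff_def
  proof (intro M.finsum_cong')
    fix j assume j: "j \<in> J"
    have "px J = a j \<otimes> px (J - {j})"
      using px_insert[of "J - {j}" j] assms(1) j by (simp add: insert_absorb)
    then have "?c j (s + k) \<otimes> px (J - {j}) [^] k = (px J [^] k) \<otimes> ?c j s"
      by (simp add: R.nat_pow_mult[symmetric] R.nat_pow_distrib R.m_ac)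
    then show "?c j (s + k) \<odot>\<^bsub>M\<^esub> lift k v (J - {j}) = (px J [^] k) \<odot>\<^bsub>M\<^esub> (?c j s \<odot>\<^bsub>M\<^esub> v (J - {j}))"
      unfolding koszul_lift_def using assms(2)[of "J - {j}"] by (simp add: smult_assoc1[symmetric])
  qed (use assms in \<open>auto intro!: smult_closed\<close>)
  also have "\<dots> = lift k (d s v) J"
    unfolding koszul_diff_def koszul_lift_def using assms
    by (intro finsum_smult_ldistr[symmetric]) (auto intro!: smult_closed)
  finally show ?thesis .
qed

text \<open>Splitting off the largest index leaves \<open>d s (d s v)\<close> for the smaller set
  and two multiples of \<open>d s v J\<close>, whose signs differ by one step and cancel.\<close>

lemma d_d:
  assumes "finite J" "\<And>I. I \<subseteq> J \<Longrightarrow> v I \<in> carrier M"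
  shows "d s (d s v) J = \<zero>\<^bsub>M\<^esub>"
  using assms
proof (induction J arbitrary: v rule: finite_linorder_max_induct)
  case (insert r J)
  let ?v = "\<lambda>I. v (insert r I)" and ?c = "\<lambda>J. sg (card J) \<otimes> a r [^] s"
  have sub: "\<And>I. I \<subseteq> J \<Longrightarrow> v I \<in> carrier M" "\<And>I. I \<subseteq> J \<Longrightarrow> ?v I \<in> carrier M"
    using insert.prems by (auto simp: subset_insertI2)
  have sub': "I \<subseteq> insert r (J - {j}) \<Longrightarrow> v I \<in> carrier M" for I j
    using insert.prems[of I] by blast
  have fin: "I \<subseteq> J \<Longrightarrow> finite I" for I using insert.hyps finite_subset by blast
  have cl: "I \<subseteq> J \<Longrightarrow> d s v I \<in> carrier M" "I \<subseteq> J \<Longrightarrow> d s ?v I \<in> carrier M" for I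
    using sub by (auto intro!: d_closed)
  have "d s (d s v) (insert r J) = d s (\<lambda>I. d s v (insert r I)) J \<oplus>\<^bsub>M\<^esub> ?c J \<odot>\<^bsub>M\<^esub> d s v J"
    using insert by (intro d_insert) (auto intro!: d_closed)
  also have "d s (\<lambda>I. d s v (insert r I)) J = d s (\<lambda>I. d s ?v I \<oplus>\<^bsub>M\<^esub> ?c I \<odot>\<^bsub>M\<^esub> v I) J"
  proof (intro d_cong)
    fix j assume "j \<in> J"
    then show "d s v (insert r (J - {j})) = d s ?v (J - {j}) \<oplus>\<^bsub>M\<^esub> ?c (J - {j}) \<odot>\<^bsub>M\<^esub> v (J - {j})"
      using insert.hyps by (intro d_insert) (auto intro: sub')
  qed (use sub cl in auto)
  also have "\<dots> = d s (d s ?v) J \<oplus>\<^bsub>M\<^esub> d s (\<lambda>I. ?c I \<odot>\<^bsub>M\<^esub> v I) J"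
    using sub cl by (intro d_add) auto
  also have "d s (d s ?v) J = \<zero>\<^bsub>M\<^esub>" by (intro insert.IH sub(2))
  \<comment> \<open>The differential at \<open>J\<close> evaluates its argument only at sets with
    one element less, so the sign depending on \<open>card I\<close> may be replaced by a constant
    and pulled out.\<close>
  also have "d s (\<lambda>I. ?c I \<odot>\<^bsub>M\<^esub> v I) J = d s (\<lambda>I. (sg (card J - 1) \<otimes> a r [^] s) \<odot>\<^bsub>M\<^esub> v I) J"
    using sub insert.hyps by (intro d_cong) auto
  also have "\<dots> = (sg (card J - 1) \<otimes> a r [^] s) \<odot>\<^bsub>M\<^esub> d s v J"
    using sub insert.hyps by (intro d_smult) auto
  finally have *: "d s (d s v) (insert r J) =
      (sg (card J - 1) \<otimes> a r [^] s) \<odot>\<^bsub>M\<^esub> d s v J \<oplus>\<^bsub>M\<^esub> ?c J \<odot>\<^bsub>M\<^esub> d s v J"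
    using cl(1)[of J] by simp
  show ?case
  \<comment> \<open>For empty \<open>J\<close> the truncated difference \<open>card J - 1\<close> is
    0 and the signs do not cancel, but then \<open>d s v J\<close> itself is zero.\<close>
  proof (cases "J = {}")
    case False
    then have "?c J = \<ominus> (sg (card J - 1) \<otimes> a r [^] s)"
      using insert.hyps by (cases "card J") (auto simp: R.r_minus R.l_minus)
    then show ?thesis using cl(1)[of J] by (simp add: * smult_l_minus M.r_neg)
  qed (use * in auto)
qed simp

lemma d_in_submodule:
  assumes "submodule H R M" "finite J" "\<And>j. j \<in> J \<Longrightarrow> a j [^] s \<odot>\<^bsub>M\<^esub> v (J - {j}) \<in> H"
    "\<And>I. I \<subseteq> J \<Longrightarrow> v I \<in> carrier M"
  shows "d s v J \<in> H"
  unfolding koszul_diff_def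
proof (rule finsum_in_submodule[OF assms(1,2)])
  fix j assume j: "j \<in> J"
  show "(sg (card {l \<in> J. l < j}) \<otimes> a j [^] s) \<odot>\<^bsub>M\<^esub> v (J - {j}) \<in> H"
    using submoduleE(4)[OF assms(1) _ assms(3)[OF j], of "sg (card {l \<in> J. l < j})"] assms(4)[of "J - {j}"]
    by (auto simp: smult_assoc1)
qed

end

section \<open>Module homomorphisms and the Koszul operations\<close>

lemma module_homD:
  assumes "f \<in> module_hom R M N"
  shows "x \<in> carrier M \<Longrightarrow> f x \<in> carrier N"
    and "x \<in> carrier M \<Longrightarrow> y \<in> carrier M \<Longrightarrow> f (x \<oplus>\<^bsub>M\<^esub> y) = f x \<oplus>\<^bsub>N\<^esub> f y"
    and "r \<in> carrier R \<Longrightarrow> x \<in> carrier M \<Longrightarrow> f (r \<odot>\<^bsub>M\<^esub> x) = r \<odot>\<^bsub>N\<^esub> f x"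
  using assms unfolding module_hom_def by auto

lemma module_hom_zero:
  assumes "module R M" "module R N" "f \<in> module_hom R M N"
  shows "f \<zero>\<^bsub>M\<^esub> = \<zero>\<^bsub>N\<^esub>"
proof -
  interpret M: module R M by fact
  interpret N: module R N by fact
  have "f (\<zero>\<^bsub>R\<^esub> \<odot>\<^bsub>M\<^esub> \<zero>\<^bsub>M\<^esub>) = \<zero>\<^bsub>R\<^esub> \<odot>\<^bsub>N\<^esub> f \<zero>\<^bsub>M\<^esub>"
    by (rule module_homD(3)[OF assms(3)]) simp_all
  moreover have "f \<zero>\<^bsub>M\<^esub> \<in> carrier N" by (rule module_homD(1)[OF assms(3)]) simp
  ultimately show ?thesis by simp
qed

lemma module_hom_finsum:
  assumes "module R M" "module R N" "f \<in> module_hom R M N" "finite A" "g \<in> A \<rightarrow> carrier M"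
  shows "f (finsum M g A) = finsum N (\<lambda>i. f (g i)) A"
proof -
  interpret M: module R M by fact
  interpret N: module R N by fact
  have fc: "\<And>x. x \<in> carrier M \<Longrightarrow> f x \<in> carrier N"
    and fa: "\<And>x y. x \<in> carrier M \<Longrightarrow> y \<in> carrier M \<Longrightarrow> f (x \<oplus>\<^bsub>M\<^esub> y) = f x \<oplus>\<^bsub>N\<^esub> f y"
    using assms(3) unfolding module_hom_def by auto
  show ?thesis using assms(4,5)
  proof (induction A rule: finite_induct)
    case (insert x F)
    then have "finsum M g (insert x F) = g x \<oplus>\<^bsub>M\<^esub> finsum M g F" "finsum M g F \<in> carrier M"
      by (auto intro!: M.finsum_insert)
    moreover have "finsum N (\<lambda>i. f (g i)) (insert x F) = f (g x) \<oplus>\<^bsub>N\<^esub> finsum N (\<lambda>i. f (g i)) F"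
      using insert fc by (intro N.finsum_insert) auto
    ultimately show ?case using insert fa by auto
  qed (use module_hom_zero assms in auto)
qed

lemma module_hom_koszul_diff:
  assumes "module R M" "module R N" "f \<in> module_hom R M N" "finite J" "\<And>j. a j \<in> carrier R"
    "\<And>I. I \<subseteq> J \<Longrightarrow> v I \<in> carrier M"
  shows "f (koszul_diff R M a s v J) = koszul_diff R N a s (\<lambda>I. f (v I)) J"
proof -
  interpret M: koszul R M a using assms by (simp add: koszul.intro koszul_axioms_def)
  interpret N: module R N by fact
  show ?thesis
    unfolding koszul_diff_def
    apply (subst module_hom_finsum[OF assms(1-3)])
    using assms(4,6) apply (auto intro!: M.smult_closed)[2]
    apply (intro N.finsum_cong')
    using assms(3,6) by (auto simp: module_hom_def Pi_def intro!: N.smult_closed)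
qed

lemma module_hom_koszul_lift:
  assumes "module R M" "f \<in> module_hom R M N" "\<And>j. a j \<in> carrier R" "v J \<in> carrier M"
  shows "f (koszul_lift R M a k v J) = koszul_lift R N a k (\<lambda>I. f (v I)) J"
proof -
  interpret M: koszul R M a using assms by (simp add: koszul.intro koszul_axioms_def)
  show ?thesis unfolding koszul_lift_def using assms by (auto simp: module_hom_def)
qed

section \<open>Ascending chains of graded submodules\<close>

lemma (in abelian_group) add_minus_cancel:
  "x \<in> carrier G \<Longrightarrow> y \<in> carrier G \<Longrightarrow> y \<oplus> (x \<ominus> y) = x"
  by (simp add: a_minus_def a_lcomm r_neg)

lemma (in abelian_group) minus_add_cancel_left:
  "p \<in> carrier G \<Longrightarrow> x \<in> carrier G \<Longrightarrow> y \<in> carrier G \<Longrightarrow> (p \<oplus> x) \<ominus> (p \<oplus> y) = x \<ominus> y"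
  using a_lcomm[of p x "\<ominus> p \<oplus> \<ominus> y"]
  by (simp add: a_minus_def minus_add a_assoc r_neg2)

lemma (in abelian_group) minus_add_add:
  "x \<in> carrier G \<Longrightarrow> y \<in> carrier G \<Longrightarrow> x' \<in> carrier G \<Longrightarrow> y' \<in> carrier G \<Longrightarrow>
    (x \<oplus> y) \<ominus> (x' \<oplus> y') = (x \<ominus> x') \<oplus> (y \<ominus> y')"
  by (simp add: a_minus_def minus_add a_ac)

text \<open>The union of a chain of ideals is one of its members; from the index where it occurs the
  chain is constant.\<close>

lemma (in noetherian_ring) ideal_chain_stabilises:
  assumes "\<And>k::nat. ideal (I k) R" "\<And>k. I k \<subseteq> I (Suc k)"
  shows "\<exists>k0. \<forall>k\<ge>k0. I k = I k0"
proof -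
  have mono: "k \<le> l \<Longrightarrow> I k \<subseteq> I l" for k l using lift_Suc_mono_le[of I] assms(2) by blast
  have "subset.chain {J. ideal J R} (range I)"
    unfolding subset_chain_def
  proof (intro conjI ballI)
    fix A B assume "A \<in> range I" "B \<in> range I"
    then obtain k l where "A = I k" "B = I l" by blast
    then show "A \<subseteq> B \<or> B \<subseteq> A"
      using mono[of k l] mono[of l k] by (cases "k \<le> l") auto
  qed (use assms(1) in auto)
  then have "\<Union>(range I) \<in> range I" by (intro ideal_chain_is_trivial) auto
  then obtain k0 where k0: "\<Union>(range I) = I k0" by blast
  have "I k = I k0" if "k0 \<le> k" for k using mono[OF that] k0 by blast
  then show ?thesis by blast
qed

section \<open>Submodules and the ascending chain condition\<close>

context module
begin

lemma submoduleI':
  assumes "H \<subseteq> carrier M" "\<zero>\<^bsub>M\<^esub> \<in> H" "\<And>x y. x \<in> H \<Longrightarrow> y \<in> H \<Longrightarrow> x \<oplus>\<^bsub>M\<^esub> y \<in> H"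
    "\<And>r x. r \<in> carrier R \<Longrightarrow> x \<in> H \<Longrightarrow> r \<odot>\<^bsub>M\<^esub> x \<in> H"
  shows "submodule H R M"
proof (rule submoduleI[OF assms(1,2) _ assms(3,4)])
  fix x assume "x \<in> H"
  then have "(\<ominus> \<one>) \<odot>\<^bsub>M\<^esub> x \<in> H" "x \<in> carrier M" using assms(1,4) by auto
  then show "\<ominus>\<^bsub>M\<^esub> x \<in> H" by (simp add: smult_l_minus)
qed

lemma submodule_subset: "submodule H R M \<Longrightarrow> x \<in> H \<Longrightarrow> x \<in> carrier M"
  using submoduleE(1) by blast

lemma submodule_single_zero: "submodule {\<zero>\<^bsub>M\<^esub>} R M"
  by (rule submoduleI') auto

lemma submodule_Int: "submodule A R M \<Longrightarrow> submodule B R M \<Longrightarrow> submodule (A \<inter> B) R M"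
  by (rule submoduleI') (auto simp: submodule_zero submoduleE dest: submodule_subset)

lemma submodule_colon:
  assumes "submodule A R M" "submodule B R M" "c \<in> carrier R"
  shows "submodule {m \<in> A. c \<odot>\<^bsub>M\<^esub> m \<in> B} R M"
proof (rule submoduleI')
  fix r m assume r: "r \<in> carrier R" and m: "m \<in> {m \<in> A. c \<odot>\<^bsub>M\<^esub> m \<in> B}"
  then have mM: "m \<in> carrier M" using assms submodule_subset by blast
  have "c \<odot>\<^bsub>M\<^esub> (r \<odot>\<^bsub>M\<^esub> m) = r \<odot>\<^bsub>M\<^esub> (c \<odot>\<^bsub>M\<^esub> m)"
    using r mM assms(3) by (metis R.m_comm smult_assoc1)
  then show "r \<odot>\<^bsub>M\<^esub> m \<in> {m \<in> A. c \<odot>\<^bsub>M\<^esub> m \<in> B}"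
    using m r submoduleE(4) assms by auto
next
  fix x y assume "x \<in> {m \<in> A. c \<odot>\<^bsub>M\<^esub> m \<in> B}" "y \<in> {m \<in> A. c \<odot>\<^bsub>M\<^esub> m \<in> B}"
  moreover from this have "x \<in> carrier M" "y \<in> carrier M" using assms submodule_subset by blast+
  ultimately show "x \<oplus>\<^bsub>M\<^esub> y \<in> {m \<in> A. c \<odot>\<^bsub>M\<^esub> m \<in> B}"
    using assms by (auto simp: smult_r_distr submoduleE(5))
qed (use assms submodule_zero submodule_subset in auto)

lemma add4:
  assumes "p \<in> carrier M" "q \<in> carrier M" "x \<in> carrier M" "y \<in> carrier M"
  shows "(p \<oplus>\<^bsub>M\<^esub> x) \<oplus>\<^bsub>M\<^esub> (q \<oplus>\<^bsub>M\<^esub> y) = (p \<oplus>\<^bsub>M\<^esub> q) \<oplus>\<^bsub>M\<^esub> (x \<oplus>\<^bsub>M\<^esub> y)"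
  using assms by (simp add: M.a_ac)

text \<open>Both the graded pieces of \<open>gext\<close> and those of \<open>gsum\<close> have this
  shape.\<close>

lemma submodule_add_smult:
  assumes "submodule A R M" "submodule B R M" "c \<in> carrier R"
  shows "submodule {y \<oplus>\<^bsub>M\<^esub> c \<odot>\<^bsub>M\<^esub> g | y g. y \<in> A \<and> g \<in> B} R M" (is "submodule ?S R M")
proof (rule submoduleI')
  show "?S \<subseteq> carrier M" using assms submodule_subset by auto
  have "\<zero>\<^bsub>M\<^esub> = \<zero>\<^bsub>M\<^esub> \<oplus>\<^bsub>M\<^esub> c \<odot>\<^bsub>M\<^esub> \<zero>\<^bsub>M\<^esub>" using assms(3) by simp
  then show "\<zero>\<^bsub>M\<^esub> \<in> ?S" using assms submodule_zero by blast
next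
  fix u v assume "u \<in> ?S" "v \<in> ?S"
  then obtain y g y' g' where h: "u = y \<oplus>\<^bsub>M\<^esub> c \<odot>\<^bsub>M\<^esub> g" "v = y' \<oplus>\<^bsub>M\<^esub> c \<odot>\<^bsub>M\<^esub> g'"
    "y \<in> A" "y' \<in> A" "g \<in> B" "g' \<in> B" by blast
  then have "y \<in> carrier M" "y' \<in> carrier M" "g \<in> carrier M" "g' \<in> carrier M"
    using assms submodule_subset by blast+
  then have "u \<oplus>\<^bsub>M\<^esub> v = (y \<oplus>\<^bsub>M\<^esub> y') \<oplus>\<^bsub>M\<^esub> c \<odot>\<^bsub>M\<^esub> (g \<oplus>\<^bsub>M\<^esub> g')"
    using assms(3) h by (simp add: smult_r_distr add4)
  then show "u \<oplus>\<^bsub>M\<^esub> v \<in> ?S" using h assms submoduleE(5) by blast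
next
  fix r u assume r: "r \<in> carrier R" and "u \<in> ?S"
  then obtain y g where h: "u = y \<oplus>\<^bsub>M\<^esub> c \<odot>\<^bsub>M\<^esub> g" "y \<in> A" "g \<in> B" by blast
  then have "y \<in> carrier M" "g \<in> carrier M" using assms submodule_subset by blast+
  moreover from this have "r \<odot>\<^bsub>M\<^esub> (c \<odot>\<^bsub>M\<^esub> g) = c \<odot>\<^bsub>M\<^esub> (r \<odot>\<^bsub>M\<^esub> g)"
    using r assms(3) by (metis R.m_comm smult_assoc1)
  ultimately have "r \<odot>\<^bsub>M\<^esub> u = (r \<odot>\<^bsub>M\<^esub> y) \<oplus>\<^bsub>M\<^esub> c \<odot>\<^bsub>M\<^esub> (r \<odot>\<^bsub>M\<^esub> g)"
    using assms(3) h r by (simp add: smult_r_distr)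
  then show "r \<odot>\<^bsub>M\<^esub> u \<in> ?S" using h assms r submoduleE(4) by blast
qed

text \<open>With \<open>c\<close> a power of \<open>x\<close> these are the leading coefficients of
  the elements of \<open>A\<close> whose lower terms lie in \<open>P\<close>, as used in Hilbert's
  basis theorem.\<close>

lemma submodule_leading:
  assumes "submodule G R M" "submodule P R M" "submodule A R M" "c \<in> carrier R"
  shows "submodule {g \<in> G. \<exists>y\<in>P. y \<oplus>\<^bsub>M\<^esub> c \<odot>\<^bsub>M\<^esub> g \<in> A} R M" (is "submodule ?S R M")
proof (rule submoduleI')
  show "?S \<subseteq> carrier M" using assms submodule_subset by auto
  have "\<zero>\<^bsub>M\<^esub> \<oplus>\<^bsub>M\<^esub> c \<odot>\<^bsub>M\<^esub> \<zero>\<^bsub>M\<^esub> \<in> A" using assms submodule_zero by simp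
  then show "\<zero>\<^bsub>M\<^esub> \<in> ?S" using assms submodule_zero by blast
next
  fix g g' assume "g \<in> ?S" "g' \<in> ?S"
  then obtain y y' where h: "y \<in> P" "y' \<in> P" "y \<oplus>\<^bsub>M\<^esub> c \<odot>\<^bsub>M\<^esub> g \<in> A" "y' \<oplus>\<^bsub>M\<^esub> c \<odot>\<^bsub>M\<^esub> g' \<in> A"
    "g \<in> G" "g' \<in> G" by blast
  then have "y \<in> carrier M" "y' \<in> carrier M" "g \<in> carrier M" "g' \<in> carrier M"
    using assms submodule_subset by blast+
  then have "(y \<oplus>\<^bsub>M\<^esub> c \<odot>\<^bsub>M\<^esub> g) \<oplus>\<^bsub>M\<^esub> (y' \<oplus>\<^bsub>M\<^esub> c \<odot>\<^bsub>M\<^esub> g') = (y \<oplus>\<^bsub>M\<^esub> y') \<oplus>\<^bsub>M\<^esub> c \<odot>\<^bsub>M\<^esub> (g \<oplus>\<^bsub>M\<^esub> g')"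
    using assms(4) by (simp add: smult_r_distr add4)
  then have "(y \<oplus>\<^bsub>M\<^esub> y') \<oplus>\<^bsub>M\<^esub> c \<odot>\<^bsub>M\<^esub> (g \<oplus>\<^bsub>M\<^esub> g') \<in> A"
    using submoduleE(5)[OF assms(3) h(3,4)] by simp
  then show "g \<oplus>\<^bsub>M\<^esub> g' \<in> ?S" using h assms submoduleE(5) by blast
next
  fix r g assume r: "r \<in> carrier R" and "g \<in> ?S"
  then obtain y where h: "y \<in> P" "y \<oplus>\<^bsub>M\<^esub> c \<odot>\<^bsub>M\<^esub> g \<in> A" "g \<in> G" by blast
  then have "y \<in> carrier M" "g \<in> carrier M" using assms submodule_subset by blast+
  moreover from this have "r \<odot>\<^bsub>M\<^esub> (c \<odot>\<^bsub>M\<^esub> g) = c \<odot>\<^bsub>M\<^esub> (r \<odot>\<^bsub>M\<^esub> g)"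
    using r assms(4) by (metis R.m_comm smult_assoc1)
  ultimately have "(r \<odot>\<^bsub>M\<^esub> y) \<oplus>\<^bsub>M\<^esub> c \<odot>\<^bsub>M\<^esub> (r \<odot>\<^bsub>M\<^esub> g) \<in> A"
    using assms(4) submoduleE(4)[OF assms(3) r h(2)] r by (simp add: smult_r_distr)
  then show "r \<odot>\<^bsub>M\<^esub> g \<in> ?S" using h r assms submoduleE(4) by blast
qed

text \<open>The condition is relative to a set \<open>H\<close>, so that it can be carried from a
  submodule to a larger one while generators of \<open>M\<close> are added one by one.\<close>

definition acc :: "'c set \<Rightarrow> bool"
  where "acc H \<longleftrightarrow> (\<forall>A :: nat \<Rightarrow> 'c set.
    (\<forall>k. submodule (A k) R M \<and> A k \<subseteq> A (Suc k) \<and> A k \<subseteq> H) \<longrightarrow> (\<exists>k0. \<forall>k\<ge>k0. A k = A k0))"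

text \<open>A chain inside \<open>R g + H\<close> is governed by two simpler chains: the ideals of
  coefficients of \<open>g\<close>, and the intersections with \<open>H\<close>. Once both are
  constant, so is the chain.\<close>

lemma acc_add_cyclic:
  assumes "noetherian_ring R" "acc H" "submodule H R M" "g \<in> carrier M"
  shows "acc {r \<odot>\<^bsub>M\<^esub> g \<oplus>\<^bsub>M\<^esub> h | r h. r \<in> carrier R \<and> h \<in> H}"
  unfolding acc_def
proof (intro allI impI)
  fix A :: "nat \<Rightarrow> 'c set"
  let ?S = "{r \<odot>\<^bsub>M\<^esub> g \<oplus>\<^bsub>M\<^esub> h | r h. r \<in> carrier R \<and> h \<in> H}"
  assume "\<forall>k. submodule (A k) R M \<and> A k \<subseteq> A (Suc k) \<and> A k \<subseteq> ?S"
  then have A: "submodule (A k) R M" "A k \<subseteq> A (Suc k)" "A k \<subseteq> ?S" for k by auto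
  define I where "I k = {r \<in> carrier R. \<exists>h\<in>H. r \<odot>\<^bsub>M\<^esub> g \<oplus>\<^bsub>M\<^esub> h \<in> A k}" for k
  have "ideal (I k) R" for k
  proof -
    have cl: "c \<otimes> r \<in> I k" if c: "c \<in> carrier R" and r: "r \<in> I k" for c r
    proof -
      obtain h where h: "h \<in> H" "r \<odot>\<^bsub>M\<^esub> g \<oplus>\<^bsub>M\<^esub> h \<in> A k" "r \<in> carrier R" using r unfolding I_def by blast
      have "c \<odot>\<^bsub>M\<^esub> (r \<odot>\<^bsub>M\<^esub> g \<oplus>\<^bsub>M\<^esub> h) = (c \<otimes> r) \<odot>\<^bsub>M\<^esub> g \<oplus>\<^bsub>M\<^esub> c \<odot>\<^bsub>M\<^esub> h"
        using c h assms(4) submodule_subset[OF assms(3) h(1)] by (simp add: smult_r_distr smult_assoc1)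
      then have "(c \<otimes> r) \<odot>\<^bsub>M\<^esub> g \<oplus>\<^bsub>M\<^esub> c \<odot>\<^bsub>M\<^esub> h \<in> A k" using submoduleE(4)[OF A(1) c h(2)] by simp
      then show ?thesis unfolding I_def using c h submoduleE(4)[OF assms(3) c h(1)] by auto
    qed
    have pl: "r \<oplus> r' \<in> I k" if rr: "r \<in> I k" "r' \<in> I k" for r r'
    proof -
      obtain h where h: "h \<in> H" "r \<odot>\<^bsub>M\<^esub> g \<oplus>\<^bsub>M\<^esub> h \<in> A k" "r \<in> carrier R" using rr unfolding I_def by blast
      obtain h' where h': "h' \<in> H" "r' \<odot>\<^bsub>M\<^esub> g \<oplus>\<^bsub>M\<^esub> h' \<in> A k" "r' \<in> carrier R" using rr unfolding I_def by blast
      have "(r \<odot>\<^bsub>M\<^esub> g \<oplus>\<^bsub>M\<^esub> h) \<oplus>\<^bsub>M\<^esub> (r' \<odot>\<^bsub>M\<^esub> g \<oplus>\<^bsub>M\<^esub> h') = (r \<oplus> r') \<odot>\<^bsub>M\<^esub> g \<oplus>\<^bsub>M\<^esub> (h \<oplus>\<^bsub>M\<^esub> h')"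
        using h h' assms(4) submodule_subset[OF assms(3) h(1)] submodule_subset[OF assms(3) h'(1)]
        by (simp add: smult_l_distr add4)
      then have "(r \<oplus> r') \<odot>\<^bsub>M\<^esub> g \<oplus>\<^bsub>M\<^esub> (h \<oplus>\<^bsub>M\<^esub> h') \<in> A k" using submoduleE(5)[OF A(1) h(2) h'(2)] by simp
      then show ?thesis unfolding I_def using h h' submoduleE(5)[OF assms(3) h(1) h'(1)] by auto
    qed
    have "\<zero> \<odot>\<^bsub>M\<^esub> g \<oplus>\<^bsub>M\<^esub> \<zero>\<^bsub>M\<^esub> \<in> A k" using assms(4) submodule_zero[OF A(1)] by simp
    then have z: "\<zero> \<in> I k" unfolding I_def using submodule_zero[OF assms(3)] by blast
    have sub: "I k \<subseteq> carrier R" unfolding I_def by auto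
    show ?thesis
    proof (intro idealI R.ring_axioms)
      show "subgroup (I k) (add_monoid R)"
      proof (rule R.add.subgroupI)
        fix r assume r: "r \<in> I k"
        then have "(\<ominus> \<one>) \<otimes> r \<in> I k" by (intro cl) auto
        then show "\<ominus> r \<in> I k" using r sub by (simp add: R.l_minus subset_iff)
      qed (use z sub pl in auto)
    next
      fix r c assume "r \<in> I k" "c \<in> carrier R"
      then show "c \<otimes> r \<in> I k" "r \<otimes> c \<in> I k" using cl[of c r] sub R.m_comm[of c r] by auto
    qed
  qed
  moreover have "I k \<subseteq> I (Suc k)" for k unfolding I_def using A(2) by blast
  ultimately obtain k1 where k1: "\<And>k. k \<ge> k1 \<Longrightarrow> I k = I k1"
    using noetherian_ring.ideal_chain_stabilises[OF assms(1), of I] by blast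
  have "\<exists>k0. \<forall>k\<ge>k0. A k \<inter> H = A k0 \<inter> H"
    using assms(2)[unfolded acc_def, rule_format, of "\<lambda>k. A k \<inter> H"] A assms(3) submodule_Int by blast
  then obtain k2 where k2: "\<And>k. k \<ge> k2 \<Longrightarrow> A k \<inter> H = A k2 \<inter> H" by blast
  define k0 where "k0 = max k1 k2"
  have "A k = A k0" if k: "k0 \<le> k" for k
  proof
    have mono: "A k0 \<subseteq> A k" using lift_Suc_mono_le[of A] A(2) k by blast
    then show "A k0 \<subseteq> A k" .
    show "A k \<subseteq> A k0"
    proof
      fix x assume x: "x \<in> A k"
      then obtain r h where h: "x = r \<odot>\<^bsub>M\<^esub> g \<oplus>\<^bsub>M\<^esub> h" "r \<in> carrier R" "h \<in> H" using A(3) by blast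
      then have "r \<in> I k" unfolding I_def using x by blast
      then have "r \<in> I k0" using k1[of k] k1[of k0] k unfolding k0_def by simp
      \<comment> \<open>This element of \<open>A k0\<close> has the same coefficient at
        \<open>g\<close> as \<open>x\<close>. The difference of the two lies in \<open>A k\<close>
        and in \<open>H\<close>, where the chain is already constant.\<close>
      then obtain h' where h': "h' \<in> H" "r \<odot>\<^bsub>M\<^esub> g \<oplus>\<^bsub>M\<^esub> h' \<in> A k0" unfolding I_def by blast
      have c: "h \<in> carrier M" "h' \<in> carrier M" using h h' submodule_subset assms(3) by blast+
      have "x \<ominus>\<^bsub>M\<^esub> (r \<odot>\<^bsub>M\<^esub> g \<oplus>\<^bsub>M\<^esub> h') = h \<ominus>\<^bsub>M\<^esub> h'"
        using h c assms(4) by (simp add: M.minus_add_cancel_left)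
      moreover have "x \<ominus>\<^bsub>M\<^esub> (r \<odot>\<^bsub>M\<^esub> g \<oplus>\<^bsub>M\<^esub> h') \<in> A k"
        using submodule_minus[OF A(1) x] h' mono by blast
      ultimately have "h \<ominus>\<^bsub>M\<^esub> h' \<in> A k \<inter> H" using submodule_minus[OF assms(3) h(3) h'(1)] by simp
      then have "h \<ominus>\<^bsub>M\<^esub> h' \<in> A k0" using k2[of k] k2[of k0] k unfolding k0_def by auto
      then have "(r \<odot>\<^bsub>M\<^esub> g \<oplus>\<^bsub>M\<^esub> h') \<oplus>\<^bsub>M\<^esub> (h \<ominus>\<^bsub>M\<^esub> h') \<in> A k0" using submoduleE(5)[OF A(1) h'(2)] by blast
      also have "(r \<odot>\<^bsub>M\<^esub> g \<oplus>\<^bsub>M\<^esub> h') \<oplus>\<^bsub>M\<^esub> (h \<ominus>\<^bsub>M\<^esub> h') = x"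
        using h c assms(4) by (simp add: M.add_minus_cancel M.a_assoc)
      finally show "x \<in> A k0" .
    qed
  qed
  then show "\<exists>k0. \<forall>k\<ge>k0. A k = A k0" by blast
qed

lemma submodule_add_cyclic:
  assumes "submodule H R M" "g \<in> carrier M"
  shows "submodule {r \<odot>\<^bsub>M\<^esub> g \<oplus>\<^bsub>M\<^esub> h | r h. r \<in> carrier R \<and> h \<in> H} R M" (is "submodule ?S R M")
proof (rule submoduleI')
  show "?S \<subseteq> carrier M" using assms submodule_subset by auto
  have "\<zero>\<^bsub>M\<^esub> = \<zero> \<odot>\<^bsub>M\<^esub> g \<oplus>\<^bsub>M\<^esub> \<zero>\<^bsub>M\<^esub>" using assms(2) by simp
  then show "\<zero>\<^bsub>M\<^esub> \<in> ?S" using assms(1) submodule_zero by blast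
next
  fix u v assume "u \<in> ?S" "v \<in> ?S"
  then obtain r h r' h' where h: "u = r \<odot>\<^bsub>M\<^esub> g \<oplus>\<^bsub>M\<^esub> h" "v = r' \<odot>\<^bsub>M\<^esub> g \<oplus>\<^bsub>M\<^esub> h'"
    "h \<in> H" "h' \<in> H" "r \<in> carrier R" "r' \<in> carrier R" by blast
  moreover from this have "h \<in> carrier M" "h' \<in> carrier M"
    using assms submodule_subset by blast+
  ultimately have "u \<oplus>\<^bsub>M\<^esub> v = (r \<oplus> r') \<odot>\<^bsub>M\<^esub> g \<oplus>\<^bsub>M\<^esub> (h \<oplus>\<^bsub>M\<^esub> h')"
    using assms(2) by (simp add: smult_l_distr add4)
  then show "u \<oplus>\<^bsub>M\<^esub> v \<in> ?S" using h assms submoduleE(5) R.a_closed by blast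
next
  fix c u assume c: "c \<in> carrier R" and "u \<in> ?S"
  then obtain r h where h: "u = r \<odot>\<^bsub>M\<^esub> g \<oplus>\<^bsub>M\<^esub> h" "h \<in> H" "r \<in> carrier R" by blast
  moreover from this have "h \<in> carrier M" using assms submodule_subset by blast
  ultimately have "c \<odot>\<^bsub>M\<^esub> u = (c \<otimes> r) \<odot>\<^bsub>M\<^esub> g \<oplus>\<^bsub>M\<^esub> c \<odot>\<^bsub>M\<^esub> h"
    using assms(2) c by (simp add: smult_r_distr smult_assoc1)
  then show "c \<odot>\<^bsub>M\<^esub> u \<in> ?S" using h c assms submoduleE(4) R.m_closed by blast
qed

lemma acc_carrier:
  assumes "noetherian_ring R" "finitely_generated_module R M"
  shows "acc (carrier M)"
proof -
  obtain S where S: "S \<subseteq> carrier M" "finite S" "ideal_smult M (carrier R) S = carrier M"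
    using assms(2) unfolding finitely_generated_module_def by blast
  \<comment> \<open>The induction only provides some submodule containing the generators; it then
    contains their span, which is \<open>M\<close>.\<close>
  have "\<exists>H. acc H \<and> submodule H R M \<and> S \<subseteq> H" using S(2,1)
  proof (induction S rule: finite_induct)
    case empty
    have "acc {\<zero>\<^bsub>M\<^esub>}" unfolding acc_def
    proof (intro allI impI)
      fix A :: "nat \<Rightarrow> 'c set"
      assume "\<forall>k. submodule (A k) R M \<and> A k \<subseteq> A (Suc k) \<and> A k \<subseteq> {\<zero>\<^bsub>M\<^esub>}"
      then have "A k = {\<zero>\<^bsub>M\<^esub>}" for k using submodule_zero by blast
      then show "\<exists>k0. \<forall>k\<ge>k0. A k = A k0" by simp
    qed
    then show ?case using submodule_single_zero by blast
  next
    case (insert g S)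
    then obtain H where H: "acc H" "submodule H R M" "S \<subseteq> H" by auto
    have g: "g \<in> carrier M" using insert by simp
    let ?H = "{r \<odot>\<^bsub>M\<^esub> g \<oplus>\<^bsub>M\<^esub> h | r h. r \<in> carrier R \<and> h \<in> H}"
    have "g = \<one> \<odot>\<^bsub>M\<^esub> g \<oplus>\<^bsub>M\<^esub> \<zero>\<^bsub>M\<^esub>" using g by simp
    then have "g \<in> ?H" using submodule_zero[OF H(2)] by blast
    moreover have "h \<in> ?H" if "h \<in> H" for h
    proof -
      have "h = \<zero> \<odot>\<^bsub>M\<^esub> g \<oplus>\<^bsub>M\<^esub> h" using g submodule_subset[OF H(2) that] by simp
      then show ?thesis using that by blast
    qed
    ultimately have "insert g S \<subseteq> ?H" using H(3) by blast
    then show ?case using acc_add_cyclic[OF assms(1) H(1,2) g] submodule_add_cyclic[OF H(2) g] by blast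
  qed
  then obtain H where H: "acc H" "submodule H R M" "S \<subseteq> H" by blast
  have "generate (add_monoid M) {r \<odot>\<^bsub>M\<^esub> x | r x. r \<in> carrier R \<and> x \<in> S} \<subseteq> H"
    using H submoduleE(4)[OF H(2)] by (intro M.add.generate_subgroup_incl) (auto simp: submodule_def)
  then have "carrier M = H" using S(3) submoduleE(1)[OF H(2)] unfolding ideal_smult_def by blast
  then show ?thesis using H(1) by simp
qed

end

section \<open>Graded submodules and the basis theorem\<close>

text \<open>A graded module over the Rees algebra is given by its homogeneous parts \<open>A n\<close>; the elements
  \<open>W\<close> generate the ideal and act as variables of degree 1.\<close>

definition gsub ::
    "('a, 'k) ring_scheme \<Rightarrow> ('a, 'm, 'x) module_scheme \<Rightarrow> 'a set \<Rightarrow> (nat \<Rightarrow> 'm set) \<Rightarrow> bool"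
  where "gsub R M W A \<longleftrightarrow> (\<forall>n. submodule (A n) R M) \<and>
    (\<forall>n. \<forall>x\<in>W. \<forall>m\<in>A n. x \<odot>\<^bsub>M\<^esub> m \<in> A (Suc n))"

text \<open>One index \<open>k0\<close> has to serve all degrees \<open>n\<close>. This uniformity,
  which is more than a chain condition in each degree separately, later produces statements for all
  large \<open>n\<close>.\<close>

definition gnoeth ::
    "('a, 'k) ring_scheme \<Rightarrow> ('a, 'm, 'x) module_scheme \<Rightarrow> 'a set \<Rightarrow> (nat \<Rightarrow> 'm set) \<Rightarrow> bool"
  where "gnoeth R M W G \<longleftrightarrow> (\<forall>A :: nat \<Rightarrow> nat \<Rightarrow> 'm set.
    (\<forall>k. gsub R M W (A k)) \<and> (\<forall>k n. A k n \<subseteq> A (Suc k) n) \<and> (\<forall>k n. A k n \<subseteq> G n) \<longrightarrow>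
    (\<exists>k0. \<forall>k\<ge>k0. \<forall>n. A k n = A k0 n))"

text \<open>The part of degree \<open>n\<close> of \<open>G + x G + \<dots> + x ^ (d - 1) G\<close>.\<close>

fun gext ::
    "('a, 'k) ring_scheme \<Rightarrow> ('a, 'm, 'x) module_scheme \<Rightarrow> 'a \<Rightarrow> (nat \<Rightarrow> 'm set) \<Rightarrow> nat \<Rightarrow> nat \<Rightarrow> 'm set"
  where
    "gext R M x G 0 n = {\<zero>\<^bsub>M\<^esub>}"
  | "gext R M x G (Suc d) n = {y \<oplus>\<^bsub>M\<^esub> x [^]\<^bsub>R\<^esub> d \<odot>\<^bsub>M\<^esub> g | y g.
       y \<in> gext R M x G d n \<and> g \<in> (if d \<le> n then G (n - d) else {\<zero>\<^bsub>M\<^esub>})}"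

lemma gsubD:
  assumes "gsub R M W A"
  shows "submodule (A n) R M" "x \<in> W \<Longrightarrow> m \<in> A n \<Longrightarrow> x \<odot>\<^bsub>M\<^esub> m \<in> A (Suc n)"
  using assms unfolding gsub_def by auto

context module
begin

context
  fixes x and G W
  assumes x: "x \<in> carrier R" and W: "W \<subseteq> carrier R" and G: "gsub R M W G"
begin

abbreviation (input) "shifted d n \<equiv> (if d \<le> n then G (n - d) else {\<zero>\<^bsub>M\<^esub>})"

lemma submodule_shifted: "submodule (shifted d n) R M"
  using gsubD(1)[OF G] submodule_single_zero by auto

lemma submodule_gext: "submodule (gext R M x G d n) R M"
proof (induction d)
  case (Suc d)
  show ?case unfolding gext.simps
    by (rule submodule_add_smult[OF Suc submodule_shifted]) (use x in simp)
qed (simp add: submodule_single_zero)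

lemma gext_mono_Suc: "gext R M x G d n \<subseteq> gext R M x G (Suc d) n"
proof
  fix y assume y: "y \<in> gext R M x G d n"
  have "y = y \<oplus>\<^bsub>M\<^esub> x [^] d \<odot>\<^bsub>M\<^esub> \<zero>\<^bsub>M\<^esub>" using submodule_subset[OF submodule_gext y] x by simp
  moreover have "\<zero>\<^bsub>M\<^esub> \<in> shifted d n" using submodule_zero[OF submodule_shifted] .
  ultimately show "y \<in> gext R M x G (Suc d) n" unfolding gext.simps using y by blast
qed

lemma gext_smult:
  assumes "u \<in> W" "y \<in> gext R M x G d n"
  shows "u \<odot>\<^bsub>M\<^esub> y \<in> gext R M x G d (Suc n)"
  using assms(2)
proof (induction d arbitrary: y)
  case (Suc d)
  then obtain z g where h: "y = z \<oplus>\<^bsub>M\<^esub> x [^] d \<odot>\<^bsub>M\<^esub> g" "z \<in> gext R M x G d n" "g \<in> shifted d n"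
    unfolding gext.simps by blast
  have c: "z \<in> carrier M" "g \<in> carrier M" "u \<in> carrier R"
    using submodule_subset[OF submodule_gext h(2)] submodule_subset[OF submodule_shifted h(3)]
      assms(1) W by auto
  have "u \<odot>\<^bsub>M\<^esub> (x [^] d \<odot>\<^bsub>M\<^esub> g) = x [^] d \<odot>\<^bsub>M\<^esub> (u \<odot>\<^bsub>M\<^esub> g)"
    using c x by (metis R.m_comm R.nat_pow_closed smult_assoc1)
  then have "u \<odot>\<^bsub>M\<^esub> y = (u \<odot>\<^bsub>M\<^esub> z) \<oplus>\<^bsub>M\<^esub> x [^] d \<odot>\<^bsub>M\<^esub> (u \<odot>\<^bsub>M\<^esub> g)"
    using c x h(1) by (simp add: smult_r_distr)
  moreover have "u \<odot>\<^bsub>M\<^esub> g \<in> shifted d (Suc n)"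
  proof (cases "d \<le> n")
    case True
    then show ?thesis using h(3) gsubD(2)[OF G assms(1), of g "n - d"] by (simp add: Suc_diff_le)
  next
    case False
    then have "u \<odot>\<^bsub>M\<^esub> g = \<zero>\<^bsub>M\<^esub>" using h(3) c(3) by simp
    then show ?thesis using submodule_zero[OF submodule_shifted] by simp
  qed
  ultimately show ?case unfolding gext.simps using Suc.IH[OF h(2)] by blast
qed (use assms(1) W in auto)

lemma gext_smult_new:
  assumes "y \<in> gext R M x G d n"
  shows "x \<odot>\<^bsub>M\<^esub> y \<in> gext R M x G (Suc d) (Suc n)"
  using assms
proof (induction d arbitrary: y)
  case 0
  then show ?case using x submodule_zero[OF submodule_gext, of "Suc 0" "Suc n"] by simp
next
  case (Suc d)
  then obtain z g where h: "y = z \<oplus>\<^bsub>M\<^esub> x [^] d \<odot>\<^bsub>M\<^esub> g" "z \<in> gext R M x G d n" "g \<in> shifted d n"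
    unfolding gext.simps by blast
  have c: "z \<in> carrier M" "g \<in> carrier M"
    using submodule_subset[OF submodule_gext h(2)] submodule_subset[OF submodule_shifted h(3)] by auto
  have "x \<odot>\<^bsub>M\<^esub> y = (x \<odot>\<^bsub>M\<^esub> z) \<oplus>\<^bsub>M\<^esub> x [^] (Suc d) \<odot>\<^bsub>M\<^esub> g"
    using c x h(1) by (simp add: smult_r_distr smult_assoc1[symmetric] R.m_comm)
  moreover have "g \<in> shifted (Suc d) (Suc n)" using h(3) by (simp split: if_splits)
  ultimately show ?case unfolding gext.simps(2)[of R M x G "Suc d"] using Suc.IH[OF h(2)] by blast
qed

text \<open>The coefficient of \<open>x [^] d\<close> in degree \<open>n\<close> has degree
  \<open>n - d\<close>, so the powers with exponents from 0 to \<open>n\<close> exhaust degree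
  \<open>n\<close>; \<open>Suc n\<close> counts them.\<close>

lemma gsub_gext: "gsub R M (insert x W) (\<lambda>n. gext R M x G (Suc n) n)"
  unfolding gsub_def
proof (intro conjI allI ballI)
  fix n u m assume "u \<in> insert x W" "m \<in> gext R M x G (Suc n) n"
  then show "u \<odot>\<^bsub>M\<^esub> m \<in> gext R M x G (Suc (Suc n)) (Suc n)"
    using gext_smult gext_smult_new gext_mono_Suc by blast
qed (rule submodule_gext)

text \<open>Hilbert's basis theorem, by the modules \<open>L k d\<close> of leading coefficients: they increase in \<open>k\<close>
  and \<open>d\<close>, so finitely many chains decide when all of them become stationary.\<close>

lemma gnoeth_gext:
  assumes GN: "gnoeth R M W G"
  shows "gnoeth R M (insert x W) (\<lambda>n. gext R M x G (Suc n) n)"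
  unfolding gnoeth_def
proof (intro allI impI, elim conjE)
  fix A :: "nat \<Rightarrow> nat \<Rightarrow> 'c set"
  assume "\<forall>k. gsub R M (insert x W) (A k)" "\<forall>k n. A k n \<subseteq> A (Suc k) n"
    "\<forall>k n. A k n \<subseteq> gext R M x G (Suc n) n"
  then have A: "gsub R M (insert x W) (A k)" "A k n \<subseteq> A (Suc k) n" "A k n \<subseteq> gext R M x G (Suc n) n" for k n
    by auto
  \<comment> \<open>Taking elements of degree \<open>n + d\<close> puts their coefficient at
    \<open>x [^] d\<close> into degree \<open>n\<close>, so \<open>L k d\<close> is a graded
    submodule of \<open>G\<close>.\<close>
  define L where "L k d n = {g \<in> G n. \<exists>y\<in>gext R M x G d (n + d). y \<oplus>\<^bsub>M\<^esub> x [^] d \<odot>\<^bsub>M\<^esub> g \<in> A k (n + d)}" for k d n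
  have LG: "L k d n \<subseteq> G n" for k d n unfolding L_def by blast
  have subL: "gsub R M W (L k d)" for k d
    unfolding gsub_def
  proof (intro conjI allI ballI)
    show "submodule (L k d n) R M" for n unfolding L_def
      by (rule submodule_leading) (use gsubD(1)[OF G] gsubD(1)[OF A(1)] submodule_gext x in auto)
    fix n u m assume u: "u \<in> W" and m: "m \<in> L k d n"
    then obtain y where y: "y \<in> gext R M x G d (n + d)" "y \<oplus>\<^bsub>M\<^esub> x [^] d \<odot>\<^bsub>M\<^esub> m \<in> A k (n + d)" "m \<in> G n"
      unfolding L_def by blast
    have c: "y \<in> carrier M" "m \<in> carrier M" "u \<in> carrier R"
      using submodule_subset[OF submodule_gext y(1)] submodule_subset[OF gsubD(1)[OF G] y(3)] u W by auto
    have "u \<odot>\<^bsub>M\<^esub> (x [^] d \<odot>\<^bsub>M\<^esub> m) = x [^] d \<odot>\<^bsub>M\<^esub> (u \<odot>\<^bsub>M\<^esub> m)"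
      using c x by (metis R.m_comm R.nat_pow_closed smult_assoc1)
    then have "u \<odot>\<^bsub>M\<^esub> (y \<oplus>\<^bsub>M\<^esub> x [^] d \<odot>\<^bsub>M\<^esub> m) = (u \<odot>\<^bsub>M\<^esub> y) \<oplus>\<^bsub>M\<^esub> x [^] d \<odot>\<^bsub>M\<^esub> (u \<odot>\<^bsub>M\<^esub> m)"
      using c x by (simp add: smult_r_distr)
    then have "(u \<odot>\<^bsub>M\<^esub> y) \<oplus>\<^bsub>M\<^esub> x [^] d \<odot>\<^bsub>M\<^esub> (u \<odot>\<^bsub>M\<^esub> m) \<in> A k (Suc n + d)"
      using gsubD(2)[OF A(1), of u] y(2) u by force
    then show "u \<odot>\<^bsub>M\<^esub> m \<in> L k d (Suc n)"
      unfolding L_def using gext_smult[OF u y(1)] gsubD(2)[OF G u y(3)] by auto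
  qed
  have Lk: "L k d n \<subseteq> L (Suc k) d n" for k d n unfolding L_def using A(2) by blast
  have Ld: "L k d n \<subseteq> L k (Suc d) n" for k d n
  proof
    fix m assume m: "m \<in> L k d n"
    then obtain y where y: "y \<in> gext R M x G d (n + d)" "y \<oplus>\<^bsub>M\<^esub> x [^] d \<odot>\<^bsub>M\<^esub> m \<in> A k (n + d)" "m \<in> G n"
      unfolding L_def by blast
    have c: "y \<in> carrier M" "m \<in> carrier M"
      using submodule_subset[OF submodule_gext y(1)] submodule_subset[OF gsubD(1)[OF G] y(3)] by auto
    have "x \<odot>\<^bsub>M\<^esub> (y \<oplus>\<^bsub>M\<^esub> x [^] d \<odot>\<^bsub>M\<^esub> m) = (x \<odot>\<^bsub>M\<^esub> y) \<oplus>\<^bsub>M\<^esub> x [^] (Suc d) \<odot>\<^bsub>M\<^esub> m"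
      using c x by (simp add: smult_r_distr smult_assoc1[symmetric] R.m_comm)
    then have "(x \<odot>\<^bsub>M\<^esub> y) \<oplus>\<^bsub>M\<^esub> x [^] (Suc d) \<odot>\<^bsub>M\<^esub> m \<in> A k (n + Suc d)"
      using gsubD(2)[OF A(1), of x] y(2) by force
    then show "m \<in> L k (Suc d) n"
      unfolding L_def using gext_smult_new[OF y(1)] y(3) by auto
  qed
  have Lkm: "k \<le> k' \<Longrightarrow> L k d n \<subseteq> L k' d n" for k k' d n
    using lift_Suc_mono_le[of "\<lambda>k. L k d n"] Lk by blast
  have Ldm: "d \<le> d' \<Longrightarrow> L k d n \<subseteq> L k d' n" for k d d' n
    using lift_Suc_mono_le[of "\<lambda>d. L k d n"] Ld by blast
  have "\<exists>k0. \<forall>k\<ge>k0. \<forall>n. L k d n = L k0 d n" for d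
    using GN[unfolded gnoeth_def, rule_format, of "\<lambda>k. L k d"] subL Lk LG by blast
  then obtain kk where kk: "\<And>d k n. k \<ge> kk d \<Longrightarrow> L k d n = L (kk d) d n" by metis
  \<comment> \<open>The diagonal chain decides all exponents \<open>d \<ge> k0\<close> at once.
    Below \<open>k0\<close> finitely many chains remain, and the maximum of their indices
    exists.\<close>
  have diag: "L k k n \<subseteq> L (Suc k) (Suc k) n" for k n using Lk Ld by blast
  have "\<exists>k0. \<forall>k\<ge>k0. \<forall>n. L k k n = L k0 k0 n"
    using GN[unfolded gnoeth_def, rule_format, of "\<lambda>k. L k k"] subL diag LG by blast
  then obtain k0 where k0: "\<And>k n. k \<ge> k0 \<Longrightarrow> L k k n = L k0 k0 n" by blast
  define K where "K = Max (insert k0 (kk ` {..<k0}))"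
  have K: "k0 \<le> K" "d < k0 \<Longrightarrow> kk d \<le> K" for d unfolding K_def by auto
  have stab: "L k d n \<subseteq> L K d n" if k: "K \<le> k" for k d n
  proof (cases "d < k0")
    case True
    then show ?thesis using kk[of d k n] kk[of d K n] K k by force
  next
    case False
    \<comment> \<open>Here \<open>d \<ge> k0\<close>, and \<open>L k d\<close> is enclosed between
      \<open>L K d\<close> and a diagonal term equal to \<open>L k0 k0\<close>, which in turn is
      contained in \<open>L K d\<close>.\<close>
    have "L k d n \<subseteq> L (max d k) (max d k) n" using Lkm[of k "max d k" d n] Ldm[of d "max d k" "max d k" n] by auto
    also have "\<dots> = L k0 k0 n" using k0[of "max d k" n] False by simp
    also have "\<dots> \<subseteq> L K d n" using Lkm[of k0 K k0 n] Ldm[of k0 d K n] K(1) False by auto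
    finally show ?thesis .
  qed
  have AK: "A K n \<subseteq> A k n" if "K \<le> k" for k n using lift_Suc_mono_le[of "\<lambda>k. A k n"] A(2) that by blast
  \<comment> \<open>Induction on the number of terms: the leading coefficient of an element of
    \<open>A k\<close> also occurs in \<open>A K\<close>, and subtracting the corresponding element
    leaves one of \<open>A k\<close> with fewer terms.\<close>
  have main: "A k n \<inter> gext R M x G d n \<subseteq> A K n" if k: "K \<le> k" for k n d
  proof (induction d)
    case 0
    then show ?case using submodule_zero[OF gsubD(1)[OF A(1)]] by auto
  next
    case (Suc d)
    show ?case
    proof
      fix u assume u: "u \<in> A k n \<inter> gext R M x G (Suc d) n"
      then obtain z g where h: "u = z \<oplus>\<^bsub>M\<^esub> x [^] d \<odot>\<^bsub>M\<^esub> g" "z \<in> gext R M x G d n" "g \<in> shifted d n"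
        unfolding gext.simps by blast
      have c: "z \<in> carrier M" "g \<in> carrier M"
        using submodule_subset[OF submodule_gext h(2)] submodule_subset[OF submodule_shifted h(3)] by auto
      show "u \<in> A K n"
      proof (cases "d \<le> n")
        case False
        then have "u = z" using h c x by simp
        then show ?thesis using u h Suc.IH by blast
      next
        case True
        define n' where "n' = n - d"
        have n: "n = n' + d" using True unfolding n'_def by simp
        have "g \<in> L k d n'" unfolding L_def using h u True n by auto
        then have "g \<in> L K d n'" using stab[OF k] by blast
        then obtain y where y: "y \<in> gext R M x G d n" "y \<oplus>\<^bsub>M\<^esub> x [^] d \<odot>\<^bsub>M\<^esub> g \<in> A K n"
          unfolding L_def n by blast
        have yc: "y \<in> carrier M" using submodule_subset[OF submodule_gext y(1)] .
        have xg: "x [^] d \<odot>\<^bsub>M\<^esub> g \<in> carrier M" using x c by simp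
        have eq: "u \<ominus>\<^bsub>M\<^esub> (y \<oplus>\<^bsub>M\<^esub> x [^] d \<odot>\<^bsub>M\<^esub> g) = z \<ominus>\<^bsub>M\<^esub> y"
          using h(1) c yc xg M.r_neg[OF xg] M.minus_add_add[OF c(1) xg yc xg] by (simp add: a_minus_def)
        have "u \<ominus>\<^bsub>M\<^esub> (y \<oplus>\<^bsub>M\<^esub> x [^] d \<odot>\<^bsub>M\<^esub> g) \<in> A k n"
          using submodule_minus[OF gsubD(1)[OF A(1)]] u y(2) AK[OF k] by blast
        moreover have "z \<ominus>\<^bsub>M\<^esub> y \<in> gext R M x G d n" using submodule_minus[OF submodule_gext h(2) y(1)] .
        ultimately have "z \<ominus>\<^bsub>M\<^esub> y \<in> A K n" using eq Suc.IH by auto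
        then have "(y \<oplus>\<^bsub>M\<^esub> x [^] d \<odot>\<^bsub>M\<^esub> g) \<oplus>\<^bsub>M\<^esub> (u \<ominus>\<^bsub>M\<^esub> (y \<oplus>\<^bsub>M\<^esub> x [^] d \<odot>\<^bsub>M\<^esub> g)) \<in> A K n"
          using eq y(2) submoduleE(5)[OF gsubD(1)[OF A(1)]] by auto
        then show ?thesis using h(1) c yc xg by (simp add: M.add_minus_cancel)
      qed
    qed
  qed
  have "A k n = A K n" if "K \<le> k" for k n
    using main[OF that, of n "Suc n"] A(3)[of k n] AK[OF that, of n] by blast
  then show "\<exists>k0. \<forall>k\<ge>k0. \<forall>n. A k n = A k0 n" by blast
qed

end

text \<open>The start is \<open>M\<close> concentrated in degree 0, where the chain condition is
  that of \<open>M\<close>; then one variable after the other is adjoined. The parts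
  \<open>G n\<close> are submodules of \<open>M\<close> itself, so no polynomial module is
  needed.\<close>

lemma gnoeth_exists:
  assumes "noetherian_ring R" "finitely_generated_module R M" "finite W" "W \<subseteq> carrier R"
  shows "\<exists>G. gsub R M W G \<and> gnoeth R M W G \<and> G 0 = carrier M"
  using assms(3,4)
proof (induction W rule: finite_induct)
  case empty
  define G where "G n = (if n = 0 then carrier M else {\<zero>\<^bsub>M\<^esub>})" for n :: nat
  have "gsub R M {} G" unfolding gsub_def G_def
    using carrier_is_submodule submodule_single_zero by simp
  moreover have "gnoeth R M {} G"
    unfolding gnoeth_def
  proof (intro allI impI, elim conjE)
    fix A :: "nat \<Rightarrow> nat \<Rightarrow> 'c set"
    assume A: "\<forall>k. gsub R M {} (A k)" "\<forall>k n. A k n \<subseteq> A (Suc k) n" "\<forall>k n. A k n \<subseteq> G n"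
    have "\<forall>k. submodule (A k 0) R M \<and> A k 0 \<subseteq> A (Suc k) 0 \<and> A k 0 \<subseteq> carrier M"
      using A gsubD(1) submoduleE(1) by blast
    then have "\<exists>k0. \<forall>k\<ge>k0. A k 0 = A k0 0"
      by (rule acc_carrier[OF assms(1,2), unfolded acc_def, THEN spec, THEN mp])
    then obtain k0 where k0: "\<And>k. k \<ge> k0 \<Longrightarrow> A k 0 = A k0 0" by blast
    have "A k n = {\<zero>\<^bsub>M\<^esub>}" if "n \<noteq> 0" for k n
    proof -
      have "A k n \<subseteq> {\<zero>\<^bsub>M\<^esub>}" using A(3)[rule_format, of k n] that unfolding G_def by simp
      moreover have "\<zero>\<^bsub>M\<^esub> \<in> A k n" using submodule_zero gsubD(1) A(1) by blast
      ultimately show ?thesis by blast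
    qed
    then have "\<forall>k\<ge>k0. \<forall>n. A k n = A k0 n" using k0 by metis
    then show "\<exists>k0. \<forall>k\<ge>k0. \<forall>n. A k n = A k0 n" by blast
  qed
  ultimately show ?case unfolding G_def by auto
next
  case (insert x W)
  then obtain G where G: "gsub R M W G" "gnoeth R M W G" "G 0 = carrier M" by auto
  have x: "x \<in> carrier R" "W \<subseteq> carrier R" using insert by auto
  have "g \<in> gext R M x G (Suc 0) 0" if "g \<in> carrier M" for g
    unfolding gext.simps by (intro CollectI exI[of _ "\<zero>\<^bsub>M\<^esub>"] exI[of _ g]) (use that G(3) in simp)
  then have "gext R M x G (Suc 0) 0 = carrier M"
    using submoduleE(1)[OF submodule_gext[OF x G(1)]] by blast
  then show ?case
    by (intro exI[of _ "\<lambda>n. gext R M x G (Suc n) n"] conjI gsub_gext[OF x G(1)] gnoeth_gext[OF x G(1,2)])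
qed

end

section \<open>Vanishing of graded Cech cohomology in large degrees\<close>

lemma (in abelian_group) neg_minus_add:
  "p \<in> carrier G \<Longrightarrow> q \<in> carrier G \<Longrightarrow> \<ominus> (p \<ominus> q) \<oplus> p = q"
  using a_lcomm[of p q "\<ominus> p"] by (simp add: a_minus_def minus_add a_comm r_neg)

lemma (in abelian_group) minus_add_eq:
  "p \<in> carrier G \<Longrightarrow> q \<in> carrier G \<Longrightarrow> r \<in> carrier G \<Longrightarrow> p \<ominus> (q \<oplus> r) = (p \<ominus> q) \<ominus> r"
  by (simp add: a_minus_def minus_add a_ac)

lemma (in abelian_group) neg_zero [simp]: "\<ominus> \<zero> = \<zero>"
  using add.inv_one by simp

lemma (in abelian_group) minus_zero_right [simp]: "x \<in> carrier G \<Longrightarrow> x \<ominus> \<zero> = x"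
  by (simp add: a_minus_def)

lemma (in abelian_group) minus_add_drop:
  assumes "p \<in> carrier G" "q \<in> carrier G" "r \<in> carrier G"
  shows "(p \<ominus> (q \<oplus> r)) \<oplus> q = p \<ominus> r"
proof -
  have "(p \<ominus> (q \<oplus> r)) \<oplus> q = (q \<oplus> p) \<ominus> (q \<oplus> r)"
    using assms by (simp add: a_minus_def a_ac)
  then show ?thesis using assms by (simp add: minus_add_cancel_left)
qed

lemma subset_lessThan_Suc_cases:
  assumes "J \<subseteq> {..<Suc r}"
  obtains "J \<subseteq> {..<r}" | J' where "J = insert r J'" "J' \<subseteq> {..<r}"
proof (cases "r \<in> J")
  case True
  show ?thesis by (rule that(2)[of "J - {r}"]) (use True assms in auto)
next
  case False
  show ?thesis by (rule that(1)) (use False assms in \<open>auto simp: less_Suc_eq\<close>)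
qed

context koszul
begin

text \<open>Cocycles and coboundaries of \<open>A / B\<close> in degree \<open>n\<close> and in the variables \<open>a 0, \<dots>, a (r - 1)\<close>,
  in all cohomological degrees at once: \<open>v J\<close> is the numerator over the \<open>s\<close>-th power of the
  product of the \<open>a j\<close>, and \<open>lift k\<close> expands the fraction.\<close>

definition gcob :: "nat \<Rightarrow> (nat \<Rightarrow> 'c set) \<Rightarrow> (nat \<Rightarrow> 'c set) \<Rightarrow> nat \<Rightarrow> nat \<Rightarrow> (nat set \<Rightarrow> 'c) \<Rightarrow> bool"
  where "gcob r A B n s v \<longleftrightarrow> (\<exists>k w. (\<forall>J\<subseteq>{..<r}. w J \<in> A (n + (s + k) * card J)) \<and>
    (\<forall>J\<subseteq>{..<r}. lift k v J \<ominus>\<^bsub>M\<^esub> d (s + k) w J \<in> B (n + (s + k) * card J)))"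

definition gcyc :: "nat \<Rightarrow> (nat \<Rightarrow> 'c set) \<Rightarrow> (nat \<Rightarrow> 'c set) \<Rightarrow> nat \<Rightarrow> nat \<Rightarrow> (nat set \<Rightarrow> 'c) \<Rightarrow> bool"
  where "gcyc r A B n s v \<longleftrightarrow> (\<forall>J\<subseteq>{..<r}. v J \<in> A (n + s * card J)) \<and>
    (\<forall>J\<subseteq>{..<r}. d s v J \<in> B (n + s * card J))"

text \<open>This includes cohomological degree 0: the differential vanishes at the empty set, so
  \<open>gcob\<close> forces \<open>v {}\<close> into \<open>B n\<close>.\<close>

definition gvan :: "nat \<Rightarrow> (nat \<Rightarrow> 'c set) \<Rightarrow> (nat \<Rightarrow> 'c set) \<Rightarrow> nat \<Rightarrow> bool"
  where "gvan r A B n \<longleftrightarrow> (\<forall>s v. gcyc r A B n s v \<longrightarrow> gcob r A B n s v)"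

lemma gcob_cong:
  assumes "\<And>J. J \<subseteq> {..<r} \<Longrightarrow> v J = v' J"
  shows "gcob r A B n s v \<longleftrightarrow> gcob r A B n s v'"
  unfolding gcob_def koszul_lift_def using assms by simp

lemma gsub_pow:
  assumes "gsub R M W A" "x \<in> W" "x \<in> carrier R" "m \<in> A n"
  shows "x [^] k \<odot>\<^bsub>M\<^esub> m \<in> A (n + k)"
proof (induction k)
  case (Suc k)
  have "x \<odot>\<^bsub>M\<^esub> (x [^] k \<odot>\<^bsub>M\<^esub> m) \<in> A (Suc (n + k))" using gsubD(2)[OF assms(1,2) Suc] .
  also have "x \<odot>\<^bsub>M\<^esub> (x [^] k \<odot>\<^bsub>M\<^esub> m) = x [^] Suc k \<odot>\<^bsub>M\<^esub> m"
    using assms submodule_subset[OF gsubD(1)[OF assms(1)] assms(4)]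
    by (simp add: smult_assoc1[symmetric] R.m_comm)
  finally show ?case by simp
qed (use assms submodule_subset[OF gsubD(1)[OF assms(1)] assms(4)] in simp)

lemma gsub_px:
  assumes "gsub R M W A" "finite J" "a ` J \<subseteq> W" "m \<in> A n"
  shows "px J [^] k \<odot>\<^bsub>M\<^esub> m \<in> A (n + k * card J)"
  using assms(2,3)
proof (induction J rule: finite_induct)
  case empty
  then show ?case using submodule_subset[OF gsubD(1)[OF assms(1)] assms(4)] assms(4)
    by (simp add: R.nat_pow_one)
next
  case (insert j J)
  have "a j [^] k \<odot>\<^bsub>M\<^esub> (px J [^] k \<odot>\<^bsub>M\<^esub> m) \<in> A ((n + k * card J) + k)"
    using insert by (intro gsub_pow[OF assms(1)]) auto
  also have "a j [^] k \<odot>\<^bsub>M\<^esub> (px J [^] k \<odot>\<^bsub>M\<^esub> m) = px (insert j J) [^] k \<odot>\<^bsub>M\<^esub> m"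
    using submodule_subset[OF gsubD(1)[OF assms(1)] assms(4)] insert.hyps
    by (simp add: smult_assoc1[symmetric] px_insert R.nat_pow_distrib)
  finally show ?case using insert.hyps by (simp add: algebra_simps)
qed

lemma gsub_carrier: "gsub R M W A \<Longrightarrow> m \<in> A n \<Longrightarrow> m \<in> carrier M"
  using submodule_subset gsubD(1) by blast

text \<open>The product \<open>px J\<close> has \<open>card J\<close> factors of degree 1, so its
  \<open>k\<close>-th power raises the degree by exactly the amount by which \<open>s + k\<close>
  shifts the numerators.\<close>

lemma gsub_lift:
  assumes "gsub R M W A" "finite J" "a ` J \<subseteq> W" "v J \<in> A (n + s * card J)"
  shows "lift k v J \<in> A (n + (s + k) * card J)"
  using gsub_px[OF assms(1-4), of k] unfolding koszul_lift_def
  by (simp add: algebra_simps)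

lemma gsub_d:
  assumes "gsub R M W A" "finite J" "a ` J \<subseteq> W" "\<And>I. I \<subseteq> J \<Longrightarrow> v I \<in> A (n + s * card I)"
  shows "d s v J \<in> A (n + s * card J)"
proof (rule d_in_submodule[OF gsubD(1)[OF assms(1)] assms(2)])
  fix j assume j: "j \<in> J"
  have "a j [^] s \<odot>\<^bsub>M\<^esub> v (J - {j}) \<in> A ((n + s * card (J - {j})) + s)"
    by (intro gsub_pow[OF assms(1)] assms(4)) (use assms(3) j in auto)
  also have "(n + s * card (J - {j})) + s = n + s * card J"
    using j assms(2) card_Suc_Diff1[OF assms(2) j] by (metis add.assoc add.commute mult_Suc_right)
  finally show "a j [^] s \<odot>\<^bsub>M\<^esub> v (J - {j}) \<in> A (n + s * card J)" .
next
  show "I \<subseteq> J \<Longrightarrow> v I \<in> carrier M" for I using gsub_carrier[OF assms(1,4)] .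
qed

text \<open>Where \<open>a r\<close> acts as zero, inverting it leaves nothing. So the components at
  sets containing \<open>r\<close> vanish in the limit and the first \<open>r\<close> variables
  determine the cohomology.\<close>

lemma gvan_killed_variable:
  assumes A: "gsub R M W A" and B: "gsub R M W B" and W: "a ` {..<Suc r} \<subseteq> W"
    and kill: "\<And>n m. m \<in> A n \<Longrightarrow> a r \<odot>\<^bsub>M\<^esub> m \<in> B (Suc n)"
    and van: "gvan r A B n"
  shows "gvan (Suc r) A B n"
  unfolding gvan_def
proof (intro allI impI)
  fix s v assume cyc: "gcyc (Suc r) A B n s v"
  then have v: "\<And>J. J \<subseteq> {..<Suc r} \<Longrightarrow> v J \<in> A (n + s * card J)" unfolding gcyc_def by auto
  have sub: "J \<subseteq> {..<r} \<Longrightarrow> J \<subseteq> {..<Suc r}" for J :: "nat set" by auto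
  have fin: "J \<subseteq> {..<r} \<Longrightarrow> finite J" for J using finite_subset by blast
  have aW: "J \<subseteq> {..<Suc r} \<Longrightarrow> a ` J \<subseteq> W" for J using W by blast
  have "gcyc r A B n s v" using cyc sub unfolding gcyc_def by auto
  then have "gcob r A B n s v" using van unfolding gvan_def by blast
  then obtain k w where w: "\<And>J. J \<subseteq> {..<r} \<Longrightarrow> w J \<in> A (n + (s + k) * card J)"
    "\<And>J. J \<subseteq> {..<r} \<Longrightarrow> lift k v J \<ominus>\<^bsub>M\<^esub> d (s + k) w J \<in> B (n + (s + k) * card J)"
    unfolding gcob_def by blast
  have wc: "J \<subseteq> {..<r} \<Longrightarrow> w J \<in> carrier M" for J using gsub_carrier[OF A w(1)] .
  have vc: "J \<subseteq> {..<Suc r} \<Longrightarrow> v J \<in> carrier M" for J using gsub_carrier[OF A v] .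
  \<comment> \<open>The primitive is extended by zero and lifted once more than \<open>k\<close>.
    The additional lift guarantees a positive power of \<open>a r\<close> in the components at sets
    containing \<open>r\<close>, even for \<open>k = 0\<close>.\<close>
  define w' where "w' J = (if r \<in> J then \<zero>\<^bsub>M\<^esub> else lift 1 w J)" for J
  have w'A: "w' J \<in> A (n + (s + Suc k) * card J)" if J: "J \<subseteq> {..<Suc r}" for J
  proof (cases "r \<in> J")
    case True
    then show ?thesis unfolding w'_def using submodule_zero gsubD(1)[OF A] by simp
  next
    case False
    then have J': "J \<subseteq> {..<r}" using J by (auto simp: less_Suc_eq)
    show ?thesis using gsub_lift[where v = w, OF A fin[OF J'] aW[OF J] w(1)[OF J'], of 1] False
      unfolding w'_def by simp
  qed
  have kill': "a r [^] Suc k \<odot>\<^bsub>M\<^esub> m \<in> B (q + Suc k)" if m: "m \<in> A q" for m q k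
  proof -
    have "a r [^] k \<odot>\<^bsub>M\<^esub> (a r \<odot>\<^bsub>M\<^esub> m) \<in> B (Suc q + k)"
      using W by (intro gsub_pow[OF B] kill[OF m]) auto
    then show ?thesis using gsub_carrier[OF A m] by (simp add: smult_assoc1)
  qed
  have "lift (Suc k) v J \<ominus>\<^bsub>M\<^esub> d (s + Suc k) w' J \<in> B (n + (s + Suc k) * card J)" if J: "J \<subseteq> {..<Suc r}" for J
    using J
  proof (cases rule: subset_lessThan_Suc_cases)
    case 1
    have lc: "I \<subseteq> J \<Longrightarrow> lift 1 w I \<in> carrier M" for I using wc 1 by blast
    have "d (s + Suc k) w' J = d (s + Suc k) (lift 1 w) J"
      using 1 lc unfolding w'_def by (intro d_cong) auto
    also have "\<dots> = lift 1 (d (s + k) w) J"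
      using d_lift[OF fin[OF 1], of w "s + k" 1] wc 1 by auto
    finally have "d (s + Suc k) w' J = lift 1 (d (s + k) w) J" .
    moreover have "lift (Suc k) v J = lift 1 (lift k v) J"
      using lift_lift[of v J 1 k] vc[OF J] by simp
    moreover have "d (s + k) w J \<in> carrier M" using wc 1 by (intro d_closed) auto
    ultimately have "lift (Suc k) v J \<ominus>\<^bsub>M\<^esub> d (s + Suc k) w' J =
        lift 1 (\<lambda>J. lift k v J \<ominus>\<^bsub>M\<^esub> d (s + k) w J) J"
      using vc[OF J] by (subst lift_minus) auto
    then show ?thesis using gsub_lift[where v = "\<lambda>J. lift k v J \<ominus>\<^bsub>M\<^esub> d (s + k) w J", OF B fin[OF 1] aW[OF J] w(2)[OF 1], of 1] by simp
  next
    \<comment> \<open>Both terms contain a positive power of \<open>a r\<close> and hence lie in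
      \<open>B\<close> separately.\<close>
    case (2 J')
    have r: "r \<notin> J'" and fJ: "finite J'" using 2 fin by auto
    have "px J' [^] Suc k \<odot>\<^bsub>M\<^esub> v J \<in> A (n + s * card J + Suc k * card J')"
      using 2 aW[OF sub[OF 2(2)]] by (intro gsub_px[OF A fJ _ v[OF J]]) auto
    then have "a r [^] Suc k \<odot>\<^bsub>M\<^esub> (px J' [^] Suc k \<odot>\<^bsub>M\<^esub> v J) \<in> B (n + s * card J + Suc k * card J' + Suc k)"
      by (rule kill')
    also have "a r [^] Suc k \<odot>\<^bsub>M\<^esub> (px J' [^] Suc k \<odot>\<^bsub>M\<^esub> v J) = lift (Suc k) v J"
    proof -
      have "px J [^] Suc k = a r [^] Suc k \<otimes> px J' [^] Suc k"
        unfolding 2(1) px_insert[OF fJ r] by (rule R.nat_pow_distrib) auto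
      then show ?thesis unfolding koszul_lift_def using vc[OF J]
        by (metis smult_assoc1 R.nat_pow_closed a_closed px_closed)
    qed
    also have "n + s * card J + Suc k * card J' + Suc k = n + (s + Suc k) * card J"
      using r fJ 2(1) by (simp add: algebra_simps)
    finally have l: "lift (Suc k) v J \<in> B (n + (s + Suc k) * card J)" .
    have lc: "I \<subseteq> J \<Longrightarrow> w' I \<in> carrier M" for I using w'A J gsub_carrier[OF A] by blast
    have "d (s + Suc k) w' J = d (s + Suc k) (\<lambda>I. w' (insert r I)) J' \<oplus>\<^bsub>M\<^esub>
        (sg (card J') \<otimes> a r [^] (s + Suc k)) \<odot>\<^bsub>M\<^esub> w' J'"
      unfolding 2(1) using fJ 2 lc by (intro d_insert) auto
    also have "(\<lambda>I. w' (insert r I)) = (\<lambda>I. \<zero>\<^bsub>M\<^esub>)" unfolding w'_def by auto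
    also have "d (s + Suc k) (\<lambda>I. \<zero>\<^bsub>M\<^esub>) J' = \<zero>\<^bsub>M\<^esub>" by (rule d_zero)
    also have "\<zero>\<^bsub>M\<^esub> \<oplus>\<^bsub>M\<^esub> (sg (card J') \<otimes> a r [^] (s + Suc k)) \<odot>\<^bsub>M\<^esub> w' J' =
        sg (card J') \<odot>\<^bsub>M\<^esub> (a r [^] Suc (s + k) \<odot>\<^bsub>M\<^esub> w' J')"
      using lc[of J'] 2(1) by (simp add: smult_assoc1 subset_insertI)
    also have "\<dots> \<in> B (n + (s + Suc k) * card J' + Suc (s + k))"
      by (intro submoduleE(4)[OF gsubD(1)[OF B]] kill' w'A sub 2(2)) simp
    also have "n + (s + Suc k) * card J' + Suc (s + k) = n + (s + Suc k) * card J"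
      using r fJ 2(1) by (simp add: algebra_simps)
    finally show ?thesis using submodule_minus[OF gsubD(1)[OF B] l] by blast
  qed
  then show "gcob (Suc r) A B n s v"
    unfolding gcob_def using w'A by (intro exI[of _ "Suc k"] exI[of _ w']) auto
qed

text \<open>The operator \<open>h\<close> removing \<open>r\<close> from the index contracts multiplication by \<open>a r [^] s\<close>.\<close>

lemma gcob_torsion:
  assumes A: "gsub R M W A" and B: "gsub R M W B"
    and cyc: "gcyc (Suc r) A B n s v"
  shows "gcob (Suc r) A B (n + s) s (\<lambda>J. a r [^] s \<odot>\<^bsub>M\<^esub> v J)"
proof -
  have v: "\<And>J. J \<subseteq> {..<Suc r} \<Longrightarrow> v J \<in> A (n + s * card J)"
    and dv: "\<And>J. J \<subseteq> {..<Suc r} \<Longrightarrow> d s v J \<in> B (n + s * card J)"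
    using cyc unfolding gcyc_def by auto
  have sub: "J \<subseteq> {..<r} \<Longrightarrow> J \<subseteq> {..<Suc r}" for J :: "nat set" by auto
  have ins: "J \<subseteq> {..<r} \<Longrightarrow> insert r J \<subseteq> {..<Suc r}" for J by auto
  have fin: "J \<subseteq> {..<r} \<Longrightarrow> finite J" for J using finite_subset by blast
  have nr: "J \<subseteq> {..<r} \<Longrightarrow> r \<notin> J" for J by auto
  have vc: "J \<subseteq> {..<Suc r} \<Longrightarrow> v J \<in> carrier M" for J using gsub_carrier[OF A v] .
  \<comment> \<open>The sign is the one with which \<open>d_insert\<close> removes \<open>r\<close>.
    As \<open>h J\<close> uses the value at a set with one more element, it lies in the part for
    \<open>n + s\<close> instead of \<open>n\<close>.\<close>
  define h where "h J = (if r \<in> J then \<zero>\<^bsub>M\<^esub> else sg (card J) \<odot>\<^bsub>M\<^esub> v (insert r J))" for J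
  have hA: "h J \<in> A (n + s + s * card J)" if J: "J \<subseteq> {..<Suc r}" for J
    using J
  proof (cases rule: subset_lessThan_Suc_cases)
    case 1
    have "v (insert r J) \<in> A (n + s + s * card J)"
      using v[OF ins[OF 1]] fin[OF 1] nr[OF 1] by (simp add: algebra_simps)
    then show ?thesis unfolding h_def using nr[OF 1] submoduleE(4)[OF gsubD(1)[OF A]] by simp
  qed (use submodule_zero[OF gsubD(1)[OF A]] in \<open>simp add: h_def\<close>)
  have hc: "J \<subseteq> {..<Suc r} \<Longrightarrow> h J \<in> carrier M" for J using gsub_carrier[OF A hA] .
  have "a r [^] s \<odot>\<^bsub>M\<^esub> v J \<ominus>\<^bsub>M\<^esub> d s h J \<in> B (n + s + s * card J)" if J: "J \<subseteq> {..<Suc r}" for J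
    using J
  proof (cases rule: subset_lessThan_Suc_cases)
    case 1
    let ?v = "\<lambda>I. v (insert r I)"
    have vi: "I \<subseteq> J \<Longrightarrow> ?v I \<in> carrier M" for I using 1 by (intro vc) auto
    have dvi: "d s ?v J \<in> carrier M" by (intro d_closed vi)
    have "d s h J = d s (\<lambda>I. sg (card J - 1) \<odot>\<^bsub>M\<^esub> ?v I) J"
      using 1 fin[OF 1] vi unfolding h_def by (intro d_cong) auto
    also have "\<dots> = sg (card J - 1) \<odot>\<^bsub>M\<^esub> d s ?v J"
      using vi fin[OF 1] by (intro d_smult) auto
    also have "\<dots> = \<ominus>\<^bsub>M\<^esub> (sg (card J) \<odot>\<^bsub>M\<^esub> d s ?v J)"
    \<comment> \<open>Truncated subtraction is wrong for empty \<open>J\<close>, where both sides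
      are zero anyway.\<close>
    proof (cases "J = {}")
      case False
      then obtain c where "card J = Suc c" using fin[OF 1] by (cases "card J") auto
      then show ?thesis using smult_sg[OF dvi, of c] dvi by simp
    qed simp
    finally have dh: "d s h J = \<ominus>\<^bsub>M\<^esub> (sg (card J) \<odot>\<^bsub>M\<^esub> d s ?v J)" .
    have "d s v (insert r J) = d s ?v J \<oplus>\<^bsub>M\<^esub> (sg (card J) \<otimes> a r [^] s) \<odot>\<^bsub>M\<^esub> v J"
      using 1 fin[OF 1] ins[OF 1] by (intro d_insert vc) auto
    also have "(sg (card J) \<otimes> a r [^] s) \<odot>\<^bsub>M\<^esub> v J = sg (card J) \<odot>\<^bsub>M\<^esub> (a r [^] s \<odot>\<^bsub>M\<^esub> v J)"
      using vc[OF J] by (simp add: smult_assoc1)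
    finally have "sg (card J) \<odot>\<^bsub>M\<^esub> d s v (insert r J) = sg (card J) \<odot>\<^bsub>M\<^esub> d s ?v J \<oplus>\<^bsub>M\<^esub> a r [^] s \<odot>\<^bsub>M\<^esub> v J"
      using dvi vc[OF J] by (simp add: smult_r_distr smult_sg_sg)
    then have "a r [^] s \<odot>\<^bsub>M\<^esub> v J \<ominus>\<^bsub>M\<^esub> d s h J = sg (card J) \<odot>\<^bsub>M\<^esub> d s v (insert r J)"
      unfolding dh using dvi vc[OF J] by (simp add: a_minus_def M.a_comm)
    also have "\<dots> \<in> B (n + s * card (insert r J))"
      by (intro submoduleE(4)[OF gsubD(1)[OF B]] dv ins 1) simp
    also have "n + s * card (insert r J) = n + s + s * card J" using fin[OF 1] nr[OF 1] by simp
    finally show ?thesis .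
  next
    case (2 J')
    have "d s h J = d s (\<lambda>I. h (insert r I)) J' \<oplus>\<^bsub>M\<^esub> (sg (card J') \<otimes> a r [^] s) \<odot>\<^bsub>M\<^esub> h J'"
      unfolding 2(1) using 2 J fin by (intro d_insert hc) auto
    also have "(\<lambda>I. h (insert r I)) = (\<lambda>I. \<zero>\<^bsub>M\<^esub>)" unfolding h_def by auto
    also have "d s (\<lambda>I. \<zero>\<^bsub>M\<^esub>) J' = \<zero>\<^bsub>M\<^esub>" by (rule d_zero)
    also have "h J' = sg (card J') \<odot>\<^bsub>M\<^esub> v J" unfolding h_def using 2 nr by auto
    also have "(sg (card J') \<otimes> a r [^] s) \<odot>\<^bsub>M\<^esub> (sg (card J') \<odot>\<^bsub>M\<^esub> v J) = a r [^] s \<odot>\<^bsub>M\<^esub> v J"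
      using vc[OF J] by (simp add: smult_assoc1 smult_comm[of "a r [^] s"] smult_sg_sg)
    finally have "a r [^] s \<odot>\<^bsub>M\<^esub> v J \<ominus>\<^bsub>M\<^esub> d s h J = \<zero>\<^bsub>M\<^esub>"
      using vc[OF J] by (simp add: a_minus_def M.r_neg)
    then show ?thesis using submodule_zero[OF gsubD(1)[OF B]] by simp
  qed
  moreover have "lift 0 (\<lambda>J. a r [^] s \<odot>\<^bsub>M\<^esub> v J) J = a r [^] s \<odot>\<^bsub>M\<^esub> v J" if "J \<subseteq> {..<Suc r}" for J
    using vc[OF that] by (intro lift_0) auto
  ultimately show ?thesis
    unfolding gcob_def using hA by (intro exI[of _ 0] exI[of _ h]) auto
qed

text \<open>The quotient of \<open>gcolon x A B\<close> by \<open>B\<close> is the kernel of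
  multiplication by \<open>x\<close> on \<open>A / B\<close>.\<close>

definition gcolon :: "'a \<Rightarrow> (nat \<Rightarrow> 'c set) \<Rightarrow> (nat \<Rightarrow> 'c set) \<Rightarrow> nat \<Rightarrow> 'c set"
  where "gcolon x A B n = {m \<in> A n. x \<odot>\<^bsub>M\<^esub> m \<in> B (Suc n)}"

text \<open>The quotient of \<open>A\<close> by \<open>gsum x A B\<close> is the cokernel of
  multiplication by \<open>x\<close> on \<open>A / B\<close>. Nothing is mapped into degree 0,
  whence the separate case.\<close>

definition gsum :: "'a \<Rightarrow> (nat \<Rightarrow> 'c set) \<Rightarrow> (nat \<Rightarrow> 'c set) \<Rightarrow> nat \<Rightarrow> 'c set"
  where "gsum x A B n = (case n of 0 \<Rightarrow> B 0 |
    Suc n' \<Rightarrow> {b \<oplus>\<^bsub>M\<^esub> x \<odot>\<^bsub>M\<^esub> m | b m. b \<in> B n \<and> m \<in> A n'})"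

lemma gsub_gcolon:
  assumes A: "gsub R M W A" and B: "gsub R M W B" and W: "W \<subseteq> carrier R" and x: "x \<in> carrier R"
  shows "gsub R M W (gcolon x A B)"
  unfolding gsub_def
proof (intro conjI allI ballI)
  show "submodule (gcolon x A B n) R M" for n
    unfolding gcolon_def using submodule_colon gsubD(1) A B x by blast
  fix n u m assume u: "u \<in> W" and m: "m \<in> gcolon x A B n"
  then have "x \<odot>\<^bsub>M\<^esub> (u \<odot>\<^bsub>M\<^esub> m) = u \<odot>\<^bsub>M\<^esub> (x \<odot>\<^bsub>M\<^esub> m)"
    using x W gsub_carrier[OF A] unfolding gcolon_def by (intro smult_comm) auto
  then show "u \<odot>\<^bsub>M\<^esub> m \<in> gcolon x A B (Suc n)"
    using m gsubD(2)[OF A u] gsubD(2)[OF B u] unfolding gcolon_def by auto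
qed

lemma gsum_superset:
  assumes A: "gsub R M W A" and B: "gsub R M W B" and x: "x \<in> carrier R"
  shows "B n \<subseteq> gsum x A B n"
proof (cases n)
  case (Suc n')
  have "b = b \<oplus>\<^bsub>M\<^esub> x \<odot>\<^bsub>M\<^esub> \<zero>\<^bsub>M\<^esub>" if "b \<in> B n" for b using gsub_carrier[OF B that] x by simp
  then show ?thesis unfolding gsum_def Suc using submodule_zero[OF gsubD(1)[OF A]] by auto
qed (simp add: gsum_def)

lemma gsum_smult:
  assumes "gsub R M W A" "gsub R M W B" "x \<in> carrier R" "m \<in> A n"
  shows "x \<odot>\<^bsub>M\<^esub> m \<in> gsum x A B (Suc n)"
proof -
  have "x \<odot>\<^bsub>M\<^esub> m = \<zero>\<^bsub>M\<^esub> \<oplus>\<^bsub>M\<^esub> x \<odot>\<^bsub>M\<^esub> m" using gsub_carrier[OF assms(1,4)] assms(3) by simp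
  then show ?thesis unfolding gsum_def using assms(4) submodule_zero[OF gsubD(1)[OF assms(2)]] by auto
qed

lemma gsub_gsum:
  assumes A: "gsub R M W A" and B: "gsub R M W B" and W: "W \<subseteq> carrier R" and x: "x \<in> carrier R"
  shows "gsub R M W (gsum x A B)"
  unfolding gsub_def
proof (intro conjI allI ballI)
  show "submodule (gsum x A B n) R M" for n
  proof (cases n)
    case 0
    then show ?thesis unfolding gsum_def using gsubD(1)[OF B] by simp
  next
    case (Suc n')
    show ?thesis unfolding gsum_def Suc
      using submodule_add_smult[OF gsubD(1)[OF B, of "Suc n'"] gsubD(1)[OF A, of n'] x] by simp
  qed
  fix n u m assume u: "u \<in> W" and m: "m \<in> gsum x A B n"
  show "u \<odot>\<^bsub>M\<^esub> m \<in> gsum x A B (Suc n)"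
  proof (cases n)
    case 0
    then show ?thesis
      using m u gsubD(2)[OF B u, of m 0] gsum_superset[OF A B x, of "Suc 0"] unfolding gsum_def by auto
  next
    case (Suc n')
    then obtain b y where h: "m = b \<oplus>\<^bsub>M\<^esub> x \<odot>\<^bsub>M\<^esub> y" "b \<in> B n" "y \<in> A n'" using m unfolding gsum_def by auto
    have c: "b \<in> carrier M" "y \<in> carrier M" "u \<in> carrier R"
      using h gsub_carrier[OF A] gsub_carrier[OF B] u W by auto
    have "u \<odot>\<^bsub>M\<^esub> m = u \<odot>\<^bsub>M\<^esub> b \<oplus>\<^bsub>M\<^esub> x \<odot>\<^bsub>M\<^esub> (u \<odot>\<^bsub>M\<^esub> y)"
      using c x h(1) smult_comm[of u x y] by (simp add: smult_r_distr)
    then show ?thesis unfolding gsum_def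
      using gsubD(2)[OF B u h(2)] gsubD(2)[OF A u h(3)] Suc by auto
  qed
qed

text \<open>The two long exact sequences that make \<open>x\<close> injective on cohomology are
  chased on numerators. If \<open>x v\<close> is \<open>d w\<close> modulo \<open>B\<close>, then
  \<open>w\<close> is a cocycle of the cokernel, hence \<open>d w2 + b + x y\<close>; thus
  \<open>x (v - d y)\<close> lies in \<open>B\<close>, and \<open>v - d y\<close> is a cocycle, so a
  coboundary, of the kernel.\<close>

lemma gcob_cancel:
  assumes A: "gsub R M W A" and B: "gsub R M W B" and W: "W \<subseteq> carrier R" and x: "x \<in> carrier R"
    and rW: "a ` {..<r} \<subseteq> W"
    and AD: "gvan r A (gsum x A B) (Suc n)" and CB: "gvan r (gcolon x A B) B n"
    and cyc: "gcyc r A B n s v" and cob: "gcob r A B (Suc n) s (\<lambda>J. x \<odot>\<^bsub>M\<^esub> v J)"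
  shows "gcob r A B n s v"
proof -
  note SA = gsubD(1)[OF A] and SB = gsubD(1)[OF B]
  have fin: "J \<subseteq> {..<r} \<Longrightarrow> finite J" for J using finite_subset by blast
  have aW: "J \<subseteq> {..<r} \<Longrightarrow> a ` J \<subseteq> W" for J using rW by blast
  have v: "\<And>J. J \<subseteq> {..<r} \<Longrightarrow> v J \<in> A (n + s * card J)"
    and dv: "\<And>J. J \<subseteq> {..<r} \<Longrightarrow> d s v J \<in> B (n + s * card J)"
    using cyc unfolding gcyc_def by auto
  have vc: "J \<subseteq> {..<r} \<Longrightarrow> v J \<in> carrier M" for J using gsub_carrier[OF A v] .
  obtain k w where w: "\<And>J. J \<subseteq> {..<r} \<Longrightarrow> w J \<in> A (Suc n + (s + k) * card J)"
    and wB: "\<And>J. J \<subseteq> {..<r} \<Longrightarrow> lift k (\<lambda>J. x \<odot>\<^bsub>M\<^esub> v J) J \<ominus>\<^bsub>M\<^esub> d (s + k) w J \<in> B (Suc n + (s + k) * card J)"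
    using cob unfolding gcob_def by blast
  have wc: "J \<subseteq> {..<r} \<Longrightarrow> w J \<in> carrier M" for J using gsub_carrier[OF A w] .
  define S where "S = s + k"
  define v1 where "v1 = lift k v"
  have v1: "v1 J \<in> A (n + S * card J)" if "J \<subseteq> {..<r}" for J
    unfolding v1_def S_def by (rule gsub_lift[where v = v, OF A fin[OF that] aW[OF that] v[OF that]])
  have v1c: "J \<subseteq> {..<r} \<Longrightarrow> v1 J \<in> carrier M" for J using gsub_carrier[OF A v1] .
  have xv1: "lift k (\<lambda>J. x \<odot>\<^bsub>M\<^esub> v J) J = x \<odot>\<^bsub>M\<^esub> v1 J" if "J \<subseteq> {..<r}" for J
    unfolding v1_def koszul_lift_def using x vc[OF that] by (intro smult_comm) auto
  have dwc: "J \<subseteq> {..<r} \<Longrightarrow> d S w J \<in> carrier M" for J by (intro d_closed wc) auto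
  have h1: "x \<odot>\<^bsub>M\<^esub> v1 J \<ominus>\<^bsub>M\<^esub> d S w J \<in> B (Suc n + S * card J)" if "J \<subseteq> {..<r}" for J
    using wB[OF that] xv1[OF that] unfolding S_def by simp
  have dv1: "d S v1 J \<in> B (n + S * card J)" if J: "J \<subseteq> {..<r}" for J
  proof -
    have "d S v1 J = lift k (d s v) J" unfolding S_def v1_def
      using fin J by (intro d_lift vc) auto
    then show ?thesis using gsub_lift[where v = "d s v", OF B fin[OF J] aW[OF J] dv[OF J], of k] unfolding S_def by simp
  qed
  \<comment> \<open>Modulo \<open>B\<close> the differential of \<open>w\<close> is \<open>x\<close>
    times \<open>v1\<close>, so \<open>w\<close> is a cocycle of the cokernel.\<close>
  have "d S w J \<in> gsum x A B (Suc n + S * card J)" if J: "J \<subseteq> {..<r}" for J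
  proof -
    have "d S w J = \<ominus>\<^bsub>M\<^esub> (x \<odot>\<^bsub>M\<^esub> v1 J \<ominus>\<^bsub>M\<^esub> d S w J) \<oplus>\<^bsub>M\<^esub> x \<odot>\<^bsub>M\<^esub> v1 J"
      using x v1c[OF J] dwc[OF J] by (simp add: M.neg_minus_add)
    then show ?thesis unfolding gsum_def
      using submoduleE(3)[OF SB h1[OF J]] v1[OF J] by auto
  qed
  then have "gcyc r A (gsum x A B) (Suc n) S w" unfolding gcyc_def using w unfolding S_def by auto
  then have "gcob r A (gsum x A B) (Suc n) S w" using AD unfolding gvan_def by blast
  then obtain k2 w2 where w2: "\<And>J. J \<subseteq> {..<r} \<Longrightarrow> w2 J \<in> A (Suc n + (S + k2) * card J)"
    and w2D: "\<And>J. J \<subseteq> {..<r} \<Longrightarrow> lift k2 w J \<ominus>\<^bsub>M\<^esub> d (S + k2) w2 J \<in> gsum x A B (Suc n + (S + k2) * card J)"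
    unfolding gcob_def by blast
  define S2 where "S2 = S + k2"
  have "\<exists>p. fst p \<in> B (Suc n + S2 * card J) \<and> snd p \<in> A (n + S2 * card J) \<and>
      lift k2 w J \<ominus>\<^bsub>M\<^esub> d S2 w2 J = fst p \<oplus>\<^bsub>M\<^esub> x \<odot>\<^bsub>M\<^esub> snd p" if J: "J \<subseteq> {..<r}" for J
  proof -
    have "lift k2 w J \<ominus>\<^bsub>M\<^esub> d S2 w2 J \<in> {b \<oplus>\<^bsub>M\<^esub> x \<odot>\<^bsub>M\<^esub> m | b m. b \<in> B (Suc n + S2 * card J) \<and> m \<in> A (n + S2 * card J)}"
      using w2D[OF J] unfolding gsum_def S2_def by simp
    then obtain b m where "lift k2 w J \<ominus>\<^bsub>M\<^esub> d S2 w2 J = b \<oplus>\<^bsub>M\<^esub> x \<odot>\<^bsub>M\<^esub> m"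
      "b \<in> B (Suc n + S2 * card J)" "m \<in> A (n + S2 * card J)" by blast
    then show ?thesis by (intro exI[of _ "(b, m)"]) simp
  qed
  then have "\<forall>J\<in>Pow {..<r}. \<exists>p. fst p \<in> B (Suc n + S2 * card J) \<and> snd p \<in> A (n + S2 * card J) \<and>
      lift k2 w J \<ominus>\<^bsub>M\<^esub> d S2 w2 J = fst p \<oplus>\<^bsub>M\<^esub> x \<odot>\<^bsub>M\<^esub> snd p" by (intro ballI) simp
  then obtain p where p: "\<forall>J\<in>Pow {..<r}. fst (p J) \<in> B (Suc n + S2 * card J) \<and>
      snd (p J) \<in> A (n + S2 * card J) \<and>
      lift k2 w J \<ominus>\<^bsub>M\<^esub> d S2 w2 J = fst (p J) \<oplus>\<^bsub>M\<^esub> x \<odot>\<^bsub>M\<^esub> snd (p J)"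
    by (rule bchoice[THEN exE])
  define b where "b J = fst (p J)" for J
  define y where "y J = snd (p J)" for J
  have b: "\<And>J. J \<subseteq> {..<r} \<Longrightarrow> b J \<in> B (Suc n + S2 * card J)"
    and y: "\<And>J. J \<subseteq> {..<r} \<Longrightarrow> y J \<in> A (n + S2 * card J)"
    and byeq: "\<And>J. J \<subseteq> {..<r} \<Longrightarrow> lift k2 w J \<ominus>\<^bsub>M\<^esub> d S2 w2 J = b J \<oplus>\<^bsub>M\<^esub> x \<odot>\<^bsub>M\<^esub> y J"
    using p unfolding b_def y_def by auto
  have bc: "J \<subseteq> {..<r} \<Longrightarrow> b J \<in> carrier M" for J using gsub_carrier[OF B b] .
  have yc: "J \<subseteq> {..<r} \<Longrightarrow> y J \<in> carrier M" for J using gsub_carrier[OF A y] .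
  have w2c: "J \<subseteq> {..<r} \<Longrightarrow> w2 J \<in> carrier M" for J using gsub_carrier[OF A w2] .
  have dw2c: "J \<subseteq> {..<r} \<Longrightarrow> d S2 w2 J \<in> carrier M" for J by (intro d_closed w2c) auto
  have dyc: "J \<subseteq> {..<r} \<Longrightarrow> d S2 y J \<in> carrier M" for J by (intro d_closed yc) auto
  have dbc: "J \<subseteq> {..<r} \<Longrightarrow> d S2 b J \<in> carrier M" for J by (intro d_closed bc) auto
  define v2 where "v2 = lift k2 v1"
  have v2: "v2 J \<in> A (n + S2 * card J)" if "J \<subseteq> {..<r}" for J
    unfolding v2_def S2_def by (rule gsub_lift[where v = v1, OF A fin[OF that] aW[OF that] v1[OF that]])
  have v2c: "J \<subseteq> {..<r} \<Longrightarrow> v2 J \<in> carrier M" for J using gsub_carrier[OF A v2] .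
  \<comment> \<open>Since \<open>d\<close> squares to zero, \<open>w2\<close> disappears when the
    decomposition of the lifted \<open>w\<close> is differentiated.\<close>
  have lw: "lift k2 (d S w) J = d S2 b J \<oplus>\<^bsub>M\<^esub> x \<odot>\<^bsub>M\<^esub> d S2 y J" if J: "J \<subseteq> {..<r}" for J
  proof -
    have "lift k2 (d S w) J = d S2 (lift k2 w) J" unfolding S2_def
      using fin J by (intro d_lift[symmetric] wc) auto
    also have "\<dots> = d S2 (lift k2 w) J \<ominus>\<^bsub>M\<^esub> d S2 (d S2 w2) J"
    proof -
      have "d S2 (d S2 w2) J = \<zero>\<^bsub>M\<^esub>" using J fin w2c by (intro d_d) auto
      moreover have "d S2 (lift k2 w) J \<in> carrier M" using J wc by (intro d_closed) auto
      ultimately show ?thesis by (simp add: a_minus_def)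
    qed
    also have "\<dots> = d S2 (\<lambda>I. lift k2 w I \<ominus>\<^bsub>M\<^esub> d S2 w2 I) J"
      using J fin wc dw2c by (intro d_minus[symmetric]) auto
    also have "\<dots> = d S2 (\<lambda>I. b I \<oplus>\<^bsub>M\<^esub> x \<odot>\<^bsub>M\<^esub> y I) J"
    proof (intro d_cong)
      fix j assume "j \<in> J"
      then show "lift k2 w (J - {j}) \<ominus>\<^bsub>M\<^esub> d S2 w2 (J - {j}) = b (J - {j}) \<oplus>\<^bsub>M\<^esub> x \<odot>\<^bsub>M\<^esub> y (J - {j})"
        using J by (intro byeq) auto
    next
      fix I assume "I \<subseteq> J"
      then show "b I \<oplus>\<^bsub>M\<^esub> x \<odot>\<^bsub>M\<^esub> y I \<in> carrier M" using bc[of I] yc[of I] x J by auto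
    qed
    also have "\<dots> = d S2 b J \<oplus>\<^bsub>M\<^esub> d S2 (\<lambda>I. x \<odot>\<^bsub>M\<^esub> y I) J"
      using J bc yc x by (intro d_add) auto
    also have "d S2 (\<lambda>I. x \<odot>\<^bsub>M\<^esub> y I) J = x \<odot>\<^bsub>M\<^esub> d S2 y J"
      using J fin yc x by (intro d_smult) auto
    finally show ?thesis .
  qed
  \<comment> \<open>Subtracting the coboundary of \<open>y\<close> leaves the class of
    \<open>v\<close> unchanged and moves the representative into the kernel of \<open>x\<close> on
    \<open>A / B\<close>.\<close>
  define u where "u J = v2 J \<ominus>\<^bsub>M\<^esub> d S2 y J" for J
  have uc: "u J \<in> carrier M" if "J \<subseteq> {..<r}" for J unfolding u_def using v2c dyc that by auto
  have uA: "u J \<in> gcolon x A B (n + S2 * card J)" if J: "J \<subseteq> {..<r}" for J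
  proof -
    have "d S2 y J \<in> A (n + S2 * card J)" using J y by (intro gsub_d[OF A fin aW]) auto
    then have 1: "u J \<in> A (n + S2 * card J)" unfolding u_def using submodule_minus[OF SA v2[OF J]] by blast
    have "lift k2 (\<lambda>J. x \<odot>\<^bsub>M\<^esub> v1 J \<ominus>\<^bsub>M\<^esub> d S w J) J \<in> B (Suc n + S2 * card J)"
      using gsub_lift[where v = "\<lambda>J. x \<odot>\<^bsub>M\<^esub> v1 J \<ominus>\<^bsub>M\<^esub> d S w J", OF B fin[OF J] aW[OF J] h1[OF J]] unfolding S2_def .
    also have "lift k2 (\<lambda>J. x \<odot>\<^bsub>M\<^esub> v1 J \<ominus>\<^bsub>M\<^esub> d S w J) J = lift k2 (\<lambda>J. x \<odot>\<^bsub>M\<^esub> v1 J) J \<ominus>\<^bsub>M\<^esub> lift k2 (d S w) J"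
      using x v1c[OF J] dwc[OF J] by (intro lift_minus) auto
    also have "lift k2 (\<lambda>J. x \<odot>\<^bsub>M\<^esub> v1 J) J = x \<odot>\<^bsub>M\<^esub> v2 J"
      unfolding v2_def koszul_lift_def using x v1c[OF J] by (intro smult_comm) auto
    finally have "x \<odot>\<^bsub>M\<^esub> v2 J \<ominus>\<^bsub>M\<^esub> (d S2 b J \<oplus>\<^bsub>M\<^esub> x \<odot>\<^bsub>M\<^esub> d S2 y J) \<in> B (Suc n + S2 * card J)"
      unfolding lw[OF J] .
    moreover have "d S2 b J \<in> B (Suc n + S2 * card J)" using J b by (intro gsub_d[OF B fin aW]) auto
    ultimately have "(x \<odot>\<^bsub>M\<^esub> v2 J \<ominus>\<^bsub>M\<^esub> (d S2 b J \<oplus>\<^bsub>M\<^esub> x \<odot>\<^bsub>M\<^esub> d S2 y J)) \<oplus>\<^bsub>M\<^esub> d S2 b J \<in> B (Suc n + S2 * card J)"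
      using submoduleE(5)[OF SB] by blast
    also have "(x \<odot>\<^bsub>M\<^esub> v2 J \<ominus>\<^bsub>M\<^esub> (d S2 b J \<oplus>\<^bsub>M\<^esub> x \<odot>\<^bsub>M\<^esub> d S2 y J)) \<oplus>\<^bsub>M\<^esub> d S2 b J = x \<odot>\<^bsub>M\<^esub> u J"
      unfolding u_def using x v2c[OF J] dyc[OF J] dbc[OF J]
      by (subst M.minus_add_drop) (auto simp: a_minus_def smult_r_distr smult_r_minus)
    finally show ?thesis unfolding gcolon_def using 1 by simp
  qed
  have du: "d S2 u J \<in> B (n + S2 * card J)" if J: "J \<subseteq> {..<r}" for J
  proof -
    have "d S2 u J = d S2 v2 J \<ominus>\<^bsub>M\<^esub> d S2 (d S2 y) J"
      unfolding u_def using J fin v2c dyc by (intro d_minus) auto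
    also have "d S2 (d S2 y) J = \<zero>\<^bsub>M\<^esub>" using J fin yc by (intro d_d) auto
    also have "d S2 v2 J = lift k2 (d S v1) J" unfolding S2_def v2_def
      using J fin v1c by (intro d_lift) auto
    also have "lift k2 (d S v1) J \<ominus>\<^bsub>M\<^esub> \<zero>\<^bsub>M\<^esub> = lift k2 (d S v1) J"
      using gsub_carrier[OF B dv1[OF J]] by (simp add: a_minus_def lift_closed)
    also have "\<dots> \<in> B (n + S2 * card J)" unfolding S2_def
      using gsub_lift[where v = "d S v1", OF B fin[OF J] aW[OF J] dv1[OF J]] .
    finally show ?thesis .
  qed
  have "gcyc r (gcolon x A B) B n S2 u" unfolding gcyc_def using uA du by auto
  then have "gcob r (gcolon x A B) B n S2 u" using CB unfolding gvan_def by blast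
  then obtain k3 z where z: "\<And>J. J \<subseteq> {..<r} \<Longrightarrow> z J \<in> gcolon x A B (n + (S2 + k3) * card J)"
    and zB: "\<And>J. J \<subseteq> {..<r} \<Longrightarrow> lift k3 u J \<ominus>\<^bsub>M\<^esub> d (S2 + k3) z J \<in> B (n + (S2 + k3) * card J)"
    unfolding gcob_def by blast
  have zA: "J \<subseteq> {..<r} \<Longrightarrow> z J \<in> A (n + (S2 + k3) * card J)" for J using z unfolding gcolon_def by auto
  have zc: "J \<subseteq> {..<r} \<Longrightarrow> z J \<in> carrier M" for J using gsub_carrier[OF A zA] .
  have S3: "S2 + k3 = s + (k + k2 + k3)" unfolding S2_def S_def by simp
  \<comment> \<open>The primitive of \<open>v\<close> adds the correction \<open>y\<close> to the
    primitive \<open>z\<close> found inside the kernel.\<close>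
  define f where "f J = lift k3 y J \<oplus>\<^bsub>M\<^esub> z J" for J
  have "f J \<in> A (n + (S2 + k3) * card J)" if J: "J \<subseteq> {..<r}" for J
    unfolding f_def using submoduleE(5)[OF SA gsub_lift[where v = y, OF A fin[OF J] aW[OF J] y[OF J]] zA[OF J]] .
  moreover have "lift (k + k2 + k3) v J \<ominus>\<^bsub>M\<^esub> d (S2 + k3) f J \<in> B (n + (S2 + k3) * card J)" if J: "J \<subseteq> {..<r}" for J
  proof -
    have "d (S2 + k3) f J = d (S2 + k3) (lift k3 y) J \<oplus>\<^bsub>M\<^esub> d (S2 + k3) z J"
      unfolding f_def using J yc zc by (intro d_add) auto
    also have "d (S2 + k3) (lift k3 y) J = lift k3 (d S2 y) J" using J fin yc by (intro d_lift) auto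
    finally have 1: "d (S2 + k3) f J = lift k3 (d S2 y) J \<oplus>\<^bsub>M\<^esub> d (S2 + k3) z J" .
    have 2: "lift (k + k2 + k3) v J = lift k3 v2 J"
      unfolding v2_def v1_def koszul_lift_def using vc[OF J]
      by (simp add: smult_assoc1[symmetric] R.nat_pow_mult add_ac)
    have "lift k3 v2 J \<ominus>\<^bsub>M\<^esub> (lift k3 (d S2 y) J \<oplus>\<^bsub>M\<^esub> d (S2 + k3) z J) =
        (lift k3 v2 J \<ominus>\<^bsub>M\<^esub> lift k3 (d S2 y) J) \<ominus>\<^bsub>M\<^esub> d (S2 + k3) z J"
      using v2c[OF J] dyc[OF J] J zc by (intro M.minus_add_eq) (auto intro!: d_closed)
    also have "lift k3 v2 J \<ominus>\<^bsub>M\<^esub> lift k3 (d S2 y) J = lift k3 u J"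
      unfolding u_def using v2c[OF J] dyc[OF J] by (intro lift_minus[symmetric]) auto
    finally show ?thesis unfolding 1 2 using zB[OF J] by simp
  qed
  ultimately show ?thesis unfolding gcob_def S3 by blast
qed

text \<open>By \<open>gcob_torsion\<close> the class of \<open>v\<close> is killed by a power of
  \<open>a r\<close>, and \<open>gcob_cancel\<close> strips off one factor after the other. The
  intermediate multiples live in degrees \<open>n + e\<close>, so kernel and cokernel have to vanish
  in all degrees from \<open>n\<close> on.\<close>

lemma gvan_extend:
  assumes A: "gsub R M W A" and B: "gsub R M W B" and W: "W \<subseteq> carrier R" and rW: "a ` {..<Suc r} \<subseteq> W"
    and AD: "\<And>m. m \<ge> n \<Longrightarrow> gvan (Suc r) A (gsum (a r) A B) m"
    and CB: "\<And>m. m \<ge> n \<Longrightarrow> gvan (Suc r) (gcolon (a r) A B) B m"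
  shows "gvan (Suc r) A B n"
  unfolding gvan_def
proof (intro allI impI)
  fix s v assume cyc: "gcyc (Suc r) A B n s v"
  have arW: "a r \<in> W" using rW by auto
  have v: "\<And>J. J \<subseteq> {..<Suc r} \<Longrightarrow> v J \<in> A (n + s * card J)"
    and dv: "\<And>J. J \<subseteq> {..<Suc r} \<Longrightarrow> d s v J \<in> B (n + s * card J)"
    using cyc unfolding gcyc_def by auto
  have vc: "J \<subseteq> {..<Suc r} \<Longrightarrow> v J \<in> carrier M" for J using gsub_carrier[OF A v] .
  have cyc': "gcyc (Suc r) A B (n + e) s (\<lambda>J. a r [^] e \<odot>\<^bsub>M\<^esub> v J)" for e
    unfolding gcyc_def
  proof (intro conjI allI impI)
    fix J assume J: "J \<subseteq> {..<Suc r}"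
    show "a r [^] e \<odot>\<^bsub>M\<^esub> v J \<in> A (n + e + s * card J)"
      using gsub_pow[OF A arW _ v[OF J], of e] by (simp add: add_ac)
    have "d s (\<lambda>J. a r [^] e \<odot>\<^bsub>M\<^esub> v J) J = a r [^] e \<odot>\<^bsub>M\<^esub> d s v J"
      using J vc finite_subset[OF J] by (intro d_smult) auto
    then show "d s (\<lambda>J. a r [^] e \<odot>\<^bsub>M\<^esub> v J) J \<in> B (n + e + s * card J)"
      using gsub_pow[OF B arW _ dv[OF J], of e] by (simp add: add_ac)
  qed
  have "gcob (Suc r) A B (n + e) s (\<lambda>J. a r [^] e \<odot>\<^bsub>M\<^esub> v J) \<Longrightarrow> gcob (Suc r) A B n s v" for e
  proof (induction e)
    case 0
    then show ?case using gcob_cong[of "Suc r" v "\<lambda>J. a r [^] (0::nat) \<odot>\<^bsub>M\<^esub> v J"] vc by simp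
  next
    case (Suc e)
    have "gcob (Suc r) A B (Suc (n + e)) s (\<lambda>J. a r \<odot>\<^bsub>M\<^esub> (a r [^] e \<odot>\<^bsub>M\<^esub> v J))"
    proof (subst gcob_cong)
      show "gcob (Suc r) A B (Suc (n + e)) s (\<lambda>J. a r [^] Suc e \<odot>\<^bsub>M\<^esub> v J)" using Suc.prems by simp
      show "a r \<odot>\<^bsub>M\<^esub> (a r [^] e \<odot>\<^bsub>M\<^esub> v J) = a r [^] Suc e \<odot>\<^bsub>M\<^esub> v J" if "J \<subseteq> {..<Suc r}" for J
        using vc[OF that] by (simp add: smult_assoc1[symmetric] R.m_comm)
    qed
    then have "gcob (Suc r) A B (n + e) s (\<lambda>J. a r [^] e \<odot>\<^bsub>M\<^esub> v J)"
      using gcob_cancel[OF A B W _ rW AD CB cyc'] by simp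
    then show ?case by (rule Suc.IH)
  qed
  then show "gcob (Suc r) A B n s v" using gcob_torsion[OF A B cyc] by blast
qed

text \<open>The induction counts the variables that may act nontrivially on \<open>A / B\<close>;
  \<open>kill\<close> says that those from \<open>r\<close> on act as zero. On the kernel and the
  cokernel of the last nontrivial variable one more variable acts as zero. The bound
  \<open>G\<close> is kept throughout, as it supplies the chain condition in the base case.\<close>

lemma gvan_eventually:
  assumes N: "gnoeth R M W G" and W: "W = a ` {..<t}" and r: "r \<le> t"
    and A: "gsub R M W A" and B: "gsub R M W B"
    and BA: "\<And>n. B n \<subseteq> A n" and AG: "\<And>n. A n \<subseteq> G n"
    and kill: "\<And>j n m. r \<le> j \<Longrightarrow> j < t \<Longrightarrow> m \<in> A n \<Longrightarrow> a j \<odot>\<^bsub>M\<^esub> m \<in> B (Suc n)"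
  shows "\<exists>n0. \<forall>n\<ge>n0. gvan r A B n"
  using r A B BA AG kill
proof (induction r arbitrary: A B)
  case 0
  text \<open>As all variables map \<open>A\<close> to \<open>B\<close>, the truncations \<open>F k\<close> form a chain of graded submodules,
    which is stationary only if \<open>A n = B n\<close> for large \<open>n\<close>.\<close>
  define F where "F k n = (if n < k then A n else B n)" for k n :: nat
  have "gsub R M W (F k)" for k
    unfolding gsub_def
  proof (intro conjI allI ballI)
    show "submodule (F k n) R M" for n unfolding F_def using gsubD(1)[OF 0(2)] gsubD(1)[OF 0(3)] by simp
    fix n u m assume u: "u \<in> W" and m: "m \<in> F k n"
    then have "m \<in> A n" using 0(4) unfolding F_def by (auto split: if_splits)
    then show "u \<odot>\<^bsub>M\<^esub> m \<in> F k (Suc n)"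
      using u 0(6) 0(4)[of "Suc n"] unfolding F_def W by auto
  qed
  moreover have "F k n \<subseteq> F (Suc k) n" "F k n \<subseteq> G n" for k n
    unfolding F_def using 0(4,5)[of n] by auto
  ultimately have "\<exists>k0. \<forall>k\<ge>k0. \<forall>n. F k n = F k0 n"
    using N[unfolded gnoeth_def, rule_format, of F] by blast
  then obtain k0 where k0: "\<And>k n. k \<ge> k0 \<Longrightarrow> F k n = F k0 n" by blast
  have AB: "A n = B n" if "n \<ge> k0" for n using k0[of "Suc n" n] that unfolding F_def by simp
  \<comment> \<open>Without variables only the empty set is left, and a cocycle is an element of
    \<open>A n = B n\<close>.\<close>
  have "gvan 0 A B n" if n: "n \<ge> k0" for n
    unfolding gvan_def
  proof (intro allI impI)
    fix s v assume "gcyc 0 A B n s v"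
    then have v: "v {} \<in> B n" unfolding gcyc_def using AB[OF n] by simp
    then have "lift 0 v {} \<ominus>\<^bsub>M\<^esub> d s (\<lambda>_. \<zero>\<^bsub>M\<^esub>) {} \<in> B n"
      using gsub_carrier[OF 0(3) v] by (simp add: a_minus_def)
    then show "gcob 0 A B n s v"
      unfolding gcob_def using submodule_zero[OF gsubD(1)[OF 0(2)]]
      by (intro exI[of _ 0] exI[of _ "\<lambda>_. \<zero>\<^bsub>M\<^esub>"]) simp
  qed
  then show ?case by blast
next
  case (Suc r)
  note A = Suc.prems(2) and B = Suc.prems(3) and BA = Suc.prems(4)
  have Wc: "W \<subseteq> carrier R" unfolding W by auto
  have rW: "a ` {..<Suc r} \<subseteq> W" unfolding W using Suc.prems(1) by auto
  let ?C = "gcolon (a r) A B" and ?D = "gsum (a r) A B"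
  have C: "gsub R M W ?C" and D: "gsub R M W ?D"
    using gsub_gcolon[OF A B Wc] gsub_gsum[OF A B Wc] by auto
  have BC: "B n \<subseteq> ?C n" for n using BA[of n] gsubD(2)[OF B, of "a r"] rW unfolding gcolon_def by auto
  have CA: "?C n \<subseteq> A n" for n unfolding gcolon_def by auto
  have BD: "B n \<subseteq> ?D n" for n using gsum_superset[OF A B] by simp
  have DA: "?D n \<subseteq> A n" for n
  proof (cases n)
    case (Suc n')
    have "b \<oplus>\<^bsub>M\<^esub> a r \<odot>\<^bsub>M\<^esub> m \<in> A n" if "b \<in> B n" "m \<in> A n'" for b m
      using that BA[of n] gsubD(2)[OF A _ that(2), of "a r"] rW Suc
      by (intro submoduleE(5)[OF gsubD(1)[OF A]]) auto
    then show ?thesis unfolding gsum_def using Suc by auto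
  qed (use BA[of 0] in \<open>simp add: gsum_def\<close>)
  have "\<exists>n0. \<forall>n\<ge>n0. gvan r ?C B n"
  proof (rule Suc.IH[OF _ C B BC])
    show "?C n \<subseteq> G n" for n using CA Suc.prems(5) by blast
    show "a j \<odot>\<^bsub>M\<^esub> m \<in> B (Suc n)" if "r \<le> j" "j < t" "m \<in> ?C n" for j n m
    proof (cases "j = r")
      case True
      then show ?thesis using that unfolding gcolon_def by simp
    next
      case False
      then show ?thesis using that CA Suc.prems(6)[of j m n] by auto
    qed
  qed (use Suc.prems in simp)
  then obtain n1 where n1: "\<And>n. n \<ge> n1 \<Longrightarrow> gvan r ?C B n" by blast
  have "\<exists>n0. \<forall>n\<ge>n0. gvan r A ?D n"
  proof (rule Suc.IH[OF _ A D DA Suc.prems(5)])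
    show "a j \<odot>\<^bsub>M\<^esub> m \<in> ?D (Suc n)" if "r \<le> j" "j < t" "m \<in> A n" for j n m
    proof (cases "j = r")
      case True
      then show ?thesis using gsum_smult[OF A B, of "a r" m n] that by simp
    next
      case False
      then show ?thesis using that BD[of "Suc n"] Suc.prems(6)[of j m n] by auto
    qed
  qed (use Suc.prems in simp)
  then obtain n2 where n2: "\<And>n. n \<ge> n2 \<Longrightarrow> gvan r A ?D n" by blast
  \<comment> \<open>The induction hypothesis concerns the first \<open>r\<close> variables only. As
    \<open>a r\<close> kills kernel and cokernel, \<open>gvan_killed_variable\<close> adds it
    back.\<close>
  have "gvan (Suc r) A B n" if n: "n \<ge> max n1 n2" for n
  proof (rule gvan_extend[OF A B Wc rW])
    fix m assume m: "n \<le> m"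
    show "gvan (Suc r) A ?D m"
      using gsum_smult[OF A B] n2[of m] n m by (intro gvan_killed_variable[OF A D rW]) auto
    show "gvan (Suc r) ?C B m"
      using n1[of m] n m by (intro gvan_killed_variable[OF C B rW]) (auto simp: gcolon_def)
  qed
  then show ?case by blast
qed

end

section \<open>Powers of an ideal\<close>

lemma (in cring) ideal_power_0: "ideal_power R I 0 = carrier R"
  unfolding ideal_power_def nat_pow_def by (simp add: ideals_set_def)

lemma (in cring) ideal_power_Suc: "ideal_power R I (Suc n) = ideal_power R I n \<cdot> I"
  unfolding ideal_power_def nat_pow_def by (simp add: ideals_set_def)

lemma (in cring) ideal_power_ideal: "ideal I R \<Longrightarrow> ideal (ideal_power R I n) R"
  by (induction n) (simp_all add: ideal_power_0 ideal_power_Suc oneideal ideal_prod_is_ideal)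

lemma (in cring) ideal_power_add:
  assumes "ideal I R"
  shows "ideal_power R I (m + n) = ideal_power R I m \<cdot> ideal_power R I n"
proof (induction n)
  case 0
  show ?case using ideal_prod_one[OF ideal_power_ideal[OF assms]] by (simp add: ideal_power_0)
next
  case (Suc n)
  then show ?case
    using ideal_prod_assoc[OF ideal_power_ideal[OF assms] ideal_power_ideal[OF assms] assms]
    by (simp add: ideal_power_Suc)
qed

lemma (in cring) ideal_power_mult:
  assumes "ideal I R" "x \<in> ideal_power R I m" "y \<in> ideal_power R I n"
  shows "x \<otimes> y \<in> ideal_power R I (m + n)"
  unfolding ideal_power_add[OF assms(1)] using assms by (intro ideal_prod.prod)

lemma (in cring) ideal_power_1: "ideal I R \<Longrightarrow> ideal_power R I 1 = I"
  using ideal_prod_one[of I] ideal_prod_commute[of I "carrier R"] oneideal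
  by (simp add: ideal_power_0 ideal_power_Suc)

lemma (in cring) pow_in_ideal_power:
  assumes "ideal I R" "x \<in> ideal_power R I m"
  shows "x [^] (k::nat) \<in> ideal_power R I (m * k)"
proof (induction k)
  case (Suc k)
  show ?case using ideal_power_mult[OF assms(1) Suc assms(2)] by (simp add: add.commute)
qed (simp add: ideal_power_0)

lemma (in cring) ideal_prod_subset:
  assumes "ideal K R" "\<And>x y. x \<in> I \<Longrightarrow> y \<in> J \<Longrightarrow> x \<otimes> y \<in> K"
  shows "I \<cdot> J \<subseteq> K"
proof
  fix z assume "z \<in> I \<cdot> J"
  then show "z \<in> K"
    by (induction rule: ideal_prod.induct)
      (use assms additive_subgroup.a_closed[OF ideal.axioms(1)[OF assms(1)]] in auto)
qed

lemma (in cring) idealI':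
  assumes "I \<subseteq> carrier R" "\<zero> \<in> I" "\<And>x y. x \<in> I \<Longrightarrow> y \<in> I \<Longrightarrow> x \<oplus> y \<in> I"
    "\<And>c x. c \<in> carrier R \<Longrightarrow> x \<in> I \<Longrightarrow> c \<otimes> x \<in> I"
  shows "ideal I R"
proof (intro idealI ring_axioms)
  show "subgroup I (add_monoid R)"
  proof (rule add.subgroupI)
    fix x assume x: "x \<in> I"
    then have "(\<ominus> \<one>) \<otimes> x \<in> I" by (intro assms) auto
    then show "\<ominus> x \<in> I" using x assms(1) by (simp add: l_minus subset_iff)
  qed (use assms in auto)
  fix x c assume "x \<in> I" "c \<in> carrier R"
  then show "c \<otimes> x \<in> I" "x \<otimes> c \<in> I" using assms(1) assms(4)[of c x] m_comm[of c x] by auto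
qed

section \<open>Reduction to generators and the Rees module\<close>

context module
begin

text \<open>Since these conductors are ideals, a membership for all \<open>r\<close> in a generated
  ideal or a product of ideals need only be checked on generators or on products.\<close>

lemma ideal_into_submodule:
  assumes "submodule H R M" "m \<in> carrier M"
  shows "ideal {r \<in> carrier R. r \<odot>\<^bsub>M\<^esub> m \<in> H} R"
proof (rule R.idealI')
  show "\<zero> \<in> {r \<in> carrier R. r \<odot>\<^bsub>M\<^esub> m \<in> H}" using assms submodule_zero by simp
qed (use assms submoduleE[OF assms(1)] in \<open>auto simp: smult_l_distr smult_assoc1\<close>)

lemma genideal_into_submodule:
  assumes "submodule H R M" "m \<in> carrier M" "W \<subseteq> carrier R" "\<And>x. x \<in> W \<Longrightarrow> x \<odot>\<^bsub>M\<^esub> m \<in> H" "r \<in> Idl W"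
  shows "r \<odot>\<^bsub>M\<^esub> m \<in> H"
proof -
  have "Idl W \<subseteq> {r \<in> carrier R. r \<odot>\<^bsub>M\<^esub> m \<in> H}"
    using assms by (intro R.genideal_minimal ideal_into_submodule) auto
  then show ?thesis using assms(5) by blast
qed

lemma ideal_prod_into_submodule:
  assumes "submodule H R M" "m \<in> carrier M" "ideal I R" "ideal J R"
    "\<And>x y. x \<in> I \<Longrightarrow> y \<in> J \<Longrightarrow> x \<odot>\<^bsub>M\<^esub> (y \<odot>\<^bsub>M\<^esub> m) \<in> H" "r \<in> I \<cdot> J"
  shows "r \<odot>\<^bsub>M\<^esub> m \<in> H"
proof -
  have "I \<cdot> J \<subseteq> {r \<in> carrier R. r \<odot>\<^bsub>M\<^esub> m \<in> H}"
  proof (rule R.ideal_prod_subset[OF ideal_into_submodule[OF assms(1,2)]])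
    fix x y assume h: "x \<in> I" "y \<in> J"
    then have "x \<in> carrier R" "y \<in> carrier R" using assms(3,4) ideal.Icarr by metis+
    then show "x \<otimes> y \<in> {r \<in> carrier R. r \<odot>\<^bsub>M\<^esub> m \<in> H}"
      using assms(5)[OF h] assms(2) by (simp add: smult_assoc1)
  qed
  then show ?thesis using assms(6) by blast
qed

text \<open>The homogeneous parts of the Rees module, as submodules of \<open>M\<close>.\<close>

definition qpow :: "'a set \<Rightarrow> nat \<Rightarrow> 'c set"
  where "qpow I n = ideal_smult M (ideal_power R I n) (carrier M)"

lemma qpow_gen:
  "ideal I R \<Longrightarrow> r \<in> ideal_power R I n \<Longrightarrow> m \<in> carrier M \<Longrightarrow> r \<odot>\<^bsub>M\<^esub> m \<in> qpow I n"
  unfolding qpow_def ideal_smult_def by (intro generate.incl) blast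

lemma ideal_smult_subset:
  assumes "submodule H R M" "\<And>r x. r \<in> I \<Longrightarrow> x \<in> N \<Longrightarrow> r \<odot>\<^bsub>M\<^esub> x \<in> H"
  shows "ideal_smult M I N \<subseteq> H"
  unfolding ideal_smult_def using assms
  by (intro M.add.generate_subgroup_incl) (auto simp: submodule_def)

lemma submodule_ideal_smult:
  assumes "I \<subseteq> carrier R" "N \<subseteq> carrier M" "\<And>c r. c \<in> carrier R \<Longrightarrow> r \<in> I \<Longrightarrow> c \<otimes> r \<in> I"
  shows "submodule (ideal_smult M I N) R M"
proof -
  let ?G = "{r \<odot>\<^bsub>M\<^esub> x | r x. r \<in> I \<and> x \<in> N}"
  have G: "?G \<subseteq> carrier M" using assms by auto
  have sub: "subgroup (generate (add_monoid M) ?G) (add_monoid M)"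
    using M.add.generate_is_subgroup[of ?G] G by simp
  have gc: "y \<in> carrier M" if "y \<in> generate (add_monoid M) ?G" for y
    using subgroup.mem_carrier[OF sub that] by simp
  show ?thesis unfolding ideal_smult_def submodule_def submodule_axioms_def
  proof (intro conjI allI impI sub)
    fix c y assume c: "c \<in> carrier R" and "y \<in> generate (add_monoid M) ?G"
    from this(2) show "c \<odot>\<^bsub>M\<^esub> y \<in> generate (add_monoid M) ?G"
    proof (induction rule: generate.induct)
      case one
      then show ?case using c generate.one[of "add_monoid M"] by simp
    next
      case (incl h)
      then obtain r x where "h = r \<odot>\<^bsub>M\<^esub> x" "r \<in> I" "x \<in> N" by blast
      then have "c \<odot>\<^bsub>M\<^esub> h = (c \<otimes> r) \<odot>\<^bsub>M\<^esub> x" "c \<otimes> r \<in> I" "x \<in> N"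
        using c assms by (auto simp: smult_assoc1 subset_iff)
      then show ?case by (auto intro!: generate.incl)
    next
      case (inv h)
      then obtain r x where h: "h = r \<odot>\<^bsub>M\<^esub> x" "r \<in> I" "x \<in> N" by blast
      then have "c \<odot>\<^bsub>M\<^esub> (\<ominus>\<^bsub>M\<^esub> h) = \<ominus>\<^bsub>M\<^esub> ((c \<otimes> r) \<odot>\<^bsub>M\<^esub> x)" "c \<otimes> r \<in> I"
        using c assms by (auto simp: smult_assoc1 subset_iff smult_r_minus)
      moreover have "(c \<otimes> r) \<odot>\<^bsub>M\<^esub> x \<in> ?G" using h \<open>c \<otimes> r \<in> I\<close> by blast
      ultimately show ?case using generate.inv[of "(c \<otimes> r) \<odot>\<^bsub>M\<^esub> x" ?G "add_monoid M"]
        unfolding a_inv_def by simp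
    next
      case (eng h1 h2)
      then have "c \<odot>\<^bsub>M\<^esub> (h1 \<oplus>\<^bsub>M\<^esub> h2) = c \<odot>\<^bsub>M\<^esub> h1 \<oplus>\<^bsub>M\<^esub> c \<odot>\<^bsub>M\<^esub> h2"
        using c gc by (simp add: smult_r_distr)
      then show ?case using generate.eng[OF eng.IH] by simp
    qed
  qed
qed

lemma submodule_qpow: "ideal I R \<Longrightarrow> submodule (qpow I n) R M"
  unfolding qpow_def using R.ideal_power_ideal[of I n]
  by (intro submodule_ideal_smult) (auto intro: ideal.I_l_closed dest: ideal.Icarr)

lemma qpow_smult:
  assumes "ideal I R" "r \<in> ideal_power R I k" "m \<in> qpow I n"
  shows "r \<odot>\<^bsub>M\<^esub> m \<in> qpow I (n + k)"
proof -
  have r: "r \<in> carrier R" using R.ideal_power_ideal[OF assms(1)] assms(2) ideal.Icarr by metis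
  have "qpow I n \<subseteq> {m \<in> carrier M. r \<odot>\<^bsub>M\<^esub> m \<in> qpow I (n + k)}"
    unfolding qpow_def[of I n]
  proof (rule ideal_smult_subset)
    show "submodule {m \<in> carrier M. r \<odot>\<^bsub>M\<^esub> m \<in> qpow I (n + k)} R M"
      by (intro submodule_colon carrier_is_submodule submodule_qpow assms r)
    fix z x assume z: "z \<in> ideal_power R I n" and x: "x \<in> carrier M"
    then have zc: "z \<in> carrier R" using R.ideal_power_ideal[OF assms(1)] ideal.Icarr by metis
    have "r \<odot>\<^bsub>M\<^esub> (z \<odot>\<^bsub>M\<^esub> x) = (z \<otimes> r) \<odot>\<^bsub>M\<^esub> x" using r zc x by (simp add: smult_assoc1[symmetric] R.m_comm)
    then show "z \<odot>\<^bsub>M\<^esub> x \<in> {m \<in> carrier M. r \<odot>\<^bsub>M\<^esub> m \<in> qpow I (n + k)}"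
      using qpow_gen[OF assms(1) R.ideal_power_mult[OF assms(1) z assms(2)] x] zc x by simp
  qed
  then show ?thesis using assms(3) by blast
qed

lemma gsub_qpow:
  assumes "W \<subseteq> carrier R"
  shows "gsub R M W (qpow (Idl W))"
  unfolding gsub_def
proof (intro conjI allI ballI)
  have I: "ideal (Idl W) R" using assms by (rule R.genideal_ideal)
  show "submodule (qpow (Idl W) n) R M" for n using submodule_qpow[OF I] .
  fix n x m assume "x \<in> W" "m \<in> qpow (Idl W) n"
  moreover from this have "x \<in> ideal_power R (Idl W) 1"
    using R.genideal_self[OF assms] R.ideal_power_1[OF I] by auto
  ultimately show "x \<odot>\<^bsub>M\<^esub> m \<in> qpow (Idl W) (Suc n)" using qpow_smult[OF I, of x 1 m n] by simp
qed

text \<open>An element of the \<open>n\<close>-th power is a sum of multiples of products of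
  \<open>n\<close> generators, each raising the degree in \<open>G\<close> by one. This places the
  Rees module inside a family with the chain condition.\<close>

lemma qpow_subset:
  assumes G: "gsub R M W G" and W: "W \<subseteq> carrier R" and G0: "G 0 = carrier M"
  shows "qpow (Idl W) n \<subseteq> G n"
proof -
  have I: "ideal (Idl W) R" using W by (rule R.genideal_ideal)
  \<comment> \<open>The starting degree \<open>k\<close> is arbitrary because the last factor of a
    product acts first and moves the element to degree \<open>Suc k\<close>.\<close>
  have *: "r \<odot>\<^bsub>M\<^esub> m \<in> G (k + n)" if "r \<in> ideal_power R (Idl W) n" "m \<in> G k" for r m k n
    using that
  proof (induction n arbitrary: r m k)
    case 0
    then show ?case using submoduleE(4)[OF gsubD(1)[OF G]] by (simp add: R.ideal_power_0)
  next
    case (Suc n)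
    have m: "m \<in> carrier M" using submodule_subset[OF gsubD(1)[OF G] Suc.prems(2)] .
    show ?case
    proof (rule ideal_prod_into_submodule[OF gsubD(1)[OF G] m R.ideal_power_ideal[OF I] I])
      show "r \<in> ideal_power R (Idl W) n \<cdot> (Idl W)" using Suc.prems(1) by (simp add: R.ideal_power_Suc)
      fix x y assume x: "x \<in> ideal_power R (Idl W) n" and y: "y \<in> Idl W"
      have "y \<odot>\<^bsub>M\<^esub> m \<in> G (Suc k)"
        using gsubD(2)[OF G _ Suc.prems(2)] by (rule genideal_into_submodule[OF gsubD(1)[OF G] m W _ y])
      then show "x \<odot>\<^bsub>M\<^esub> (y \<odot>\<^bsub>M\<^esub> m) \<in> G (k + Suc n)" using Suc.IH[OF x] by fastforce
    qed
  qed
  show ?thesis unfolding qpow_def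
    using *[of _ n _ 0] G0 by (intro ideal_smult_subset gsubD(1)[OF G]) auto
qed

end

section \<open>Torsion for an ideal and for its generators\<close>

context koszul
begin

text \<open>For \<open>t = 0\<close> the ideal is zero and its zeroth power is \<open>R\<close>, hence the exponent \<open>Suc N\<close>.\<close>

lemma ideal_power_kills:
  assumes "x \<in> carrier M" "\<And>j. j < t \<Longrightarrow> a j [^] b j \<odot>\<^bsub>M\<^esub> x = \<zero>\<^bsub>M\<^esub>"
    and "(\<Sum>j<t. b j) = (N::nat)" and "r \<in> ideal_power R (Idl (a ` {..<t})) (Suc N)"
  shows "r \<odot>\<^bsub>M\<^esub> x = \<zero>\<^bsub>M\<^esub>"
  using assms
proof (induction N arbitrary: x b r)
  case (0 x b r)
  have W: "a ` {..<t} \<subseteq> carrier R" by auto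
  have I: "ideal (Idl (a ` {..<t})) R" by (rule R.genideal_ideal[OF W])
  have "r \<in> Idl (a ` {..<t})" using 0(4) R.ideal_power_1[OF I] by simp
  moreover have "u \<odot>\<^bsub>M\<^esub> x \<in> {\<zero>\<^bsub>M\<^esub>}" if "u \<in> a ` {..<t}" for u
  proof -
    obtain j where j: "j < t" "u = a j" using \<open>u \<in> a ` {..<t}\<close> by auto
    then have "b j = 0" using 0(3) by auto
    then have "x = \<zero>\<^bsub>M\<^esub>" using 0(2)[OF j(1)] 0(1) by simp
    then show ?thesis using j by simp
  qed
  ultimately have "r \<odot>\<^bsub>M\<^esub> x \<in> {\<zero>\<^bsub>M\<^esub>}"
    using genideal_into_submodule[OF submodule_single_zero 0(1) W] by blast
  then show ?case by simp
next
  case (Suc N x b r)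
  have W: "a ` {..<t} \<subseteq> carrier R" by auto
  have I: "ideal (Idl (a ` {..<t})) R" by (rule R.genideal_ideal[OF W])
  \<comment> \<open>Passing to \<open>a j x\<close> lowers the exponent at \<open>j\<close> by one
    and with it the sum; the pigeonhole argument on monomials thus becomes an induction on the sum
    of the exponents.\<close>
  have kill: "u \<odot>\<^bsub>M\<^esub> (a j \<odot>\<^bsub>M\<^esub> x) = \<zero>\<^bsub>M\<^esub>" if u: "u \<in> ideal_power R (Idl (a ` {..<t})) (Suc N)" and j: "j < t" for u j
  proof (cases "b j")
    case 0
    then have "x = \<zero>\<^bsub>M\<^esub>" using Suc.prems(2)[OF j] Suc.prems(1) by simp
    then show ?thesis using R.ideal_power_ideal[OF I] u ideal.Icarr
      by (metis a_closed smult_r_null)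
  next
    case (Suc c)
    show ?thesis
    proof (rule Suc.IH[OF _ _ _ u])
      show "a j \<odot>\<^bsub>M\<^esub> x \<in> carrier M" using Suc.prems(1) by simp
      show "a l [^] (b(j := c)) l \<odot>\<^bsub>M\<^esub> (a j \<odot>\<^bsub>M\<^esub> x) = \<zero>\<^bsub>M\<^esub>" if l: "l < t" for l
      proof (cases "l = j")
        case True
        then show ?thesis using Suc.prems(1) Suc.prems(2)[OF j] \<open>b j = Suc c\<close>
          by (simp add: smult_assoc1)
      next
        case False
        then show ?thesis using Suc.prems(1) Suc.prems(2)[OF l] smult_comm[of "a l [^] b l" "a j" x] by simp
      qed
      have "sum b {..<t} = b j + sum b ({..<t} - {j})" using j by (simp add: sum.remove)
      moreover have "sum (b(j := c)) {..<t} = c + sum (b(j := c)) ({..<t} - {j})"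
        using j by (simp add: sum.remove[of _ j])
      moreover have "sum (b(j := c)) ({..<t} - {j}) = sum b ({..<t} - {j})" by (intro sum.cong) auto
      ultimately show "sum (b(j := c)) {..<t} = N" using Suc.prems(3) Suc by simp
    qed
  qed
  have "r \<odot>\<^bsub>M\<^esub> x \<in> {\<zero>\<^bsub>M\<^esub>}"
  proof (rule ideal_prod_into_submodule[OF submodule_single_zero Suc.prems(1) R.ideal_power_ideal[OF I, of "Suc N"] I])
    show "r \<in> ideal_power R (Idl (a ` {..<t})) (Suc N) \<cdot> (Idl (a ` {..<t}))"
      using Suc.prems(4) by (simp add: R.ideal_power_Suc)
    fix u y assume u: "u \<in> ideal_power R (Idl (a ` {..<t})) (Suc N)" and y: "y \<in> Idl (a ` {..<t})"
    have uc: "u \<in> carrier R" using R.ideal_power_ideal[OF I] u ideal.Icarr by metis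
    have "y \<odot>\<^bsub>M\<^esub> x \<in> {m \<in> carrier M. u \<odot>\<^bsub>M\<^esub> m \<in> {\<zero>\<^bsub>M\<^esub>}}"
    proof (rule genideal_into_submodule[OF _ Suc.prems(1) W _ y])
      show "submodule {m \<in> carrier M. u \<odot>\<^bsub>M\<^esub> m \<in> {\<zero>\<^bsub>M\<^esub>}} R M"
        by (intro submodule_colon carrier_is_submodule submodule_single_zero uc)
    qed (use kill u Suc.prems(1) in auto)
    then show "u \<odot>\<^bsub>M\<^esub> (y \<odot>\<^bsub>M\<^esub> x) \<in> {\<zero>\<^bsub>M\<^esub>}" by simp
  qed
  then show ?case by simp
qed

text \<open>This translates the section functor into the language of generators, in which torsion
  elements are Koszul cocycles of degree 0.\<close>

lemma ideal_power_torsion_iff: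
  assumes "x \<in> carrier M"
  shows "(\<exists>k. \<forall>r\<in>ideal_power R (Idl (a ` {..<t})) k. r \<odot>\<^bsub>M\<^esub> x = \<zero>\<^bsub>M\<^esub>) \<longleftrightarrow>
    (\<exists>k::nat. \<forall>j<t. a j [^] k \<odot>\<^bsub>M\<^esub> x = \<zero>\<^bsub>M\<^esub>)"
proof
  have W: "a ` {..<t} \<subseteq> carrier R" by auto
  have I: "ideal (Idl (a ` {..<t})) R" by (rule R.genideal_ideal[OF W])
  assume "\<exists>k. \<forall>r\<in>ideal_power R (Idl (a ` {..<t})) k. r \<odot>\<^bsub>M\<^esub> x = \<zero>\<^bsub>M\<^esub>"
  then obtain k where k: "\<And>r. r \<in> ideal_power R (Idl (a ` {..<t})) k \<Longrightarrow> r \<odot>\<^bsub>M\<^esub> x = \<zero>\<^bsub>M\<^esub>" by blast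
  have "a j [^] k \<in> ideal_power R (Idl (a ` {..<t})) k" if "j < t" for j
    using R.pow_in_ideal_power[OF I, of "a j" 1 k] R.genideal_self[OF W] that R.ideal_power_1[OF I] by auto
  then show "\<exists>k::nat. \<forall>j<t. a j [^] k \<odot>\<^bsub>M\<^esub> x = \<zero>\<^bsub>M\<^esub>" using k by blast
next
  assume "\<exists>k::nat. \<forall>j<t. a j [^] k \<odot>\<^bsub>M\<^esub> x = \<zero>\<^bsub>M\<^esub>"
  then obtain k :: nat where "\<And>j. j < t \<Longrightarrow> a j [^] k \<odot>\<^bsub>M\<^esub> x = \<zero>\<^bsub>M\<^esub>" by blast
  then show "\<exists>k. \<forall>r\<in>ideal_power R (Idl (a ` {..<t})) k. r \<odot>\<^bsub>M\<^esub> x = \<zero>\<^bsub>M\<^esub>"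
    using ideal_power_kills[OF assms, of t "\<lambda>_. k"] by blast
qed

end

section \<open>Cech cohomology of injective modules\<close>

context module
begin

text \<open>Baer's criterion for \<open>H\<close>, with a homomorphism from an ideal to \<open>H\<close> given by its graph \<open>\<rho>\<close>.\<close>

definition baer :: "'c set \<Rightarrow> bool"
  where "baer H \<longleftrightarrow> submodule H R M \<and> (\<forall>\<rho>. \<rho> \<subseteq> carrier R \<times> H \<longrightarrow> (\<zero>, \<zero>\<^bsub>M\<^esub>) \<in> \<rho> \<longrightarrow>
    (\<forall>u h u' h'. (u, h) \<in> \<rho> \<longrightarrow> (u', h') \<in> \<rho> \<longrightarrow> (u \<oplus> u', h \<oplus>\<^bsub>M\<^esub> h') \<in> \<rho>) \<longrightarrow>
    (\<forall>c\<in>carrier R. \<forall>u h. (u, h) \<in> \<rho> \<longrightarrow> (c \<otimes> u, c \<odot>\<^bsub>M\<^esub> h) \<in> \<rho>) \<longrightarrow>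
    (\<forall>h. (\<zero>, h) \<in> \<rho> \<longrightarrow> h = \<zero>\<^bsub>M\<^esub>) \<longrightarrow>
    (\<exists>e\<in>H. \<forall>u h. (u, h) \<in> \<rho> \<longrightarrow> h = u \<odot>\<^bsub>M\<^esub> e))"

lemma baer_submodule: "baer H \<Longrightarrow> submodule H R M"
  unfolding baer_def by blast

lemma baerD:
  assumes "baer H" "\<rho> \<subseteq> carrier R \<times> H" "(\<zero>, \<zero>\<^bsub>M\<^esub>) \<in> \<rho>"
    "\<And>u h u' h'. (u, h) \<in> \<rho> \<Longrightarrow> (u', h') \<in> \<rho> \<Longrightarrow> (u \<oplus> u', h \<oplus>\<^bsub>M\<^esub> h') \<in> \<rho>"
    "\<And>c u h. c \<in> carrier R \<Longrightarrow> (u, h) \<in> \<rho> \<Longrightarrow> (c \<otimes> u, c \<odot>\<^bsub>M\<^esub> h) \<in> \<rho>"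
    "\<And>h. (\<zero>, h) \<in> \<rho> \<Longrightarrow> h = \<zero>\<^bsub>M\<^esub>"
  obtains e where "e \<in> H" "\<And>u h. (u, h) \<in> \<rho> \<Longrightarrow> h = u \<odot>\<^bsub>M\<^esub> e"
proof -
  have "\<exists>e\<in>H. \<forall>u h. (u, h) \<in> \<rho> \<longrightarrow> h = u \<odot>\<^bsub>M\<^esub> e"
    by (rule assms(1)[unfolded baer_def, THEN conjunct2, rule_format], rule assms(2), rule assms(3),
        rule assms(4), assumption+, rule assms(5), assumption+, rule assms(6), assumption)
  then show thesis using that by blast
qed

lemma graph_functional:
  assumes "\<rho> \<subseteq> carrier R \<times> carrier M"
    "\<And>u h u' h'. (u, h) \<in> \<rho> \<Longrightarrow> (u', h') \<in> \<rho> \<Longrightarrow> (u \<oplus> u', h \<oplus>\<^bsub>M\<^esub> h') \<in> \<rho>"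
    "\<And>c u h. c \<in> carrier R \<Longrightarrow> (u, h) \<in> \<rho> \<Longrightarrow> (c \<otimes> u, c \<odot>\<^bsub>M\<^esub> h) \<in> \<rho>"
    "\<And>h. (\<zero>, h) \<in> \<rho> \<Longrightarrow> h = \<zero>\<^bsub>M\<^esub>"
    and "(u, h) \<in> \<rho>" "(u, h') \<in> \<rho>"
  shows "h = h'"
proof -
  have c: "u \<in> carrier R" "h \<in> carrier M" "h' \<in> carrier M" using assms(1,5,6) by auto
  have "(\<ominus> \<one> \<otimes> u, \<ominus> \<one> \<odot>\<^bsub>M\<^esub> h') \<in> \<rho>" using assms(3)[OF _ assms(6)] by simp
  then have "(\<ominus> u, \<ominus>\<^bsub>M\<^esub> h') \<in> \<rho>" using c by (simp add: R.l_minus smult_l_minus)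
  then have "(u \<oplus> \<ominus> u, h \<oplus>\<^bsub>M\<^esub> \<ominus>\<^bsub>M\<^esub> h') \<in> \<rho>" using assms(2)[OF assms(5)] by blast
  then have "h \<oplus>\<^bsub>M\<^esub> \<ominus>\<^bsub>M\<^esub> h' = \<zero>\<^bsub>M\<^esub>" using assms(4) c by (simp add: R.r_neg)
  then show ?thesis using c M.minus_equality M.minus_minus M.a_inv_closed M.a_comm by metis
qed

lemma graph_domain_ideal:
  assumes "\<rho> \<subseteq> carrier R \<times> carrier M" "(\<zero>, \<zero>\<^bsub>M\<^esub>) \<in> \<rho>"
    "\<And>u h u' h'. (u, h) \<in> \<rho> \<Longrightarrow> (u', h') \<in> \<rho> \<Longrightarrow> (u \<oplus> u', h \<oplus>\<^bsub>M\<^esub> h') \<in> \<rho>"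
    "\<And>c u h. c \<in> carrier R \<Longrightarrow> (u, h) \<in> \<rho> \<Longrightarrow> (c \<otimes> u, c \<odot>\<^bsub>M\<^esub> h) \<in> \<rho>"
  shows "ideal (Domain \<rho>) R"
  by (rule R.idealI') (use assms in blast)+

lemma ring_as_module:
  "module R \<lparr>carrier = carrier R, monoid.mult = monoid.mult R, one = monoid.one R, ring.zero = ring.zero R, add = add R, smult = monoid.mult R\<rparr>"
    (is "module R ?P")
proof (rule moduleI)
  show "abelian_group ?P"
    by (rule abelian_groupI) (auto simp: R.a_ac intro: R.a_inv_closed R.l_neg)
qed (auto simp: R.l_distr R.r_distr R.m_assoc R.is_cring)

text \<open>Of all test modules only the ring and an ideal in it are used, and their carriers have
  the required type. The element \<open>e\<close> is the value at 1 of the extended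
  homomorphism.\<close>

lemma injective_imp_baer:
  assumes "injective_module R M"
  shows "baer (carrier M)"
  unfolding baer_def
proof (intro conjI allI impI carrier_is_submodule)
  fix \<rho> assume \<rho>: "\<rho> \<subseteq> carrier R \<times> carrier M" "(\<zero>, \<zero>\<^bsub>M\<^esub>) \<in> \<rho>"
    "\<forall>u h u' h'. (u, h) \<in> \<rho> \<longrightarrow> (u', h') \<in> \<rho> \<longrightarrow> (u \<oplus> u', h \<oplus>\<^bsub>M\<^esub> h') \<in> \<rho>"
    "\<forall>c\<in>carrier R. \<forall>u h. (u, h) \<in> \<rho> \<longrightarrow> (c \<otimes> u, c \<odot>\<^bsub>M\<^esub> h) \<in> \<rho>"
    "\<forall>h. (\<zero>, h) \<in> \<rho> \<longrightarrow> h = \<zero>\<^bsub>M\<^esub>"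
  define P where "P = \<lparr>carrier = carrier R, monoid.mult = monoid.mult R, one = monoid.one R, ring.zero = ring.zero R, add = add R, smult = monoid.mult R\<rparr>"
  define I where "I = Domain \<rho>"
  have I: "ideal I R" unfolding I_def
    by (rule graph_domain_ideal[OF \<rho>(1,2) \<rho>(3)[rule_format] \<rho>(4)[rule_format]])
  have modP: "module R P" unfolding P_def by (rule ring_as_module)
  interpret P: module R P by (rule modP)
  have "submodule I R P"
    using additive_subgroup.a_subset[OF ideal.axioms(1)[OF I]] additive_subgroup.zero_closed[OF ideal.axioms(1)[OF I]]
      additive_subgroup.a_closed[OF ideal.axioms(1)[OF I]] ideal.I_l_closed[OF I]
    by (intro P.submoduleI') (auto simp: P_def)
  then have modI: "module R (P\<lparr>carrier := I\<rparr>)" using modP by (rule submodule.submodule_is_module)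
  define f where "f u = (THE h. (u, h) \<in> \<rho>)" for u
  have f: "(u, h) \<in> \<rho> \<Longrightarrow> f u = h" for u h
    unfolding f_def
    using graph_functional[OF \<rho>(1) \<rho>(3)[rule_format] \<rho>(4)[rule_format] \<rho>(5)[rule_format]]
    by (intro the_equality)
  have fI: "u \<in> I \<Longrightarrow> (u, f u) \<in> \<rho>" for u unfolding I_def using f by blast
  have fh: "f \<in> module_hom R (P\<lparr>carrier := I\<rparr>) M"
    unfolding module_hom_def
  proof (intro CollectI conjI ballI)
    show "f \<in> carrier (P\<lparr>carrier := I\<rparr>) \<rightarrow> carrier M" using fI \<rho>(1) by auto
    fix u assume u: "u \<in> carrier (P\<lparr>carrier := I\<rparr>)"
    show "f (c \<odot>\<^bsub>P\<lparr>carrier := I\<rparr>\<^esub> u) = c \<odot>\<^bsub>M\<^esub> f u" if "c \<in> carrier R" for c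
    proof -
      have "(c \<otimes> u, c \<odot>\<^bsub>M\<^esub> f u) \<in> \<rho>" using u by (intro \<rho>(4)[rule_format, OF that] fI) simp
      then show ?thesis using f by (simp add: P_def)
    qed
    fix u' assume u': "u' \<in> carrier (P\<lparr>carrier := I\<rparr>)"
    show "f (u \<oplus>\<^bsub>P\<lparr>carrier := I\<rparr>\<^esub> u') = f u \<oplus>\<^bsub>M\<^esub> f u'"
    proof -
      have "(u \<oplus> u', f u \<oplus>\<^bsub>M\<^esub> f u') \<in> \<rho>" using u u' by (intro \<rho>(3)[rule_format] fI) simp_all
      then show ?thesis using f by (simp add: P_def)
    qed
  qed
  have idh: "id \<in> module_hom R (P\<lparr>carrier := I\<rparr>) P"
    unfolding module_hom_def using ideal.Icarr[OF I] by (auto simp: P_def)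
  have "\<exists>g\<in>module_hom R P M. \<forall>u\<in>carrier (P\<lparr>carrier := I\<rparr>). g (id u) = f u"
    by (rule assms[unfolded injective_module_def, THEN conjunct2, rule_format])
      (use fh idh modP modI in \<open>simp_all add: id_def\<close>)
  then obtain g where g: "g \<in> module_hom R P M" "\<And>u. u \<in> I \<Longrightarrow> g u = f u" by auto
  have "h = u \<odot>\<^bsub>M\<^esub> g \<one>" if h: "(u, h) \<in> \<rho>" for u h
  proof -
    have "u \<in> carrier R" "u \<in> I" using h \<rho>(1) unfolding I_def by auto
    then have "g (u \<odot>\<^bsub>P\<^esub> \<one>) = u \<odot>\<^bsub>M\<^esub> g \<one>" using g(1) by (intro module_homD(3)) (auto simp: P_def)
    then show ?thesis using g(2)[OF \<open>u \<in> I\<close>] f[OF h] \<open>u \<in> carrier R\<close> by (simp add: P_def)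
  qed
  moreover have "g \<one> \<in> carrier M" using g(1) by (rule module_homD(1)) (simp add: P_def)
  ultimately show "\<exists>e\<in>carrier M. \<forall>u h. (u, h) \<in> \<rho> \<longrightarrow> h = u \<odot>\<^bsub>M\<^esub> e" by blast
qed

text \<open>The kernel of the localization map from \<open>H\<close> at \<open>x\<close>.\<close>

definition torsion :: "'a \<Rightarrow> 'c set \<Rightarrow> 'c set"
  where "torsion x H = {h \<in> H. \<exists>k::nat. x [^] k \<odot>\<^bsub>M\<^esub> h = \<zero>\<^bsub>M\<^esub>}"

lemma smult_pow_zero_mono:
  assumes "x \<in> carrier R" "h \<in> carrier M" "x [^] (k::nat) \<odot>\<^bsub>M\<^esub> h = \<zero>\<^bsub>M\<^esub>" "k \<le> l"
  shows "x [^] l \<odot>\<^bsub>M\<^esub> h = \<zero>\<^bsub>M\<^esub>"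
proof -
  have "x [^] l = x [^] (l - k) \<otimes> x [^] k" using assms by (simp add: R.nat_pow_mult)
  then show ?thesis using assms by (simp add: smult_assoc1)
qed

lemma submodule_torsion:
  assumes "submodule H R M" "x \<in> carrier R"
  shows "submodule (torsion x H) R M"
proof (rule submoduleI')
  have HM: "H \<subseteq> carrier M" using submoduleE(1)[OF assms(1)] .
  then show "torsion x H \<subseteq> carrier M" unfolding torsion_def by blast
  show "\<zero>\<^bsub>M\<^esub> \<in> torsion x H" unfolding torsion_def using submodule_zero assms by simp
  fix h assume h: "h \<in> torsion x H"
  then obtain k :: nat where k: "x [^] k \<odot>\<^bsub>M\<^esub> h = \<zero>\<^bsub>M\<^esub>" "h \<in> H" unfolding torsion_def by blast
  show "c \<odot>\<^bsub>M\<^esub> h \<in> torsion x H" if c: "c \<in> carrier R" for c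
  proof -
    have "x [^] k \<odot>\<^bsub>M\<^esub> (c \<odot>\<^bsub>M\<^esub> h) = c \<odot>\<^bsub>M\<^esub> (x [^] k \<odot>\<^bsub>M\<^esub> h)"
      using c k(2) assms(2) HM by (intro smult_comm) auto
    then show ?thesis unfolding torsion_def using k c submoduleE(4)[OF assms(1)] by auto
  qed
  fix g assume g: "g \<in> torsion x H"
  then obtain l :: nat where l: "x [^] l \<odot>\<^bsub>M\<^esub> g = \<zero>\<^bsub>M\<^esub>" "g \<in> H" unfolding torsion_def by blast
  have "x [^] max k l \<odot>\<^bsub>M\<^esub> h = \<zero>\<^bsub>M\<^esub>" "x [^] max k l \<odot>\<^bsub>M\<^esub> g = \<zero>\<^bsub>M\<^esub>"
    using smult_pow_zero_mono[OF assms(2)] k l HM by (meson subsetD max.cobounded1 max.cobounded2)+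
  then have "x [^] max k l \<odot>\<^bsub>M\<^esub> (h \<oplus>\<^bsub>M\<^esub> g) = \<zero>\<^bsub>M\<^esub>"
    using k l HM assms(2) by (simp add: smult_r_distr subset_iff)
  then show "h \<oplus>\<^bsub>M\<^esub> g \<in> torsion x H"
    unfolding torsion_def using submoduleE(5)[OF assms(1) k(2) l(2)] by blast
qed

text \<open>The Artin--Rees lemma for a principal ideal, as a stationary chain of colon ideals.\<close>

lemma ideal_colon_pow_stabilises:
  assumes "noetherian_ring R" "ideal I R" "x \<in> carrier R"
  obtains k0 :: nat where "\<And>k r. r \<in> carrier R \<Longrightarrow> x [^] (k0 + k) \<otimes> r \<in> I \<Longrightarrow> x [^] k0 \<otimes> r \<in> I"
proof -
  interpret I: ideal I R by fact
  define L where "L k = {r \<in> carrier R. x [^] (k::nat) \<otimes> r \<in> I}" for k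
  have "ideal (L k) R" for k
  proof (rule R.idealI')
    show "c \<otimes> r \<in> L k" if "c \<in> carrier R" "r \<in> L k" for c r
      using that assms(3) I.I_l_closed[of "x [^] k \<otimes> r" c] unfolding L_def
      by (simp add: R.m_lcomm)
  qed (use assms(3) I.a_closed in \<open>auto simp: L_def R.r_distr\<close>)
  moreover have "L k \<subseteq> L (Suc k)" for k
  proof
    fix r assume r: "r \<in> L k"
    then have "x \<otimes> (x [^] k \<otimes> r) \<in> I" unfolding L_def using I.I_l_closed assms(3) by blast
    then show "r \<in> L (Suc k)" using r assms(3) unfolding L_def by (simp add: R.m_assoc R.m_lcomm)
  qed
  ultimately obtain k0 where k0: "\<And>k. k \<ge> k0 \<Longrightarrow> L k = L k0"
    using noetherian_ring.ideal_chain_stabilises[OF assms(1), of L] by blast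
  show thesis
  proof (rule that[of k0])
    fix k r assume "r \<in> carrier R" "x [^] (k0 + k) \<otimes> r \<in> I"
    then have "r \<in> L (k0 + k)" unfolding L_def by simp
    then show "x [^] k0 \<otimes> r \<in> I" using k0[of "k0 + k"] unfolding L_def by simp
  qed
qed

text \<open>A homomorphism from an ideal \<open>I\<close> to the torsion part is killed by a single
  power \<open>x [^] n\<close>. By Artin--Rees the multiples of \<open>x [^] m\<close> inside
  \<open>I\<close> lie in \<open>x [^] n\<close> times \<open>I\<close> for
  \<open>m = k0 + n\<close>, so the homomorphism extends by zero to \<open>I\<close> plus the
  multiples of \<open>x [^] m\<close>. The element representing this extension in \<open>H\<close>
  is then torsion itself.\<close>

lemma baer_torsion:
  assumes N: "noetherian_ring R" and H: "baer H" and x: "x \<in> carrier R"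
  shows "baer (torsion x H)"
  unfolding baer_def
proof (intro conjI allI impI)
  note SH = baer_submodule[OF H]
  show ST: "submodule (torsion x H) R M" by (rule submodule_torsion[OF SH x])
  fix \<rho> assume \<rho>: "\<rho> \<subseteq> carrier R \<times> torsion x H" "(\<zero>, \<zero>\<^bsub>M\<^esub>) \<in> \<rho>"
    "\<forall>u h u' h'. (u, h) \<in> \<rho> \<longrightarrow> (u', h') \<in> \<rho> \<longrightarrow> (u \<oplus> u', h \<oplus>\<^bsub>M\<^esub> h') \<in> \<rho>"
    "\<forall>c\<in>carrier R. \<forall>u h. (u, h) \<in> \<rho> \<longrightarrow> (c \<otimes> u, c \<odot>\<^bsub>M\<^esub> h) \<in> \<rho>"
    "\<forall>h. (\<zero>, h) \<in> \<rho> \<longrightarrow> h = \<zero>\<^bsub>M\<^esub>"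
  have \<rho>M: "\<rho> \<subseteq> carrier R \<times> carrier M" using \<rho>(1) submoduleE(1)[OF ST] by blast
  have fn: "h = h'" if "(u, h) \<in> \<rho>" "(u, h') \<in> \<rho>" for u h h'
    by (rule graph_functional[OF \<rho>M \<rho>(3)[rule_format] \<rho>(4)[rule_format] \<rho>(5)[rule_format] that])
  define I where "I = Domain \<rho>"
  have I: "ideal I R" unfolding I_def
    by (rule graph_domain_ideal[OF \<rho>M \<rho>(2) \<rho>(3)[rule_format] \<rho>(4)[rule_format]])
  \<comment> \<open>The elements of \<open>I\<close> whose images are killed by
    \<open>x [^] k\<close> form an ascending chain of ideals with union \<open>I\<close>; where it
    is constant lies the common exponent.\<close>
  have "\<exists>n::nat. \<forall>u h. (u, h) \<in> \<rho> \<longrightarrow> x [^] n \<odot>\<^bsub>M\<^esub> h = \<zero>\<^bsub>M\<^esub>"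
  proof -
    define L where "L k = {u. \<exists>h. (u, h) \<in> \<rho> \<and> x [^] (k::nat) \<odot>\<^bsub>M\<^esub> h = \<zero>\<^bsub>M\<^esub>}" for k
    have "ideal (L k) R" for k
    proof (rule R.idealI')
      show "L k \<subseteq> carrier R" unfolding L_def using \<rho>M by blast
      show "\<zero> \<in> L k" unfolding L_def using \<rho>(2) x by auto
    next
      fix u u' assume "u \<in> L k" "u' \<in> L k"
      then obtain h h' where h: "(u, h) \<in> \<rho>" "(u', h') \<in> \<rho>" "x [^] k \<odot>\<^bsub>M\<^esub> h = \<zero>\<^bsub>M\<^esub>" "x [^] k \<odot>\<^bsub>M\<^esub> h' = \<zero>\<^bsub>M\<^esub>"
        unfolding L_def by blast
      moreover have "h \<in> carrier M" "h' \<in> carrier M" using h(1,2) \<rho>M by auto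
      ultimately have "x [^] k \<odot>\<^bsub>M\<^esub> (h \<oplus>\<^bsub>M\<^esub> h') = \<zero>\<^bsub>M\<^esub>" using x by (simp add: smult_r_distr)
      then show "u \<oplus> u' \<in> L k" unfolding L_def using h \<rho>(3) by blast
    next
      fix c u assume c: "c \<in> carrier R" and "u \<in> L k"
      then obtain h where h: "(u, h) \<in> \<rho>" "x [^] k \<odot>\<^bsub>M\<^esub> h = \<zero>\<^bsub>M\<^esub>" unfolding L_def by blast
      moreover have "h \<in> carrier M" using h \<rho>M by auto
      ultimately have "x [^] k \<odot>\<^bsub>M\<^esub> (c \<odot>\<^bsub>M\<^esub> h) = \<zero>\<^bsub>M\<^esub>"
        using x c smult_comm[of "x [^] k" c h] by simp
      then show "c \<otimes> u \<in> L k" unfolding L_def using h c \<rho>(4) by blast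
    qed
    moreover have "L k \<subseteq> L (Suc k)" for k
    proof
      fix u assume "u \<in> L k"
      then obtain h where h: "(u, h) \<in> \<rho>" "x [^] k \<odot>\<^bsub>M\<^esub> h = \<zero>\<^bsub>M\<^esub>" unfolding L_def by blast
      moreover have "h \<in> carrier M" using h \<rho>M by auto
      ultimately have "x [^] Suc k \<odot>\<^bsub>M\<^esub> h = \<zero>\<^bsub>M\<^esub>" using smult_pow_zero_mono[OF x, of h k "Suc k"] by simp
      then show "u \<in> L (Suc k)" unfolding L_def using h by blast
    qed
    ultimately obtain n where n: "\<And>k. k \<ge> n \<Longrightarrow> L k = L n"
      using noetherian_ring.ideal_chain_stabilises[OF N, of L] by blast
    have "x [^] n \<odot>\<^bsub>M\<^esub> h = \<zero>\<^bsub>M\<^esub>" if h: "(u, h) \<in> \<rho>" for u h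
    proof -
      have "h \<in> torsion x H" "h \<in> carrier M" using h \<rho>(1) \<rho>M by auto
      then obtain k :: nat where "x [^] k \<odot>\<^bsub>M\<^esub> h = \<zero>\<^bsub>M\<^esub>" unfolding torsion_def by blast
      then have "x [^] max n k \<odot>\<^bsub>M\<^esub> h = \<zero>\<^bsub>M\<^esub>" using smult_pow_zero_mono[OF x \<open>h \<in> carrier M\<close>] by simp
      then have "u \<in> L (max n k)" unfolding L_def using h by blast
      then have "u \<in> L n" using n[of "max n k"] by simp
      then show ?thesis unfolding L_def using fn[OF h] by blast
    qed
    then show ?thesis by blast
  qed
  then obtain n :: nat where n: "\<And>u h. (u, h) \<in> \<rho> \<Longrightarrow> x [^] n \<odot>\<^bsub>M\<^esub> h = \<zero>\<^bsub>M\<^esub>" by blast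
  obtain k0 :: nat where k0: "\<And>k r. r \<in> carrier R \<Longrightarrow> x [^] (k0 + k) \<otimes> r \<in> I \<Longrightarrow> x [^] k0 \<otimes> r \<in> I"
    using ideal_colon_pow_stabilises[OF N I x] by blast
  define m where "m = k0 + n"
  \<comment> \<open>The graph of the extension by zero. Writing homomorphisms as graphs postpones
    its well-definedness to the single check at zero below.\<close>
  define \<sigma> where "\<sigma> = {(u \<oplus> x [^] m \<otimes> r, h) | u h r. (u, h) \<in> \<rho> \<and> r \<in> carrier R}"
  obtain e where e: "e \<in> H" "\<And>u h. (u, h) \<in> \<sigma> \<Longrightarrow> h = u \<odot>\<^bsub>M\<^esub> e"
  proof (rule baerD[OF H, of \<sigma>])
    show "\<sigma> \<subseteq> carrier R \<times> H" unfolding \<sigma>_def using \<rho>(1) x by (auto simp: torsion_def)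
    have "\<zero> \<oplus> x [^] m \<otimes> \<zero> = \<zero>" using x by simp
    then show "(\<zero>, \<zero>\<^bsub>M\<^esub>) \<in> \<sigma>" unfolding \<sigma>_def using \<rho>(2) by force
  next
    fix v h v' h' assume "(v, h) \<in> \<sigma>" "(v', h') \<in> \<sigma>"
    then obtain u r u' r' where h: "v = u \<oplus> x [^] m \<otimes> r" "v' = u' \<oplus> x [^] m \<otimes> r'" "(u, h) \<in> \<rho>" "(u', h') \<in> \<rho>"
      "r \<in> carrier R" "r' \<in> carrier R" unfolding \<sigma>_def by blast
    moreover have "u \<in> carrier R" "u' \<in> carrier R" using h(3,4) \<rho>M by auto
    ultimately have "v \<oplus> v' = (u \<oplus> u') \<oplus> x [^] m \<otimes> (r \<oplus> r')"
      using x by (simp add: R.r_distr R.a_ac)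
    moreover have "(u \<oplus> u', h \<oplus>\<^bsub>M\<^esub> h') \<in> \<rho>" using h \<rho>(3) by blast
    ultimately show "(v \<oplus> v', h \<oplus>\<^bsub>M\<^esub> h') \<in> \<sigma>" unfolding \<sigma>_def using h by blast
  next
    fix c v h assume c: "c \<in> carrier R" and "(v, h) \<in> \<sigma>"
    then obtain u r where h: "v = u \<oplus> x [^] m \<otimes> r" "(u, h) \<in> \<rho>" "r \<in> carrier R" unfolding \<sigma>_def by blast
    moreover have "u \<in> carrier R" using h \<rho>M by auto
    ultimately have "c \<otimes> v = (c \<otimes> u) \<oplus> x [^] m \<otimes> (c \<otimes> r)"
      using x c by (simp add: R.r_distr R.m_lcomm)
    moreover have "(c \<otimes> u, c \<odot>\<^bsub>M\<^esub> h) \<in> \<rho>" using h c \<rho>(4) by blast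
    ultimately show "(c \<otimes> v, c \<odot>\<^bsub>M\<^esub> h) \<in> \<sigma>" unfolding \<sigma>_def using h c by blast
  next
    fix h assume "(\<zero>, h) \<in> \<sigma>"
    then obtain u r where h: "\<zero> = u \<oplus> x [^] m \<otimes> r" "(u, h) \<in> \<rho>" "r \<in> carrier R" unfolding \<sigma>_def by blast
    have uc: "u \<in> carrier R" using h \<rho>M by auto
    \<comment> \<open>A representation of zero puts \<open>u\<close> into \<open>I\<close> and into
      the multiples of \<open>x [^] m\<close>. By the choice of \<open>m\<close> it is
      \<open>x [^] n\<close> times an element of \<open>I\<close>, so its image is zero.\<close>
    have u: "u = x [^] m \<otimes> (\<ominus> r)"
      using h(1) uc x h(3) R.minus_equality[of u "x [^] m \<otimes> r"] by (simp add: R.r_minus)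
    then have "x [^] (k0 + n) \<otimes> (\<ominus> r) \<in> I" unfolding I_def using h(2) m_def by blast
    then have "x [^] k0 \<otimes> (\<ominus> r) \<in> I" using k0 h(3) by simp
    then obtain h' where h': "(x [^] k0 \<otimes> (\<ominus> r), h') \<in> \<rho>" unfolding I_def by blast
    then have "(x [^] n \<otimes> (x [^] k0 \<otimes> (\<ominus> r)), x [^] n \<odot>\<^bsub>M\<^esub> h') \<in> \<rho>" using \<rho>(4) x by simp
    moreover have "x [^] n \<otimes> (x [^] k0 \<otimes> (\<ominus> r)) = u"
      unfolding u m_def using x h(3) by (simp add: R.m_assoc[symmetric] R.nat_pow_mult add.commute del: R.r_minus)
    ultimately have "h = x [^] n \<odot>\<^bsub>M\<^esub> h'" using fn h(2) by simp
    then show "h = \<zero>\<^bsub>M\<^esub>" using n[OF h'] by simp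
  next
    fix e assume "e \<in> H" "\<And>u h. (u, h) \<in> \<sigma> \<Longrightarrow> h = u \<odot>\<^bsub>M\<^esub> e"
    then show thesis by (rule that)
  qed
  have sub: "\<rho> \<subseteq> \<sigma>"
  proof
    fix p assume p: "p \<in> \<rho>"
    obtain u h where uh: "p = (u, h)" by force
    then have "u = u \<oplus> x [^] m \<otimes> \<zero>" using p \<rho>M x by auto
    then show "p \<in> \<sigma>" unfolding \<sigma>_def using p uh by blast
  qed
  \<comment> \<open>The extension vanishes at \<open>x [^] m\<close>, hence \<open>x [^] m\<close>
    kills \<open>e\<close>.\<close>
  have "(\<zero> \<oplus> x [^] m \<otimes> \<one>, \<zero>\<^bsub>M\<^esub>) \<in> \<sigma>" unfolding \<sigma>_def using \<rho>(2) by blast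
  then have "x [^] m \<odot>\<^bsub>M\<^esub> e = \<zero>\<^bsub>M\<^esub>" using e(2)[of "x [^] m" "\<zero>\<^bsub>M\<^esub>"] x by simp
  then have "e \<in> torsion x H" unfolding torsion_def using e(1) by blast
  then show "\<exists>e\<in>torsion x H. \<forall>u h. (u, h) \<in> \<rho> \<longrightarrow> h = u \<odot>\<^bsub>M\<^esub> e" using e(2) sub by blast
qed

text \<open>Surjectivity onto the localization, written with numerators: \<open>e\<close> equals the
  fraction \<open>h\<close> over \<open>x [^] s\<close>. Sending
  \<open>x [^] (s + k) \<otimes> r\<close> to \<open>x [^] k \<otimes> r\<close> applied to
  \<open>h\<close> is well defined once the annihilators of the powers of \<open>x\<close> are
  constant from \<open>k\<close> on. This \<open>k\<close> depends on neither \<open>s\<close> nor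
  \<open>h\<close>, so it serves whole families.\<close>

lemma baer_divide:
  assumes N: "noetherian_ring R" and H: "baer H" and x: "x \<in> carrier R"
  shows "\<exists>k::nat. \<forall>s::nat. \<forall>h\<in>H. \<exists>e\<in>H. x [^] (s + k) \<odot>\<^bsub>M\<^esub> e = x [^] k \<odot>\<^bsub>M\<^esub> h"
proof -
  note SH = baer_submodule[OF H]
  have Z: "ideal {\<zero>} R" by (rule R.zeroideal)
  obtain k :: nat where k: "\<And>l r. r \<in> carrier R \<Longrightarrow> x [^] (k + l) \<otimes> r \<in> {\<zero>} \<Longrightarrow> x [^] k \<otimes> r \<in> {\<zero>}"
    using ideal_colon_pow_stabilises[OF N Z x] by blast
  have "\<exists>e\<in>H. x [^] (s + k) \<odot>\<^bsub>M\<^esub> e = x [^] k \<odot>\<^bsub>M\<^esub> h" if h: "h \<in> H" for s :: nat and h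
  proof -
    have hM: "h \<in> carrier M" using submodule_subset[OF SH h] .
    define \<rho> where "\<rho> = {(x [^] (s + k) \<otimes> r, (x [^] k \<otimes> r) \<odot>\<^bsub>M\<^esub> h) | r. r \<in> carrier R}"
    obtain e where e: "e \<in> H" "\<And>u h. (u, h) \<in> \<rho> \<Longrightarrow> h = u \<odot>\<^bsub>M\<^esub> e"
    proof (rule baerD[OF H, of \<rho>])
      show "\<rho> \<subseteq> carrier R \<times> H" unfolding \<rho>_def using x submoduleE(4)[OF SH _ h] by auto
      have "x [^] (s + k) \<otimes> \<zero> = \<zero>" "(x [^] k \<otimes> \<zero>) \<odot>\<^bsub>M\<^esub> h = \<zero>\<^bsub>M\<^esub>" using x hM by auto
      then show "(\<zero>, \<zero>\<^bsub>M\<^esub>) \<in> \<rho>" unfolding \<rho>_def by force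
    next
      fix u g u' g' assume "(u, g) \<in> \<rho>" "(u', g') \<in> \<rho>"
      then obtain r r' where r: "u = x [^] (s + k) \<otimes> r" "u' = x [^] (s + k) \<otimes> r'" "g = (x [^] k \<otimes> r) \<odot>\<^bsub>M\<^esub> h"
        "g' = (x [^] k \<otimes> r') \<odot>\<^bsub>M\<^esub> h" "r \<in> carrier R" "r' \<in> carrier R" unfolding \<rho>_def by blast
      then have "u \<oplus> u' = x [^] (s + k) \<otimes> (r \<oplus> r')" "g \<oplus>\<^bsub>M\<^esub> g' = (x [^] k \<otimes> (r \<oplus> r')) \<odot>\<^bsub>M\<^esub> h"
        using x hM by (auto simp: R.r_distr smult_l_distr)
      then show "(u \<oplus> u', g \<oplus>\<^bsub>M\<^esub> g') \<in> \<rho>" unfolding \<rho>_def using r by auto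
    next
      fix c u g assume c: "c \<in> carrier R" and "(u, g) \<in> \<rho>"
      then obtain r where r: "u = x [^] (s + k) \<otimes> r" "g = (x [^] k \<otimes> r) \<odot>\<^bsub>M\<^esub> h" "r \<in> carrier R"
        unfolding \<rho>_def by blast
      then have "c \<otimes> u = x [^] (s + k) \<otimes> (c \<otimes> r)" "c \<odot>\<^bsub>M\<^esub> g = (x [^] k \<otimes> (c \<otimes> r)) \<odot>\<^bsub>M\<^esub> h"
        using x hM c by (auto simp: R.m_lcomm smult_assoc1[symmetric])
      then show "(c \<otimes> u, c \<odot>\<^bsub>M\<^esub> g) \<in> \<rho>" unfolding \<rho>_def using r c by auto
    next
      fix g assume "(\<zero>, g) \<in> \<rho>"
      then obtain r where r: "\<zero> = x [^] (s + k) \<otimes> r" "g = (x [^] k \<otimes> r) \<odot>\<^bsub>M\<^esub> h" "r \<in> carrier R"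
        unfolding \<rho>_def by blast
      then have "x [^] k \<otimes> r = \<zero>" using k[of r s] by (simp add: add.commute)
      then show "g = \<zero>\<^bsub>M\<^esub>" unfolding r(2) using hM by simp
    next
      fix e assume "e \<in> H" "\<And>u g. (u, g) \<in> \<rho> \<Longrightarrow> g = u \<odot>\<^bsub>M\<^esub> e"
      then show thesis by (rule that)
    qed
    have "(x [^] (s + k) \<otimes> \<one>, (x [^] k \<otimes> \<one>) \<odot>\<^bsub>M\<^esub> h) \<in> \<rho>" unfolding \<rho>_def by blast
    then show ?thesis using e x by (intro bexI[of _ e]) auto
  qed
  then show ?thesis by blast
qed

end

context koszul
begin

text \<open>Induction on the variables. Divisibility by the last variable \<open>x\<close> allows a
  coboundary to clear all components at sets containing \<open>r\<close>. The cocycle condition then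
  makes the remaining components \<open>x\<close>-torsion, and the torsion part again satisfies
  Baer's criterion, so the induction hypothesis yields a primitive there. The condition on
  \<open>v {}\<close> excludes classes of degree 0, which need not vanish.\<close>

lemma baer_vanishing:
  assumes N: "noetherian_ring R"
  shows "baer H \<Longrightarrow> (\<And>J. J \<subseteq> {..<r} \<Longrightarrow> v J \<in> H) \<Longrightarrow> v {} = \<zero>\<^bsub>M\<^esub> \<Longrightarrow>
    (\<And>J. J \<subseteq> {..<r} \<Longrightarrow> d s v J = \<zero>\<^bsub>M\<^esub>) \<Longrightarrow>
    \<exists>k w. (\<forall>J\<subseteq>{..<r}. w J \<in> H) \<and> (\<forall>J\<subseteq>{..<r}. lift k v J = d (s + k) w J)"
proof (induction r arbitrary: H s v)
  case 0
  then show ?case using submodule_zero[OF baer_submodule[OF 0(1)]]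
    by (intro exI[of _ 0] exI[of _ "\<lambda>_. \<zero>\<^bsub>M\<^esub>"]) (simp add: koszul_lift_def)
next
  case (Suc r)
  note H = Suc.prems(1) and v = Suc.prems(2) and v0 = Suc.prems(3) and dv = Suc.prems(4)
  note SH = baer_submodule[OF H]
  have HM: "h \<in> H \<Longrightarrow> h \<in> carrier M" for h using submodule_subset[OF SH] .
  have sub: "J \<subseteq> {..<r} \<Longrightarrow> J \<subseteq> {..<Suc r}" for J :: "nat set" by auto
  have ins: "J \<subseteq> {..<r} \<Longrightarrow> insert r J \<subseteq> {..<Suc r}" for J by auto
  have nr: "J \<subseteq> {..<r} \<Longrightarrow> r \<notin> J" for J by auto
  have fin: "J \<subseteq> {..<Suc r} \<Longrightarrow> finite J" for J using finite_subset by blast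
  have vc: "J \<subseteq> {..<Suc r} \<Longrightarrow> v J \<in> carrier M" for J using HM[OF v] .
  define x where "x = a r"
  have x: "x \<in> carrier R" unfolding x_def by simp
  obtain k :: nat where k: "\<And>s h. h \<in> H \<Longrightarrow> \<exists>e\<in>H. x [^] (s + k) \<odot>\<^bsub>M\<^esub> e = x [^] k \<odot>\<^bsub>M\<^esub> h"
    using baer_divide[OF N H x] by blast
  have "\<forall>J\<in>Pow {..<r}. \<exists>e. e \<in> H \<and> x [^] (s + k) \<odot>\<^bsub>M\<^esub> e = x [^] k \<odot>\<^bsub>M\<^esub> v (insert r J)"
  proof
    fix J assume "J \<in> Pow {..<r}"
    then have "v (insert r J) \<in> H" using v ins by blast
    then show "\<exists>e. e \<in> H \<and> x [^] (s + k) \<odot>\<^bsub>M\<^esub> e = x [^] k \<odot>\<^bsub>M\<^esub> v (insert r J)" using k[of _ s] by blast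
  qed
  then obtain y where y: "\<forall>J\<in>Pow {..<r}. y J \<in> H \<and> x [^] (s + k) \<odot>\<^bsub>M\<^esub> y J = x [^] k \<odot>\<^bsub>M\<^esub> v (insert r J)"
    by (rule bchoice[THEN exE])
  have yH: "y J \<in> H" and yx: "x [^] (s + k) \<odot>\<^bsub>M\<^esub> y J = x [^] k \<odot>\<^bsub>M\<^esub> v (insert r J)" if "J \<subseteq> {..<r}" for J
    using y that by auto
  \<comment> \<open>The sign and the power of \<open>px J\<close> are chosen so that the
    differential of \<open>w1\<close> at \<open>insert r J\<close> is exactly the lift of
    \<open>v\<close>.\<close>
  define w1 where "w1 J = (if r \<in> J then \<zero>\<^bsub>M\<^esub> else sg (card J) \<odot>\<^bsub>M\<^esub> (px J [^] k \<odot>\<^bsub>M\<^esub> y J))" for J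
  have w1H: "w1 J \<in> H" if J: "J \<subseteq> {..<Suc r}" for J
    using J
  proof (cases rule: subset_lessThan_Suc_cases)
    case 1
    then show ?thesis unfolding w1_def using nr[OF 1] submoduleE(4)[OF SH] yH[OF 1] by simp
  qed (use submodule_zero[OF SH] in \<open>simp add: w1_def\<close>)
  have w1c: "J \<subseteq> {..<Suc r} \<Longrightarrow> w1 J \<in> carrier M" for J using HM[OF w1H] .
  have dw1c: "J \<subseteq> {..<Suc r} \<Longrightarrow> d (s + k) w1 J \<in> carrier M" for J using w1c by (intro d_closed) auto
  have dw1H: "d (s + k) w1 J \<in> H" if J: "J \<subseteq> {..<Suc r}" for J
    by (rule d_in_submodule[OF SH fin[OF J]]) (use J w1c in \<open>auto intro!: submoduleE(4)[OF SH] w1H\<close>)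
  have dw1: "d (s + k) w1 (insert r J) = lift k v (insert r J)" if J: "J \<subseteq> {..<r}" for J
  proof -
    have c: "y J \<in> carrier M" "v (insert r J) \<in> carrier M" using HM[OF yH[OF J]] vc[OF ins[OF J]] by auto
    have "d (s + k) w1 (insert r J) = d (s + k) (\<lambda>I. w1 (insert r I)) J \<oplus>\<^bsub>M\<^esub> (sg (card J) \<otimes> a r [^] (s + k)) \<odot>\<^bsub>M\<^esub> w1 J"
      using J fin[OF sub[OF J]] by (intro d_insert w1c) auto
    also have "(\<lambda>I. w1 (insert r I)) = (\<lambda>I. \<zero>\<^bsub>M\<^esub>)" unfolding w1_def by auto
    also have "d (s + k) (\<lambda>I. \<zero>\<^bsub>M\<^esub>) J = \<zero>\<^bsub>M\<^esub>" by (rule d_zero)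
    also have "\<zero>\<^bsub>M\<^esub> \<oplus>\<^bsub>M\<^esub> (sg (card J) \<otimes> a r [^] (s + k)) \<odot>\<^bsub>M\<^esub> w1 J =
        px J [^] k \<odot>\<^bsub>M\<^esub> (x [^] (s + k) \<odot>\<^bsub>M\<^esub> y J)"
      unfolding w1_def x_def using nr[OF J] c(1)
      by (simp add: smult_assoc1 smult_comm[of "a r [^] (s + k)" "sg _"] smult_comm[of "a r [^] (s + k)" "px _ [^] _"] smult_sg_sg)
    also have "\<dots> = px J [^] k \<odot>\<^bsub>M\<^esub> (x [^] k \<odot>\<^bsub>M\<^esub> v (insert r J))" using yx[OF J] by simp
    also have "\<dots> = lift k v (insert r J)"
    proof -
      have "px (insert r J) [^] k = a r [^] k \<otimes> px J [^] k"
        unfolding px_insert[OF fin[OF sub[OF J]] nr[OF J]] by (rule R.nat_pow_distrib) auto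
      then show ?thesis unfolding koszul_lift_def x_def using c by (simp add: smult_assoc1 smult_comm[of "a r [^] k"])
    qed
    finally show ?thesis .
  qed
  define v1 where "v1 J = lift k v J \<ominus>\<^bsub>M\<^esub> d (s + k) w1 J" for J
  have v1H: "v1 J \<in> H" if J: "J \<subseteq> {..<Suc r}" for J
    unfolding v1_def using submodule_minus[OF SH _ dw1H[OF J]] submoduleE(4)[OF SH _ v[OF J]]
    by (simp add: koszul_lift_def)
  have v1c: "J \<subseteq> {..<Suc r} \<Longrightarrow> v1 J \<in> carrier M" for J using HM[OF v1H] .
  have v10: "v1 {} = \<zero>\<^bsub>M\<^esub>" unfolding v1_def using v0 by simp
  have v1r: "v1 (insert r J) = \<zero>\<^bsub>M\<^esub>" if J: "J \<subseteq> {..<r}" for J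
    unfolding v1_def dw1[OF J] using vc[OF ins[OF J]] lift_closed by (simp add: a_minus_def M.r_neg)
  have dv1: "d (s + k) v1 J = \<zero>\<^bsub>M\<^esub>" if J: "J \<subseteq> {..<Suc r}" for J
  proof -
    have "d (s + k) v1 J = d (s + k) (lift k v) J \<ominus>\<^bsub>M\<^esub> d (s + k) (d (s + k) w1) J"
      unfolding v1_def using J fin[OF J] vc dw1c by (intro d_minus) auto
    also have "d (s + k) (d (s + k) w1) J = \<zero>\<^bsub>M\<^esub>" using J fin[OF J] w1c by (intro d_d) auto
    also have "d (s + k) (lift k v) J = lift k (d s v) J" using J fin[OF J] vc by (intro d_lift) auto
    also have "\<dots> = \<zero>\<^bsub>M\<^esub>" unfolding koszul_lift_def dv[OF J] by simp
    finally show ?thesis by simp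
  qed
  \<comment> \<open>At \<open>insert r J\<close> the differential of \<open>v1\<close> reduces to a
    power of \<open>x\<close> times \<open>v1 J\<close> up to sign, as the components containing
    \<open>r\<close> are gone.\<close>
  have v1T: "v1 J \<in> torsion x H" if J: "J \<subseteq> {..<r}" for J
  proof -
    have "d (s + k) v1 (insert r J) = d (s + k) (\<lambda>I. v1 (insert r I)) J \<oplus>\<^bsub>M\<^esub> (sg (card J) \<otimes> a r [^] (s + k)) \<odot>\<^bsub>M\<^esub> v1 J"
      using J fin[OF sub[OF J]] by (intro d_insert v1c) auto
    also have "d (s + k) (\<lambda>I. v1 (insert r I)) J = d (s + k) (\<lambda>I. \<zero>\<^bsub>M\<^esub>) J"
      using J by (intro d_cong v1r) auto
    also have "\<dots> = \<zero>\<^bsub>M\<^esub>" by (rule d_zero)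
    finally have "sg (card J) \<odot>\<^bsub>M\<^esub> (x [^] (s + k) \<odot>\<^bsub>M\<^esub> v1 J) = \<zero>\<^bsub>M\<^esub>"
      using dv1[OF ins[OF J]] v1c[OF sub[OF J]] by (simp add: smult_assoc1 x_def)
    then have "sg (card J) \<odot>\<^bsub>M\<^esub> (sg (card J) \<odot>\<^bsub>M\<^esub> (x [^] (s + k) \<odot>\<^bsub>M\<^esub> v1 J)) = \<zero>\<^bsub>M\<^esub>" by simp
    then have "x [^] (s + k) \<odot>\<^bsub>M\<^esub> v1 J = \<zero>\<^bsub>M\<^esub>" using v1c[OF sub[OF J]] x smult_sg_sg by simp
    then show ?thesis unfolding torsion_def using v1H[OF sub[OF J]] by blast
  qed
  have "\<exists>k' w. (\<forall>J\<subseteq>{..<r}. w J \<in> torsion x H) \<and> (\<forall>J\<subseteq>{..<r}. lift k' v1 J = d (s + k + k') w J)"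
    using v1T v10 dv1 sub by (intro Suc.IH baer_torsion[OF N H x]) auto
  then obtain k2 w2 where w2: "\<And>J. J \<subseteq> {..<r} \<Longrightarrow> w2 J \<in> torsion x H"
    and dw2: "\<And>J. J \<subseteq> {..<r} \<Longrightarrow> lift k2 v1 J = d (s + k + k2) w2 J" by blast
  have w2H: "J \<subseteq> {..<r} \<Longrightarrow> w2 J \<in> H" for J using w2 unfolding torsion_def by blast
  have w2c: "J \<subseteq> {..<r} \<Longrightarrow> w2 J \<in> carrier M" for J using HM[OF w2H] .
  have "\<forall>J\<in>Pow {..<r}. \<exists>l::nat. x [^] l \<odot>\<^bsub>M\<^esub> w2 J = \<zero>\<^bsub>M\<^esub>" using w2 unfolding torsion_def by blast
  then obtain l :: "nat set \<Rightarrow> nat" where l: "\<forall>J\<in>Pow {..<r}. x [^] l J \<odot>\<^bsub>M\<^esub> w2 J = \<zero>\<^bsub>M\<^esub>"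
    by (rule bchoice[THEN exE])
  \<comment> \<open>There are finitely many sets \<open>J\<close>, so one power of \<open>x\<close>
    kills all components of the primitive.\<close>
  define K where "K = Max (l ` Pow {..<r})"
  have K: "x [^] K' \<odot>\<^bsub>M\<^esub> w2 J = \<zero>\<^bsub>M\<^esub>" if J: "J \<subseteq> {..<r}" and K': "K \<le> K'" for J K'
  proof (rule smult_pow_zero_mono[OF x w2c[OF J]])
    show "x [^] l J \<odot>\<^bsub>M\<^esub> w2 J = \<zero>\<^bsub>M\<^esub>" using l J by blast
    have "l J \<le> K" unfolding K_def using J by (intro Max_ge) auto
    then show "l J \<le> K'" using K' by simp
  qed
  \<comment> \<open>After this lift the extension by zero is a primitive also at sets containing
    \<open>r\<close>: there its differential is a high power of \<open>x\<close> times a torsion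
    element, hence zero.\<close>
  define w3 where "w3 J = (if r \<in> J then \<zero>\<^bsub>M\<^esub> else lift K w2 J)" for J
  have w3H: "w3 J \<in> H" if J: "J \<subseteq> {..<Suc r}" for J
    using J
  proof (cases rule: subset_lessThan_Suc_cases)
    case 1
    then show ?thesis unfolding w3_def using nr[OF 1] submoduleE(4)[OF SH] w2H[OF 1] by (simp add: koszul_lift_def)
  qed (use submodule_zero[OF SH] in \<open>simp add: w3_def\<close>)
  have w3c: "J \<subseteq> {..<Suc r} \<Longrightarrow> w3 J \<in> carrier M" for J using HM[OF w3H] .
  define S where "S = s + k + k2 + K"
  have dw3: "d S w3 J = lift (k2 + K) v1 J" if J: "J \<subseteq> {..<Suc r}" for J
    using J
  proof (cases rule: subset_lessThan_Suc_cases)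
    case 1
    have c: "I \<subseteq> J \<Longrightarrow> w2 I \<in> carrier M" for I using 1 w2c by blast
    have "d S w3 J = d S (lift K w2) J" using 1 c unfolding w3_def by (intro d_cong) auto
    also have "\<dots> = lift K (d (s + k + k2) w2) J" unfolding S_def using fin[OF J] c by (intro d_lift) auto
    also have "\<dots> = lift K (lift k2 v1) J" unfolding koszul_lift_def[of _ _ _ K] using dw2[OF 1] by simp
    also have "\<dots> = lift (k2 + K) v1 J" using lift_lift[of v1 J K k2] v1c[OF J] by (simp add: add.commute)
    finally show ?thesis .
  next
    case (2 J')
    have "d S w3 J = d S (\<lambda>I. w3 (insert r I)) J' \<oplus>\<^bsub>M\<^esub> (sg (card J') \<otimes> a r [^] S) \<odot>\<^bsub>M\<^esub> w3 J'"
      unfolding 2(1) using 2 fin[OF sub[OF 2(2)]] by (intro d_insert w3c) auto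
    also have "(\<lambda>I. w3 (insert r I)) = (\<lambda>I. \<zero>\<^bsub>M\<^esub>)" unfolding w3_def by auto
    also have "d S (\<lambda>I. \<zero>\<^bsub>M\<^esub>) J' = \<zero>\<^bsub>M\<^esub>" by (rule d_zero)
    also have "(sg (card J') \<otimes> a r [^] S) \<odot>\<^bsub>M\<^esub> w3 J' = sg (card J') \<odot>\<^bsub>M\<^esub> (px J' [^] K \<odot>\<^bsub>M\<^esub> (x [^] S \<odot>\<^bsub>M\<^esub> w2 J'))"
      unfolding w3_def koszul_lift_def x_def using nr[OF 2(2)] w2c[OF 2(2)]
      by (simp add: smult_assoc1 smult_comm[of "a r [^] S" "px _ [^] _"])
    also have "x [^] S \<odot>\<^bsub>M\<^esub> w2 J' = \<zero>\<^bsub>M\<^esub>" using K[OF 2(2), of S] unfolding S_def by simp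
    finally have "d S w3 J = \<zero>\<^bsub>M\<^esub>" by simp
    then show ?thesis using v1r[OF 2(2)] 2(1) by (simp add: koszul_lift_def)
  qed
  define w where "w J = w3 J \<oplus>\<^bsub>M\<^esub> lift (k2 + K) w1 J" for J
  have "w J \<in> H" if J: "J \<subseteq> {..<Suc r}" for J
    unfolding w_def using submoduleE(5)[OF SH w3H[OF J]] submoduleE(4)[OF SH _ w1H[OF J]] by (simp add: koszul_lift_def)
  moreover have "lift (k + k2 + K) v J = d (s + (k + k2 + K)) w J" if J: "J \<subseteq> {..<Suc r}" for J
  proof -
    have "d S w J = d S w3 J \<oplus>\<^bsub>M\<^esub> d S (lift (k2 + K) w1) J"
      unfolding w_def using J w3c w1c by (intro d_add) auto
    also have "d S (lift (k2 + K) w1) J = lift (k2 + K) (d (s + k) w1) J"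
      using d_lift[of J w1 "s + k" "k2 + K"] fin[OF J] J w1c unfolding S_def by (auto simp: add_ac)
    also have "d S w3 J = lift (k2 + K) (lift k v) J \<ominus>\<^bsub>M\<^esub> lift (k2 + K) (d (s + k) w1) J"
      unfolding dw3[OF J] v1_def using vc[OF J] dw1c[OF J] by (intro lift_minus) auto
    also have "\<dots> \<oplus>\<^bsub>M\<^esub> lift (k2 + K) (d (s + k) w1) J = lift (k2 + K) (lift k v) J"
      using vc[OF J] dw1c[OF J]
      by (simp add: a_minus_def M.a_assoc M.l_neg lift_closed)
    also have "\<dots> = lift (k + k2 + K) v J"
      using lift_lift[of v J "k2 + K" k] vc[OF J] by (simp add: add_ac)
    finally show ?thesis unfolding S_def by (simp add: add_ac)
  qed
  ultimately show ?case by blast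
qed

end

section \<open>Comparison of an injective resolution with the Cech complex\<close>

context koszul
begin

text \<open>A cochain of degree \<open>p\<close> is stored as a family on all subsets that is zero
  off cardinality \<open>p\<close>, so results about all cohomological degrees at once apply to it
  directly.\<close>

definition coch :: "nat \<Rightarrow> nat \<Rightarrow> (nat set \<Rightarrow> 'c) \<Rightarrow> bool"
  where "coch t p v \<longleftrightarrow> (\<forall>J\<subseteq>{..<t}. v J \<in> carrier M \<and> (card J \<noteq> p \<longrightarrow> v J = \<zero>\<^bsub>M\<^esub>))"

lemma cochD:
  assumes "coch t p v" "J \<subseteq> {..<t}"
  shows "v J \<in> carrier M" "card J \<noteq> p \<Longrightarrow> v J = \<zero>\<^bsub>M\<^esub>"
  using assms unfolding coch_def by auto

lemma fin_sub: "J \<subseteq> {..<t::nat} \<Longrightarrow> finite J"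
  using finite_subset by blast

lemma d_eq_zeroI:
  assumes "\<And>j. j \<in> J \<Longrightarrow> a j [^] s \<odot>\<^bsub>M\<^esub> v (J - {j}) = \<zero>\<^bsub>M\<^esub>" "finite J" "\<And>I. I \<subseteq> J \<Longrightarrow> v I \<in> carrier M"
  shows "d s v J = \<zero>\<^bsub>M\<^esub>"
proof -
  have "d s v J \<in> {\<zero>\<^bsub>M\<^esub>}" using assms by (intro d_in_submodule submodule_single_zero) auto
  then show ?thesis by simp
qed

lemma coch_d: "coch t p v \<Longrightarrow> coch t (Suc p) (d s v)"
  unfolding coch_def[of t "Suc p"]
proof (intro allI impI conjI)
  fix J assume v: "coch t p v" and J: "J \<subseteq> {..<t}"
  have c: "I \<subseteq> J \<Longrightarrow> v I \<in> carrier M" for I using cochD(1)[OF v] J by blast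
  show "d s v J \<in> carrier M" using c by (rule d_closed)
  assume p: "card J \<noteq> Suc p"
  show "d s v J = \<zero>\<^bsub>M\<^esub>"
  proof (rule d_eq_zeroI[OF _ fin_sub[OF J] c])
    fix j assume j: "j \<in> J"
    then have "card (J - {j}) \<noteq> p" using p card_Suc_Diff1[OF fin_sub[OF J] j] by simp
    then have "v (J - {j}) = \<zero>\<^bsub>M\<^esub>" using J by (intro cochD(2)[OF v]) auto
    then show "a j [^] s \<odot>\<^bsub>M\<^esub> v (J - {j}) = \<zero>\<^bsub>M\<^esub>" by simp
  qed
qed

lemma coch_lift: "coch t p v \<Longrightarrow> coch t p (lift k v)"
  unfolding coch_def koszul_lift_def by simp

lemma coch_add: "coch t p v \<Longrightarrow> coch t p w \<Longrightarrow> coch t p (\<lambda>J. v J \<oplus>\<^bsub>M\<^esub> w J)"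
  unfolding coch_def by simp

lemma coch_minus: "coch t p v \<Longrightarrow> coch t p w \<Longrightarrow> coch t p (\<lambda>J. v J \<ominus>\<^bsub>M\<^esub> w J)"
  unfolding coch_def by simp

lemma coch_smult: "c \<in> carrier R \<Longrightarrow> coch t p v \<Longrightarrow> coch t p (\<lambda>J. c \<odot>\<^bsub>M\<^esub> v J)"
  unfolding coch_def by simp

definition homog :: "nat \<Rightarrow> (nat set \<Rightarrow> 'c) \<Rightarrow> nat set \<Rightarrow> 'c"
  where "homog p v J = (if card J = p then v J else \<zero>\<^bsub>M\<^esub>)"

lemma coch_homog: "(\<And>J. J \<subseteq> {..<t} \<Longrightarrow> v J \<in> carrier M) \<Longrightarrow> coch t p (homog p v)"
  unfolding coch_def homog_def by simp

lemma d_homog: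
  assumes "J \<subseteq> {..<t}" "card J = Suc p" "\<And>J. J \<subseteq> {..<t} \<Longrightarrow> v J \<in> carrier M"
  shows "d s (homog p v) J = d s v J"
proof (rule d_cong)
  fix j assume "j \<in> J"
  then show "homog p v (J - {j}) = v (J - {j})"
    unfolding homog_def using assms(2) card_Suc_Diff1[OF fin_sub[OF assms(1)], of j] by simp
qed (use assms in auto)

text \<open>The differential raises the cardinality by one, so only the component of degree
  \<open>p\<close> of a primitive contributes to a cochain of degree \<open>Suc p\<close>.\<close>

lemma coch_primitive:
  assumes "coch t (Suc p) u" "\<And>J. J \<subseteq> {..<t} \<Longrightarrow> w J \<in> carrier M"
    "\<And>J. J \<subseteq> {..<t} \<Longrightarrow> lift k u J = d s w J"
  shows "coch t p (homog p w)" "J \<subseteq> {..<t} \<Longrightarrow> lift k u J = d s (homog p w) J"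
proof -
  show c: "coch t p (homog p w)" using assms(2) by (rule coch_homog)
  show "lift k u J = d s (homog p w) J" if J: "J \<subseteq> {..<t}"
  proof (cases "card J = Suc p")
    case True
    then show ?thesis using assms(3)[OF J] d_homog[OF J True assms(2)] by simp
  next
    case False
    then show ?thesis using cochD(2)[OF coch_lift[OF assms(1)] J] cochD(2)[OF coch_d[OF c] J] by simp
  qed
qed

lemma coch_vanishing:
  assumes "noetherian_ring R" "baer (carrier M)" "coch t (Suc p) u"
    "\<And>J. J \<subseteq> {..<t} \<Longrightarrow> d s u J = \<zero>\<^bsub>M\<^esub>"
  shows "\<exists>k v. coch t p v \<and> (\<forall>J\<subseteq>{..<t}. lift k u J = d (s + k) v J)"
proof -
  have "u {} = \<zero>\<^bsub>M\<^esub>" using cochD(2)[OF assms(3)] by simp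
  then obtain k w where w: "\<And>J. J \<subseteq> {..<t} \<Longrightarrow> w J \<in> carrier M"
    "\<And>J. J \<subseteq> {..<t} \<Longrightarrow> lift k u J = d (s + k) w J"
    using baer_vanishing[OF assms(1,2), of t u s] cochD(1)[OF assms(3)] assms(4) by blast
  show ?thesis using coch_primitive[OF assms(3) w] by blast
qed

definition point :: "'c \<Rightarrow> nat set \<Rightarrow> 'c"
  where "point e J = (if J = {} then e else \<zero>\<^bsub>M\<^esub>)"

lemma coch_point: "e \<in> carrier M \<Longrightarrow> coch t 0 (point e)"
  unfolding coch_def point_def using fin_sub by (auto simp: card_eq_0_iff)

lemma d_point:
  assumes "e \<in> carrier M" "\<And>j. j < t \<Longrightarrow> a j [^] s \<odot>\<^bsub>M\<^esub> e = \<zero>\<^bsub>M\<^esub>" "J \<subseteq> {..<t}"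
  shows "d s (point e) J = \<zero>\<^bsub>M\<^esub>"
  by (rule d_eq_zeroI) (use assms fin_sub in \<open>auto simp: point_def\<close>)

lemma coch_0_eq_point: "coch t 0 v \<Longrightarrow> J \<subseteq> {..<t} \<Longrightarrow> v J = point (v {}) J"
  unfolding coch_def point_def using fin_sub by (auto simp: card_eq_0_iff)

lemma d_singleton:
  assumes "v {} \<in> carrier M" "v {j} \<in> carrier M"
  shows "d s v {j} = a j [^] s \<odot>\<^bsub>M\<^esub> v {}"
proof -
  have "d s v (insert j {}) = d s (\<lambda>I. v (insert j I)) {} \<oplus>\<^bsub>M\<^esub> (sg (card ({}::nat set)) \<otimes> a j [^] s) \<odot>\<^bsub>M\<^esub> v {}"
    using assms by (intro d_insert) (auto simp: subset_singleton_iff)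
  then show ?thesis using assms by simp
qed

end

section \<open>Zigzags between a resolution and Koszul cochains\<close>

locale resolution = koszul R M a for R (structure) and M (structure) and a +
  fixes E :: "nat \<Rightarrow> ('a, 'e) module" and \<delta> :: "nat \<Rightarrow> 'e \<Rightarrow> 'e" and \<epsilon> and t :: nat
  assumes noeth: "noetherian_ring R" and res: "injective_resolution R M E \<delta> \<epsilon>"
begin

lemma module_E: "Module.module R (E q)"
  using res unfolding injective_resolution_def injective_module_def by blast

sublocale E: koszul R "E q" a for q
  by (intro koszul.intro module_E koszul_axioms.intro a_closed)

lemma baer_E: "E.baer q (carrier (E q))"
  using res unfolding injective_resolution_def by (intro E.injective_imp_baer) blast

lemma delta: "\<delta> q \<in> module_hom R (E q) (E (Suc q))"
  using res unfolding injective_resolution_def by blast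

lemma eps: "\<epsilon> \<in> module_hom R M (E 0)"
  using res unfolding injective_resolution_def by blast

lemmas delta_closed = module_homD(1)[OF delta]
  and delta_add = module_homD(2)[OF delta]
  and delta_smult = module_homD(3)[OF delta]
  and delta_zero = module_hom_zero[OF module_E module_E delta]
  and eps_closed = module_homD(1)[OF eps]
  and eps_add = module_homD(2)[OF eps]
  and eps_smult = module_homD(3)[OF eps]
  and eps_zero = module_hom_zero[OF module_axioms module_E eps]

lemma delta_minus:
  assumes "x \<in> carrier (E q)" "y \<in> carrier (E q)"
  shows "\<delta> q (x \<ominus>\<^bsub>E q\<^esub> y) = \<delta> q x \<ominus>\<^bsub>E (Suc q)\<^esub> \<delta> q y"
proof -
  have "\<delta> q (\<ominus>\<^bsub>E q\<^esub> y) = \<delta> q ((\<ominus> \<one>) \<odot>\<^bsub>E q\<^esub> y)" using assms by (simp add: E.smult_l_minus)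
  also have "\<dots> = (\<ominus> \<one>) \<odot>\<^bsub>E (Suc q)\<^esub> \<delta> q y" using assms by (intro delta_smult) auto
  also have "\<dots> = \<ominus>\<^bsub>E (Suc q)\<^esub> \<delta> q y" using assms delta_closed by (simp add: E.smult_l_minus)
  finally show ?thesis unfolding a_minus_def using assms by (simp add: delta_add)
qed

lemma eps_inj: "x \<in> carrier M \<Longrightarrow> y \<in> carrier M \<Longrightarrow> \<epsilon> x = \<epsilon> y \<Longrightarrow> x = y"
  using res unfolding injective_resolution_def inj_on_def by blast

lemma exact:
  assumes "x \<in> carrier (E (Suc q))" "\<delta> (Suc q) x = \<zero>\<^bsub>E (Suc (Suc q))\<^esub>"
  obtains y where "y \<in> carrier (E q)" "\<delta> q y = x"
proof -
  have "\<delta> q ` carrier (E q) = a_kernel (E (Suc q)) (E (Suc (Suc q))) (\<delta> (Suc q))"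
    using res unfolding injective_resolution_def by blast
  moreover have "x \<in> a_kernel (E (Suc q)) (E (Suc (Suc q))) (\<delta> (Suc q))"
    using assms by (simp add: a_kernel_def')
  ultimately have "x \<in> \<delta> q ` carrier (E q)" by simp
  then show thesis using that by blast
qed

lemma delta_delta: "y \<in> carrier (E q) \<Longrightarrow> \<delta> (Suc q) (\<delta> q y) = \<zero>\<^bsub>E (Suc (Suc q))\<^esub>"
proof -
  assume y: "y \<in> carrier (E q)"
  have "\<delta> q ` carrier (E q) = a_kernel (E (Suc q)) (E (Suc (Suc q))) (\<delta> (Suc q))"
    using res unfolding injective_resolution_def by blast
  then have "\<delta> q y \<in> a_kernel (E (Suc q)) (E (Suc (Suc q))) (\<delta> (Suc q))" using y by blast
  then show ?thesis by (simp add: a_kernel_def')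
qed

lemma exact0:
  assumes "x \<in> carrier (E 0)" "\<delta> 0 x = \<zero>\<^bsub>E 1\<^esub>"
  obtains m where "m \<in> carrier M" "\<epsilon> m = x"
proof -
  have "\<epsilon> ` carrier M = a_kernel (E 0) (E 1) (\<delta> 0)"
    using res unfolding injective_resolution_def by blast
  moreover have "x \<in> a_kernel (E 0) (E 1) (\<delta> 0)"
    using assms by (simp add: a_kernel_def')
  ultimately have "x \<in> \<epsilon> ` carrier M" by simp
  then show thesis using that by blast
qed

lemma delta_eps: "m \<in> carrier M \<Longrightarrow> \<delta> 0 (\<epsilon> m) = \<zero>\<^bsub>E 1\<^esub>"
proof -
  assume m: "m \<in> carrier M"
  have "\<epsilon> ` carrier M = a_kernel (E 0) (E 1) (\<delta> 0)"
    using res unfolding injective_resolution_def by blast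
  then have "\<epsilon> m \<in> a_kernel (E 0) (E 1) (\<delta> 0)" using m by blast
  then show ?thesis by (simp add: a_kernel_def')
qed

lemma delta_d:
  assumes "E.coch q t p v" "J \<subseteq> {..<t}"
  shows "\<delta> q (E.d q s v J) = E.d (Suc q) s (\<lambda>I. \<delta> q (v I)) J"
  using assms E.cochD(1)[OF assms(1)] fin_sub
  by (intro module_hom_koszul_diff[OF module_E module_E delta]) auto

lemma delta_lift:
  "v J \<in> carrier (E q) \<Longrightarrow> \<delta> q (E.lift q k v J) = E.lift (Suc q) k (\<lambda>I. \<delta> q (v I)) J"
  by (rule module_hom_koszul_lift[OF module_E delta]) auto

lemma eps_d:
  assumes "coch t p v" "J \<subseteq> {..<t}"
  shows "\<epsilon> (d s v J) = E.d 0 s (\<lambda>I. \<epsilon> (v I)) J"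
  using assms cochD(1)[OF assms(1)] fin_sub
  by (intro module_hom_koszul_diff[OF module_axioms module_E eps]) auto

lemma eps_lift:
  "v J \<in> carrier M \<Longrightarrow> \<epsilon> (lift k v J) = E.lift 0 k (\<lambda>I. \<epsilon> (v I)) J"
  by (rule module_hom_koszul_lift[OF module_axioms eps]) auto

lemma coch_delta: "E.coch q t p v \<Longrightarrow> E.coch (Suc q) t p (\<lambda>J. \<delta> q (v J))"
  unfolding E.coch_def using delta_closed delta_zero by simp

lemma coch_eps: "coch t p v \<Longrightarrow> E.coch 0 t p (\<lambda>J. \<epsilon> (v J))"
  unfolding E.coch_def coch_def using eps_closed eps_zero by simp

lemma coch_exact:
  assumes "E.coch (Suc q) t p u" "\<And>J. J \<subseteq> {..<t} \<Longrightarrow> \<delta> (Suc q) (u J) = \<zero>\<^bsub>E (Suc (Suc q))\<^esub>"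
  obtains v where "E.coch q t p v" "\<And>J. J \<subseteq> {..<t} \<Longrightarrow> \<delta> q (v J) = u J"
proof -
  have "\<forall>J\<in>Pow {..<t}. \<exists>y. y \<in> carrier (E q) \<and> \<delta> q y = u J"
  proof
    fix J assume "J \<in> Pow {..<t}"
    then have J: "J \<subseteq> {..<t}" by simp
    show "\<exists>y. y \<in> carrier (E q) \<and> \<delta> q y = u J"
      by (rule exact[OF E.cochD(1)[OF assms(1) J] assms(2)[OF J]]) blast
  qed
  then obtain y where y: "\<forall>J\<in>Pow {..<t}. y J \<in> carrier (E q) \<and> \<delta> q (y J) = u J"
    by (rule bchoice[THEN exE])
  show thesis
  proof (rule that[of "E.homog q p y"])
    show "E.coch q t p (E.homog q p y)" using y by (intro E.coch_homog) auto
    show "\<delta> q (E.homog q p y J) = u J" if "J \<subseteq> {..<t}" for J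
      unfolding E.homog_def using y that E.cochD(2)[OF assms(1) that] delta_zero by auto
  qed
qed

lemma coch_exact0:
  assumes "E.coch 0 t p u" "\<And>J. J \<subseteq> {..<t} \<Longrightarrow> \<delta> 0 (u J) = \<zero>\<^bsub>E 1\<^esub>"
  obtains v where "coch t p v" "\<And>J. J \<subseteq> {..<t} \<Longrightarrow> \<epsilon> (v J) = u J"
proof -
  have "\<forall>J\<in>Pow {..<t}. \<exists>y. y \<in> carrier M \<and> \<epsilon> y = u J"
  proof
    fix J assume "J \<in> Pow {..<t}"
    then have J: "J \<subseteq> {..<t}" by simp
    show "\<exists>y. y \<in> carrier M \<and> \<epsilon> y = u J"
      by (rule exact0[OF E.cochD(1)[OF assms(1) J] assms(2)[OF J]]) blast
  qed
  then obtain y where y: "\<forall>J\<in>Pow {..<t}. y J \<in> carrier M \<and> \<epsilon> (y J) = u J"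
    by (rule bchoice[THEN exE])
  show thesis
  proof (rule that[of "homog p y"])
    show "coch t p (homog p y)" using y by (intro coch_homog) auto
    show "\<epsilon> (homog p y J) = u J" if "J \<subseteq> {..<t}" for J
      unfolding homog_def using y that E.cochD(2)[OF assms(1) that] eps_zero by auto
  qed
qed

text \<open>Zigzags in the double complex of the \<open>E q\<close> at the common denominator exponent \<open>s\<close>: \<open>p\<close> steps
  lead from \<open>e\<close> in \<open>E (q + p)\<close> to the cochain \<open>u\<close> of degree \<open>p\<close> with values in \<open>E q\<close>.\<close>

fun zigzag :: "nat \<Rightarrow> nat \<Rightarrow> nat \<Rightarrow> 'e \<Rightarrow> (nat set \<Rightarrow> 'e) \<Rightarrow> bool"
  where
    "zigzag s 0 q e u \<longleftrightarrow> E.coch q t 0 u \<and> u {} = e"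
  | "zigzag s (Suc p) q e u \<longleftrightarrow> (\<exists>u0 v. zigzag s p (Suc q) e u0 \<and> E.coch q t p v \<and>
      (\<forall>J\<subseteq>{..<t}. \<delta> q (v J) = u0 J \<and> u J = E.d q s v J))"

text \<open>Torsion elements with a visible exponent: \<open>e\<close>, viewed as a cochain of
  degree 0, is a Koszul cocycle at exponent \<open>s\<close>.\<close>

definition tors :: "nat \<Rightarrow> nat \<Rightarrow> 'e \<Rightarrow> bool"
  where "tors q s e \<longleftrightarrow> e \<in> carrier (E q) \<and> (\<forall>j<t. a j [^] s \<odot>\<^bsub>E q\<^esub> e = \<zero>\<^bsub>E q\<^esub>)"

lemma tors_mono:
  assumes "tors q s e" "s \<le> s'"
  shows "tors q s' e"
  unfolding tors_def
proof (intro conjI allI impI)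
  show "e \<in> carrier (E q)" using assms unfolding tors_def by blast
  show "a j [^] s' \<odot>\<^bsub>E q\<^esub> e = \<zero>\<^bsub>E q\<^esub>" if "j < t" for j
    using assms(1) that unfolding tors_def by (intro E.smult_pow_zero_mono[OF a_closed _ _ assms(2)]) auto
qed

lemma zigzag_cong: "zigzag s p q e u \<Longrightarrow> (\<And>J. J \<subseteq> {..<t} \<Longrightarrow> u J = u' J) \<Longrightarrow> zigzag s p q e u'"
  by (cases p) (auto simp: E.coch_def)

lemma zigzag_coch: "zigzag s p q e u \<Longrightarrow> E.coch q t p u"
proof (cases p)
  case (Suc p')
  assume "zigzag s p q e u"
  then obtain v where v: "E.coch q t p' v" "\<And>J. J \<subseteq> {..<t} \<Longrightarrow> u J = E.d q s v J"
    unfolding Suc by auto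
  show ?thesis using E.coch_d[OF v(1), of s] v(2) unfolding Suc E.coch_def by auto
qed simp

text \<open>The two differentials commute and have square zero, so the conditions on
  \<open>e\<close> pass along the steps, and every stage is a cocycle for both.\<close>

lemma zigzag_closed:
  assumes "zigzag s p q e u" "tors (q + p) s e" "\<delta> (q + p) e = \<zero>\<^bsub>E (Suc (q + p))\<^esub>" "J \<subseteq> {..<t}"
  shows "\<delta> q (u J) = \<zero>\<^bsub>E (Suc q)\<^esub> \<and> E.d q s u J = \<zero>\<^bsub>E q\<^esub>"
  using assms
proof (induction p arbitrary: q u J)
  case 0
  have u: "E.coch q t 0 u" "u {} = e" using 0(1) by auto
  have eq: "I \<subseteq> {..<t} \<Longrightarrow> u I = E.point q e I" for I using E.coch_0_eq_point[OF u(1)] u(2) by simp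
  have "E.d q s u J = E.d q s (E.point q e) J"
    using 0(4) E.cochD(1)[OF E.coch_point[of e q t]] 0(2)
    unfolding tors_def by (intro E.d_cong eq) auto
  also have "\<dots> = \<zero>\<^bsub>E q\<^esub>" using 0(2,4) unfolding tors_def by (intro E.d_point) auto
  finally have "E.d q s u J = \<zero>\<^bsub>E q\<^esub>" .
  moreover have "u J = E.point q e J" using E.coch_0_eq_point[OF u(1) 0(4)] u(2) by simp
  ultimately show ?case using 0(3) delta_zero by (simp add: E.point_def)
next
  case (Suc p)
  then obtain u0 v where h: "zigzag s p (Suc q) e u0" "E.coch q t p v"
    "\<And>J. J \<subseteq> {..<t} \<Longrightarrow> \<delta> q (v J) = u0 J" "\<And>J. J \<subseteq> {..<t} \<Longrightarrow> u J = E.d q s v J" by auto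
  note J = Suc.prems(4)
  have c0: "E.coch (Suc q) t p u0" using zigzag_coch[OF h(1)] .
  have "\<delta> q (u J) = E.d (Suc q) s (\<lambda>I. \<delta> q (v I)) J" using h(4)[OF J] delta_d[OF h(2) J] by simp
  also have "\<dots> = E.d (Suc q) s u0 J"
    using J E.cochD(1)[OF c0] by (intro E.d_cong h(3)) auto
  also have "\<dots> = \<zero>\<^bsub>E (Suc q)\<^esub>" using Suc.IH[OF h(1)] Suc.prems by simp
  finally have 1: "\<delta> q (u J) = \<zero>\<^bsub>E (Suc q)\<^esub>" .
  have "E.d q s u J = E.d q s (E.d q s v) J"
    using J E.cochD(1)[OF E.coch_d[OF h(2)]] by (intro E.d_cong h(4)) auto
  also have "\<dots> = \<zero>\<^bsub>E q\<^esub>" using J E.cochD(1)[OF h(2)] fin_sub by (intro E.d_d) auto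
  finally show ?case using 1 by simp
qed

lemma zigzag_add:
  "zigzag s p q e u \<Longrightarrow> zigzag s p q e' u' \<Longrightarrow> zigzag s p q (e \<oplus>\<^bsub>E (q + p)\<^esub> e') (\<lambda>J. u J \<oplus>\<^bsub>E q\<^esub> u' J)"
proof (induction p arbitrary: q u u')
  case 0
  then show ?case by (auto intro: E.coch_add)
next
  case (Suc p)
  then obtain u0 v where h: "zigzag s p (Suc q) e u0" "E.coch q t p v"
    "\<And>J. J \<subseteq> {..<t} \<Longrightarrow> \<delta> q (v J) = u0 J" "\<And>J. J \<subseteq> {..<t} \<Longrightarrow> u J = E.d q s v J" by auto
  from Suc obtain u0' v' where h': "zigzag s p (Suc q) e' u0'" "E.coch q t p v'"
    "\<And>J. J \<subseteq> {..<t} \<Longrightarrow> \<delta> q (v' J) = u0' J" "\<And>J. J \<subseteq> {..<t} \<Longrightarrow> u' J = E.d q s v' J" by auto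
  have "zigzag s p (Suc q) (e \<oplus>\<^bsub>E (q + Suc p)\<^esub> e') (\<lambda>J. u0 J \<oplus>\<^bsub>E (Suc q)\<^esub> u0' J)"
    using Suc.IH[OF h(1) h'(1)] by simp
  moreover have "E.coch q t p (\<lambda>J. v J \<oplus>\<^bsub>E q\<^esub> v' J)" using h(2) h'(2) by (rule E.coch_add)
  moreover have "\<delta> q (v J \<oplus>\<^bsub>E q\<^esub> v' J) = u0 J \<oplus>\<^bsub>E (Suc q)\<^esub> u0' J \<and>
      u J \<oplus>\<^bsub>E q\<^esub> u' J = E.d q s (\<lambda>J. v J \<oplus>\<^bsub>E q\<^esub> v' J) J" if J: "J \<subseteq> {..<t}" for J
    using delta_add E.cochD(1)[OF h(2)] E.cochD(1)[OF h'(2)] h(3,4) h'(3,4) J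
      E.d_add[of J v q v' s] by auto
  ultimately show ?case unfolding zigzag.simps by blast
qed

lemma zigzag_smult:
  assumes c: "c \<in> carrier R"
  shows "zigzag s p q e u \<Longrightarrow> zigzag s p q (c \<odot>\<^bsub>E (q + p)\<^esub> e) (\<lambda>J. c \<odot>\<^bsub>E q\<^esub> u J)"
proof (induction p arbitrary: q u)
  case 0
  then show ?case using c by (auto intro: E.coch_smult)
next
  case (Suc p)
  then obtain u0 v where h: "zigzag s p (Suc q) e u0" "E.coch q t p v"
    "\<And>J. J \<subseteq> {..<t} \<Longrightarrow> \<delta> q (v J) = u0 J" "\<And>J. J \<subseteq> {..<t} \<Longrightarrow> u J = E.d q s v J" by auto
  have "zigzag s p (Suc q) (c \<odot>\<^bsub>E (q + Suc p)\<^esub> e) (\<lambda>J. c \<odot>\<^bsub>E (Suc q)\<^esub> u0 J)"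
    using Suc.IH[OF h(1)] by simp
  moreover have "E.coch q t p (\<lambda>J. c \<odot>\<^bsub>E q\<^esub> v J)" using c h(2) by (rule E.coch_smult)
  moreover have "\<delta> q (c \<odot>\<^bsub>E q\<^esub> v J) = c \<odot>\<^bsub>E (Suc q)\<^esub> u0 J \<and>
      c \<odot>\<^bsub>E q\<^esub> u J = E.d q s (\<lambda>J. c \<odot>\<^bsub>E q\<^esub> v J) J" if J: "J \<subseteq> {..<t}" for J
  proof -
    have "E.d q s (\<lambda>J. c \<odot>\<^bsub>E q\<^esub> v J) J = c \<odot>\<^bsub>E q\<^esub> E.d q s v J"
      using J c fin_sub[OF J] E.cochD(1)[OF h(2)] by (intro E.d_smult) auto
    then show ?thesis using delta_smult c E.cochD(1)[OF h(2)] h(3,4) J by auto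
  qed
  ultimately show ?case unfolding zigzag.simps by blast
qed

lemma zigzag_lift: "zigzag s p q e u \<Longrightarrow> zigzag (s + k) p q e (E.lift q k u)"
proof (induction p arbitrary: q u)
  case 0
  then show ?case using E.coch_lift[of q t 0 u k] E.cochD(1)[of q t 0 u "{}"] by simp
next
  case (Suc p)
  then obtain u0 v where h: "zigzag s p (Suc q) e u0" "E.coch q t p v"
    "\<And>J. J \<subseteq> {..<t} \<Longrightarrow> \<delta> q (v J) = u0 J" "\<And>J. J \<subseteq> {..<t} \<Longrightarrow> u J = E.d q s v J" by auto
  have "\<delta> q (E.lift q k v J) = E.lift (Suc q) k u0 J \<and>
      E.lift q k u J = E.d q (s + k) (E.lift q k v) J" if J: "J \<subseteq> {..<t}" for J
  proof
    show "\<delta> q (E.lift q k v J) = E.lift (Suc q) k u0 J"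
      using delta_lift[of v J q k] E.cochD(1)[OF h(2) J] h(3)[OF J] by (simp add: koszul_lift_def)
    have "E.d q (s + k) (E.lift q k v) J = E.lift q k (E.d q s v) J"
      using J fin_sub[OF J] E.cochD(1)[OF h(2)] by (intro E.d_lift) auto
    then show "E.lift q k u J = E.d q (s + k) (E.lift q k v) J"
      using h(4)[OF J] by (simp add: koszul_lift_def)
  qed
  then show ?case unfolding zigzag.simps using Suc.IH[OF h(1)] E.coch_lift[OF h(2)] by blast
qed

text \<open>Each step needs a preimage under the resolution differential, which exists on the nose,
  so the exponent \<open>s\<close> is kept.\<close>

lemma zigzag_exists_right:
  "tors (q + p) s e \<Longrightarrow> \<delta> (q + p) e = \<zero>\<^bsub>E (Suc (q + p))\<^esub> \<Longrightarrow> \<exists>u. zigzag s p q e u"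
proof (induction p arbitrary: q)
  case 0
  have "E.point q e {} = e" by (simp add: E.point_def)
  then show ?case using E.coch_point[of e q t] 0
    by (intro exI[of _ "E.point q e"]) (simp add: tors_def)
next
  case (Suc p)
  from Suc.prems have "\<exists>u. zigzag s p (Suc q) e u" by (intro Suc.IH) simp_all
  then obtain u0 where u0: "zigzag s p (Suc q) e u0" by blast
  have "\<delta> (Suc q) (u0 J) = \<zero>\<^bsub>E (Suc (Suc q))\<^esub>" if "J \<subseteq> {..<t}" for J
    using zigzag_closed[OF u0] Suc.prems that by simp
  then obtain v where v: "E.coch q t p v" "\<And>J. J \<subseteq> {..<t} \<Longrightarrow> \<delta> q (v J) = u0 J"
    using coch_exact[OF zigzag_coch[OF u0]] by blast
  show ?case unfolding zigzag.simps
    by (intro exI[of _ "E.d q s v"] exI[of _ u0] exI[of _ v]) (use u0 v in auto)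
qed

text \<open>In this direction each step needs a primitive for the Koszul differential. It exists
  only after lifting, by the vanishing for injective modules, so the exponent grows.\<close>

lemma zigzag_exists_left:
  assumes "E.coch q t p u" "\<And>J. J \<subseteq> {..<t} \<Longrightarrow> \<delta> q (u J) = \<zero>\<^bsub>E (Suc q)\<^esub>"
    "\<And>J. J \<subseteq> {..<t} \<Longrightarrow> E.d q s u J = \<zero>\<^bsub>E q\<^esub>"
  shows "\<exists>k e. tors (q + p) (s + k) e \<and> \<delta> (q + p) e = \<zero>\<^bsub>E (Suc (q + p))\<^esub> \<and>
    zigzag (s + k) p q e (E.lift q k u)"
  using assms
proof (induction p arbitrary: q u s)
  case 0
  have c: "u {} \<in> carrier (E q)" using E.cochD(1)[OF 0(1)] by simp
  have "a j [^] s \<odot>\<^bsub>E q\<^esub> u {} = \<zero>\<^bsub>E q\<^esub>" if j: "j < t" for j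
    using E.d_singleton[of u q j s] c E.cochD(1)[OF 0(1), of "{j}"] 0(3)[of "{j}"] j by auto
  then have "tors q s (u {})" unfolding tors_def using c by blast
  moreover have "zigzag s 0 q (u {}) (E.lift q 0 u)" using E.coch_lift[OF 0(1), of 0] c by simp
  ultimately show ?case using 0(2)[of "{}"] by (intro exI[of _ 0] exI[of _ "u {}"]) simp
next
  case (Suc p)
  obtain k v where v: "E.coch q t p v" "\<And>J. J \<subseteq> {..<t} \<Longrightarrow> E.lift q k u J = E.d q (s + k) v J"
    using E.coch_vanishing[OF noeth baer_E Suc.prems(1,3)] by blast
  define u0 where "u0 J = \<delta> q (v J)" for J
  have u0: "E.coch (Suc q) t p u0" unfolding u0_def using coch_delta[OF v(1)] .
  have "\<delta> (Suc q) (u0 J) = \<zero>\<^bsub>E (Suc (Suc q))\<^esub>" if "J \<subseteq> {..<t}" for J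
    unfolding u0_def using delta_delta E.cochD(1)[OF v(1) that] .
  moreover have "E.d (Suc q) (s + k) u0 J = \<zero>\<^bsub>E (Suc q)\<^esub>" if J: "J \<subseteq> {..<t}" for J
  proof -
    have "E.d (Suc q) (s + k) u0 J = \<delta> q (E.d q (s + k) v J)"
      unfolding u0_def using delta_d[OF v(1) J] by simp
    also have "\<dots> = \<delta> q (E.lift q k u J)" using v(2)[OF J] by simp
    also have "\<dots> = E.lift (Suc q) k (\<lambda>I. \<delta> q (u I)) J"
      using delta_lift E.cochD(1)[OF Suc.prems(1) J] by simp
    also have "\<dots> = \<zero>\<^bsub>E (Suc q)\<^esub>" using Suc.prems(2)[OF J] by (simp add: koszul_lift_def)
    finally show ?thesis .
  qed
  ultimately obtain k' e where e: "tors (Suc q + p) (s + k + k') e" "\<delta> (Suc q + p) e = \<zero>\<^bsub>E (Suc (Suc q + p))\<^esub>"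
    "zigzag (s + k + k') p (Suc q) e (E.lift (Suc q) k' u0)"
    using Suc.IH[OF u0] by blast
  have "\<delta> q (E.lift q k' v J) = E.lift (Suc q) k' u0 J \<and>
      E.lift q (k + k') u J = E.d q (s + k + k') (E.lift q k' v) J" if J: "J \<subseteq> {..<t}" for J
  proof
    show "\<delta> q (E.lift q k' v J) = E.lift (Suc q) k' u0 J"
      using delta_lift E.cochD(1)[OF v(1) J] unfolding u0_def by simp
    have "E.d q (s + k + k') (E.lift q k' v) J = E.lift q k' (E.d q (s + k) v) J"
      using J fin_sub[OF J] E.cochD(1)[OF v(1)] by (intro E.d_lift) auto
    also have "\<dots> = E.lift q k' (E.lift q k u) J" using v(2)[OF J] by (simp add: koszul_lift_def)
    also have "\<dots> = E.lift q (k + k') u J"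
      using E.lift_lift[of u J q k' k] E.cochD(1)[OF Suc.prems(1) J] by (simp add: add.commute)
    finally show "E.lift q (k + k') u J = E.d q (s + k + k') (E.lift q k' v) J" by simp
  qed
  then have "zigzag (s + k + k') (Suc p) q e (E.lift q (k + k') u)"
    unfolding zigzag.simps using e(3) E.coch_lift[OF v(1)] by blast
  then show ?case using e(1,2) by (intro exI[of _ "k + k'"] exI[of _ e]) (simp add: add.assoc)
qed

text \<open>A boundary on the side of the resolution is pushed through the zigzag: at every stage
  the correction found one step earlier is pulled back along \<open>\<delta>\<close> and subtracted.
  The resulting primitive is \<open>\<delta>\<close>-closed, so for \<open>q = 0\<close> it will
  come from \<open>M\<close>.\<close>

lemma zigzag_boundary_right:
  assumes "zigzag s (Suc p) q (\<delta> (q + p) e) u" "tors (q + p) l e"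
  shows "\<exists>k w. E.coch q t p w \<and> (\<forall>J\<subseteq>{..<t}. \<delta> q (w J) = \<zero>\<^bsub>E (Suc q)\<^esub> \<and>
    E.lift q k u J = E.d q (s + k) w J)"
  using assms
proof (induction p arbitrary: q u)
  case 0
  then obtain u0 v where h: "zigzag s 0 (Suc q) (\<delta> q e) u0" "E.coch q t 0 v"
    "\<And>J. J \<subseteq> {..<t} \<Longrightarrow> \<delta> q (v J) = u0 J" "\<And>J. J \<subseteq> {..<t} \<Longrightarrow> u J = E.d q s v J" by auto
  have c: "v {} \<in> carrier (E q)" "e \<in> carrier (E q)"
    using E.cochD(1)[OF h(2)] 0(2) unfolding tors_def by auto
  \<comment> \<open>The values \<open>v {}\<close> and \<open>e\<close> have the same image under
    \<open>\<delta>\<close>. Subtracting \<open>e\<close> does not change the differential at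
    exponent \<open>s + l\<close>, because \<open>a j [^] l\<close> kills \<open>e\<close>.\<close>
  define w where "w = E.point q (v {} \<ominus>\<^bsub>E q\<^esub> e)"
  have w: "E.coch q t 0 w" unfolding w_def using c by (intro E.coch_point) simp
  have "u0 {} = \<delta> q e" using h(1) by simp
  then have "\<delta> q (v {}) = \<delta> q e" using h(3)[of "{}"] by simp
  then have "\<delta> q (v {} \<ominus>\<^bsub>E q\<^esub> e) = \<zero>\<^bsub>E (Suc q)\<^esub>"
    using c delta_minus delta_closed by (simp add: a_minus_def E.r_neg)
  then have "\<delta> q (w J) = \<zero>\<^bsub>E (Suc q)\<^esub>" for J unfolding w_def E.point_def using delta_zero by simp
  moreover have "E.lift q l u J = E.d q (s + l) w J" if J: "J \<subseteq> {..<t}" for J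
  proof -
    have "E.lift q l u J = E.lift q l (E.d q s v) J" using h(4)[OF J] by (simp add: koszul_lift_def)
    also have "\<dots> = E.d q (s + l) (E.lift q l v) J"
      using J fin_sub[OF J] E.cochD(1)[OF h(2)] by (intro E.d_lift[symmetric]) auto
    also have "\<dots> = E.d q (s + l) (\<lambda>J. w J \<oplus>\<^bsub>E q\<^esub> E.point q e J) J"
    proof (rule E.d_cong)
      have cc: "v {} \<ominus>\<^bsub>E q\<^esub> e \<oplus>\<^bsub>E q\<^esub> e = v {}"
        using c E.add_minus_cancel[of "v {}" q e] by (simp add: E.a_comm)
      have eq: "E.lift q l v I = w I \<oplus>\<^bsub>E q\<^esub> E.point q e I" if "I \<subseteq> {..<t}" for I
      proof (cases "I = {}")
        case True
        then show ?thesis unfolding w_def E.point_def using c cc by simp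
      next
        case False
        then show ?thesis using E.coch_0_eq_point[OF h(2) that]
          unfolding w_def E.point_def by (simp add: koszul_lift_def)
      qed
      show "j \<in> J \<Longrightarrow> E.lift q l v (J - {j}) = w (J - {j}) \<oplus>\<^bsub>E q\<^esub> E.point q e (J - {j})" for j
        using J by (intro eq) auto
      show "I \<subseteq> J \<Longrightarrow> w I \<oplus>\<^bsub>E q\<^esub> E.point q e I \<in> carrier (E q)" for I
        unfolding w_def E.point_def using c by simp
    qed
    also have "\<dots> = E.d q (s + l) w J \<oplus>\<^bsub>E q\<^esub> E.d q (s + l) (E.point q e) J"
      unfolding w_def E.point_def using c by (intro E.d_add) auto
    also have "E.d q (s + l) (E.point q e) J = \<zero>\<^bsub>E q\<^esub>"
      using tors_mono[OF 0(2), of "s + l"] J unfolding tors_def by (intro E.d_point) auto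
    finally show ?thesis using E.cochD(1)[OF E.coch_d[OF w] J] by simp
  qed
  ultimately show ?case using w by blast
next
  case (Suc p)
  from Suc.prems(1) obtain u0 v where h: "zigzag s (Suc p) (Suc q) (\<delta> (Suc q + p) e) u0" "E.coch q t (Suc p) v"
    "\<And>J. J \<subseteq> {..<t} \<Longrightarrow> \<delta> q (v J) = u0 J" "\<And>J. J \<subseteq> {..<t} \<Longrightarrow> u J = E.d q s v J"
    unfolding zigzag.simps(2)[of s "Suc p"] add_Suc add_Suc_right by blast
  obtain k w where w: "E.coch (Suc q) t p w" "\<And>J. J \<subseteq> {..<t} \<Longrightarrow> \<delta> (Suc q) (w J) = \<zero>\<^bsub>E (Suc (Suc q))\<^esub>"
    "\<And>J. J \<subseteq> {..<t} \<Longrightarrow> E.lift (Suc q) k u0 J = E.d (Suc q) (s + k) w J"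
    using Suc.IH[OF h(1)] Suc.prems(2) by auto
  obtain w' where w': "E.coch q t p w'" "\<And>J. J \<subseteq> {..<t} \<Longrightarrow> \<delta> q (w' J) = w J"
    using coch_exact[OF w(1,2)] by blast
  \<comment> \<open>Here \<open>d w'\<close> corrects \<open>v\<close> without changing its Koszul
    differential, and it has the same image under \<open>\<delta>\<close> as the lifted
    \<open>v\<close>.\<close>
  define f where "f J = E.lift q k v J \<ominus>\<^bsub>E q\<^esub> E.d q (s + k) w' J" for J
  have c1: "E.coch q t (Suc p) (E.lift q k v)" and c2: "E.coch q t (Suc p) (E.d q (s + k) w')"
    using E.coch_lift[OF h(2)] E.coch_d[OF w'(1)] by auto
  have f: "E.coch q t (Suc p) f" unfolding f_def using E.coch_minus[OF c1 c2] .
  moreover have "\<delta> q (f J) = \<zero>\<^bsub>E (Suc q)\<^esub> \<and> E.lift q k u J = E.d q (s + k) f J" if J: "J \<subseteq> {..<t}" for J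
  proof
    have "\<delta> q (f J) = \<delta> q (E.lift q k v J) \<ominus>\<^bsub>E (Suc q)\<^esub> \<delta> q (E.d q (s + k) w' J)"
      unfolding f_def using E.cochD(1)[OF c1 J] E.cochD(1)[OF c2 J] by (rule delta_minus)
    also have "\<delta> q (E.lift q k v J) = E.lift (Suc q) k u0 J"
      using delta_lift E.cochD(1)[OF h(2) J] h(3)[OF J] by (simp add: koszul_lift_def)
    also have "\<delta> q (E.d q (s + k) w' J) = E.d (Suc q) (s + k) (\<lambda>I. \<delta> q (w' I)) J"
      by (rule delta_d[OF w'(1) J])
    also have "\<dots> = E.d (Suc q) (s + k) w J"
      using J E.cochD(1)[OF w(1)] by (intro E.d_cong w'(2)) auto
    also have "E.lift (Suc q) k u0 J \<ominus>\<^bsub>E (Suc q)\<^esub> E.d (Suc q) (s + k) w J = \<zero>\<^bsub>E (Suc q)\<^esub>"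
      unfolding w(3)[OF J] using E.cochD(1)[OF E.coch_d[OF w(1)] J] by (simp add: a_minus_def E.r_neg)
    finally show "\<delta> q (f J) = \<zero>\<^bsub>E (Suc q)\<^esub>" .
    have "E.d q (s + k) f J = E.d q (s + k) (E.lift q k v) J \<ominus>\<^bsub>E q\<^esub>
        E.d q (s + k) (E.d q (s + k) w') J"
      unfolding f_def using J fin_sub[OF J] E.cochD(1)[OF c1] E.cochD(1)[OF c2] by (intro E.d_minus) auto
    also have "E.d q (s + k) (E.d q (s + k) w') J = \<zero>\<^bsub>E q\<^esub>"
      using J fin_sub[OF J] E.cochD(1)[OF w'(1)] by (intro E.d_d) auto
    also have "E.d q (s + k) (E.lift q k v) J = E.lift q k (E.d q s v) J"
      using J fin_sub[OF J] E.cochD(1)[OF h(2)] by (intro E.d_lift) auto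
    also have "\<dots> = E.lift q k u J" using h(4)[OF J] by (simp add: koszul_lift_def)
    finally show "E.lift q k u J = E.d q (s + k) f J"
      using h(4)[OF J] E.cochD(1)[OF E.coch_lift[OF E.coch_d[OF h(2)]] J, of k s] by (simp add: koszul_lift_def)
  qed
  ultimately show ?case by blast
qed

text \<open>The same argument in the opposite direction: the primitive \<open>w\<close> is compared
  with the intermediate cochain \<open>v\<close>, and their difference is a Koszul cocycle, hence a
  coboundary after lifting or, at the end, a torsion element.\<close>

lemma zigzag_boundary_left:
  assumes "zigzag s (Suc p) q e u" "E.coch q t p w"
    "\<And>J. J \<subseteq> {..<t} \<Longrightarrow> \<delta> q (w J) = \<zero>\<^bsub>E (Suc q)\<^esub>" "\<And>J. J \<subseteq> {..<t} \<Longrightarrow> u J = E.d q s w J"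
  shows "\<exists>l e'. tors (q + p) l e' \<and> \<delta> (q + p) e' = e"
  using assms
proof (induction p arbitrary: q u w s)
  case 0
  then obtain u0 v where h: "zigzag s 0 (Suc q) e u0" "E.coch q t 0 v"
    "\<And>J. J \<subseteq> {..<t} \<Longrightarrow> \<delta> q (v J) = u0 J" "\<And>J. J \<subseteq> {..<t} \<Longrightarrow> u J = E.d q s v J" by auto
  note c = E.cochD(1)[OF h(2)] and cw = E.cochD(1)[OF 0(2)]
  \<comment> \<open>At singletons the Koszul differential is multiplication by
    \<open>a j [^] s\<close>, so equal differentials make the difference of the two values
    torsion.\<close>
  have "a j [^] s \<odot>\<^bsub>E q\<^esub> (v {} \<ominus>\<^bsub>E q\<^esub> w {}) = \<zero>\<^bsub>E q\<^esub>" if j: "j < t" for j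
  proof -
    have "a j [^] s \<odot>\<^bsub>E q\<^esub> v {} = E.d q s v {j}"
      using E.d_singleton c[of "{}"] c[of "{j}"] j by simp
    also have "\<dots> = E.d q s w {j}" using h(4)[of "{j}"] 0(4)[of "{j}"] j by simp
    also have "\<dots> = a j [^] s \<odot>\<^bsub>E q\<^esub> w {}"
      using E.d_singleton cw[of "{}"] cw[of "{j}"] j by simp
    finally show ?thesis using c[of "{}"] cw[of "{}"]
      by (simp add: a_minus_def E.smult_r_distr E.smult_r_minus E.r_neg)
  qed
  moreover have "\<delta> q (v {} \<ominus>\<^bsub>E q\<^esub> w {}) = e"
    using delta_minus[of "v {}" q "w {}"] c[of "{}"] cw[of "{}"] h(1) h(3)[of "{}"] 0(3)[of "{}"] delta_closed[of "v {}" q]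
    by simp
  ultimately show ?case using c[of "{}"] cw[of "{}"]
    by (intro exI[of _ s] exI[of _ "v {} \<ominus>\<^bsub>E q\<^esub> w {}"]) (simp add: tors_def)
next
  case (Suc p)
  from Suc.prems(1) obtain u0 v where h: "zigzag s (Suc p) (Suc q) e u0" "E.coch q t (Suc p) v"
    "\<And>J. J \<subseteq> {..<t} \<Longrightarrow> \<delta> q (v J) = u0 J" "\<And>J. J \<subseteq> {..<t} \<Longrightarrow> u J = E.d q s v J"
    unfolding zigzag.simps(2)[of s "Suc p"] add_Suc add_Suc_right by blast
  \<comment> \<open>Since \<open>w\<close> is \<open>\<delta>\<close>-closed, \<open>f\<close> still
    maps to \<open>u0\<close>; a Koszul primitive \<open>g\<close> of \<open>f\<close> thus gives
    the primitive of \<open>u0\<close> for the next step.\<close>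
  define f where "f J = v J \<ominus>\<^bsub>E q\<^esub> w J" for J
  note cv = E.cochD(1)[OF h(2)] and cw = E.cochD(1)[OF Suc.prems(2)]
  have f: "E.coch q t (Suc p) f" unfolding f_def using E.coch_minus[OF h(2) Suc.prems(2)] .
  have kf: "E.d q s f J = \<zero>\<^bsub>E q\<^esub>" if J: "J \<subseteq> {..<t}" for J
  proof -
    have "E.d q s f J = E.d q s v J \<ominus>\<^bsub>E q\<^esub> E.d q s w J"
      unfolding f_def using J fin_sub[OF J] cv cw by (intro E.d_minus) auto
    also have "E.d q s v J = E.d q s w J" using h(4)[OF J] Suc.prems(4)[OF J] by simp
    finally show ?thesis
      using E.cochD(1)[OF E.coch_d[OF Suc.prems(2)] J] by (simp add: a_minus_def E.r_neg)
  qed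
  obtain k g where g: "E.coch q t p g" "\<And>J. J \<subseteq> {..<t} \<Longrightarrow> E.lift q k f J = E.d q (s + k) g J"
    using E.coch_vanishing[OF noeth baer_E f kf] by blast
  have "E.lift (Suc q) k u0 J = E.d (Suc q) (s + k) (\<lambda>I. \<delta> q (g I)) J" if J: "J \<subseteq> {..<t}" for J
  proof -
    have "E.d (Suc q) (s + k) (\<lambda>I. \<delta> q (g I)) J = \<delta> q (E.d q (s + k) g J)"
      using delta_d[OF g(1) J] by simp
    also have "\<dots> = \<delta> q (E.lift q k f J)" using g(2)[OF J] by simp
    also have "\<dots> = E.lift (Suc q) k (\<lambda>I. \<delta> q (f I)) J" using delta_lift E.cochD(1)[OF f J] by simp
    also have "\<delta> q (f J) = u0 J"
      unfolding f_def using delta_minus[OF cv[OF J] cw[OF J]] h(3)[OF J] Suc.prems(3)[OF J] delta_closed[OF cv[OF J]]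
      by simp
    then have "E.lift (Suc q) k (\<lambda>I. \<delta> q (f I)) J = E.lift (Suc q) k u0 J" by (simp add: koszul_lift_def)
    finally show ?thesis by simp
  qed
  then have "\<exists>l e'. tors (Suc q + p) l e' \<and> \<delta> (Suc q + p) e' = e"
    using delta_delta E.cochD(1)[OF g(1)]
    by (intro Suc.IH[OF zigzag_lift[OF h(1)] coch_delta[OF g(1)]]) auto
  then show ?case by simp
qed

text \<open>The class of \<open>e\<close> in local cohomology corresponds to the Cech class with numerators \<open>m\<close>.\<close>

definition corr :: "nat \<Rightarrow> nat \<Rightarrow> 'e \<Rightarrow> (nat set \<Rightarrow> 'c) \<Rightarrow> bool"
  where "corr i s e m \<longleftrightarrow> coch t i m \<and> zigzag s i 0 e (\<lambda>J. \<epsilon> (m J))"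

lemma corr_add:
  assumes "corr i s e m" "corr i s e' m'"
  shows "corr i s (e \<oplus>\<^bsub>E i\<^esub> e') (\<lambda>J. m J \<oplus>\<^bsub>M\<^esub> m' J)"
proof -
  have m: "coch t i m" "coch t i m'" using assms unfolding corr_def by auto
  have "zigzag s i 0 (e \<oplus>\<^bsub>E i\<^esub> e') (\<lambda>J. \<epsilon> (m J) \<oplus>\<^bsub>E 0\<^esub> \<epsilon> (m' J))"
    using zigzag_add assms unfolding corr_def by fastforce
  then have "zigzag s i 0 (e \<oplus>\<^bsub>E i\<^esub> e') (\<lambda>J. \<epsilon> (m J \<oplus>\<^bsub>M\<^esub> m' J))"
    by (rule zigzag_cong) (use eps_add cochD(1)[OF m(1)] cochD(1)[OF m(2)] in auto)
  then show ?thesis unfolding corr_def using coch_add[OF m] by blast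
qed

lemma corr_smult:
  assumes "c \<in> carrier R" "corr i s e m"
  shows "corr i s (c \<odot>\<^bsub>E i\<^esub> e) (\<lambda>J. c \<odot>\<^bsub>M\<^esub> m J)"
proof -
  have m: "coch t i m" using assms unfolding corr_def by auto
  have "zigzag s i 0 (c \<odot>\<^bsub>E i\<^esub> e) (\<lambda>J. c \<odot>\<^bsub>E 0\<^esub> \<epsilon> (m J))"
    using zigzag_smult[OF assms(1)] assms(2) unfolding corr_def by fastforce
  then have "zigzag s i 0 (c \<odot>\<^bsub>E i\<^esub> e) (\<lambda>J. \<epsilon> (c \<odot>\<^bsub>M\<^esub> m J))"
    by (rule zigzag_cong) (use eps_smult[OF assms(1)] cochD(1)[OF m] in auto)
  then show ?thesis unfolding corr_def using coch_smult[OF assms(1) m] by blast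
qed

lemma corr_lift:
  assumes "corr i s e m"
  shows "corr i (s + k) e (lift k m)"
proof -
  have m: "coch t i m" using assms unfolding corr_def by auto
  have "zigzag (s + k) i 0 e (E.lift 0 k (\<lambda>J. \<epsilon> (m J)))" using zigzag_lift assms unfolding corr_def by blast
  then have "zigzag (s + k) i 0 e (\<lambda>J. \<epsilon> (lift k m J))"
    by (rule zigzag_cong) (use eps_lift cochD(1)[OF m] in auto)
  then show ?thesis unfolding corr_def using coch_lift[OF m] by blast
qed

text \<open>The last cochain of the zigzag is \<open>\<delta>\<close>-closed with values in
  \<open>E 0\<close>, so it comes from \<open>M\<close>, and injectivity of
  \<open>\<epsilon>\<close> transports the cocycle condition to the numerators.\<close>

lemma corr_right:
  assumes "tors i s e" "\<delta> i e = \<zero>\<^bsub>E (Suc i)\<^esub>"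
  shows "\<exists>m. corr i s e m \<and> (\<forall>J\<subseteq>{..<t}. d s m J = \<zero>\<^bsub>M\<^esub>)"
proof -
  obtain u where u: "zigzag s i 0 e u" using zigzag_exists_right[of 0 i s e] assms by auto
  note cl = zigzag_closed[OF u]
  have d0: "\<delta> 0 (u J) = \<zero>\<^bsub>E 1\<^esub>" and du: "E.d 0 s u J = \<zero>\<^bsub>E 0\<^esub>" if "J \<subseteq> {..<t}" for J
    using cl[OF _ _ that] assms by auto
  obtain m where m: "coch t i m" "\<And>J. J \<subseteq> {..<t} \<Longrightarrow> \<epsilon> (m J) = u J"
    using coch_exact0[OF zigzag_coch[OF u] d0] by blast
  have "d s m J = \<zero>\<^bsub>M\<^esub>" if J: "J \<subseteq> {..<t}" for J
  proof (rule eps_inj)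
    have "\<epsilon> (d s m J) = E.d 0 s (\<lambda>I. \<epsilon> (m I)) J" by (rule eps_d[OF m(1) J])
    also have "\<dots> = E.d 0 s u J"
      using J E.cochD(1)[OF zigzag_coch[OF u]] by (intro E.d_cong m(2)) auto
    finally show "\<epsilon> (d s m J) = \<epsilon> \<zero>\<^bsub>M\<^esub>" using du[OF J] eps_zero by simp
  qed (use cochD(1)[OF coch_d[OF m(1)] J] in auto)
  moreover have "corr i s e m" unfolding corr_def using m zigzag_cong[OF u] by auto
  ultimately show ?thesis by blast
qed

lemma corr_left:
  assumes "coch t i m" "\<And>J. J \<subseteq> {..<t} \<Longrightarrow> d s m J = \<zero>\<^bsub>M\<^esub>"
  shows "\<exists>k e. tors i (s + k) e \<and> \<delta> i e = \<zero>\<^bsub>E (Suc i)\<^esub> \<and> corr i (s + k) e (lift k m)"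
proof -
  have "E.d 0 s (\<lambda>J. \<epsilon> (m J)) J = \<zero>\<^bsub>E 0\<^esub>" if J: "J \<subseteq> {..<t}" for J
    using eps_d[OF assms(1) J, of s] assms(2)[OF J] eps_zero by simp
  then obtain k e where e: "tors (0 + i) (s + k) e" "\<delta> (0 + i) e = \<zero>\<^bsub>E (Suc (0 + i))\<^esub>"
    "zigzag (s + k) i 0 e (E.lift 0 k (\<lambda>J. \<epsilon> (m J)))"
    using zigzag_exists_left[OF coch_eps[OF assms(1)], of s] delta_eps cochD(1)[OF assms(1)] by fastforce
  have "zigzag (s + k) i 0 e (\<lambda>J. \<epsilon> (lift k m J))"
    using e(3) by (rule zigzag_cong) (use eps_lift cochD(1)[OF assms(1)] in auto)
  then show ?thesis unfolding corr_def using e coch_lift[OF assms(1)] by auto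
qed

lemma corr_boundary_right:
  assumes "corr (Suc p) s (\<delta> p e) m" "tors p l e"
  shows "\<exists>k w. coch t p w \<and> (\<forall>J\<subseteq>{..<t}. lift k m J = d (s + k) w J)"
proof -
  have m: "coch t (Suc p) m" and z: "zigzag s (Suc p) 0 (\<delta> (0 + p) e) (\<lambda>J. \<epsilon> (m J))"
    using assms(1) unfolding corr_def by auto
  have e': "tors (0 + p) l e" using assms(2) by simp
  obtain k w where w: "E.coch 0 t p w" "\<And>J. J \<subseteq> {..<t} \<Longrightarrow> \<delta> 0 (w J) = \<zero>\<^bsub>E (Suc 0)\<^esub>"
    "\<And>J. J \<subseteq> {..<t} \<Longrightarrow> E.lift 0 k (\<lambda>J. \<epsilon> (m J)) J = E.d 0 (s + k) w J"
    using zigzag_boundary_right[OF z e'] by blast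
  obtain w' where w': "coch t p w'" "\<And>J. J \<subseteq> {..<t} \<Longrightarrow> \<epsilon> (w' J) = w J"
    using coch_exact0[OF w(1)] w(2) by auto
  have "lift k m J = d (s + k) w' J" if J: "J \<subseteq> {..<t}" for J
  proof (rule eps_inj)
    have "\<epsilon> (lift k m J) = E.d 0 (s + k) w J" using w(3)[OF J] eps_lift[of m J k] cochD(1)[OF m J] by simp
    also have "\<dots> = E.d 0 (s + k) (\<lambda>I. \<epsilon> (w' I)) J"
      using J eps_closed cochD(1)[OF w'(1)] by (intro E.d_cong w'(2)[symmetric]) auto
    finally show "\<epsilon> (lift k m J) = \<epsilon> (d (s + k) w' J)" using eps_d[OF w'(1) J] by simp
  qed (use cochD(1)[OF coch_d[OF w'(1)] J] cochD(1)[OF coch_lift[OF m] J] in auto)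
  then show ?thesis using w'(1) by blast
qed

lemma corr_boundary_left:
  assumes "corr (Suc p) s e m" "coch t p w" "\<And>J. J \<subseteq> {..<t} \<Longrightarrow> m J = d s w J"
  shows "\<exists>l e'. tors p l e' \<and> \<delta> p e' = e"
proof -
  have z: "zigzag s (Suc p) 0 e (\<lambda>J. \<epsilon> (m J))" using assms(1) unfolding corr_def by auto
  have "\<exists>l e'. tors (0 + p) l e' \<and> \<delta> (0 + p) e' = e"
  proof (rule zigzag_boundary_left[OF z coch_eps[OF assms(2)]])
    show "\<delta> 0 (\<epsilon> (w J)) = \<zero>\<^bsub>E (Suc 0)\<^esub>" if "J \<subseteq> {..<t}" for J
      using delta_eps cochD(1)[OF assms(2) that] by simp
    show "\<epsilon> (m J) = E.d 0 s (\<lambda>J. \<epsilon> (w J)) J" if "J \<subseteq> {..<t}" for J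
      using assms(3)[OF that] eps_d[OF assms(2) that] by simp
  qed
  then show ?thesis by simp
qed

lemma corr_0: "corr 0 s e m \<Longrightarrow> e = \<epsilon> (m {})"
  unfolding corr_def by simp

end

section \<open>Quotient modules and cohomology\<close>

lemma module_hom_minus:
  assumes "module R M" "module R N" "f \<in> module_hom R M N" "x \<in> carrier M" "y \<in> carrier M"
  shows "f (x \<ominus>\<^bsub>M\<^esub> y) = f x \<ominus>\<^bsub>N\<^esub> f y"
proof -
  interpret M: module R M by fact
  interpret N: module R N by fact
  have "f (\<ominus>\<^bsub>M\<^esub> y) = f ((\<ominus>\<^bsub>R\<^esub> \<one>\<^bsub>R\<^esub>) \<odot>\<^bsub>M\<^esub> y)" using assms(5) by (simp add: M.smult_l_minus)
  also have "\<dots> = (\<ominus>\<^bsub>R\<^esub> \<one>\<^bsub>R\<^esub>) \<odot>\<^bsub>N\<^esub> f y" using assms by (intro module_homD(3)[OF assms(3)]) auto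
  also have "\<dots> = \<ominus>\<^bsub>N\<^esub> f y" using module_homD(1)[OF assms(3,5)] by (simp add: N.smult_l_minus)
  finally show ?thesis
    unfolding a_minus_def using assms(4,5) module_homD(2)[OF assms(3,4)] by simp
qed

context module
begin

lemma submodule_abelian_subgroup: "submodule N R M \<Longrightarrow> abelian_subgroup N M"
  by (intro abelian_subgroupI3 additive_subgroupI M.abelian_group_axioms) (simp add: submodule_def)

lemma coset_eq_iff:
  assumes "submodule N R M" "x \<in> carrier M" "y \<in> carrier M"
  shows "N +>\<^bsub>M\<^esub> x = N +>\<^bsub>M\<^esub> y \<longleftrightarrow> x \<ominus>\<^bsub>M\<^esub> y \<in> N"
proof -
  interpret N: abelian_subgroup N M using assms(1) by (rule submodule_abelian_subgroup)
  have "N +>\<^bsub>M\<^esub> x = N +>\<^bsub>M\<^esub> y \<longleftrightarrow> x \<in> N +>\<^bsub>M\<^esub> y"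
    using N.a_repr_independence'[of x y] N.a_repr_independenceD[of x y] N.a_rcos_self[OF assms(2)] assms by metis
  then show ?thesis using N.a_rcos_module[OF assms(3,2)] by (simp add: a_minus_def)
qed

lemma coset_mem_iff:
  assumes "submodule N R M" "x \<in> carrier M"
  shows "y \<in> N +>\<^bsub>M\<^esub> x \<longleftrightarrow> y \<in> carrier M \<and> N +>\<^bsub>M\<^esub> y = N +>\<^bsub>M\<^esub> x"
proof -
  interpret N: abelian_subgroup N M using assms(1) by (rule submodule_abelian_subgroup)
  show ?thesis
    using N.a_repr_independence'[of y x] N.a_rcos_self[of y] assms N.a_elemrcos_carrier[of x y] by metis
qed

lemma coset_zero: "submodule N R M \<Longrightarrow> N +>\<^bsub>M\<^esub> \<zero>\<^bsub>M\<^esub> = N"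
  using submoduleE(1) M.a_coset_add_zero by blast

lemma coset_eq_self_iff:
  assumes "submodule N R M" "x \<in> carrier M"
  shows "N +>\<^bsub>M\<^esub> x = N \<longleftrightarrow> x \<in> N"
  using coset_eq_iff[OF assms M.zero_closed] coset_zero[OF assms(1)] assms(2) by simp

lemma quot_carrier: "carrier (quot_module M N) = {N +>\<^bsub>M\<^esub> x | x. x \<in> carrier M}"
  unfolding quot_module_def by (auto simp: A_RCOSETS_def')

lemma quot_zero [simp]: "\<zero>\<^bsub>quot_module M N\<^esub> = N"
  unfolding quot_module_def by simp

lemma quot_add:
  assumes "submodule N R M" "x \<in> carrier M" "y \<in> carrier M"
  shows "(N +>\<^bsub>M\<^esub> x) \<oplus>\<^bsub>quot_module M N\<^esub> (N +>\<^bsub>M\<^esub> y) = N +>\<^bsub>M\<^esub> (x \<oplus>\<^bsub>M\<^esub> y)"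
proof -
  interpret N: abelian_subgroup N M using assms(1) by (rule submodule_abelian_subgroup)
  show ?thesis unfolding quot_module_def using N.a_rcos_sum[OF assms(2,3)] by simp
qed

text \<open>Operations on quotients are defined as unions over a coset; such a union collapses to
  one value as soon as the operation does not depend on the representative.\<close>

lemma coset_map_eq:
  assumes "submodule N R M" "x \<in> carrier M"
    and "\<And>y. y \<in> carrier M \<Longrightarrow> N +>\<^bsub>M\<^esub> y = N +>\<^bsub>M\<^esub> x \<Longrightarrow> f y = f x"
  shows "(\<Union>y\<in>N +>\<^bsub>M\<^esub> x. f y) = f x"
proof -
  have "x \<in> N +>\<^bsub>M\<^esub> x" using coset_mem_iff[OF assms(1,2)] assms(2) by blast
  moreover have "f y = f x" if "y \<in> N +>\<^bsub>M\<^esub> x" for y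
    using that coset_mem_iff[OF assms(1,2)] assms(3) by blast
  ultimately show ?thesis by blast
qed

lemma quot_smult:
  assumes "submodule N R M" "r \<in> carrier R" "x \<in> carrier M"
  shows "r \<odot>\<^bsub>quot_module M N\<^esub> (N +>\<^bsub>M\<^esub> x) = N +>\<^bsub>M\<^esub> (r \<odot>\<^bsub>M\<^esub> x)"
proof -
  have "(\<Union>y\<in>N +>\<^bsub>M\<^esub> x. N +>\<^bsub>M\<^esub> (r \<odot>\<^bsub>M\<^esub> y)) = N +>\<^bsub>M\<^esub> (r \<odot>\<^bsub>M\<^esub> x)"
  proof (rule coset_map_eq[OF assms(1,3)])
    fix y assume y: "y \<in> carrier M" "N +>\<^bsub>M\<^esub> y = N +>\<^bsub>M\<^esub> x"
    then have "r \<odot>\<^bsub>M\<^esub> (y \<ominus>\<^bsub>M\<^esub> x) \<in> N"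
      using coset_eq_iff[OF assms(1) y(1) assms(3)] submoduleE(4)[OF assms(1,2)] by blast
    also have "r \<odot>\<^bsub>M\<^esub> (y \<ominus>\<^bsub>M\<^esub> x) = r \<odot>\<^bsub>M\<^esub> y \<ominus>\<^bsub>M\<^esub> r \<odot>\<^bsub>M\<^esub> x"
      using y assms by (simp add: a_minus_def smult_r_distr smult_r_minus)
    finally show "N +>\<^bsub>M\<^esub> (r \<odot>\<^bsub>M\<^esub> y) = N +>\<^bsub>M\<^esub> (r \<odot>\<^bsub>M\<^esub> x)"
      using coset_eq_iff[OF assms(1)] y assms by simp
  qed
  then show ?thesis unfolding quot_module_def by simp
qed

lemma module_quot:
  assumes N: "submodule N R M"
  shows "module R (quot_module M N)"
proof (rule moduleI)
  let ?Q = "quot_module M N"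
  have rep: "\<exists>x. U = N +>\<^bsub>M\<^esub> x \<and> x \<in> carrier M" if "U \<in> carrier ?Q" for U
    using that unfolding quot_carrier by blast
  have cl: "x \<in> carrier M \<Longrightarrow> N +>\<^bsub>M\<^esub> x \<in> carrier ?Q" for x unfolding quot_carrier by blast
  note qa = quot_add[OF N] and qs = quot_smult[OF N]
  show "cring R" by (rule R.is_cring)
  show "abelian_group ?Q"
  proof (rule abelian_groupI)
    fix U V assume "U \<in> carrier ?Q" "V \<in> carrier ?Q"
    then obtain x y where xy: "U = N +>\<^bsub>M\<^esub> x" "x \<in> carrier M" "V = N +>\<^bsub>M\<^esub> y" "y \<in> carrier M"
      using rep by metis
    then show "U \<oplus>\<^bsub>?Q\<^esub> V \<in> carrier ?Q" by (simp add: qa cl)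
    from xy show "U \<oplus>\<^bsub>?Q\<^esub> V = V \<oplus>\<^bsub>?Q\<^esub> U" by (simp add: qa M.a_comm)
    fix W assume "W \<in> carrier ?Q"
    then obtain z where "W = N +>\<^bsub>M\<^esub> z" "z \<in> carrier M" using rep by metis
    with xy show "U \<oplus>\<^bsub>?Q\<^esub> V \<oplus>\<^bsub>?Q\<^esub> W = U \<oplus>\<^bsub>?Q\<^esub> (V \<oplus>\<^bsub>?Q\<^esub> W)" by (simp add: qa M.a_assoc)
  next
    show "\<zero>\<^bsub>?Q\<^esub> \<in> carrier ?Q" using cl[OF M.zero_closed] by (simp add: coset_zero[OF N])
    fix U assume "U \<in> carrier ?Q"
    then obtain x where x: "U = N +>\<^bsub>M\<^esub> x" "x \<in> carrier M" using rep by metis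
    have z: "\<zero>\<^bsub>?Q\<^esub> = N +>\<^bsub>M\<^esub> \<zero>\<^bsub>M\<^esub>" by (simp add: coset_zero[OF N])
    show "\<zero>\<^bsub>?Q\<^esub> \<oplus>\<^bsub>?Q\<^esub> U = U" unfolding z x(1) using x(2) by (simp add: qa)
    have "(N +>\<^bsub>M\<^esub> (\<ominus>\<^bsub>M\<^esub> x)) \<oplus>\<^bsub>?Q\<^esub> U = \<zero>\<^bsub>?Q\<^esub>" unfolding z x(1) using x(2) by (simp add: qa M.l_neg)
    then show "\<exists>V\<in>carrier ?Q. V \<oplus>\<^bsub>?Q\<^esub> U = \<zero>\<^bsub>?Q\<^esub>" using cl x(2) by blast
  qed
  fix a b U assume ab: "a \<in> carrier R" "b \<in> carrier R" and "U \<in> carrier ?Q"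
  then obtain x where x: "U = N +>\<^bsub>M\<^esub> x" "x \<in> carrier M" using rep by metis
  show "a \<odot>\<^bsub>?Q\<^esub> U \<in> carrier ?Q" unfolding x(1) using x(2) ab by (simp add: qs cl)
  show "(a \<oplus> b) \<odot>\<^bsub>?Q\<^esub> U = a \<odot>\<^bsub>?Q\<^esub> U \<oplus>\<^bsub>?Q\<^esub> b \<odot>\<^bsub>?Q\<^esub> U"
    unfolding x(1) using x(2) ab by (simp add: qs qa smult_l_distr)
  show "(a \<otimes> b) \<odot>\<^bsub>?Q\<^esub> U = a \<odot>\<^bsub>?Q\<^esub> (b \<odot>\<^bsub>?Q\<^esub> U)"
    unfolding x(1) using x(2) ab by (simp add: qs smult_assoc1)
  fix V assume "V \<in> carrier ?Q"
  then obtain y where y: "V = N +>\<^bsub>M\<^esub> y" "y \<in> carrier M" using rep by metis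
  show "a \<odot>\<^bsub>?Q\<^esub> (U \<oplus>\<^bsub>?Q\<^esub> V) = a \<odot>\<^bsub>?Q\<^esub> U \<oplus>\<^bsub>?Q\<^esub> a \<odot>\<^bsub>?Q\<^esub> V"
    unfolding x(1) y(1) using x(2) y(2) ab by (simp add: qs qa smult_r_distr)
next
  fix U assume "U \<in> carrier (quot_module M N)"
  then show "\<one> \<odot>\<^bsub>quot_module M N\<^esub> U = U" using quot_smult[OF N] unfolding quot_carrier by auto
qed

end

text \<open>A linear relation that is total on both sides and matches \<open>B\<close> with
  \<open>C\<close> induces the isomorphism. No choice of images is needed, which suits the
  comparison by zigzags.\<close>

lemma quot_module_isomorphicI:
  assumes M: "module R M" and N: "module R N" and B: "submodule B R M" and C: "submodule C R N"
    and car: "\<And>x y. S x y \<Longrightarrow> x \<in> carrier M \<and> y \<in> carrier N"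
    and left: "\<And>x. x \<in> carrier M \<Longrightarrow> \<exists>y. S x y" and right: "\<And>y. y \<in> carrier N \<Longrightarrow> \<exists>x. S x y"
    and add: "\<And>x y x' y'. S x y \<Longrightarrow> S x' y' \<Longrightarrow> S (x \<oplus>\<^bsub>M\<^esub> x') (y \<oplus>\<^bsub>N\<^esub> y')"
    and smult: "\<And>r x y. r \<in> carrier R \<Longrightarrow> S x y \<Longrightarrow> S (r \<odot>\<^bsub>M\<^esub> x) (r \<odot>\<^bsub>N\<^esub> y)"
    and BC: "\<And>x y. S x y \<Longrightarrow> x \<in> B \<longleftrightarrow> y \<in> C"
  shows "module_isomorphic R (quot_module M B) (quot_module N C)"
proof -
  interpret M: module R M by fact
  interpret N: module R N by fact
  \<comment> \<open>Applying \<open>BC\<close> to a difference gives well-definedness and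
    injectivity at the same time.\<close>
  have cos: "B +>\<^bsub>M\<^esub> x = B +>\<^bsub>M\<^esub> x' \<longleftrightarrow> C +>\<^bsub>N\<^esub> y = C +>\<^bsub>N\<^esub> y'" if s: "S x y" "S x' y'" for x y x' y'
  proof -
    have "S (x \<oplus>\<^bsub>M\<^esub> (\<ominus>\<^bsub>R\<^esub> \<one>\<^bsub>R\<^esub>) \<odot>\<^bsub>M\<^esub> x') (y \<oplus>\<^bsub>N\<^esub> (\<ominus>\<^bsub>R\<^esub> \<one>\<^bsub>R\<^esub>) \<odot>\<^bsub>N\<^esub> y')"
      using s by (intro add smult) auto
    then have "S (x \<ominus>\<^bsub>M\<^esub> x') (y \<ominus>\<^bsub>N\<^esub> y')"
      using car[OF s(1)] car[OF s(2)] by (simp add: M.smult_l_minus N.smult_l_minus a_minus_def)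
    then show ?thesis
      using BC car[OF s(1)] car[OF s(2)] M.coset_eq_iff[OF B] N.coset_eq_iff[OF C] by blast
  qed
  define f where "f U = C +>\<^bsub>N\<^esub> (SOME y. \<exists>x\<in>U. S x y)" for U
  have f: "f (B +>\<^bsub>M\<^esub> x) = C +>\<^bsub>N\<^esub> y" if s: "S x y" for x y
  proof -
    have x: "x \<in> carrier M" using car[OF s] by blast
    then have "\<exists>z. \<exists>x\<in>B +>\<^bsub>M\<^esub> x. S x z" using s M.coset_mem_iff[OF B x] by blast
    then have "\<exists>x'\<in>B +>\<^bsub>M\<^esub> x. S x' (SOME z. \<exists>x\<in>B +>\<^bsub>M\<^esub> x. S x z)" by (rule someI_ex)
    then obtain x' where x': "x' \<in> B +>\<^bsub>M\<^esub> x" "S x' (SOME z. \<exists>x\<in>B +>\<^bsub>M\<^esub> x. S x z)" by blast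
    then have "B +>\<^bsub>M\<^esub> x' = B +>\<^bsub>M\<^esub> x" using M.coset_mem_iff[OF B x] by blast
    then show ?thesis unfolding f_def using cos[OF x'(2) s] by blast
  qed
  have rep: "\<exists>x y. U = B +>\<^bsub>M\<^esub> x \<and> S x y" if "U \<in> carrier (quot_module M B)" for U
    using that left unfolding M.quot_carrier by blast
  have "f \<in> module_hom R (quot_module M B) (quot_module N C)"
    unfolding module_hom_def
  proof (intro CollectI conjI ballI)
    show "f \<in> carrier (quot_module M B) \<rightarrow> carrier (quot_module N C)"
    proof
      fix U assume "U \<in> carrier (quot_module M B)"
      then obtain x y where "U = B +>\<^bsub>M\<^esub> x" "S x y" using rep by blast
      then show "f U \<in> carrier (quot_module N C)" using f car unfolding N.quot_carrier by blast
    qed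
    fix U assume "U \<in> carrier (quot_module M B)"
    then obtain x y where x: "U = B +>\<^bsub>M\<^esub> x" "S x y" using rep by blast
    show "f (r \<odot>\<^bsub>quot_module M B\<^esub> U) = r \<odot>\<^bsub>quot_module N C\<^esub> f U" if r: "r \<in> carrier R" for r
      unfolding x(1) f[OF x(2)] using car[OF x(2)] r f[OF smult[OF r x(2)]]
      by (simp add: M.quot_smult[OF B] N.quot_smult[OF C])
    fix V assume "V \<in> carrier (quot_module M B)"
    then obtain x' y' where x': "V = B +>\<^bsub>M\<^esub> x'" "S x' y'" using rep by blast
    show "f (U \<oplus>\<^bsub>quot_module M B\<^esub> V) = f U \<oplus>\<^bsub>quot_module N C\<^esub> f V"
      unfolding x(1) x'(1) f[OF x(2)] f[OF x'(2)]
      using car[OF x(2)] car[OF x'(2)] f[OF add[OF x(2) x'(2)]]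
      by (simp add: M.quot_add[OF B] N.quot_add[OF C])
  qed
  moreover have "bij_betw f (carrier (quot_module M B)) (carrier (quot_module N C))"
    unfolding bij_betw_def
  proof
    show "inj_on f (carrier (quot_module M B))"
    proof (rule inj_onI)
      fix U V assume "U \<in> carrier (quot_module M B)" "V \<in> carrier (quot_module M B)" and eq: "f U = f V"
      then obtain x y x' y' where x: "U = B +>\<^bsub>M\<^esub> x" "S x y" and x': "V = B +>\<^bsub>M\<^esub> x'" "S x' y'"
        using rep by meson
      have "C +>\<^bsub>N\<^esub> y = C +>\<^bsub>N\<^esub> y'" using eq f[OF x(2)] f[OF x'(2)] x(1) x'(1) by simp
      then show "U = V" using cos[OF x(2) x'(2)] x(1) x'(1) by simp
    qed
    show "f ` carrier (quot_module M B) = carrier (quot_module N C)"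
    proof
      show "f ` carrier (quot_module M B) \<subseteq> carrier (quot_module N C)"
        using calculation unfolding module_hom_def by blast
      show "carrier (quot_module N C) \<subseteq> f ` carrier (quot_module M B)"
      proof
        fix V assume "V \<in> carrier (quot_module N C)"
        then obtain y where "V = C +>\<^bsub>N\<^esub> y" "y \<in> carrier N" unfolding N.quot_carrier by blast
        moreover from this obtain x where x: "S x y" using right by blast
        ultimately have "V = f (B +>\<^bsub>M\<^esub> x)" using f by simp
        then show "V \<in> f ` carrier (quot_module M B)" using car[OF x] unfolding M.quot_carrier by blast
      qed
    qed
  qed
  ultimately show ?thesis unfolding module_isomorphic_def by blast
qed

section \<open>Cochain complexes and their quotients\<close>

definition cochain_complex ::
    "('a, 'k) ring_scheme \<Rightarrow> (nat \<Rightarrow> ('a, 'm, 'x) module_scheme) \<Rightarrow> (nat \<Rightarrow> 'm \<Rightarrow> 'm) \<Rightarrow> bool"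
  where "cochain_complex R C d \<longleftrightarrow> (\<forall>i. module R (C i)) \<and> (\<forall>i. d i \<in> module_hom R (C i) (C (Suc i))) \<and>
    (\<forall>i. \<forall>x\<in>carrier (C i). d (Suc i) (d i x) = \<zero>\<^bsub>C (Suc (Suc i))\<^esub>)"

lemma submodule_kernel:
  assumes "module R M" "module R N" "f \<in> module_hom R M N"
  shows "submodule (a_kernel M N f) R M"
proof -
  interpret M: module R M by fact
  interpret N: module R N by fact
  show ?thesis
    using module_homD[OF assms(3)] module_hom_zero[OF assms]
    by (intro M.submoduleI') (auto simp: a_kernel_def')
qed

lemma submodule_image:
  assumes "module R M" "module R N" "f \<in> module_hom R M N"
  shows "submodule (f ` carrier M) R N"
proof -
  interpret M: module R M by fact
  interpret N: module R N by fact
  show ?thesis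
  proof (rule N.submoduleI')
    show "f ` carrier M \<subseteq> carrier N" using module_homD(1)[OF assms(3)] by auto
    show "\<zero>\<^bsub>N\<^esub> \<in> f ` carrier M" using module_hom_zero[OF assms] M.zero_closed by (metis imageI)
    show "x \<oplus>\<^bsub>N\<^esub> y \<in> f ` carrier M" if "x \<in> f ` carrier M" "y \<in> f ` carrier M" for x y
      using that module_homD(2)[OF assms(3)] by (force simp flip: module_homD(2)[OF assms(3)])
    show "r \<odot>\<^bsub>N\<^esub> x \<in> f ` carrier M" if "r \<in> carrier R" "x \<in> f ` carrier M" for r x
      using that by (force simp flip: module_homD(3)[OF assms(3)])
  qed
qed

lemma submodule_restrict:
  assumes "module R M" "submodule K R M" "submodule B R M" "B \<subseteq> K"
  shows "submodule B R (M\<lparr>carrier := K\<rparr>)"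
proof -
  interpret M: module R M by fact
  interpret K: module R "M\<lparr>carrier := K\<rparr>" using assms(2,1) by (rule submodule.submodule_is_module)
  show ?thesis
    using assms(4) M.submoduleE[OF assms(3)] M.submodule_zero[OF assms(3)]
    by (intro K.submoduleI') auto
qed

lemma submodule_coboundaries:
  assumes "cochain_complex R C d"
  shows "submodule (coboundaries C d i) R (C i)"
proof (cases i)
  case 0
  interpret module R "C 0" using assms unfolding cochain_complex_def by blast
  show ?thesis unfolding coboundaries_def 0 using submodule_single_zero by simp
next
  case (Suc p)
  show ?thesis unfolding coboundaries_def Suc using assms
    by (auto simp: cochain_complex_def intro: submodule_image)
qed

lemma coboundaries_subset:
  assumes "cochain_complex R C d"
  shows "coboundaries C d i \<subseteq> a_kernel (C i) (C (Suc i)) (d i)"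
proof (cases i)
  case 0
  have m: "module R (C 0)" "module R (C (Suc 0))" "d 0 \<in> module_hom R (C 0) (C (Suc 0))"
    using assms unfolding cochain_complex_def by blast+
  interpret module R "C 0" by (rule m(1))
  show ?thesis unfolding coboundaries_def 0 using module_hom_zero[OF m]
    by (simp add: a_kernel_def')
next
  case (Suc p)
  have "d p \<in> module_hom R (C p) (C (Suc p))" using assms unfolding cochain_complex_def by blast
  then show ?thesis unfolding coboundaries_def Suc using assms module_homD(1)
    by (fastforce simp: a_kernel_def' cochain_complex_def)
qed

lemma cohomology_isomorphicI:
  assumes C: "cochain_complex R C d" and C': "cochain_complex R C' d'"
    and car: "\<And>x y. S x y \<Longrightarrow> x \<in> carrier (C i) \<and> d i x = \<zero>\<^bsub>C (Suc i)\<^esub> \<and> y \<in> carrier (C' i) \<and> d' i y = \<zero>\<^bsub>C' (Suc i)\<^esub>"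
    and left: "\<And>x. x \<in> carrier (C i) \<Longrightarrow> d i x = \<zero>\<^bsub>C (Suc i)\<^esub> \<Longrightarrow> \<exists>y. S x y"
    and right: "\<And>y. y \<in> carrier (C' i) \<Longrightarrow> d' i y = \<zero>\<^bsub>C' (Suc i)\<^esub> \<Longrightarrow> \<exists>x. S x y"
    and add: "\<And>x y x' y'. S x y \<Longrightarrow> S x' y' \<Longrightarrow> S (x \<oplus>\<^bsub>C i\<^esub> x') (y \<oplus>\<^bsub>C' i\<^esub> y')"
    and smult: "\<And>r x y. r \<in> carrier R \<Longrightarrow> S x y \<Longrightarrow> S (r \<odot>\<^bsub>C i\<^esub> x) (r \<odot>\<^bsub>C' i\<^esub> y)"
    and cob: "\<And>x y. S x y \<Longrightarrow> x \<in> coboundaries C d i \<longleftrightarrow> y \<in> coboundaries C' d' i"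
  shows "module_isomorphic R (cohomology C d i) (cohomology C' d' i)"
proof -
  let ?K = "a_kernel (C i) (C (Suc i)) (d i)" and ?K' = "a_kernel (C' i) (C' (Suc i)) (d' i)"
  have m: "module R (C j)" "module R (C' j)" "d j \<in> module_hom R (C j) (C (Suc j))"
    "d' j \<in> module_hom R (C' j) (C' (Suc j))" for j
    using C C' unfolding cochain_complex_def by auto
  have K: "submodule ?K R (C i)" and K': "submodule ?K' R (C' i)"
    using m by (auto intro: submodule_kernel)
  show ?thesis
    unfolding cohomology_def
  proof (rule quot_module_isomorphicI[where S = S])
    show "module R (C i\<lparr>carrier := ?K\<rparr>)" "module R (C' i\<lparr>carrier := ?K'\<rparr>)"
      using submodule.submodule_is_module[OF K m(1)] submodule.submodule_is_module[OF K' m(2)] by auto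
    show "submodule (coboundaries C d i) R (C i\<lparr>carrier := ?K\<rparr>)"
      by (rule submodule_restrict[OF m(1) K submodule_coboundaries[OF C] coboundaries_subset[OF C]])
    show "submodule (coboundaries C' d' i) R (C' i\<lparr>carrier := ?K'\<rparr>)"
      by (rule submodule_restrict[OF m(2) K' submodule_coboundaries[OF C'] coboundaries_subset[OF C']])
  qed (use car left right add smult cob in \<open>auto simp: a_kernel_def'\<close>)
qed

lemma quot_diff_coset:
  assumes "module R (C i)" "module R (C (Suc i))" "d i \<in> module_hom R (C i) (C (Suc i))"
    "submodule (D i) R (C i)" "submodule (D (Suc i)) R (C (Suc i))" "d i ` D i \<subseteq> D (Suc i)" "x \<in> carrier (C i)"
  shows "quot_diff C d D i (D i +>\<^bsub>C i\<^esub> x) = D (Suc i) +>\<^bsub>C (Suc i)\<^esub> d i x"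
proof -
  interpret C: module R "C i" by fact
  interpret C': module R "C (Suc i)" by fact
  show ?thesis unfolding quot_diff_def
  proof (rule C.coset_map_eq[OF assms(4,7)])
    fix y assume y: "y \<in> carrier (C i)" "D i +>\<^bsub>C i\<^esub> y = D i +>\<^bsub>C i\<^esub> x"
    then have "d i (y \<ominus>\<^bsub>C i\<^esub> x) \<in> D (Suc i)"
      using C.coset_eq_iff[OF assms(4) y(1) assms(7)] assms(6) by blast
    then show "D (Suc i) +>\<^bsub>C (Suc i)\<^esub> d i y = D (Suc i) +>\<^bsub>C (Suc i)\<^esub> d i x"
      using C'.coset_eq_iff[OF assms(5)] module_hom_minus[OF assms(1-3) y(1) assms(7)]
        module_homD(1)[OF assms(3)] y assms(7) by simp
  qed
qed

lemma cochain_complex_quot: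
  assumes C: "cochain_complex R C d" and D: "\<And>i. submodule (D i) R (C i)" "\<And>i. d i ` D i \<subseteq> D (Suc i)"
  shows "cochain_complex R (quot_complex C D) (quot_diff C d D)"
proof -
  have m: "module R (C j)" "d j \<in> module_hom R (C j) (C (Suc j))"
    "x \<in> carrier (C j) \<Longrightarrow> d (Suc j) (d j x) = \<zero>\<^bsub>C (Suc (Suc j))\<^esub>" for j x
    using C unfolding cochain_complex_def by auto
  note qd = quot_diff_coset[where d = d and D = D, OF m(1) m(1) m(2) D(1) D(1) D(2)]
  note qc = module.quot_carrier[OF m(1)]
  note qa = module.quot_add[OF m(1) D(1)]
  note qs = module.quot_smult[OF m(1) D(1)]
  note cl = module_homD(1)[OF m(2)]
  show ?thesis
    unfolding cochain_complex_def quot_complex_def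
  proof (intro conjI allI ballI)
    show "module R (quot_module (C i) (D i))" for i by (rule module.module_quot[OF m(1) D(1)])
    show "quot_diff C d D i \<in> module_hom R (quot_module (C i) (D i)) (quot_module (C (Suc i)) (D (Suc i)))" for i
      unfolding module_hom_def
    proof (intro CollectI conjI ballI)
      interpret Ci: module R "C i" by (rule m(1))
      show "quot_diff C d D i \<in> carrier (quot_module (C i) (D i)) \<rightarrow> carrier (quot_module (C (Suc i)) (D (Suc i)))"
        unfolding qc using qd cl by fastforce
      fix U assume "U \<in> carrier (quot_module (C i) (D i))"
      then obtain x where x: "U = D i +>\<^bsub>C i\<^esub> x" "x \<in> carrier (C i)" unfolding qc by blast
      show "quot_diff C d D i (r \<odot>\<^bsub>quot_module (C i) (D i)\<^esub> U) =
          r \<odot>\<^bsub>quot_module (C (Suc i)) (D (Suc i))\<^esub> quot_diff C d D i U" if "r \<in> carrier R" for r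
        unfolding x(1) using x(2) that by (simp add: qs qd cl module_homD(3)[OF m(2)])
      fix V assume "V \<in> carrier (quot_module (C i) (D i))"
      then obtain y where y: "V = D i +>\<^bsub>C i\<^esub> y" "y \<in> carrier (C i)" unfolding qc by blast
      show "quot_diff C d D i (U \<oplus>\<^bsub>quot_module (C i) (D i)\<^esub> V) =
          quot_diff C d D i U \<oplus>\<^bsub>quot_module (C (Suc i)) (D (Suc i))\<^esub> quot_diff C d D i V"
        unfolding x(1) y(1) using x(2) y(2) by (simp add: qa qd cl module_homD(2)[OF m(2)])
    qed
    fix i U assume "U \<in> carrier (quot_module (C i) (D i))"
    then obtain x where x: "U = D i +>\<^bsub>C i\<^esub> x" "x \<in> carrier (C i)" unfolding qc by blast
    show "quot_diff C d D (Suc i) (quot_diff C d D i U) = \<zero>\<^bsub>quot_module (C (Suc (Suc i))) (D (Suc (Suc i)))\<^esub>"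
      unfolding x(1) qd[OF x(2)] qd[OF cl[OF x(2)]] m(3)[OF x(2)]
      by (simp add: module.coset_zero[OF m(1) D(1)] module.quot_zero[OF m(1)])
  qed
qed

section \<open>Localizations\<close>

context module
begin

context
  fixes x assumes x: "x \<in> carrier R"
begin

abbreviation (input) "fr \<equiv> fraction R M x"
abbreviation (input) "L \<equiv> localization R M x"

lemma pow_pow: "m \<in> carrier M \<Longrightarrow> x [^] (i::nat) \<odot>\<^bsub>M\<^esub> (x [^] (j::nat) \<odot>\<^bsub>M\<^esub> m) = x [^] (i + j) \<odot>\<^bsub>M\<^esub> m"
  using x by (simp add: smult_assoc1[symmetric] R.nat_pow_mult)

lemma fraction_mem:
  "(m', s') \<in> fr m s \<longleftrightarrow> m' \<in> carrier M \<and> (\<exists>k. x [^] (k + s') \<odot>\<^bsub>M\<^esub> m = x [^] (k + s) \<odot>\<^bsub>M\<^esub> m')"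
  unfolding fraction_def by simp

lemma fraction_self: "m \<in> carrier M \<Longrightarrow> (m, s) \<in> fr m s"
  unfolding fraction_mem by blast

text \<open>Multiplying the first equation by the power \<open>l + s''\<close> and the second by
  \<open>k + s\<close> makes their middle terms agree; the exponent \<open>k + l + s'\<close>
  results.\<close>

lemma fraction_trans:
  fixes k l s s' s'' :: nat
  assumes "m \<in> carrier M" "m' \<in> carrier M" "m'' \<in> carrier M"
    "x [^] (k + s') \<odot>\<^bsub>M\<^esub> m = x [^] (k + s) \<odot>\<^bsub>M\<^esub> m'"
    "x [^] (l + s'') \<odot>\<^bsub>M\<^esub> m' = x [^] (l + s') \<odot>\<^bsub>M\<^esub> m''"
  shows "x [^] ((k + l + s') + s'') \<odot>\<^bsub>M\<^esub> m = x [^] ((k + l + s') + s) \<odot>\<^bsub>M\<^esub> m''"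
proof -
  have "x [^] ((k + l + s') + s'') \<odot>\<^bsub>M\<^esub> m = x [^] (l + s'') \<odot>\<^bsub>M\<^esub> (x [^] (k + s') \<odot>\<^bsub>M\<^esub> m)"
    using assms(1) by (simp add: pow_pow ac_simps)
  also have "\<dots> = x [^] (k + s) \<odot>\<^bsub>M\<^esub> (x [^] (l + s'') \<odot>\<^bsub>M\<^esub> m')"
    unfolding assms(4) using assms(2) by (simp add: pow_pow ac_simps)
  also have "\<dots> = x [^] ((k + l + s') + s) \<odot>\<^bsub>M\<^esub> m''"
    unfolding assms(5) using assms(3) by (simp add: pow_pow ac_simps)
  finally show ?thesis .
qed

lemma fraction_eq_iff:
  assumes m: "m \<in> carrier M" "m' \<in> carrier M"
  shows "fr m s = fr m' s' \<longleftrightarrow> (\<exists>k. x [^] (k + s') \<odot>\<^bsub>M\<^esub> m = x [^] (k + s) \<odot>\<^bsub>M\<^esub> m')"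
proof
  assume "fr m s = fr m' s'"
  then have "(m', s') \<in> fr m s" using fraction_self m(2) by simp
  then show "\<exists>k. x [^] (k + s') \<odot>\<^bsub>M\<^esub> m = x [^] (k + s) \<odot>\<^bsub>M\<^esub> m'" unfolding fraction_mem by blast
next
  assume "\<exists>k. x [^] (k + s') \<odot>\<^bsub>M\<^esub> m = x [^] (k + s) \<odot>\<^bsub>M\<^esub> m'"
  then obtain k where k: "x [^] (k + s') \<odot>\<^bsub>M\<^esub> m = x [^] (k + s) \<odot>\<^bsub>M\<^esub> m'" by blast
  have "(n, p) \<in> fr m s \<longleftrightarrow> (n, p) \<in> fr m' s'" for n p
  proof
    assume "(n, p) \<in> fr m s"
    then obtain l where "n \<in> carrier M" "x [^] (l + p) \<odot>\<^bsub>M\<^esub> m = x [^] (l + s) \<odot>\<^bsub>M\<^esub> n"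
      unfolding fraction_mem by blast
    then show "(n, p) \<in> fr m' s'" using fraction_trans[OF m(2,1) _ k[symmetric]] unfolding fraction_mem by blast
  next
    assume "(n, p) \<in> fr m' s'"
    then obtain l where "n \<in> carrier M" "x [^] (l + p) \<odot>\<^bsub>M\<^esub> m' = x [^] (l + s') \<odot>\<^bsub>M\<^esub> n"
      unfolding fraction_mem by blast
    then show "(n, p) \<in> fr m s" using fraction_trans[OF m _ k] unfolding fraction_mem by blast
  qed
  then show "fr m s = fr m' s'" by auto
qed

lemma fraction_expand: "m \<in> carrier M \<Longrightarrow> fr m s = fr (x [^] k \<odot>\<^bsub>M\<^esub> m) (s + k)"
  using x by (subst fraction_eq_iff) (auto simp: pow_pow ac_simps)

lemma fraction_class_map:
  assumes "m \<in> carrier M"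
    "\<And>n p k. n \<in> carrier M \<Longrightarrow> x [^] (k + p) \<odot>\<^bsub>M\<^esub> m = x [^] (k + s) \<odot>\<^bsub>M\<^esub> n \<Longrightarrow> g n p = g m s"
  shows "(\<Union>(n, p)\<in>fr m s. g n p) = g m s"
proof -
  have "g n p = g m s" if "(n, p) \<in> fr m s" for n p using that assms(2) unfolding fraction_mem by blast
  then show ?thesis using fraction_self[OF assms(1), of s] by blast
qed

lemma loc_carrier: "carrier L = {fr m s | m s. m \<in> carrier M}"
  unfolding localization_def by simp

lemma loc_zero: "\<zero>\<^bsub>L\<^esub> = fr \<zero>\<^bsub>M\<^esub> s"
  unfolding localization_def using x by (simp add: fraction_eq_iff)

lemma loc_add:
  assumes m: "m \<in> carrier M" "m' \<in> carrier M"
  shows "fr m s \<oplus>\<^bsub>L\<^esub> fr m' s' = fr (x [^] s' \<odot>\<^bsub>M\<^esub> m \<oplus>\<^bsub>M\<^esub> x [^] s \<odot>\<^bsub>M\<^esub> m') (s + s')"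
proof -
  let ?g = "\<lambda>m s m' s'. fr (x [^] s' \<odot>\<^bsub>M\<^esub> m \<oplus>\<^bsub>M\<^esub> x [^] s \<odot>\<^bsub>M\<^esub> m') (s + s')"
  have 1: "?g n p m' s' = ?g m s m' s'"
    if "n \<in> carrier M" "m \<in> carrier M" "m' \<in> carrier M" "x [^] (k + p) \<odot>\<^bsub>M\<^esub> m = x [^] (k + s) \<odot>\<^bsub>M\<^esub> n" for n p k m s m' s'
  proof -
    have "x [^] (k + (s + s')) \<odot>\<^bsub>M\<^esub> (x [^] s' \<odot>\<^bsub>M\<^esub> n) = x [^] (s' + s') \<odot>\<^bsub>M\<^esub> (x [^] (k + s) \<odot>\<^bsub>M\<^esub> n)"
      using that(1) by (simp add: pow_pow ac_simps)
    also have "\<dots> = x [^] (k + (p + s')) \<odot>\<^bsub>M\<^esub> (x [^] s' \<odot>\<^bsub>M\<^esub> m)"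
      unfolding that(4)[symmetric] using that(2) by (simp add: pow_pow ac_simps)
    finally have "x [^] (k + (s + s')) \<odot>\<^bsub>M\<^esub> (x [^] s' \<odot>\<^bsub>M\<^esub> n) = x [^] (k + (p + s')) \<odot>\<^bsub>M\<^esub> (x [^] s' \<odot>\<^bsub>M\<^esub> m)" .
    moreover have "x [^] (k + (s + s')) \<odot>\<^bsub>M\<^esub> (x [^] p \<odot>\<^bsub>M\<^esub> m') = x [^] (k + (p + s')) \<odot>\<^bsub>M\<^esub> (x [^] s \<odot>\<^bsub>M\<^esub> m')"
      using that(3) by (simp add: pow_pow ac_simps)
    ultimately show ?thesis
      using that x by (subst fraction_eq_iff) (auto simp: smult_r_distr intro!: exI[of _ k])
  qed
  \<comment> \<open>By symmetry, independence of the representative is needed in one argument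
    only.\<close>
  have comm: "?g m s m' s' = ?g m' s' m s" if "m \<in> carrier M" "m' \<in> carrier M" for m s m' s'
    using that x by (simp add: M.a_comm add.commute)
  have "fr m s \<oplus>\<^bsub>L\<^esub> fr m' s' = (\<Union>(n, p)\<in>fr m s. \<Union>(n', p')\<in>fr m' s'. ?g n p n' p')"
    unfolding localization_def by simp
  also have "\<dots> = (\<Union>(n', p')\<in>fr m' s'. ?g m s n' p')"
  proof (rule fraction_class_map[OF m(1)])
    fix n p k assume n: "n \<in> carrier M" "x [^] (k + p) \<odot>\<^bsub>M\<^esub> m = x [^] (k + s) \<odot>\<^bsub>M\<^esub> n"
    have "?g n p n' p' = ?g m s n' p'" if "(n', p') \<in> fr m' s'" for n' p'
      using that 1[OF n(1) m(1) _ n(2)] unfolding fraction_mem by blast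
    then show "(\<Union>(n', p')\<in>fr m' s'. ?g n p n' p') = (\<Union>(n', p')\<in>fr m' s'. ?g m s n' p')" by blast
  qed
  also have "\<dots> = ?g m s m' s'"
  proof (rule fraction_class_map[OF m(2)])
    fix n p k assume n: "n \<in> carrier M" "x [^] (k + p) \<odot>\<^bsub>M\<^esub> m' = x [^] (k + s') \<odot>\<^bsub>M\<^esub> n"
    show "?g m s n p = ?g m s m' s'"
      unfolding comm[OF m(1) n(1)] comm[OF m] by (rule 1[OF n(1) m(2,1) n(2)])
  qed
  finally show ?thesis .
qed

lemma loc_add_same:
  assumes "m \<in> carrier M" "m' \<in> carrier M"
  shows "fr m s \<oplus>\<^bsub>L\<^esub> fr m' s = fr (m \<oplus>\<^bsub>M\<^esub> m') s"
  using assms fraction_expand[of "m \<oplus>\<^bsub>M\<^esub> m'" s s] x by (simp add: loc_add smult_r_distr)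

lemma loc_smult:
  assumes "r \<in> carrier R" "m \<in> carrier M"
  shows "r \<odot>\<^bsub>L\<^esub> fr m s = fr (r \<odot>\<^bsub>M\<^esub> m) s"
proof -
  have "(\<Union>(n, p)\<in>fr m s. fr (r \<odot>\<^bsub>M\<^esub> n) p) = fr (r \<odot>\<^bsub>M\<^esub> m) s"
  proof (rule fraction_class_map[OF assms(2)])
    fix n p k assume n: "n \<in> carrier M" "x [^] (k + p) \<odot>\<^bsub>M\<^esub> m = x [^] (k + s) \<odot>\<^bsub>M\<^esub> n"
    have "x [^] (k + s) \<odot>\<^bsub>M\<^esub> (r \<odot>\<^bsub>M\<^esub> n) = r \<odot>\<^bsub>M\<^esub> (x [^] (k + s) \<odot>\<^bsub>M\<^esub> n)"
      using n assms x by (intro smult_comm) auto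
    also have "\<dots> = x [^] (k + p) \<odot>\<^bsub>M\<^esub> (r \<odot>\<^bsub>M\<^esub> m)"
      unfolding n(2)[symmetric] using assms x by (intro smult_comm) auto
    finally show "fr (r \<odot>\<^bsub>M\<^esub> n) p = fr (r \<odot>\<^bsub>M\<^esub> m) s" using n assms by (subst fraction_eq_iff) auto
  qed
  then show ?thesis unfolding localization_def by simp
qed

lemma fraction_zero_iff:
  assumes "m \<in> carrier M"
  shows "fr m s = \<zero>\<^bsub>L\<^esub> \<longleftrightarrow> (\<exists>k::nat. x [^] k \<odot>\<^bsub>M\<^esub> m = \<zero>\<^bsub>M\<^esub>)"
proof -
  have "fr m s = \<zero>\<^bsub>L\<^esub> \<longleftrightarrow> (\<exists>k. x [^] (k + s) \<odot>\<^bsub>M\<^esub> m = \<zero>\<^bsub>M\<^esub>)"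
    unfolding loc_zero[of s] using fraction_eq_iff[OF assms M.zero_closed] x by simp
  then show ?thesis using smult_pow_zero_mono[OF x assms] by (metis le_add1)
qed

lemma common_denominator:
  assumes "U \<in> carrier L" "V \<in> carrier L"
  obtains m m' s where "m \<in> carrier M" "m' \<in> carrier M" "U = fr m s" "V = fr m' s"
proof -
  obtain m s m' s' where h: "U = fr m s" "V = fr m' s'" "m \<in> carrier M" "m' \<in> carrier M"
    using assms unfolding loc_carrier by blast
  have "U = fr (x [^] s' \<odot>\<^bsub>M\<^esub> m) (s + s')" "V = fr (x [^] s \<odot>\<^bsub>M\<^esub> m') (s + s')"
    using h fraction_expand[of m s s'] fraction_expand[of m' s' s] by (auto simp: add.commute)
  then show thesis by (rule that[rotated 2]) (use h x in auto)
qed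

lemma module_localization: "module R L"
proof (rule moduleI)
  have cl: "m \<in> carrier M \<Longrightarrow> fr m s \<in> carrier L" for m s unfolding loc_carrier by blast
  show "cring R" by (rule R.is_cring)
  show "abelian_group L"
  proof (rule abelian_groupI)
    fix U V assume UV: "U \<in> carrier L" "V \<in> carrier L"
    obtain m n s where h: "m \<in> carrier M" "n \<in> carrier M" "U = fr m s" "V = fr n s"
      using common_denominator[OF UV] by blast
    show c: "U \<oplus>\<^bsub>L\<^esub> V \<in> carrier L" using h by (simp add: loc_add_same cl)
    show "U \<oplus>\<^bsub>L\<^esub> V = V \<oplus>\<^bsub>L\<^esub> U" using h by (simp add: loc_add_same M.a_comm)
    fix W assume "W \<in> carrier L"
    then obtain p s' where w: "W = fr p s'" "p \<in> carrier M" unfolding loc_carrier by blast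
    have "U = fr (x [^] s' \<odot>\<^bsub>M\<^esub> m) (s + s')" "V = fr (x [^] s' \<odot>\<^bsub>M\<^esub> n) (s + s')" "W = fr (x [^] s \<odot>\<^bsub>M\<^esub> p) (s + s')"
      using h w fraction_expand[of m s s'] fraction_expand[of n s s'] fraction_expand[of p s' s] by (auto simp: add.commute)
    then show "U \<oplus>\<^bsub>L\<^esub> V \<oplus>\<^bsub>L\<^esub> W = U \<oplus>\<^bsub>L\<^esub> (V \<oplus>\<^bsub>L\<^esub> W)" using h w x by (simp add: loc_add_same M.a_assoc)
  next
    show "\<zero>\<^bsub>L\<^esub> \<in> carrier L" unfolding loc_zero[of 0] by (simp add: cl)
    fix U assume "U \<in> carrier L"
    then obtain m s where h: "U = fr m s" "m \<in> carrier M" unfolding loc_carrier by blast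
    show "\<zero>\<^bsub>L\<^esub> \<oplus>\<^bsub>L\<^esub> U = U" unfolding loc_zero[of s] using h by (simp add: loc_add_same)
    have "fr (\<ominus>\<^bsub>M\<^esub> m) s \<oplus>\<^bsub>L\<^esub> U = \<zero>\<^bsub>L\<^esub>" unfolding loc_zero[of s] using h by (simp add: loc_add_same M.l_neg)
    then show "\<exists>V\<in>carrier L. V \<oplus>\<^bsub>L\<^esub> U = \<zero>\<^bsub>L\<^esub>" using cl h by blast
  qed
  fix a b U assume ab: "a \<in> carrier R" "b \<in> carrier R" and U: "U \<in> carrier L"
  obtain m s where h: "U = fr m s" "m \<in> carrier M" using U unfolding loc_carrier by blast
  show "a \<odot>\<^bsub>L\<^esub> U \<in> carrier L" using h ab by (simp add: loc_smult cl)
  show "(a \<oplus> b) \<odot>\<^bsub>L\<^esub> U = a \<odot>\<^bsub>L\<^esub> U \<oplus>\<^bsub>L\<^esub> b \<odot>\<^bsub>L\<^esub> U" using h ab by (simp add: loc_smult loc_add_same smult_l_distr)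
  show "(a \<otimes> b) \<odot>\<^bsub>L\<^esub> U = a \<odot>\<^bsub>L\<^esub> (b \<odot>\<^bsub>L\<^esub> U)" using h ab by (simp add: loc_smult smult_assoc1)
  fix V assume V: "V \<in> carrier L"
  obtain m n s where h: "m \<in> carrier M" "n \<in> carrier M" "U = fr m s" "V = fr n s"
    using common_denominator[OF U V] by blast
  then show "a \<odot>\<^bsub>L\<^esub> (U \<oplus>\<^bsub>L\<^esub> V) = a \<odot>\<^bsub>L\<^esub> U \<oplus>\<^bsub>L\<^esub> a \<odot>\<^bsub>L\<^esub> V"
    using ab by (simp add: loc_smult loc_add_same smult_r_distr)
next
  fix U assume "U \<in> carrier L"
  then show "\<one> \<odot>\<^bsub>L\<^esub> U = U" using loc_smult unfolding loc_carrier by auto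
qed

lemma loc_finsum:
  assumes "finite J" "\<And>j. j \<in> J \<Longrightarrow> f j \<in> carrier M"
  shows "(\<Oplus>\<^bsub>L\<^esub>j\<in>J. fr (f j) s) = fr (\<Oplus>\<^bsub>M\<^esub>j\<in>J. f j) s"
proof -
  interpret L: module R L by (rule module_localization)
  show ?thesis using assms
  proof (induction J rule: finite_induct)
    case (insert j J)
    have "(\<Oplus>\<^bsub>L\<^esub>j\<in>insert j J. fr (f j) s) = fr (f j) s \<oplus>\<^bsub>L\<^esub> (\<Oplus>\<^bsub>L\<^esub>j\<in>J. fr (f j) s)"
      using insert by (intro L.finsum_insert) (auto simp: loc_carrier)
    also have "\<dots> = fr (f j \<oplus>\<^bsub>M\<^esub> (\<Oplus>\<^bsub>M\<^esub>j\<in>J. f j)) s"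
      using insert by (simp add: loc_add_same)
    also have "f j \<oplus>\<^bsub>M\<^esub> (\<Oplus>\<^bsub>M\<^esub>j\<in>J. f j) = (\<Oplus>\<^bsub>M\<^esub>j\<in>insert j J. f j)"
      using insert by (intro M.finsum_insert[symmetric]) auto
    finally show ?case .
  qed (simp add: loc_zero[of s])
qed

lemma loc_map_fraction:
  assumes "y \<in> carrier R" "m \<in> carrier M"
  shows "loc_map R M y (y \<otimes> x) (fr m s) = fraction R M (y \<otimes> x) (y [^] s \<odot>\<^bsub>M\<^esub> m) s"
  unfolding loc_map_def
proof (rule fraction_class_map[OF assms(2)])
  fix n p k assume n: "n \<in> carrier M" "x [^] (k + p) \<odot>\<^bsub>M\<^esub> m = x [^] (k + s) \<odot>\<^bsub>M\<^esub> n"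
  have *: "(y \<otimes> x) [^] (k + i) \<odot>\<^bsub>M\<^esub> (y [^] j \<odot>\<^bsub>M\<^esub> u) = y [^] (k + i + j) \<odot>\<^bsub>M\<^esub> (x [^] (k + i) \<odot>\<^bsub>M\<^esub> u)"
    if "u \<in> carrier M" for u and i j :: nat
  proof -
    have "(y \<otimes> x) [^] (k + i) \<otimes> y [^] j = y [^] (k + i + j) \<otimes> x [^] (k + i)"
      using x assms(1) by (simp add: R.nat_pow_distrib R.nat_pow_mult[symmetric] R.m_ac)
    then show ?thesis using x assms(1) that by (simp add: smult_assoc1[symmetric])
  qed
  have "(y \<otimes> x) [^] (k + s) \<odot>\<^bsub>M\<^esub> (y [^] p \<odot>\<^bsub>M\<^esub> n) = (y \<otimes> x) [^] (k + p) \<odot>\<^bsub>M\<^esub> (y [^] s \<odot>\<^bsub>M\<^esub> m)"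
    using *[OF n(1), of s p] *[OF assms(2), of p s] n(2) by (simp add: ac_simps)
  then show "fraction R M (y \<otimes> x) (y [^] p \<odot>\<^bsub>M\<^esub> n) p = fraction R M (y \<otimes> x) (y [^] s \<odot>\<^bsub>M\<^esub> m) s"
    using module.fraction_eq_iff[OF module_axioms] x assms n by (subst module.fraction_eq_iff[OF module_axioms]) auto
qed

lemma submodule_fractions:
  assumes "\<And>s. submodule (P s) R M" "\<And>m s k. m \<in> P s \<Longrightarrow> x [^] (k::nat) \<odot>\<^bsub>M\<^esub> m \<in> P (s + k)"
  shows "submodule {fr m s | m s. m \<in> P s} R L"
proof -
  interpret L: module R L by (rule module_localization)
  have PM: "m \<in> P s \<Longrightarrow> m \<in> carrier M" for m s using submodule_subset[OF assms(1)] .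
  show ?thesis
  proof (rule L.submoduleI')
    show "{fr m s | m s. m \<in> P s} \<subseteq> carrier L" unfolding loc_carrier using PM by blast
    show "\<zero>\<^bsub>L\<^esub> \<in> {fr m s | m s. m \<in> P s}" unfolding loc_zero[of 0] using submodule_zero[OF assms(1)] by blast
  next
    fix U V assume "U \<in> {fr m s | m s. m \<in> P s}" "V \<in> {fr m s | m s. m \<in> P s}"
    then obtain m s m' s' where h: "U = fr m s" "m \<in> P s" "V = fr m' s'" "m' \<in> P s'" by blast
    have "x [^] s' \<odot>\<^bsub>M\<^esub> m \<oplus>\<^bsub>M\<^esub> x [^] s \<odot>\<^bsub>M\<^esub> m' \<in> P (s + s')"
      using assms(2)[OF h(2), of s'] assms(2)[OF h(4), of s] submoduleE(5)[OF assms(1)] by (simp add: add.commute)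
    then show "U \<oplus>\<^bsub>L\<^esub> V \<in> {fr m s | m s. m \<in> P s}" using h PM by (auto simp: loc_add)
  next
    fix r U assume r: "r \<in> carrier R" and "U \<in> {fr m s | m s. m \<in> P s}"
    then obtain m s where h: "U = fr m s" "m \<in> P s" by blast
    then have "r \<odot>\<^bsub>L\<^esub> U = fr (r \<odot>\<^bsub>M\<^esub> m) s" using r PM by (simp add: loc_smult)
    then show "r \<odot>\<^bsub>L\<^esub> U \<in> {fr m s | m s. m \<in> P s}" using submoduleE(4)[OF assms(1) r h(2)] by blast
  qed
qed

text \<open>The module \<open>\<qq> ^ n M[\<qq> ^ e / x]\<close> is the degree \<open>n\<close> part of a localized Rees module.\<close>

lemma ideal_smult_adjoin_fractions:
  assumes I: "ideal I R" and xe: "x \<in> ideal_power R I e"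
  shows "ideal_smult L (ideal_power R I n) (adjoin_fractions R M I e x) =
    {fr m s | m s. m \<in> qpow I (n + e * s)}"
proof
  interpret L: module R L by (rule module_localization)
  let ?H = "{fr m s | m s. m \<in> qpow I (n + e * s)}" and ?A = "adjoin_fractions R M I e x"
  have sH: "submodule ?H R L"
  proof (rule submodule_fractions)
    show "submodule (qpow I (n + e * s)) R M" for s by (rule submodule_qpow[OF I])
    show "x [^] k \<odot>\<^bsub>M\<^esub> m \<in> qpow I (n + e * (s + k))" if "m \<in> qpow I (n + e * s)" for m s k
      using qpow_smult[OF I R.pow_in_ideal_power[OF I xe, of k] that] by (simp add: algebra_simps)
  qed
  have Ic: "r \<in> ideal_power R I k \<Longrightarrow> r \<in> carrier R" for r k
    using R.ideal_power_ideal[OF I] ideal.Icarr by metis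
  show "ideal_smult L (ideal_power R I n) ?A \<subseteq> ?H"
  proof (rule L.ideal_smult_subset[OF sH])
    fix r U assume r: "r \<in> ideal_power R I n" and "U \<in> ?A"
    then obtain s m q where h: "U = fr (m 0) 0 \<oplus>\<^bsub>L\<^esub> (\<Oplus>\<^bsub>L\<^esub>i\<in>{1..s}. fr (q i \<odot>\<^bsub>M\<^esub> m i) i)"
      "\<And>i. i \<in> {0..s} \<Longrightarrow> m i \<in> carrier M" "\<And>i. i \<in> {1..s} \<Longrightarrow> q i \<in> ideal_power R I (e * i)"
      unfolding adjoin_fractions_def by blast
    let ?K = "{U \<in> carrier L. r \<odot>\<^bsub>L\<^esub> U \<in> ?H}"
    have K: "submodule ?K R L" by (intro L.submodule_colon L.carrier_is_submodule sH Ic[OF r])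
    have "fr (m 0) 0 \<in> ?K"
    proof -
      have m0: "m 0 \<in> carrier M" using h(2) by simp
      have "r \<odot>\<^bsub>M\<^esub> m 0 \<in> qpow I (n + e * 0)" using qpow_gen[OF I r m0] by simp
      then show ?thesis using m0 loc_smult[OF Ic[OF r] m0] unfolding loc_carrier by blast
    qed
    moreover have "(\<Oplus>\<^bsub>L\<^esub>i\<in>{1..s}. fr (q i \<odot>\<^bsub>M\<^esub> m i) i) \<in> ?K"
    proof (rule L.finsum_in_submodule[OF K])
      fix i assume i: "i \<in> {1..s}"
      then have mi: "m i \<in> carrier M" "q i \<in> carrier R" using h(2,3) Ic by auto
      have "r \<otimes> q i \<in> ideal_power R I (n + e * i)" by (rule R.ideal_power_mult[OF I r h(3)[OF i]])
      then have "r \<odot>\<^bsub>M\<^esub> (q i \<odot>\<^bsub>M\<^esub> m i) \<in> qpow I (n + e * i)"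
        using qpow_gen[OF I _ mi(1)] mi Ic[OF r] by (simp add: smult_assoc1[symmetric])
      then show "fr (q i \<odot>\<^bsub>M\<^esub> m i) i \<in> ?K"
        using mi loc_smult[OF Ic[OF r], of "q i \<odot>\<^bsub>M\<^esub> m i" i] unfolding loc_carrier by auto
    qed simp
    ultimately have "U \<in> ?K" unfolding h(1) using L.submoduleE(5)[OF K] by blast
    then show "r \<odot>\<^bsub>L\<^esub> U \<in> ?H" by blast
  qed
  have Asub: "?A \<subseteq> carrier L"
  proof
    fix U assume "U \<in> ?A"
    then obtain s m q where h: "U = fr (m 0) 0 \<oplus>\<^bsub>L\<^esub> (\<Oplus>\<^bsub>L\<^esub>i\<in>{1..s}. fr (q i \<odot>\<^bsub>M\<^esub> m i) i)"
      "\<And>i. i \<in> {0..s} \<Longrightarrow> m i \<in> carrier M" "\<And>i. i \<in> {1..s} \<Longrightarrow> q i \<in> ideal_power R I (e * i)"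
      unfolding adjoin_fractions_def by blast
    have "fr (m 0) 0 \<in> carrier L" using h(2)[of 0] unfolding loc_carrier by auto
    moreover have "(\<Oplus>\<^bsub>L\<^esub>i\<in>{1..s}. fr (q i \<odot>\<^bsub>M\<^esub> m i) i) \<in> carrier L"
    proof (rule L.finsum_closed, rule Pi_I)
      fix i assume i: "i \<in> {1..s}"
      then have "q i \<odot>\<^bsub>M\<^esub> m i \<in> carrier M" using h(2)[of i] Ic[OF h(3)[OF i]] by auto
      then show "fr (q i \<odot>\<^bsub>M\<^esub> m i) i \<in> carrier L" unfolding loc_carrier by blast
    qed
    ultimately show "U \<in> carrier L" unfolding h(1) by simp
  qed
  let ?T = "ideal_smult L (ideal_power R I n) ?A"
  have sT: "submodule ?T R L"
    using R.ideal_power_ideal[OF I, of n] Asub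
    by (intro L.submodule_ideal_smult) (auto intro: ideal.I_l_closed Ic)
  show "?H \<subseteq> ?T"
  proof
    fix U assume "U \<in> ?H"
    then obtain m s where h: "U = fr m s" "m \<in> qpow I (n + e * s)" by blast
    \<comment> \<open>The numerators over \<open>x [^] s\<close> that give elements of the left hand
      side form a submodule, so only generators of \<open>qpow\<close> have to be tested.\<close>
    let ?P = "{m \<in> carrier M. fr m s \<in> ?T}"
    have sP: "submodule ?P R M"
    proof (rule submoduleI')
      show "\<zero>\<^bsub>M\<^esub> \<in> ?P" using L.submodule_zero[OF sT] loc_zero[of s] by simp
    next
      fix u v assume uv: "u \<in> ?P" "v \<in> ?P"
      then have "fr u s \<oplus>\<^bsub>L\<^esub> fr v s \<in> ?T" using L.submoduleE(5)[OF sT] by blast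
      then show "u \<oplus>\<^bsub>M\<^esub> v \<in> ?P" using uv loc_add_same[of u v s] by simp
    next
      fix r u assume r: "r \<in> carrier R" and u: "u \<in> ?P"
      then have "r \<odot>\<^bsub>L\<^esub> fr u s \<in> ?T" using L.submoduleE(4)[OF sT r] by blast
      then show "r \<odot>\<^bsub>M\<^esub> u \<in> ?P" using u r loc_smult[OF r, of u s] by simp
    qed blast
    have adj: "fr (y \<odot>\<^bsub>M\<^esub> u) s \<in> ?A" if y: "y \<in> ideal_power R I (e * s)" and u: "u \<in> carrier M" for y u
    proof (cases "s = 0")
      \<comment> \<open>In \<open>adjoin_fractions\<close> the term with denominator 1 has no
        coefficient \<open>q\<close>, so for \<open>s = 0\<close> the scalar \<open>y\<close> is
        absorbed into \<open>m 0\<close>.\<close>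
      case True
      have yL: "fr (y \<odot>\<^bsub>M\<^esub> u) 0 \<in> carrier L" using Ic[OF y] u unfolding loc_carrier by auto
      have "fr (y \<odot>\<^bsub>M\<^esub> u) 0 = fr (y \<odot>\<^bsub>M\<^esub> u) 0 \<oplus>\<^bsub>L\<^esub> (\<Oplus>\<^bsub>L\<^esub>i\<in>{1..0}. fr (y \<odot>\<^bsub>M\<^esub> (y \<odot>\<^bsub>M\<^esub> u)) i)"
        using yL by simp
      then show ?thesis unfolding adjoin_fractions_def True
        using Ic[OF y] u by (intro CollectI exI[of _ "0::nat"] exI[of _ "\<lambda>_. y \<odot>\<^bsub>M\<^esub> u"] exI[of _ "\<lambda>_. y"]) auto
    next
      case False
      \<comment> \<open>A single fraction is a sum in which all other coefficients are zero.\<close>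
      let ?q = "\<lambda>i. if s = i then y else \<zero>"
      have yu: "y \<odot>\<^bsub>M\<^esub> u \<in> carrier M" using Ic[OF y] u by simp
      have yL: "fr (y \<odot>\<^bsub>M\<^esub> u) i \<in> carrier L" for i using yu unfolding loc_carrier by blast
      have "(\<Oplus>\<^bsub>L\<^esub>i\<in>{1..s}. fr (?q i \<odot>\<^bsub>M\<^esub> (if i = 0 then \<zero>\<^bsub>M\<^esub> else u)) i) =
          (\<Oplus>\<^bsub>L\<^esub>i\<in>{1..s}. if s = i then fr (y \<odot>\<^bsub>M\<^esub> u) i else \<zero>\<^bsub>L\<^esub>)"
        using u yL by (intro L.finsum_cong') (auto simp: loc_zero[symmetric])
      also have "\<dots> = fr (y \<odot>\<^bsub>M\<^esub> u) s"
        using False yL by (intro L.finsum_singleton) auto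
      finally have "fr (y \<odot>\<^bsub>M\<^esub> u) s =
          fr \<zero>\<^bsub>M\<^esub> 0 \<oplus>\<^bsub>L\<^esub> (\<Oplus>\<^bsub>L\<^esub>i\<in>{1..s}. fr (?q i \<odot>\<^bsub>M\<^esub> (if i = 0 then \<zero>\<^bsub>M\<^esub> else u)) i)"
        using yL[of s] by (simp add: loc_zero[symmetric])
      then show ?thesis unfolding adjoin_fractions_def
        using y u additive_subgroup.zero_closed[OF ideal.axioms(1)[OF R.ideal_power_ideal[OF I]]]
        by (intro CollectI exI[of _ s] exI[of _ "\<lambda>i. if i = 0 then \<zero>\<^bsub>M\<^esub> else u"] exI[of _ ?q]) auto
    qed
    have "qpow I (n + e * s) \<subseteq> ?P" unfolding qpow_def
    proof (rule ideal_smult_subset[OF sP])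
      fix r u assume r: "r \<in> ideal_power R I (n + e * s)" and u: "u \<in> carrier M"
      show "r \<odot>\<^bsub>M\<^esub> u \<in> ?P"
      proof (rule ideal_prod_into_submodule[OF sP u R.ideal_power_ideal[OF I] R.ideal_power_ideal[OF I]])
        show "r \<in> ideal_power R I n \<cdot> ideal_power R I (e * s)" using r R.ideal_power_add[OF I] by simp
        fix z y assume z: "z \<in> ideal_power R I n" and y: "y \<in> ideal_power R I (e * s)"
        have yu: "y \<odot>\<^bsub>M\<^esub> u \<in> carrier M" using Ic[OF y] u by simp
        have "z \<odot>\<^bsub>L\<^esub> fr (y \<odot>\<^bsub>M\<^esub> u) s \<in> ?T" unfolding ideal_smult_def
          using z adj[OF y u] by (intro generate.incl) blast
        then show "z \<odot>\<^bsub>M\<^esub> (y \<odot>\<^bsub>M\<^esub> u) \<in> ?P" using loc_smult[OF Ic[OF z] yu] Ic[OF z] yu by simp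
      qed
    qed
    then show "U \<in> ?T" using h by blast
  qed
qed

end

end

section \<open>The Cech complex in terms of numerators\<close>

lemma module_prod:
  assumes R: "cring R" and N: "\<And>i. i \<in> I \<Longrightarrow> module R (N i)"
  shows "module R (prod_module I N)"
proof -
  interpret R: cring R by fact
  have z: "i \<in> I \<Longrightarrow> \<zero>\<^bsub>N i\<^esub> \<in> carrier (N i)" for i
    using N module.axioms(2) abelian_group.axioms(1) abelian_monoid.zero_closed by blast
  show ?thesis
  proof (rule moduleI[OF R])
    show "abelian_group (prod_module I N)"
    proof (rule abelian_groupI)
      fix f g assume f: "f \<in> carrier (prod_module I N)" and g: "g \<in> carrier (prod_module I N)"
      have fg: "f i \<in> carrier (N i)" "g i \<in> carrier (N i)" if "i \<in> I" for i
        using f g that unfolding prod_module_def by auto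
      show "f \<oplus>\<^bsub>prod_module I N\<^esub> g \<in> carrier (prod_module I N)"
        using fg abelian_groupE(1)[OF module.axioms(2)[OF N]] unfolding prod_module_def by auto
      show "f \<oplus>\<^bsub>prod_module I N\<^esub> g = g \<oplus>\<^bsub>prod_module I N\<^esub> f"
        using fg abelian_groupE(4)[OF module.axioms(2)[OF N]] unfolding prod_module_def
        by (auto intro!: restrict_ext)
      fix h assume h: "h \<in> carrier (prod_module I N)"
      have "h i \<in> carrier (N i)" if "i \<in> I" for i using h that unfolding prod_module_def by auto
      then show "f \<oplus>\<^bsub>prod_module I N\<^esub> g \<oplus>\<^bsub>prod_module I N\<^esub> h = f \<oplus>\<^bsub>prod_module I N\<^esub> (g \<oplus>\<^bsub>prod_module I N\<^esub> h)"
        using fg abelian_groupE(3)[OF module.axioms(2)[OF N]] unfolding prod_module_def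
        by (auto intro!: restrict_ext)
    next
      show "\<zero>\<^bsub>prod_module I N\<^esub> \<in> carrier (prod_module I N)" using z unfolding prod_module_def by auto
      fix f assume f: "f \<in> carrier (prod_module I N)"
      have fi: "f i \<in> carrier (N i)" if "i \<in> I" for i using f that unfolding prod_module_def by auto
      have "f = (\<lambda>i\<in>I. f i)" using f unfolding prod_module_def by (auto simp: PiE_def extensional_restrict)
      moreover have "(\<lambda>i\<in>I. (\<lambda>i\<in>I. \<zero>\<^bsub>N i\<^esub>) i \<oplus>\<^bsub>N i\<^esub> f i) = (\<lambda>i\<in>I. f i)"
        using fi abelian_groupE(5)[OF module.axioms(2)[OF N]] by (auto intro!: restrict_ext)
      ultimately show "\<zero>\<^bsub>prod_module I N\<^esub> \<oplus>\<^bsub>prod_module I N\<^esub> f = f" unfolding prod_module_def by simp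
      have "\<forall>i\<in>I. \<exists>y. y \<in> carrier (N i) \<and> y \<oplus>\<^bsub>N i\<^esub> f i = \<zero>\<^bsub>N i\<^esub>"
        using fi abelian_groupE(6)[OF module.axioms(2)[OF N]] by blast
      then obtain y where "\<forall>i\<in>I. y i \<in> carrier (N i) \<and> y i \<oplus>\<^bsub>N i\<^esub> f i = \<zero>\<^bsub>N i\<^esub>"
        by (rule bchoice[THEN exE])
      then show "\<exists>g\<in>carrier (prod_module I N). g \<oplus>\<^bsub>prod_module I N\<^esub> f = \<zero>\<^bsub>prod_module I N\<^esub>"
        unfolding prod_module_def by (intro bexI[of _ "\<lambda>i\<in>I. y i"]) (auto intro!: restrict_ext)
    qed
  next
    fix r s f assume r: "r \<in> carrier R" "s \<in> carrier R" and f: "f \<in> carrier (prod_module I N)"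
    have fi: "f i \<in> carrier (N i)" if "i \<in> I" for i using f that unfolding prod_module_def by auto
    show "r \<odot>\<^bsub>prod_module I N\<^esub> f \<in> carrier (prod_module I N)"
      using fi r module.smult_closed[OF N] unfolding prod_module_def by auto
    show "(r \<oplus>\<^bsub>R\<^esub> s) \<odot>\<^bsub>prod_module I N\<^esub> f = r \<odot>\<^bsub>prod_module I N\<^esub> f \<oplus>\<^bsub>prod_module I N\<^esub> s \<odot>\<^bsub>prod_module I N\<^esub> f"
      using fi r module.smult_l_distr[OF N] unfolding prod_module_def by (auto intro!: restrict_ext)
    show "(r \<otimes>\<^bsub>R\<^esub> s) \<odot>\<^bsub>prod_module I N\<^esub> f = r \<odot>\<^bsub>prod_module I N\<^esub> (s \<odot>\<^bsub>prod_module I N\<^esub> f)"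
      using fi r module.smult_assoc1[OF N] unfolding prod_module_def by (auto intro!: restrict_ext)
    fix g assume g: "g \<in> carrier (prod_module I N)"
    have "g i \<in> carrier (N i)" if "i \<in> I" for i using g that unfolding prod_module_def by auto
    then show "r \<odot>\<^bsub>prod_module I N\<^esub> (f \<oplus>\<^bsub>prod_module I N\<^esub> g) =
        r \<odot>\<^bsub>prod_module I N\<^esub> f \<oplus>\<^bsub>prod_module I N\<^esub> r \<odot>\<^bsub>prod_module I N\<^esub> g"
      using fi r module.smult_r_distr[OF N] unfolding prod_module_def by (auto intro!: restrict_ext)
  next
    fix f assume f: "f \<in> carrier (prod_module I N)"
    have fi: "f i \<in> carrier (N i)" if "i \<in> I" for i using f that unfolding prod_module_def by auto
    have "f = (\<lambda>i\<in>I. f i)" using f unfolding prod_module_def by (auto simp: PiE_def extensional_restrict)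
    moreover have "(\<lambda>i\<in>I. \<one>\<^bsub>R\<^esub> \<odot>\<^bsub>N i\<^esub> f i) = (\<lambda>i\<in>I. f i)"
      using fi module.smult_one[OF N] by (auto intro!: restrict_ext)
    ultimately show "\<one>\<^bsub>R\<^esub> \<odot>\<^bsub>prod_module I N\<^esub> f = f" unfolding prod_module_def by simp
  qed
qed

text \<open>The Koszul constructions take a family on all natural numbers; it agrees with the list
  on the valid indices.\<close>

locale cech = koszul +
  fixes al :: "'a list"
  assumes nth_al: "\<And>j. j < length al \<Longrightarrow> a j = al ! j"
begin

abbreviation t where "t \<equiv> length al"
abbreviation C where "C \<equiv> cech_term R al M"
abbreviation D where "D \<equiv> cech_sub R al M"
abbreviation cd where "cd \<equiv> cech_diff R al M"
abbreviation \<qq> where "\<qq> \<equiv> Idl (set al)"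

lemma set_al: "set al = a ` {..<t}"
  using nth_al by (auto simp: in_set_conv_nth image_iff)

lemma ideal_q: "ideal \<qq> R"
  unfolding set_al by (rule R.genideal_ideal) auto

lemma index_iff: "J \<in> cech_index al i \<longleftrightarrow> J \<subseteq> {..<t} \<and> card J = i"
  unfolding cech_index_def by simp

lemma finite_index: "finite (cech_index al i)"
  unfolding cech_index_def by (rule finite_subset[of _ "Pow {..<t}"]) auto

lemma cech_elt_eq: "J \<subseteq> {..<t} \<Longrightarrow> cech_elt R al J = px J"
  unfolding cech_elt_def using nth_al by (intro R.finprod_cong') auto

lemma px_remove: "J \<subseteq> {..<t} \<Longrightarrow> j \<in> J \<Longrightarrow> px J = a j \<otimes> px (J - {j})"
  using px_insert[of "J - {j}" j] fin_sub[of J t] by (simp add: insert_absorb)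

lemma px_in_q: "J \<subseteq> {..<t} \<Longrightarrow> px J \<in> ideal_power R \<qq> (card J)"
proof -
  assume "J \<subseteq> {..<t}"
  then have "finite J" "J \<subseteq> {..<t}" using fin_sub by auto
  then show ?thesis
  proof (induction J rule: finite_induct)
    case (insert j J)
    have "a j \<in> ideal_power R \<qq> 1"
      using R.ideal_power_1[OF ideal_q] R.genideal_self[of "set al"] insert.prems set_al by auto
    then have "a j \<otimes> px J \<in> ideal_power R \<qq> (1 + card J)"
      using insert by (intro R.ideal_power_mult[OF ideal_q]) auto
    then show ?case using insert.hyps by (simp add: px_insert)
  qed (simp add: R.ideal_power_0)
qed

abbreviation Lc :: "nat set \<Rightarrow> ('a, ('c \<times> nat) set) module" where "Lc J \<equiv> localization R M (px J)"

lemma module_loc_px: "Module.module R (Lc J)"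
  by (rule module_localization) simp

lemma cech_term_eq: "C i = prod_module (cech_index al i) Lc"
  unfolding cech_term_def prod_module_def using cech_elt_eq index_iff
  by (auto simp: fun_eq_iff intro!: restrict_ext PiE_cong)

lemma module_cech_term: "Module.module R (C i)"
  unfolding cech_term_eq by (rule module_prod[OF R.is_cring module_loc_px])

definition cfam :: "nat \<Rightarrow> nat \<Rightarrow> (nat set \<Rightarrow> 'c) \<Rightarrow> nat set \<Rightarrow> ('c \<times> nat) set"
  where "cfam i s m = (\<lambda>J\<in>cech_index al i. fraction R M (px J) (m J) s)"

lemma cfam_carrier: "coch t i m \<Longrightarrow> cfam i s m \<in> carrier (C i)"
  unfolding cech_term_eq prod_module_def cfam_def using index_iff cochD(1)[of t i m]
  by (auto simp: loc_carrier)

lemma cfam_add: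
  "coch t i m \<Longrightarrow> coch t i m' \<Longrightarrow> cfam i s m \<oplus>\<^bsub>C i\<^esub> cfam i s m' = cfam i s (\<lambda>J. m J \<oplus>\<^bsub>M\<^esub> m' J)"
  unfolding cech_term_eq prod_module_def cfam_def using index_iff cochD(1)[of t i m] cochD(1)[of t i m']
  by (auto simp: loc_add_same intro!: restrict_ext)

lemma cfam_smult:
  "r \<in> carrier R \<Longrightarrow> coch t i m \<Longrightarrow> r \<odot>\<^bsub>C i\<^esub> cfam i s m = cfam i s (\<lambda>J. r \<odot>\<^bsub>M\<^esub> m J)"
  unfolding cech_term_eq prod_module_def cfam_def using index_iff cochD(1)[of t i m]
  by (auto simp: loc_smult intro!: restrict_ext)

lemma cfam_lift: "coch t i m \<Longrightarrow> cfam i s m = cfam i (s + k) (lift k m)"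
  unfolding cfam_def koszul_lift_def using index_iff cochD(1)[of t i m]
  by (auto simp: fraction_expand[symmetric] intro!: restrict_ext)

lemma cfam_cong: "(\<And>J. J \<subseteq> {..<t} \<Longrightarrow> m J = m' J) \<Longrightarrow> cfam i s m = cfam i s m'"
  unfolding cfam_def using index_iff by (auto intro!: restrict_ext)

lemma cfam_minus:
  assumes "coch t i m" "coch t i m'"
  shows "cfam i s m \<ominus>\<^bsub>C i\<^esub> cfam i s m' = cfam i s (\<lambda>J. m J \<ominus>\<^bsub>M\<^esub> m' J)"
proof -
  interpret Ci: module R "C i" by (rule module_cech_term)
  have "cfam i s m \<ominus>\<^bsub>C i\<^esub> cfam i s m' = cfam i s m \<oplus>\<^bsub>C i\<^esub> (\<ominus> \<one>) \<odot>\<^bsub>C i\<^esub> cfam i s m'"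
    using cfam_carrier[OF assms(2)] by (simp add: a_minus_def Ci.smult_l_minus)
  also have "\<dots> = cfam i s (\<lambda>J. m J \<oplus>\<^bsub>M\<^esub> (\<ominus> \<one>) \<odot>\<^bsub>M\<^esub> m' J)"
    using assms by (simp add: cfam_smult cfam_add coch_smult)
  also have "\<dots> = cfam i s (\<lambda>J. m J \<ominus>\<^bsub>M\<^esub> m' J)"
    using cochD(1)[OF assms(2)] by (intro cfam_cong) (simp add: a_minus_def smult_l_minus)
  finally show ?thesis .
qed

lemma cfam_zero_iff:
  assumes m: "coch t i m"
  shows "cfam i s m = \<zero>\<^bsub>C i\<^esub> \<longleftrightarrow> (\<exists>k. \<forall>J\<subseteq>{..<t}. lift k m J = \<zero>\<^bsub>M\<^esub>)"
proof -
  have z: "\<zero>\<^bsub>C i\<^esub> = (\<lambda>J\<in>cech_index al i. \<zero>\<^bsub>Lc J\<^esub>)" unfolding cech_term_eq prod_module_def by simp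
  have "cfam i s m = \<zero>\<^bsub>C i\<^esub> \<longleftrightarrow> (\<forall>J\<in>cech_index al i. fraction R M (px J) (m J) s = \<zero>\<^bsub>Lc J\<^esub>)"
    unfolding z cfam_def by (auto simp: fun_eq_iff restrict_def split: if_splits)
  also have "\<dots> \<longleftrightarrow> (\<forall>J\<in>cech_index al i. \<exists>k::nat. px J [^] k \<odot>\<^bsub>M\<^esub> m J = \<zero>\<^bsub>M\<^esub>)"
    using fraction_zero_iff[OF px_closed] cochD(1)[OF m] index_iff by simp
  also have "\<dots> \<longleftrightarrow> (\<exists>k. \<forall>J\<subseteq>{..<t}. lift k m J = \<zero>\<^bsub>M\<^esub>)"
  proof
    assume "\<forall>J\<in>cech_index al i. \<exists>k::nat. px J [^] k \<odot>\<^bsub>M\<^esub> m J = \<zero>\<^bsub>M\<^esub>"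
    then obtain k :: "nat set \<Rightarrow> nat" where k: "\<forall>J\<in>cech_index al i. px J [^] k J \<odot>\<^bsub>M\<^esub> m J = \<zero>\<^bsub>M\<^esub>"
      by (rule bchoice[THEN exE])
    \<comment> \<open>The sum bounds each of the finitely many exponents, so it serves as a common
      one.\<close>
    define K where "K = sum k (cech_index al i)"
    have "lift K m J = \<zero>\<^bsub>M\<^esub>" if J: "J \<subseteq> {..<t}" for J
    proof (cases "card J = i")
      case True
      then have Ji: "J \<in> cech_index al i" using J index_iff by simp
      have "k J \<le> K" unfolding K_def using Ji finite_index by (intro member_le_sum) auto
      then show ?thesis unfolding koszul_lift_def
        using k Ji smult_pow_zero_mono[OF px_closed cochD(1)[OF m J]] by blast
    next
      case False
      then show ?thesis using cochD(2)[OF m J] by (simp add: koszul_lift_def)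
    qed
    then show "\<exists>k. \<forall>J\<subseteq>{..<t}. lift k m J = \<zero>\<^bsub>M\<^esub>" by blast
  next
    assume "\<exists>k. \<forall>J\<subseteq>{..<t}. lift k m J = \<zero>\<^bsub>M\<^esub>"
    then obtain k where k: "\<forall>J\<subseteq>{..<t}. lift k m J = \<zero>\<^bsub>M\<^esub>" ..
    show "\<forall>J\<in>cech_index al i. \<exists>k::nat. px J [^] k \<odot>\<^bsub>M\<^esub> m J = \<zero>\<^bsub>M\<^esub>"
    proof
      fix J assume "J \<in> cech_index al i"
      then have "px J [^] k \<odot>\<^bsub>M\<^esub> m J = \<zero>\<^bsub>M\<^esub>" using k by (simp add: index_iff koszul_lift_def)
      then show "\<exists>k::nat. px J [^] k \<odot>\<^bsub>M\<^esub> m J = \<zero>\<^bsub>M\<^esub>" ..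
    qed
  qed
  finally show ?thesis .
qed

text \<open>Finitely many fractions have a common denominator exponent. The sets
  \<open>P s J\<close> prescribe where numerators lie; they are instantiated with all of
  \<open>M\<close> and with the parts of the Rees module.\<close>

lemma cfam_exists_aux:
  assumes "\<And>J. J \<in> cech_index al i \<Longrightarrow> \<exists>m s. m \<in> P s J \<and> u J = fraction R M (px J) m s"
    and "u \<in> extensional (cech_index al i)" and P: "\<And>s J m. m \<in> P s J \<Longrightarrow> m \<in> carrier M"
    "\<And>s k J m. J \<in> cech_index al i \<Longrightarrow> m \<in> P s J \<Longrightarrow> px J [^] (k::nat) \<odot>\<^bsub>M\<^esub> m \<in> P (s + k) J"
  obtains s m where "coch t i m" "u = cfam i s m" "\<And>J. J \<in> cech_index al i \<Longrightarrow> m J \<in> P s J"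
proof -
  have "\<forall>J\<in>cech_index al i. \<exists>p. fst p \<in> P (snd p) J \<and> u J = fraction R M (px J) (fst p) (snd p)"
    using assms(1) by fastforce
  then obtain p where p: "\<forall>J\<in>cech_index al i. fst (p J) \<in> P (snd (p J)) J \<and>
      u J = fraction R M (px J) (fst (p J)) (snd (p J))"
    by (rule bchoice[THEN exE])
  define s where "s = (\<Sum>J\<in>cech_index al i. snd (p J))"
  define m where "m J = (if J \<in> cech_index al i then px J [^] (s - snd (p J)) \<odot>\<^bsub>M\<^esub> fst (p J) else \<zero>\<^bsub>M\<^esub>)" for J
  have le: "snd (p J) \<le> s" if "J \<in> cech_index al i" for J
    unfolding s_def using that finite_index by (intro member_le_sum) auto
  have mP: "m J \<in> P s J" if J: "J \<in> cech_index al i" for J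
    using P(2)[OF J, of "fst (p J)" "snd (p J)" "s - snd (p J)"] p J le[OF J] unfolding m_def by simp
  have "coch t i m" unfolding coch_def
    using mP P(1) index_iff unfolding m_def by auto
  moreover have "u = cfam i s m"
  proof (rule extensionalityI[OF assms(2)])
    show "cfam i s m \<in> extensional (cech_index al i)" unfolding cfam_def by simp
    fix J assume J: "J \<in> cech_index al i"
    then have c: "fst (p J) \<in> carrier M" using p P(1) by blast
    have "u J = fraction R M (px J) (fst (p J)) (snd (p J))" using p J by blast
    also have "\<dots> = fraction R M (px J) (m J) s"
      using fraction_expand[OF px_closed c, of J "snd (p J)" "s - snd (p J)"] le[OF J] J unfolding m_def by simp
    finally show "u J = cfam i s m J" unfolding cfam_def using J by simp
  qed
  ultimately show thesis using that mP by blast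
qed

lemma cfam_exists:
  assumes "u \<in> carrier (C i)"
  obtains s m where "coch t i m" "u = cfam i s m"
proof (rule cfam_exists_aux[of i "\<lambda>s J. carrier M" u])
  show "\<exists>m s. m \<in> carrier M \<and> u J = fraction R M (px J) m s" if "J \<in> cech_index al i" for J
  proof -
    have "u J \<in> carrier (Lc J)" using assms that unfolding cech_term_eq prod_module_def by auto
    then show ?thesis unfolding loc_carrier[OF px_closed] by blast
  qed
  show "u \<in> extensional (cech_index al i)" using assms unfolding cech_term_eq prod_module_def by (auto simp: PiE_def)
qed (use that in auto)

lemma cfam_exists2:
  assumes "u \<in> carrier (C i)" "v \<in> carrier (C i)"
  obtains s m m' where "coch t i m" "coch t i m'" "u = cfam i s m" "v = cfam i s m'"
proof -
  obtain s m where h: "coch t i m" "u = cfam i s m" using cfam_exists[OF assms(1)] by blast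
  obtain s' m' where h': "coch t i m'" "v = cfam i s' m'" using cfam_exists[OF assms(2)] by blast
  show thesis
  proof (rule that)
    show "coch t i (lift s' m)" "coch t i (lift s m')" using coch_lift h h' by auto
    show "u = cfam i (s + s') (lift s' m)" using h cfam_lift by simp
    show "v = cfam i (s + s') (lift s m')" using h' cfam_lift[OF h'(1), of s' s] by (simp add: add.commute)
  qed
qed

text \<open>The localization map from \<open>J - {j}\<close> to \<open>J\<close> multiplies the
  numerator by \<open>a j [^] s\<close>, which is the coefficient in the Koszul differential at the
  same exponent.\<close>

lemma cech_diff_cfam:
  assumes m: "coch t i m"
  shows "cd i (cfam i s m) = cfam (Suc i) s (d s m)"
  unfolding cech_diff_def cfam_def[of "Suc i"]
proof (rule restrict_ext)
  fix J assume "J \<in> cech_index al (Suc i)"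
  then have J: "J \<subseteq> {..<t}" "card J = Suc i" using index_iff by auto
  interpret L: module R "Lc J" by (rule module_loc_px)
  have fin: "finite J" using fin_sub[OF J(1)] .
  have mc: "m (J - {j}) \<in> carrier M" for j using J(1) by (intro cochD(1)[OF m]) auto
  have "(\<Oplus>\<^bsub>Lc J\<^esub>j\<in>J. sg (card {l \<in> J. l < j}) \<odot>\<^bsub>Lc J\<^esub> loc_map R M (al ! j) (px J) (cfam i s m (J - {j}))) =
      (\<Oplus>\<^bsub>Lc J\<^esub>j\<in>J. fraction R M (px J) ((sg (card {l \<in> J. l < j}) \<otimes> a j [^] s) \<odot>\<^bsub>M\<^esub> m (J - {j})) s)"
  proof (rule L.finsum_cong'[OF refl])
    show "(\<lambda>j. fraction R M (px J) ((sg (card {l \<in> J. l < j}) \<otimes> a j [^] s) \<odot>\<^bsub>M\<^esub> m (J - {j})) s) \<in> J \<rightarrow> carrier (Lc J)"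
      using mc by (auto simp: loc_carrier)
    fix j assume j: "j \<in> J"
    have "J - {j} \<in> cech_index al i" using j J fin index_iff by (auto simp: card_Diff_singleton)
    then have "loc_map R M (al ! j) (px J) (cfam i s m (J - {j})) =
        loc_map R M (a j) (a j \<otimes> px (J - {j})) (fraction R M (px (J - {j})) (m (J - {j})) s)"
      using nth_al[of j] j J px_remove[OF J(1) j] unfolding cfam_def by auto
    also have "\<dots> = fraction R M (px J) (a j [^] s \<odot>\<^bsub>M\<^esub> m (J - {j})) s"
      unfolding px_remove[OF J(1) j] by (rule loc_map_fraction[OF px_closed a_closed mc])
    finally show "sg (card {l \<in> J. l < j}) \<odot>\<^bsub>Lc J\<^esub> loc_map R M (al ! j) (px J) (cfam i s m (J - {j})) =
        fraction R M (px J) ((sg (card {l \<in> J. l < j}) \<otimes> a j [^] s) \<odot>\<^bsub>M\<^esub> m (J - {j})) s"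
      using mc by (simp add: loc_smult smult_assoc1)
  qed
  also have "\<dots> = fraction R M (px J) (d s m J) s"
    unfolding koszul_diff_def using mc by (intro loc_finsum[OF px_closed fin]) auto
  finally show "(\<Oplus>\<^bsub>localization R M (cech_elt R al J)\<^esub>j\<in>J. sg (card {l \<in> J. l < j}) \<odot>\<^bsub>localization R M (cech_elt R al J)\<^esub>
      loc_map R M (al ! j) (cech_elt R al J) (cfam i s m (J - {j}))) = fraction R M (px J) (d s m J) s"
    unfolding cech_elt_eq[OF J(1)] .
qed

lemma cech_diff_hom: "cd i \<in> Defs.module_hom R (C i) (C (Suc i))"
  unfolding module_hom_def
proof (intro CollectI conjI ballI)
  show "cd i \<in> carrier (C i) \<rightarrow> carrier (C (Suc i))"
  proof
    fix u assume "u \<in> carrier (C i)"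
    then obtain s m where h: "coch t i m" "u = cfam i s m" by (rule cfam_exists)
    then show "cd i u \<in> carrier (C (Suc i))" using cech_diff_cfam cfam_carrier coch_d by simp
  qed
  fix u assume u: "u \<in> carrier (C i)"
  then obtain s m where h: "coch t i m" "u = cfam i s m" by (rule cfam_exists)
  show "cd i (r \<odot>\<^bsub>C i\<^esub> u) = r \<odot>\<^bsub>C (Suc i)\<^esub> cd i u" if r: "r \<in> carrier R" for r
  proof -
    have "cfam (Suc i) s (d s (\<lambda>J. r \<odot>\<^bsub>M\<^esub> m J)) = cfam (Suc i) s (\<lambda>J. r \<odot>\<^bsub>M\<^esub> d s m J)"
    proof (rule cfam_cong)
      fix J assume J: "J \<subseteq> {..<t}"
      then show "d s (\<lambda>J. r \<odot>\<^bsub>M\<^esub> m J) J = r \<odot>\<^bsub>M\<^esub> d s m J"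
        using cochD(1)[OF h(1)] fin_sub[OF J] r by (intro d_smult) auto
    qed
    then show ?thesis using h r by (simp add: cfam_smult cech_diff_cfam coch_smult coch_d)
  qed
  fix v assume "v \<in> carrier (C i)"
  with u obtain s m m' where h: "coch t i m" "coch t i m'" "u = cfam i s m" "v = cfam i s m'"
    by (rule cfam_exists2)
  have "cfam (Suc i) s (d s (\<lambda>J. m J \<oplus>\<^bsub>M\<^esub> m' J)) = cfam (Suc i) s (\<lambda>J. d s m J \<oplus>\<^bsub>M\<^esub> d s m' J)"
  proof (rule cfam_cong)
    fix J assume J: "J \<subseteq> {..<t}"
    then show "d s (\<lambda>J. m J \<oplus>\<^bsub>M\<^esub> m' J) J = d s m J \<oplus>\<^bsub>M\<^esub> d s m' J"
      using cochD(1)[OF h(1)] cochD(1)[OF h(2)] by (intro d_add) auto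
  qed
  then show "cd i (u \<oplus>\<^bsub>C i\<^esub> v) = cd i u \<oplus>\<^bsub>C (Suc i)\<^esub> cd i v"
    using h by (simp add: cfam_add cech_diff_cfam coch_add coch_d)
qed

lemma cfam_eq_zeroI:
  assumes "coch t i m" "\<And>J. J \<subseteq> {..<t} \<Longrightarrow> m J = \<zero>\<^bsub>M\<^esub>"
  shows "cfam i s m = \<zero>\<^bsub>C i\<^esub>"
  unfolding cfam_zero_iff[OF assms(1)] using assms(2) by (intro exI[of _ 0]) (simp add: koszul_lift_def)

lemma cochain_complex_cech: "cochain_complex R C cd"
  unfolding cochain_complex_def
proof (intro conjI allI ballI module_cech_term cech_diff_hom)
  fix i u assume "u \<in> carrier (C i)"
  then obtain s m where h: "coch t i m" "u = cfam i s m" by (rule cfam_exists)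
  have "d s (d s m) J = \<zero>\<^bsub>M\<^esub>" if J: "J \<subseteq> {..<t}" for J
    using J cochD(1)[OF h(1)] fin_sub[OF J] by (intro d_d) auto
  then show "cd (Suc i) (cd i u) = \<zero>\<^bsub>C (Suc (Suc i))\<^esub>"
    using h by (simp add: cech_diff_cfam coch_d cfam_eq_zeroI)
qed

lemma cfam_cocycle:
  assumes m: "coch t i m" and z: "cd i (cfam i s m) = \<zero>\<^bsub>C (Suc i)\<^esub>"
  obtains k where "\<And>J. J \<subseteq> {..<t} \<Longrightarrow> d (s + k) (lift k m) J = \<zero>\<^bsub>M\<^esub>"
proof -
  obtain k where k: "\<And>J. J \<subseteq> {..<t} \<Longrightarrow> lift k (d s m) J = \<zero>\<^bsub>M\<^esub>"
    using z cfam_zero_iff[OF coch_d[OF m]] unfolding cech_diff_cfam[OF m] by blast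
  have "d (s + k) (lift k m) J = \<zero>\<^bsub>M\<^esub>" if J: "J \<subseteq> {..<t}" for J
    using k[OF J] d_lift[of J m s k] J fin_sub[OF J] cochD(1)[OF m] by auto
  then show thesis using that by blast
qed

text \<open>By \<open>ideal_smult_adjoin_fractions\<close> membership is a condition on each
  numerator, stable under expansion, so a common exponent can be chosen. At sets of another
  cardinality the numerator is zero and satisfies the condition as well.\<close>

lemma cech_sub_iff:
  "u \<in> D n i \<longleftrightarrow> (\<exists>s m. coch t i m \<and> u = cfam i s m \<and> (\<forall>J\<subseteq>{..<t}. m J \<in> qpow \<qq> (n + s * card J)))"
proof -
  have D: "D n i = (\<Pi>\<^sub>E J\<in>cech_index al i. {fraction R M (px J) m s | m s. m \<in> qpow \<qq> (n + card J * s)})"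
    unfolding cech_sub_def Let_def
  proof (rule PiE_cong)
    fix J assume "J \<in> cech_index al i"
    then have J: "J \<subseteq> {..<t}" "card J = i" using index_iff by auto
    show "ideal_smult (localization R M (cech_elt R al J)) (ideal_power R \<qq> n) (adjoin_fractions R M \<qq> i (cech_elt R al J)) =
        {fraction R M (px J) m s | m s. m \<in> qpow \<qq> (n + card J * s)}"
      using ideal_smult_adjoin_fractions[OF px_closed ideal_q px_in_q[OF J(1)], of n] unfolding cech_elt_eq[OF J(1)] J(2) .
  qed
  show ?thesis
  proof
    assume u: "u \<in> D n i"
    obtain s m where h: "coch t i m" "u = cfam i s m" "\<And>J. J \<in> cech_index al i \<Longrightarrow> m J \<in> qpow \<qq> (n + s * card J)"
    proof (rule cfam_exists_aux[of i "\<lambda>s J. qpow \<qq> (n + s * card J)" u])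
      fix J assume J: "J \<in> cech_index al i"
      show "\<exists>m s. m \<in> qpow \<qq> (n + s * card J) \<and> u J = fraction R M (px J) m s"
        using PiE_mem[OF u[unfolded D] J] by (auto simp: mult.commute)
      fix s k m assume "m \<in> qpow \<qq> (n + s * card J)"
      then show "px J [^] (k::nat) \<odot>\<^bsub>M\<^esub> m \<in> qpow \<qq> (n + (s + k) * card J)"
        using qpow_smult[OF ideal_q R.pow_in_ideal_power[OF ideal_q px_in_q, of J k], of m "n + s * card J"] J index_iff
        by (simp add: algebra_simps)
    next
      show "u \<in> extensional (cech_index al i)" using u unfolding D by (auto simp: PiE_def)
      show "m \<in> carrier M" if "m \<in> qpow \<qq> (n + s * card J)" for s m and J :: "nat set"
        using submodule_subset[OF submodule_qpow[OF ideal_q] that] .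
    qed blast
    have "m J \<in> qpow \<qq> (n + s * card J)" if "J \<subseteq> {..<t}" for J
      using h(3)[of J] cochD(2)[OF h(1) that] that index_iff submodule_zero[OF submodule_qpow[OF ideal_q]]
      by (cases "card J = i") auto
    then show "\<exists>s m. coch t i m \<and> u = cfam i s m \<and> (\<forall>J\<subseteq>{..<t}. m J \<in> qpow \<qq> (n + s * card J))" using h by blast
  next
    assume "\<exists>s m. coch t i m \<and> u = cfam i s m \<and> (\<forall>J\<subseteq>{..<t}. m J \<in> qpow \<qq> (n + s * card J))"
    then obtain s m where h: "u = cfam i s m" "\<And>J. J \<subseteq> {..<t} \<Longrightarrow> m J \<in> qpow \<qq> (n + s * card J)" by blast
    show "u \<in> D n i" unfolding D h(1) cfam_def
    proof (rule restrict_PiE_iff[THEN iffD2], rule ballI)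
      fix J assume "J \<in> cech_index al i"
      then have "m J \<in> qpow \<qq> (n + card J * s)" using h(2)[of J] index_iff by (simp add: mult.commute)
      then show "fraction R M (px J) (m J) s \<in> {fraction R M (px J) m s | m s. m \<in> qpow \<qq> (n + card J * s)}" by blast
    qed
  qed
qed

lemma cech_subI:
  assumes "coch t i m" "\<And>J. J \<subseteq> {..<t} \<Longrightarrow> m J \<in> qpow \<qq> (n + s * card J)"
  shows "cfam i s m \<in> D n i"
  unfolding cech_sub_iff by (intro exI[of _ s] exI[of _ m]) (simp add: assms)

lemma gsub_q: "gsub R M (set al) (qpow \<qq>)"
  unfolding set_al by (rule gsub_qpow) auto

lemma lift_qpow:
  "J \<subseteq> {..<t} \<Longrightarrow> m J \<in> qpow \<qq> (n + s * card J) \<Longrightarrow> lift k m J \<in> qpow \<qq> (n + (s + k) * card J)"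
  using fin_sub[of J t] set_al by (intro gsub_lift[OF gsub_q]) auto

lemma submodule_cech_sub: "submodule (D n i) R (C i)"
proof -
  interpret Ci: module R "C i" by (rule module_cech_term)
  note SQ = submodule_qpow[OF ideal_q]
  show ?thesis
  proof (rule Ci.submoduleI')
    show "D n i \<subseteq> carrier (C i)" unfolding subset_iff cech_sub_iff by (auto simp: cfam_carrier)
    have c: "coch t i (\<lambda>_. \<zero>\<^bsub>M\<^esub>)" unfolding coch_def by simp
    then have "\<zero>\<^bsub>C i\<^esub> = cfam i 0 (\<lambda>_. \<zero>\<^bsub>M\<^esub>)" using cfam_eq_zeroI by simp
    then show "\<zero>\<^bsub>C i\<^esub> \<in> D n i" using cech_subI[OF c submodule_zero[OF SQ]] by simp
  next
    fix u v assume "u \<in> D n i"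
    then obtain s m where hu: "coch t i m" "u = cfam i s m" "\<And>J. J \<subseteq> {..<t} \<Longrightarrow> m J \<in> qpow \<qq> (n + s * card J)"
      unfolding cech_sub_iff by blast
    assume "v \<in> D n i"
    then obtain s' m' where hv: "coch t i m'" "v = cfam i s' m'" "\<And>J. J \<subseteq> {..<t} \<Longrightarrow> m' J \<in> qpow \<qq> (n + s' * card J)"
      unfolding cech_sub_iff by blast
    note h = hu hv
    let ?m = "\<lambda>J. lift s' m J \<oplus>\<^bsub>M\<^esub> lift s m' J"
    have "u = cfam i (s + s') (lift s' m)" "v = cfam i (s + s') (lift s m')"
      using h(2,5) cfam_lift[OF h(1), of s s'] cfam_lift[OF h(4), of s' s] by (auto simp: add.commute)
    then have "u \<oplus>\<^bsub>C i\<^esub> v = cfam i (s + s') ?m" using cfam_add coch_lift h(1,4) by simp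
    moreover have "coch t i ?m" using h(1,4) coch_lift coch_add by blast
    moreover have "?m J \<in> qpow \<qq> (n + (s + s') * card J)" if J: "J \<subseteq> {..<t}" for J
      using lift_qpow[of J m n s s', OF J h(3)[OF J]] lift_qpow[of J m' n s' s, OF J h(6)[OF J]]
      by (intro submoduleE(5)[OF SQ]) (simp_all add: add.commute)
    ultimately show "u \<oplus>\<^bsub>C i\<^esub> v \<in> D n i" using cech_subI by simp
  next
    fix r u assume r: "r \<in> carrier R" and "u \<in> D n i"
    from \<open>u \<in> D n i\<close> obtain s m where h: "coch t i m" "u = cfam i s m" "\<And>J. J \<subseteq> {..<t} \<Longrightarrow> m J \<in> qpow \<qq> (n + s * card J)"
      unfolding cech_sub_iff by blast
    have "r \<odot>\<^bsub>C i\<^esub> u = cfam i s (\<lambda>J. r \<odot>\<^bsub>M\<^esub> m J)" using cfam_smult[OF r h(1)] h(2) by simp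
    then show "r \<odot>\<^bsub>C i\<^esub> u \<in> D n i"
      using cech_subI[OF coch_smult[OF r h(1)] submoduleE(4)[OF SQ r h(3)]] by simp
  qed
qed

lemma cech_diff_cech_sub: "cd i ` D n i \<subseteq> D n (Suc i)"
proof
  fix v assume "v \<in> cd i ` D n i"
  then obtain u where u: "v = cd i u" "u \<in> D n i" by blast
  from u(2) obtain s m where h: "coch t i m" "u = cfam i s m" "\<And>J. J \<subseteq> {..<t} \<Longrightarrow> m J \<in> qpow \<qq> (n + s * card J)"
    unfolding cech_sub_iff by blast
  have "d s m J \<in> qpow \<qq> (n + s * card J)" if J: "J \<subseteq> {..<t}" for J
    using fin_sub[OF J] J set_al by (intro gsub_d[OF gsub_q] h(3)) auto
  then show "v \<in> D n (Suc i)" using cech_subI[OF coch_d[OF h(1)]] u(1) h(2) cech_diff_cfam[OF h(1)] by simp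
qed

text \<open>All variables are allowed to act nontrivially, so the condition \<open>kill\<close> of
  \<open>gvan_eventually\<close> is vacuous here.\<close>

lemma gvan_q:
  assumes "noetherian_ring R" "finitely_generated_module R M"
  shows "\<exists>n0. \<forall>n\<ge>n0. gvan t (qpow \<qq>) (\<lambda>_. {\<zero>\<^bsub>M\<^esub>}) n"
proof -
  have W: "set al \<subseteq> carrier R" unfolding set_al by auto
  obtain G where G: "gsub R M (set al) G" "gnoeth R M (set al) G" "G 0 = carrier M"
    using gnoeth_exists[OF assms _ W] by auto
  have "gsub R M (set al) (\<lambda>_. {\<zero>\<^bsub>M\<^esub>})"
    unfolding gsub_def using W submodule_single_zero by auto
  then show ?thesis
    using qpow_subset[OF G(1) W G(3)] submodule_zero[OF submodule_qpow[OF ideal_q]]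
    by (intro gvan_eventually[OF G(2) set_al order_refl gsub_q]) auto
qed

text \<open>A zero Cech differential means zero numerators only after lifting; then the vanishing
  for \<open>qpow\<close> over zero gives a primitive with numerators in the correct degrees. In
  degree 0 the outcome is that there are no nonzero cocycles.\<close>

lemma cech_sub_exact:
  assumes van: "gvan t (qpow \<qq>) (\<lambda>_. {\<zero>\<^bsub>M\<^esub>}) n"
    and u: "u \<in> D n i" and z: "cd i u = \<zero>\<^bsub>C (Suc i)\<^esub>"
  shows "case i of 0 \<Rightarrow> u = \<zero>\<^bsub>C 0\<^esub> | Suc p \<Rightarrow> \<exists>v\<in>D n p. u = cd p v"
proof -
  obtain s m where m: "coch t i m" "u = cfam i s m" "\<And>J. J \<subseteq> {..<t} \<Longrightarrow> m J \<in> qpow \<qq> (n + s * card J)"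
    using u unfolding cech_sub_iff by blast
  obtain k where k: "\<And>J. J \<subseteq> {..<t} \<Longrightarrow> d (s + k) (lift k m) J = \<zero>\<^bsub>M\<^esub>"
    using cfam_cocycle[OF m(1)] z m(2) by blast
  have "gcyc t (qpow \<qq>) (\<lambda>_. {\<zero>\<^bsub>M\<^esub>}) n (s + k) (lift k m)"
    unfolding gcyc_def using lift_qpow m(3) k by blast
  then obtain k' w where w: "\<And>J. J \<subseteq> {..<t} \<Longrightarrow> w J \<in> qpow \<qq> (n + (s + k + k') * card J)"
    "\<And>J. J \<subseteq> {..<t} \<Longrightarrow> lift k' (lift k m) J \<ominus>\<^bsub>M\<^esub> d (s + k + k') w J \<in> {\<zero>\<^bsub>M\<^esub>}"
    using van[unfolded gvan_def, rule_format, of "s + k" "lift k m"] unfolding gcob_def by blast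
  have wc: "J \<subseteq> {..<t} \<Longrightarrow> w J \<in> carrier M" for J
    using submodule_subset[OF submodule_qpow[OF ideal_q] w(1)] .
  have lm: "coch t i (lift k m)" using m(1) by (rule coch_lift)
  have eq: "lift k' (lift k m) J = d (s + k + k') w J" if J: "J \<subseteq> {..<t}" for J
  proof -
    have c: "lift k' (lift k m) J \<in> carrier M" "d (s + k + k') w J \<in> carrier M"
      using cochD(1)[OF coch_lift[OF lm] J] wc J by (auto intro!: d_closed)
    have "lift k' (lift k m) J = d (s + k + k') w J \<oplus>\<^bsub>M\<^esub> (lift k' (lift k m) J \<ominus>\<^bsub>M\<^esub> d (s + k + k') w J)"
      using c M.add_minus_cancel by simp
    then show ?thesis using w(2)[OF J] c by simp
  qed
  have u': "u = cfam i (s + k + k') (lift k' (lift k m))"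
    using m(1,2) lm cfam_lift by simp
  show ?thesis
  proof (cases i)
    case 0
    have "lift k' (lift k m) J = \<zero>\<^bsub>M\<^esub>" if J: "J \<subseteq> {..<t}" for J
    proof (cases "J = {}")
      case True
      then show ?thesis using eq[OF J] by simp
    next
      case False
      then show ?thesis using cochD(2)[OF coch_lift[OF lm] J] 0 fin_sub[OF J] by (simp add: card_eq_0_iff)
    qed
    then show ?thesis using u' cfam_eq_zeroI[OF coch_lift[OF lm]] 0 by simp
  next
    case (Suc p)
    have lm': "coch t (Suc p) (lift k m)" using lm Suc by simp
    define w' where "w' = homog p w"
    have w': "coch t p w'" "\<And>J. J \<subseteq> {..<t} \<Longrightarrow> lift k' (lift k m) J = d (s + k + k') w' J"
      unfolding w'_def using coch_primitive[OF lm' wc eq] by auto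
    have "u = cfam (Suc p) (s + k + k') (d (s + k + k') w')"
      unfolding u' Suc using w'(2) by (rule cfam_cong)
    then have "u = cd p (cfam p (s + k + k') w')" using cech_diff_cfam[OF w'(1)] by simp
    moreover have "cfam p (s + k + k') w' \<in> D n p"
      using w(1) submodule_zero[OF submodule_qpow[OF ideal_q]]
      by (intro cech_subI w'(1)) (auto simp: w'_def homog_def)
    ultimately show ?thesis using Suc by auto
  qed
qed

end

section \<open>The torsion subcomplex of a resolution\<close>

lemma (in resolution) module_section:
  "Module.module R (section_functor R (Idl (a ` {..<t})) (E j)) \<and>
   carrier (section_functor R (Idl (a ` {..<t})) (E j)) = {x. \<exists>k. tors j k x}"
proof
  have car: "carrier (section_functor R (Idl (a ` {..<t})) (E j)) = {x. \<exists>k. tors j k x}"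
    unfolding section_functor_def tors_def using E.ideal_power_torsion_iff[of _ j t] by auto
  then show "carrier (section_functor R (Idl (a ` {..<t})) (E j)) = {x. \<exists>k. tors j k x}" .
  have "submodule {x. \<exists>k. tors j k x} R (E j)"
  proof (rule E.submoduleI')
    show "{x. \<exists>k. tors j k x} \<subseteq> carrier (E j)" unfolding tors_def by blast
    show "\<zero>\<^bsub>E j\<^esub> \<in> {x. \<exists>k. tors j k x}" unfolding tors_def by simp
  next
    fix x y assume "x \<in> {x. \<exists>k. tors j k x}" "y \<in> {x. \<exists>k. tors j k x}"
    then obtain k l where "tors j k x" "tors j l y" by blast
    then have "tors j (max k l) x" "tors j (max k l) y" using tors_mono by auto
    then have "tors j (max k l) (x \<oplus>\<^bsub>E j\<^esub> y)" unfolding tors_def by (simp add: E.smult_r_distr)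
    then show "x \<oplus>\<^bsub>E j\<^esub> y \<in> {x. \<exists>k. tors j k x}" by blast
  next
    fix r x assume r: "r \<in> carrier R" and "x \<in> {x. \<exists>k. tors j k x}"
    then obtain k where k: "tors j k x" by blast
    have "tors j k (r \<odot>\<^bsub>E j\<^esub> x)" unfolding tors_def
    proof (intro conjI allI impI)
      have x: "x \<in> carrier (E j)" using k unfolding tors_def by blast
      then show "r \<odot>\<^bsub>E j\<^esub> x \<in> carrier (E j)" using r by simp
      show "a l [^] k \<odot>\<^bsub>E j\<^esub> (r \<odot>\<^bsub>E j\<^esub> x) = \<zero>\<^bsub>E j\<^esub>" if "l < t" for l
        using k that r E.smult_comm[of "a l [^] k" r x j] x unfolding tors_def by simp
    qed
    then show "r \<odot>\<^bsub>E j\<^esub> x \<in> {x. \<exists>k. tors j k x}" by blast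
  qed
  then have "Module.module R (E j\<lparr>carrier := {x. \<exists>k. tors j k x}\<rparr>)"
    using module_E by (rule submodule.submodule_is_module)
  then show "Module.module R (section_functor R (Idl (a ` {..<t})) (E j))"
    using car unfolding section_functor_def by simp
qed

lemma (in resolution) complex_section:
  "cochain_complex R (\<lambda>j. section_functor R (Idl (a ` {..<t})) (E j)) \<delta>"
proof -
  let ?G = "\<lambda>j. section_functor R (Idl (a ` {..<t})) (E j)"
  have fields: "add (?G j) = add (E j)" "smult (?G j) = smult (E j)" "\<zero>\<^bsub>?G j\<^esub> = \<zero>\<^bsub>E j\<^esub>" for j
    unfolding section_functor_def by simp_all
  have tE: "tors j k x \<Longrightarrow> x \<in> carrier (E j)" for j k x unfolding tors_def by blast
  have dt: "tors (Suc j) k (\<delta> j x)" if "tors j k x" for j k x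
    unfolding tors_def
  proof (intro conjI allI impI)
    show "\<delta> j x \<in> carrier (E (Suc j))" using delta_closed[OF tE[OF that]] .
    show "a l [^] k \<odot>\<^bsub>E (Suc j)\<^esub> \<delta> j x = \<zero>\<^bsub>E (Suc j)\<^esub>" if l: "l < t" for l
    proof -
      have "a l [^] k \<odot>\<^bsub>E (Suc j)\<^esub> \<delta> j x = \<delta> j (a l [^] k \<odot>\<^bsub>E j\<^esub> x)"
        using tE[OF \<open>tors j k x\<close>] by (simp add: delta_smult)
      also have "a l [^] k \<odot>\<^bsub>E j\<^esub> x = \<zero>\<^bsub>E j\<^esub>" using \<open>tors j k x\<close> l unfolding tors_def by blast
      finally show ?thesis using delta_zero by simp
    qed
  qed
  show ?thesis
    unfolding cochain_complex_def
  proof (intro conjI allI ballI)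
    show "Module.module R (?G j)" for j using module_section by blast
    show "\<delta> j \<in> Defs.module_hom R (?G j) (?G (Suc j))" for j
      unfolding module_hom_def fields using module_section delta_add delta_smult tE by (auto intro: dt)
    show "\<delta> (Suc j) (\<delta> j x) = \<zero>\<^bsub>?G (Suc (Suc j))\<^esub>" if "x \<in> carrier (?G j)" for j x
      unfolding fields using that module_section delta_delta tE by auto
  qed
qed

section \<open>Local cohomology and the truncated Cech complex\<close>

context cech
begin

text \<open>Exactness of the subcomplex replaces the long exact sequence in three places: a cocycle
  of the quotient complex is corrected to a Cech cocycle, a Cech cocycle of degree 0 lying in the
  subcomplex is zero, and a Cech cocycle that is a coboundary modulo the subcomplex is a Cech
  coboundary.\<close>

lemma local_cohomology_isomorphic:
  fixes E :: "nat \<Rightarrow> ('a, 'e) module"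
  assumes noeth: "noetherian_ring R" and res: "injective_resolution R M E \<delta> \<epsilon>"
    and van: "gvan t (qpow \<qq>) (\<lambda>_. {\<zero>\<^bsub>M\<^esub>}) n"
  shows "module_isomorphic R (local_cohomology R \<qq> E \<delta> i) (cech_L R al M n i)"
proof -
  interpret rs: resolution R M a E \<delta> \<epsilon> t
    by (intro resolution.intro koszul_axioms resolution_axioms.intro noeth res)
  let ?G = "\<lambda>j. section_functor R \<qq> (E j)"
  let ?Q = "quot_complex C (D n)" and ?qd = "quot_diff C cd (D n)"
  have G: "cochain_complex R ?G \<delta>" using rs.complex_section unfolding set_al .
  have carG: "carrier (?G j) = {x. \<exists>k. rs.tors j k x}" for j using rs.module_section unfolding set_al by blast
  have fields: "add (?G j) = add (E j)" "smult (?G j) = smult (E j)" "\<zero>\<^bsub>?G j\<^esub> = \<zero>\<^bsub>E j\<^esub>" for j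
    unfolding section_functor_def by simp_all
  have Q: "cochain_complex R ?Q ?qd" by (rule cochain_complex_quot[OF cochain_complex_cech submodule_cech_sub cech_diff_cech_sub])
  have Qcar: "carrier (?Q j) = {D n j +>\<^bsub>C j\<^esub> u | u. u \<in> carrier (C j)}" for j
    unfolding quot_complex_def by (rule module.quot_carrier[OF module_cech_term])
  have Qz: "\<zero>\<^bsub>?Q j\<^esub> = D n j" for j unfolding quot_complex_def by (rule module.quot_zero[OF module_cech_term])
  have qd: "?qd j (D n j +>\<^bsub>C j\<^esub> u) = D n (Suc j) +>\<^bsub>C (Suc j)\<^esub> cd j u" if "u \<in> carrier (C j)" for j u
    using that by (intro quot_diff_coset[where D = "D n", OF module_cech_term module_cech_term cech_diff_hom submodule_cech_sub submodule_cech_sub cech_diff_cech_sub])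
  have cdc: "u \<in> carrier (C j) \<Longrightarrow> cd j u \<in> carrier (C (Suc j))" for j u by (rule module_homD(1)[OF cech_diff_hom])
  note ceq = module.coset_eq_iff[OF module_cech_term submodule_cech_sub]
  note cself = module.coset_eq_self_iff[OF module_cech_term submodule_cech_sub]
  \<comment> \<open>A torsion cocycle is related to the coset of each Cech cochain reached from it
    by a zigzag. The exponent \<open>s\<close> is part of the data, since the numerators only make
    sense together with it.\<close>
  define S where "S e U \<longleftrightarrow> (\<exists>s m. (\<exists>k. rs.tors i k e) \<and> \<delta> i e = \<zero>\<^bsub>E (Suc i)\<^esub> \<and> rs.corr i s e m \<and>
    (\<forall>J\<subseteq>{..<t}. d s m J = \<zero>\<^bsub>M\<^esub>) \<and> U = D n i +>\<^bsub>C i\<^esub> cfam i s m)" for e U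
  have SE: "\<exists>s m. (\<exists>k. rs.tors i k e) \<and> \<delta> i e = \<zero>\<^bsub>E (Suc i)\<^esub> \<and> rs.corr i s e m \<and> coch t i m \<and>
      cd i (cfam i s m) = \<zero>\<^bsub>C (Suc i)\<^esub> \<and> (\<forall>J\<subseteq>{..<t}. d s m J = \<zero>\<^bsub>M\<^esub>) \<and> U = D n i +>\<^bsub>C i\<^esub> cfam i s m"
    if "S e U" for e U
  proof -
    obtain s m where h: "\<exists>k. rs.tors i k e" "\<delta> i e = \<zero>\<^bsub>E (Suc i)\<^esub>" "rs.corr i s e m"
      "\<And>J. J \<subseteq> {..<t} \<Longrightarrow> d s m J = \<zero>\<^bsub>M\<^esub>" "U = D n i +>\<^bsub>C i\<^esub> cfam i s m"
      using \<open>S e U\<close> unfolding S_def by blast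
    have m: "coch t i m" using h(3) unfolding rs.corr_def by blast
    have "cd i (cfam i s m) = \<zero>\<^bsub>C (Suc i)\<^esub>" unfolding cech_diff_cfam[OF m] using h(4) by (intro cfam_eq_zeroI coch_d m)
    then show ?thesis using h m by blast
  qed
  show ?thesis
    unfolding local_cohomology_def cech_L_def
  proof (rule cohomology_isomorphicI[OF G Q, where S = S])
    fix e U assume "S e U"
    then obtain s m where h: "\<exists>k. rs.tors i k e" "\<delta> i e = \<zero>\<^bsub>E (Suc i)\<^esub>" "coch t i m"
      "cd i (cfam i s m) = \<zero>\<^bsub>C (Suc i)\<^esub>" "U = D n i +>\<^bsub>C i\<^esub> cfam i s m"
      using SE by blast
    have "?qd i U = \<zero>\<^bsub>?Q (Suc i)\<^esub>"
      unfolding h(5) qd[OF cfam_carrier[OF h(3)]] h(4) Qz by (rule module.coset_zero[OF module_cech_term submodule_cech_sub])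
    then show "e \<in> carrier (?G i) \<and> \<delta> i e = \<zero>\<^bsub>?G (Suc i)\<^esub> \<and> U \<in> carrier (?Q i) \<and> ?qd i U = \<zero>\<^bsub>?Q (Suc i)\<^esub>"
      unfolding carG fields Qcar using h cfam_carrier by blast
  next
    fix e assume "e \<in> carrier (?G i)" "\<delta> i e = \<zero>\<^bsub>?G (Suc i)\<^esub>"
    then obtain s where s: "rs.tors i s e" "\<delta> i e = \<zero>\<^bsub>E (Suc i)\<^esub>" unfolding carG fields by blast
    then show "\<exists>U. S e U" unfolding S_def using rs.corr_right[OF s] by blast
  next
    fix U assume "U \<in> carrier (?Q i)" and Uz: "?qd i U = \<zero>\<^bsub>?Q (Suc i)\<^esub>"
    then obtain u where u: "U = D n i +>\<^bsub>C i\<^esub> u" "u \<in> carrier (C i)" unfolding Qcar by blast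
    interpret Ci: module R "C i" by (rule module_cech_term)
    interpret Cs: module R "C (Suc i)" by (rule module_cech_term)
    \<comment> \<open>The differential of \<open>u\<close> is a cocycle of the subcomplex, hence the
      differential of some \<open>v\<close> in it; \<open>u\<close> minus \<open>v\<close> is a Cech
      cocycle in the same coset.\<close>
    have "cd i u \<in> D n (Suc i)" using Uz unfolding u(1) qd[OF u(2)] Qz cself[OF cdc[OF u(2)]] .
    moreover have "cd (Suc i) (cd i u) = \<zero>\<^bsub>C (Suc (Suc i))\<^esub>"
      using cochain_complex_cech u(2) unfolding cochain_complex_def by blast
    ultimately obtain v where v: "v \<in> D n i" "cd i u = cd i v" using cech_sub_exact[OF van, of _ "Suc i"] by auto
    have vc: "v \<in> carrier (C i)" using Ci.submodule_subset[OF submodule_cech_sub v(1)] .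
    have "cd i (u \<ominus>\<^bsub>C i\<^esub> v) = \<zero>\<^bsub>C (Suc i)\<^esub>"
      using module_hom_minus[OF module_cech_term module_cech_term cech_diff_hom u(2) vc] v(2) cdc[OF vc] by (simp add: a_minus_def Cs.r_neg)
    moreover obtain s m where m: "coch t i m" "u \<ominus>\<^bsub>C i\<^esub> v = cfam i s m" using cfam_exists u(2) vc Ci.minus_closed by metis
    ultimately obtain k where k: "\<And>J. J \<subseteq> {..<t} \<Longrightarrow> d (s + k) (lift k m) J = \<zero>\<^bsub>M\<^esub>"
      using cfam_cocycle[OF m(1)] by metis
    note lm = coch_lift[OF m(1), of k]
    obtain k' e where e: "rs.tors i (s + k + k') e" "\<delta> i e = \<zero>\<^bsub>E (Suc i)\<^esub>" "rs.corr i (s + k + k') e (lift k' (lift k m))"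
      using rs.corr_left[OF lm k] by blast
    have "d (s + k + k') (lift k' (lift k m)) J = \<zero>\<^bsub>M\<^esub>" if J: "J \<subseteq> {..<t}" for J
      using d_lift[of J "lift k m" "s + k" k'] J fin_sub[OF J] cochD(1)[OF lm] k[OF J] by (auto simp: koszul_lift_def)
    moreover have "u \<ominus>\<^bsub>C i\<^esub> v = cfam i (s + k + k') (lift k' (lift k m))"
      using m(2) cfam_lift[OF m(1)] cfam_lift[OF lm] by simp
    moreover have "U = D n i +>\<^bsub>C i\<^esub> (u \<ominus>\<^bsub>C i\<^esub> v)"
    proof -
      have "u \<ominus>\<^bsub>C i\<^esub> (u \<ominus>\<^bsub>C i\<^esub> v) = v"
        using u(2) vc by (simp add: a_minus_def Ci.minus_add Ci.r_neg1 Ci.r_neg2)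
      then show ?thesis unfolding u(1) using ceq u(2) vc v(1) by simp
    qed
    ultimately show "\<exists>e. S e U" unfolding S_def using e by metis
  next
    fix e U e' U' assume "S e U" "S e' U'"
    obtain s m where h: "\<exists>k. rs.tors i k e" "\<delta> i e = \<zero>\<^bsub>E (Suc i)\<^esub>" "rs.corr i s e m" "coch t i m"
      "\<And>J. J \<subseteq> {..<t} \<Longrightarrow> d s m J = \<zero>\<^bsub>M\<^esub>" "U = D n i +>\<^bsub>C i\<^esub> cfam i s m" using SE[OF \<open>S e U\<close>] by blast
    obtain s' m' where h': "\<exists>k. rs.tors i k e'" "\<delta> i e' = \<zero>\<^bsub>E (Suc i)\<^esub>" "rs.corr i s' e' m'" "coch t i m'"
      "\<And>J. J \<subseteq> {..<t} \<Longrightarrow> d s' m' J = \<zero>\<^bsub>M\<^esub>" "U' = D n i +>\<^bsub>C i\<^esub> cfam i s' m'" using SE[OF \<open>S e' U'\<close>] by blast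
    \<comment> \<open>Both families are brought to the exponent \<open>s + s'\<close> before they
      are added.\<close>
    let ?m = "lift s' m" and ?m' = "lift s m'"
    note lm = coch_lift[OF h(4), of s'] and lm' = coch_lift[OF h'(4), of s]
    have "rs.corr i (s + s') e ?m" "rs.corr i (s + s') e' ?m'"
      using rs.corr_lift[OF h(3), of s'] rs.corr_lift[OF h'(3), of s] by (auto simp: add.commute)
    then have "rs.corr i (s + s') (e \<oplus>\<^bsub>E i\<^esub> e') (\<lambda>J. ?m J \<oplus>\<^bsub>M\<^esub> ?m' J)" by (rule rs.corr_add)
    moreover have "d (s + s') (\<lambda>J. ?m J \<oplus>\<^bsub>M\<^esub> ?m' J) J = \<zero>\<^bsub>M\<^esub>" if J: "J \<subseteq> {..<t}" for J
    proof -
      have "d (s + s') (\<lambda>J. ?m J \<oplus>\<^bsub>M\<^esub> ?m' J) J = d (s + s') ?m J \<oplus>\<^bsub>M\<^esub> d (s + s') ?m' J"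
        using J cochD(1)[OF lm] cochD(1)[OF lm'] by (intro d_add) auto
      also have "d (s + s') ?m J = lift s' (d s m) J" using J fin_sub[OF J] cochD(1)[OF h(4)] by (intro d_lift) auto
      also have "d (s + s') ?m' J = lift s (d s' m') J"
        using d_lift[of J m' s' s] J fin_sub[OF J] cochD(1)[OF h'(4)] by (auto simp: add.commute)
      finally show ?thesis using h(5)[OF J] h'(5)[OF J] by (simp add: koszul_lift_def)
    qed
    moreover have "U \<oplus>\<^bsub>?Q i\<^esub> U' = D n i +>\<^bsub>C i\<^esub> cfam i (s + s') (\<lambda>J. ?m J \<oplus>\<^bsub>M\<^esub> ?m' J)"
    proof -
      have "U = D n i +>\<^bsub>C i\<^esub> cfam i (s + s') ?m" "U' = D n i +>\<^bsub>C i\<^esub> cfam i (s + s') ?m'"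
        using h(6) h'(6) cfam_lift[OF h(4), of s s'] cfam_lift[OF h'(4), of s' s] by (auto simp: add.commute)
      then show ?thesis unfolding quot_complex_def
        using module.quot_add[OF module_cech_term submodule_cech_sub cfam_carrier[OF lm] cfam_carrier[OF lm']] cfam_add[OF lm lm'] by simp
    qed
    moreover have "\<delta> i (e \<oplus>\<^bsub>E i\<^esub> e') = \<zero>\<^bsub>E (Suc i)\<^esub>"
      using h(1,2) h'(1,2) rs.delta_add unfolding rs.tors_def by auto
    moreover have "\<exists>k. rs.tors i k (e \<oplus>\<^bsub>E i\<^esub> e')"
    proof -
      interpret Gi: module R "?G i" using G unfolding cochain_complex_def by blast
      have "e \<oplus>\<^bsub>?G i\<^esub> e' \<in> carrier (?G i)" using h(1) h'(1) by (intro Gi.a_closed) (auto simp: carG)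
      then show ?thesis unfolding carG fields by blast
    qed
    ultimately show "S (e \<oplus>\<^bsub>?G i\<^esub> e') (U \<oplus>\<^bsub>?Q i\<^esub> U')" unfolding S_def fields by blast
  next
    fix r e U assume r: "r \<in> carrier R" and "S e U"
    then obtain s m where h: "\<exists>k. rs.tors i k e" "\<delta> i e = \<zero>\<^bsub>E (Suc i)\<^esub>" "rs.corr i s e m" "coch t i m"
      "\<And>J. J \<subseteq> {..<t} \<Longrightarrow> d s m J = \<zero>\<^bsub>M\<^esub>" "U = D n i +>\<^bsub>C i\<^esub> cfam i s m" using SE by blast
    have ec: "e \<in> carrier (E i)" using h(1) unfolding rs.tors_def by blast
    have "rs.corr i s (r \<odot>\<^bsub>E i\<^esub> e) (\<lambda>J. r \<odot>\<^bsub>M\<^esub> m J)" using r h(3) by (rule rs.corr_smult)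
    moreover have "d s (\<lambda>J. r \<odot>\<^bsub>M\<^esub> m J) J = \<zero>\<^bsub>M\<^esub>" if J: "J \<subseteq> {..<t}" for J
    proof -
      have "d s (\<lambda>J. r \<odot>\<^bsub>M\<^esub> m J) J = r \<odot>\<^bsub>M\<^esub> d s m J"
        using J r fin_sub[OF J] cochD(1)[OF h(4)] by (intro d_smult) auto
      then show ?thesis using h(5)[OF J] r by simp
    qed
    moreover have "r \<odot>\<^bsub>?Q i\<^esub> U = D n i +>\<^bsub>C i\<^esub> cfam i s (\<lambda>J. r \<odot>\<^bsub>M\<^esub> m J)"
      unfolding h(6) quot_complex_def
      using module.quot_smult[OF module_cech_term submodule_cech_sub r cfam_carrier[OF h(4)]] cfam_smult[OF r h(4)] by simp
    moreover have "\<delta> i (r \<odot>\<^bsub>E i\<^esub> e) = \<zero>\<^bsub>E (Suc i)\<^esub>" using rs.delta_smult[OF r ec] h(2) r by simp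
    moreover have "\<exists>k. rs.tors i k (r \<odot>\<^bsub>E i\<^esub> e)"
    proof -
      interpret Gi: module R "?G i" using G unfolding cochain_complex_def by blast
      have "r \<odot>\<^bsub>?G i\<^esub> e \<in> carrier (?G i)" using r h(1) by (intro Gi.smult_closed) (auto simp: carG)
      then show ?thesis unfolding carG fields by blast
    qed
    ultimately show "S (r \<odot>\<^bsub>?G i\<^esub> e) (r \<odot>\<^bsub>?Q i\<^esub> U)" unfolding S_def fields by blast
  next
    fix e U assume "S e U"
    then obtain s m where h: "\<exists>k. rs.tors i k e" "\<delta> i e = \<zero>\<^bsub>E (Suc i)\<^esub>" "rs.corr i s e m" "coch t i m"
      "cd i (cfam i s m) = \<zero>\<^bsub>C (Suc i)\<^esub>" "U = D n i +>\<^bsub>C i\<^esub> cfam i s m" using SE by blast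
    note mc = cfam_carrier[OF h(4), of s]
    show "e \<in> coboundaries ?G \<delta> i \<longleftrightarrow> U \<in> coboundaries ?Q ?qd i"
    proof (cases i)
      case 0
      have e: "e = \<epsilon> (m {})" using rs.corr_0 h(3) 0 by simp
      have m0: "m {} \<in> carrier M" using cochD(1)[OF h(4)] by simp
      have "e = \<zero>\<^bsub>E 0\<^esub> \<longleftrightarrow> m {} = \<zero>\<^bsub>M\<^esub>" unfolding e using rs.eps_zero rs.eps_inj[OF m0] by auto
      also have "\<dots> \<longleftrightarrow> cfam i s m = \<zero>\<^bsub>C i\<^esub>"
      proof
        assume z: "m {} = \<zero>\<^bsub>M\<^esub>"
        show "cfam i s m = \<zero>\<^bsub>C i\<^esub>"
        proof (rule cfam_eq_zeroI[OF h(4)])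
          show "m J = \<zero>\<^bsub>M\<^esub>" if J: "J \<subseteq> {..<t}" for J
            using z cochD(2)[OF h(4) J] 0 fin_sub[OF J] by (cases "J = {}") (auto simp: card_eq_0_iff)
        qed
      next
        assume "cfam i s m = \<zero>\<^bsub>C i\<^esub>"
        then obtain k where "lift k m {} = \<zero>\<^bsub>M\<^esub>" unfolding cfam_zero_iff[OF h(4)] by auto
        then show "m {} = \<zero>\<^bsub>M\<^esub>" using m0 by simp
      qed
      also have "\<dots> \<longleftrightarrow> cfam i s m \<in> D n i"
      proof
        assume "cfam i s m = \<zero>\<^bsub>C i\<^esub>"
        then show "cfam i s m \<in> D n i" using module.submodule_zero[OF module_cech_term submodule_cech_sub] by simp
      next
        assume "cfam i s m \<in> D n i"
        then show "cfam i s m = \<zero>\<^bsub>C i\<^esub>" using cech_sub_exact[OF van _ h(5)] 0 by simp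
      qed
      also have "\<dots> \<longleftrightarrow> U = D n i" unfolding h(6) using cself[OF mc] by simp
      finally show ?thesis unfolding coboundaries_def using 0 Qz fields by simp
    next
      case (Suc p)
      have cobG: "e \<in> coboundaries ?G \<delta> i \<longleftrightarrow> (\<exists>l e'. rs.tors p l e' \<and> \<delta> p e' = e)"
        unfolding coboundaries_def Suc by (auto simp: carG)
      have cobQ: "U \<in> coboundaries ?Q ?qd i \<longleftrightarrow> (\<exists>v\<in>carrier (C p). U = D n i +>\<^bsub>C i\<^esub> cd p v)"
        unfolding coboundaries_def Suc using qd[of _ p] by (auto simp: Qcar image_iff)
      have corr: "rs.corr (Suc p) s e m" and m: "coch t (Suc p) m" using h(3,4) Suc by auto
      show ?thesis unfolding cobG cobQ
      proof
        assume "\<exists>l e'. rs.tors p l e' \<and> \<delta> p e' = e"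
        then obtain l e' where e': "rs.tors p l e'" "\<delta> p e' = e" by blast
        obtain k w where w: "coch t p w" "\<And>J. J \<subseteq> {..<t} \<Longrightarrow> lift k m J = d (s + k) w J"
          using rs.corr_boundary_right[of p s e' m l] corr e' by blast
        have "cfam i s m = cfam i (s + k) (lift k m)" using cfam_lift[OF h(4)] .
        also have "\<dots> = cfam i (s + k) (d (s + k) w)" using w(2) by (rule cfam_cong)
        also have "\<dots> = cd p (cfam p (s + k) w)" using cech_diff_cfam[OF w(1)] Suc by simp
        finally show "\<exists>v\<in>carrier (C p). U = D n i +>\<^bsub>C i\<^esub> cd p v" using h(6) cfam_carrier[OF w(1)] by auto
      next
        assume "\<exists>v\<in>carrier (C p). U = D n i +>\<^bsub>C i\<^esub> cd p v"
        then obtain v where v: "v \<in> carrier (C p)" "U = D n i +>\<^bsub>C i\<^esub> cd p v" by blast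
        interpret Ci: module R "C i" by (rule module_cech_term)
        interpret Cs: module R "C (Suc i)" by (rule module_cech_term)
        interpret Cp: module R "C p" by (rule module_cech_term)
        have vi: "cd p v \<in> carrier (C i)" using cdc[OF v(1)] Suc by simp
        \<comment> \<open>The difference is a cocycle of the subcomplex, hence
          \<open>cd p v'\<close>; adding \<open>v'\<close> to \<open>v\<close> turns the primitive
          modulo the subcomplex into an honest one.\<close>
        have "cfam i s m \<ominus>\<^bsub>C i\<^esub> cd p v \<in> D n i" using v(2) h(6) ceq[OF mc vi] by simp
        moreover have "cd i (cd p v) = \<zero>\<^bsub>C (Suc i)\<^esub>"
          using cochain_complex_cech v(1) Suc unfolding cochain_complex_def by simp
        then have "cd i (cfam i s m \<ominus>\<^bsub>C i\<^esub> cd p v) = \<zero>\<^bsub>C (Suc i)\<^esub>"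
          using module_hom_minus[OF module_cech_term module_cech_term cech_diff_hom mc vi] h(5) by simp
        ultimately obtain v' where v': "v' \<in> D n p" "cfam i s m \<ominus>\<^bsub>C i\<^esub> cd p v = cd p v'"
          using cech_sub_exact[OF van, of _ i] Suc by auto
        have v'c: "v' \<in> carrier (C p)" using Cp.submodule_subset[OF submodule_cech_sub v'(1)] .
        have "cfam i s m = cd p v \<oplus>\<^bsub>C i\<^esub> (cfam i s m \<ominus>\<^bsub>C i\<^esub> cd p v)"
          using Ci.add_minus_cancel[OF mc vi] by simp
        also have "\<dots> = cd p (v \<oplus>\<^bsub>C p\<^esub> v')"
          unfolding v'(2) using module_homD(2)[OF cech_diff_hom v(1) v'c] Suc by simp
        finally have eq: "cfam i s m = cd p (v \<oplus>\<^bsub>C p\<^esub> v')" .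
        obtain s' w where w: "coch t p w" "v \<oplus>\<^bsub>C p\<^esub> v' = cfam p s' w"
          using cfam_exists v(1) v'c Cp.a_closed by metis
        \<comment> \<open>Equality of Cech cochains gives equality of numerators only after a common
          exponent and a further lift \<open>k\<close>, which is what the zigzag lemma
          needs.\<close>
        let ?f = "\<lambda>J. lift s' m J \<ominus>\<^bsub>M\<^esub> lift s (d s' w) J"
        note c1 = coch_lift[OF m, of s'] and c2 = coch_lift[OF coch_d[OF w(1)], of s s']
        have "cfam (Suc p) s m = cfam (Suc p) s' (d s' w)" using eq w cech_diff_cfam[OF w(1)] Suc by simp
        then have "cfam (Suc p) (s + s') (lift s' m) = cfam (Suc p) (s + s') (lift s (d s' w))"
          using cfam_lift[OF m, of s s'] cfam_lift[OF coch_d[OF w(1)], of s' s' s] by (simp add: add.commute)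
        moreover have "cfam (Suc p) (s + s') ?f = cfam (Suc p) (s + s') (lift s' m) \<ominus>\<^bsub>C (Suc p)\<^esub> cfam (Suc p) (s + s') (lift s (d s' w))"
          using cfam_minus[OF c1 c2] by simp
        ultimately have "cfam (Suc p) (s + s') ?f = \<zero>\<^bsub>C (Suc p)\<^esub>"
          using cfam_carrier[OF c2, of "s + s'"] Ci.r_neg Suc by (simp add: a_minus_def)
        then obtain k where k: "\<And>J. J \<subseteq> {..<t} \<Longrightarrow> lift k ?f J = \<zero>\<^bsub>M\<^esub>"
          unfolding cfam_zero_iff[OF coch_minus[OF c1 c2]] by blast
        have "lift k (lift s' m) J = d (s + s' + k) (lift (s + k) w) J" if J: "J \<subseteq> {..<t}" for J
        proof -
          have c: "lift k (lift s' m) J \<in> carrier M" "lift k (lift s (d s' w)) J \<in> carrier M"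
            using cochD(1)[OF coch_lift[OF c1] J] cochD(1)[OF coch_lift[OF c2] J] by auto
          have "lift k (lift s' m) J \<ominus>\<^bsub>M\<^esub> lift k (lift s (d s' w)) J = \<zero>\<^bsub>M\<^esub>"
            using k[OF J] lift_minus[of "lift s' m" J "lift s (d s' w)" k] cochD(1)[OF c1 J] cochD(1)[OF c2 J] by simp
          then have "lift k (lift s' m) J = lift k (lift s (d s' w)) J"
            using M.add_minus_cancel[OF c] c by simp
          also have "\<dots> = lift (s + k) (d s' w) J"
            using lift_lift[of "d s' w" J k s] cochD(1)[OF coch_d[OF w(1)] J] by (simp add: add.commute)
          also have "\<dots> = d (s' + (s + k)) (lift (s + k) w) J"
            using J fin_sub[OF J] cochD(1)[OF w(1)] by (intro d_lift[symmetric]) auto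
          finally show ?thesis by (simp add: ac_simps)
        qed
        then show "\<exists>l e'. rs.tors p l e' \<and> \<delta> p e' = e"
          by (intro rs.corr_boundary_left[OF rs.corr_lift[OF rs.corr_lift[OF corr]] coch_lift[OF w(1)]])
      qed
    qed
  qed
qed

end

theorem corollary1p2:
  fixes R :: "('a, 'k) ring_scheme" and M :: "('a, 'm, 'x) module_scheme" and a :: "'a list"
  assumes "local_ring R" and "noetherian_ring R"
    and "set a \<subseteq> carrier R"
    and "module R M" and "finitely_generated_module R M"
  shows "\<forall>\<^sub>F n in sequentially. \<forall>i. \<forall>(E :: nat \<Rightarrow> ('a, 'e) module) \<delta> \<epsilon>.
    injective_resolution R M E \<delta> \<epsilon> \<longrightarrow>
    module_isomorphic R (local_cohomology R (Idl\<^bsub>R\<^esub> (set a)) E \<delta> i) (cech_L R a M n i)"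
proof -
  interpret module R M by fact
  \<comment> \<open>Padding by zero keeps all values in the carrier, as the locale requires.\<close>
  define b where "b j = (if j < length a then a ! j else \<zero>\<^bsub>R\<^esub>)" for j
  have "b j \<in> carrier R" for j unfolding b_def using assms(3) by auto
  then interpret cech R M b a
    by (intro cech.intro koszul.intro koszul_axioms.intro cech_axioms.intro module_axioms) (auto simp: b_def)
  \<comment> \<open>The bound is obtained before \<open>i\<close> and the resolution are chosen, so
    it is uniform in both.\<close>
  obtain n0 where "\<And>n. n \<ge> n0 \<Longrightarrow> gvan (length a) (qpow (Idl\<^bsub>R\<^esub> (set a))) (\<lambda>_. {\<zero>\<^bsub>M\<^esub>}) n"
    using gvan_q[OF assms(2,5)] by blast
  then show ?thesis
    unfolding eventually_sequentially using local_cohomology_isomorphic[OF assms(2)] by blast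
qed

end
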